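(* Let $\mathcal{M}$ be a $\sigma$-finite infinite factor and let $A,B\in\mathcal{M}^+$. If $A=\sum_{j=1}^\infty C_j$ for some $C_j\in\mathcal{M}^+$ with $C_j\sim B$ for all $j$, then the following conditions hold: (i) $\|A\|\ge\|B\|$ and $R_B\prec R_A$. If $\mathcal{M}$ is semifinite, then $\|A\|_e\ge\|B\|$. (ii) One of the following mutually exclusive conditions holds: (1) $\|A\|>\|B\|$; (2) $\|A\|=\|B\|$ and $\chi_{\{\|B\|\}}(B)=0$; (3) $\|A\|=\|B\|$, $\chi_{\{\|B\|\}}(B)\ne0$, $B\ne\|B\|\chi_{\{\|B\|\}}(B)$, and $\chi_{\{\|A\|\}}(A)$ is infinite; (4) $\|A\|=\|B\|$, $B=\|B\|\chi_{\{\|B\|\}}(B)$, $A=\|A\|\chi_{\{\|A\|\}}(A)$, and $\chi_{\{\|A\|\}}(A)$ is infinite. If $A=\sum_{j=1}^\infty C_j$ for some $C_j\cong B$ for all $j$, then in addition to conditions (i) and (ii), the following conditions hold: (iii) $N_A\prec N_B$. (iv) $0\in\sigma(B)$, and if $\mathcal{M}$ is semifinite, then $0\in\sigma_e(B)$. (v) If $\|A\|=\|B\|$, then $\chi_{\{\|B\|\}}(B)\prec N_B$.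
   Context: $\mathcal{M}$ acts on a Hilbert space; $\mathcal{M}^+$ is its set of positive elements. A $\sigma$-finite infinite factor is either semifinite (type I$_\infty$ or II$_\infty$) or of type III. When $\mathcal{M}$ is semifinite, $\mathcal{J}$ is the norm-closed two-sided ideal generated by the finite projections of $\mathcal{M}$, $\pi:\mathcal{M}\to\mathcal{M}/\mathcal{J}$ is the quotient map, $\|A\|_e=\|\pi(A)\|$ and $\sigma_e(A)=\sigma(\pi(A))$. For $B,C\in\mathcal{M}^+$, $B\sim C$ means $B=XX^*$ and $C=X^*X$ for some $X\in\mathcal{M}$; $C\cong B$ means $C=UBU^*$ for some unitary $U\in\mathcal{M}$. For projections, $P\prec Q$ means $P$ is Murray-von Neumann equivalent in $\mathcal{M}$ to a subprojection of $Q$; "infinite" for a projection is meant relative to $\mathcal{M}$. $R_A$ and $N_A$ are the range projection of $A$ and the projection on the null space of $A$. $\chi_S(B)$ is the spectral projection of $B$ for the Borel set $S$. Infinite sums of operators converge in the strong operator topology. *)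

theory Defs
  imports "HOL-Analysis.Analysis"
begin

section \<open>Complex Hilbert spaces\<close>

text \<open>The library has only real inner products.  A complex Hilbert space is rendered as a complete
  real inner product space with a compatible complex scalar multiplication and a sesquilinear form
  (linear in the first argument) whose real part is the real inner product; hence the norm is the
  one given by the complex inner product.\<close>

class complex_hilbert = real_inner + complete_space +
  fixes scaleC :: "complex \<Rightarrow> 'a \<Rightarrow> 'a" (infixr \<open>*\<^sub>C\<close> 75)
    and cinner :: "'a \<Rightarrow> 'a \<Rightarrow> complex"
  assumes scaleC_add_right: "c *\<^sub>C (x + y) = c *\<^sub>C x + c *\<^sub>C y"
    and scaleC_add_left: "(c + d) *\<^sub>C x = c *\<^sub>C x + d *\<^sub>C x"
    and scaleC_scaleC: "c *\<^sub>C d *\<^sub>C x = (c * d) *\<^sub>C x"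
    and scaleC_of_real: "complex_of_real r *\<^sub>C x = r *\<^sub>R x"
    and cinner_commute: "cinner x y = cnj (cinner y x)"
    and cinner_add_left: "cinner (x + y) z = cinner x z + cinner y z"
    and cinner_scaleC_left: "cinner (c *\<^sub>C x) y = c * cinner x y"
    and Re_cinner: "Re (cinner x y) = inner x y"

instance complex_hilbert \<subseteq> banach ..

instantiation complex :: complex_hilbert
begin

definition scaleC_complex :: "complex \<Rightarrow> complex \<Rightarrow> complex"
  where "scaleC_complex c x = c * x"

definition cinner_complex :: "complex \<Rightarrow> complex \<Rightarrow> complex"
  where "cinner_complex x y = x * cnj y"

instance
  by standard
    (auto simp: scaleC_complex_def cinner_complex_def inner_complex_def algebra_simps
      scaleR_conv_of_real)

end

lemma norm_scaleC: "norm (c *\<^sub>C x) = cmod c * norm (x :: 'a :: complex_hilbert)"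
proof -
  have "cinner (c *\<^sub>C x) (c *\<^sub>C x) = (c * cnj c) * cinner x x"
    using cinner_commute[of x "c *\<^sub>C x"] cinner_commute[of x x]
    by (simp add: cinner_scaleC_left)
  also have "\<dots> = complex_of_real ((cmod c)\<^sup>2) * cinner x x"
    by (simp only: complex_norm_square)
  finally have "inner (c *\<^sub>C x) (c *\<^sub>C x) = (cmod c)\<^sup>2 * inner x x"
    by (simp flip: Re_cinner)
  then show ?thesis
    by (simp add: norm_eq_sqrt_inner real_sqrt_mult)
qed

lemma bounded_linear_scaleC: "bounded_linear (\<lambda>x :: 'a :: complex_hilbert. c *\<^sub>C x)"
proof (rule bounded_linear_intro[where K = "cmod c"])
  show "c *\<^sub>C (r *\<^sub>R x) = r *\<^sub>R (c *\<^sub>C x)" for r and x :: 'a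
    by (simp add: scaleC_scaleC mult.commute flip: scaleC_of_real)
qed (simp_all add: scaleC_add_right norm_scaleC mult.commute)

section \<open>Bounded operators\<close>

text \<open>Operators are elements of the library type of bounded real-linear maps; those that are
  complex-linear form \<open>bounded_ops\<close>.  The library norm on this type is the operator norm.\<close>

type_synonym 'a op = "'a \<Rightarrow>\<^sub>L 'a"

definition bounded_ops :: "'a::complex_hilbert op set"
  where "bounded_ops = {A. \<forall>c x. blinfun_apply A (c *\<^sub>C x) = c *\<^sub>C blinfun_apply A x}"

definition scalar_op :: "complex \<Rightarrow> 'a::complex_hilbert op"
  where "scalar_op c = Blinfun (\<lambda>x. c *\<^sub>C x)"

lemma scalar_op_apply [simp]: "blinfun_apply (scalar_op c) x = c *\<^sub>C x"
  by (simp add: scalar_op_def bounded_linear_Blinfun_apply bounded_linear_scaleC)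

definition adj :: "'a::complex_hilbert op \<Rightarrow> 'a op" (\<open>_\<^sup>\<dagger>\<close> [1000] 999)
  where "A\<^sup>\<dagger> = (THE T. \<forall>x y. cinner (blinfun_apply A x) y = cinner x (blinfun_apply T y))"

definition is_projection :: "'a::complex_hilbert op \<Rightarrow> bool"
  where "is_projection P \<longleftrightarrow> P \<in> bounded_ops \<and> P o\<^sub>L P = P \<and> P\<^sup>\<dagger> = P"

definition projection_onto :: "'a::complex_hilbert set \<Rightarrow> 'a op"
  where "projection_onto S = (THE P. is_projection P \<and> range (blinfun_apply P) = S)"

definition range_projection :: "'a::complex_hilbert op \<Rightarrow> 'a op"
  where "range_projection A = projection_onto (closure (range (blinfun_apply A)))"

definition null_projection :: "'a::complex_hilbert op \<Rightarrow> 'a op"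
  where "null_projection A = projection_onto {x. blinfun_apply A x = 0}"

definition strong_sums :: "(nat \<Rightarrow> 'a::complex_hilbert op) \<Rightarrow> 'a op \<Rightarrow> bool"
  where "strong_sums C A \<longleftrightarrow> (\<forall>x. (\<lambda>j. blinfun_apply (C j) x) sums blinfun_apply A x)"

section \<open>Spectral projections of self-adjoint operators\<close>

text \<open>Values of \<open>E\<close> outside the Borel sets are irrelevant.\<close>

definition projection_valued_measure :: "(real set \<Rightarrow> 'a::complex_hilbert op) \<Rightarrow> bool"
  where "projection_valued_measure E \<longleftrightarrow>
    (\<forall>S\<in>sets borel. is_projection (E S)) \<and>
    E {} = 0 \<and> E UNIV = id_blinfun \<and>
    (\<forall>S\<in>sets borel. \<forall>T\<in>sets borel. E (S \<inter> T) = E S o\<^sub>L E T) \<and>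
    (\<forall>S. range S \<subseteq> sets borel \<longrightarrow> disjoint_family S \<longrightarrow> strong_sums (\<lambda>n. E (S n)) (E (\<Union>n. S n)))"

definition diagonal_measure :: "(real set \<Rightarrow> 'a::complex_hilbert op) \<Rightarrow> 'a \<Rightarrow> real measure"
  where "diagonal_measure E x =
    measure_of UNIV (sets borel) (\<lambda>S. ennreal (Re (cinner (blinfun_apply (E S) x) x)))"

text \<open>\<open>E\<close> is the spectral measure of \<open>B\<close>: it has compact support and \<open>B = \<integral>t dE(t)\<close> in the weak sense.
  By polarization the diagonal matrix coefficients suffice.\<close>

definition spectral_measure_of :: "'a::complex_hilbert op \<Rightarrow> (real set \<Rightarrow> 'a op) \<Rightarrow> bool"
  where "spectral_measure_of B E \<longleftrightarrow>
    projection_valued_measure E \<and>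
    (\<exists>K. compact K \<and> E K = id_blinfun) \<and>
    (\<forall>x. cinner (blinfun_apply B x) x = complex_of_real (\<integral>t. t \<partial>diagonal_measure E x))"

definition spectral_projection :: "real set \<Rightarrow> 'a::complex_hilbert op \<Rightarrow> 'a op"
  where "spectral_projection S B = (THE P. \<exists>E. spectral_measure_of B E \<and> P = E S)"

section \<open>Von Neumann algebras and factors\<close>

definition commutant :: "'a::complex_hilbert op set \<Rightarrow> 'a op set"
  where "commutant M = {T \<in> bounded_ops. \<forall>A\<in>M. T o\<^sub>L A = A o\<^sub>L T}"

definition von_neumann_algebra :: "'a::complex_hilbert op set \<Rightarrow> bool"
  where "von_neumann_algebra M \<longleftrightarrow>
    M \<subseteq> bounded_ops \<and> (\<forall>A\<in>M. A\<^sup>\<dagger> \<in> M) \<and> commutant (commutant M) = M"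

definition is_factor :: "'a::complex_hilbert op set \<Rightarrow> bool"
  where "is_factor M \<longleftrightarrow> von_neumann_algebra M \<and> M \<inter> commutant M = range scalar_op"

definition positives :: "'a::complex_hilbert op set \<Rightarrow> 'a op set"
  where "positives M = {A \<in> M. \<forall>x. cinner (blinfun_apply A x) x \<in> nonneg_Reals}"

definition projections :: "'a::complex_hilbert op set \<Rightarrow> 'a op set"
  where "projections M = {P \<in> M. is_projection P}"

definition subprojection :: "'a::complex_hilbert op \<Rightarrow> 'a op \<Rightarrow> bool"
  where "subprojection P Q \<longleftrightarrow> range (blinfun_apply P) \<subseteq> range (blinfun_apply Q)"

text \<open>Between projections this is Murray-von Neumann equivalence: \<open>X\<close> is then automatically a
  partial isometry.\<close>

definition op_equiv :: "'a::complex_hilbert op set \<Rightarrow> 'a op \<Rightarrow> 'a op \<Rightarrow> bool"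
  where "op_equiv M B C \<longleftrightarrow> (\<exists>X\<in>M. B = X o\<^sub>L X\<^sup>\<dagger> \<and> C = X\<^sup>\<dagger> o\<^sub>L X)"

definition unitarily_equiv :: "'a::complex_hilbert op set \<Rightarrow> 'a op \<Rightarrow> 'a op \<Rightarrow> bool"
  where "unitarily_equiv M C B \<longleftrightarrow>
    (\<exists>U\<in>M. U o\<^sub>L U\<^sup>\<dagger> = id_blinfun \<and> U\<^sup>\<dagger> o\<^sub>L U = id_blinfun \<and> C = U o\<^sub>L B o\<^sub>L U\<^sup>\<dagger>)"

definition proj_subequiv :: "'a::complex_hilbert op set \<Rightarrow> 'a op \<Rightarrow> 'a op \<Rightarrow> bool"
  where "proj_subequiv M P Q \<longleftrightarrow> (\<exists>R\<in>projections M. subprojection R Q \<and> op_equiv M P R)"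

definition finite_projection :: "'a::complex_hilbert op set \<Rightarrow> 'a op \<Rightarrow> bool"
  where "finite_projection M P \<longleftrightarrow> P \<in> projections M \<and>
    (\<forall>Q\<in>projections M. subprojection Q P \<and> op_equiv M P Q \<longrightarrow> Q = P)"

definition infinite_projection :: "'a::complex_hilbert op set \<Rightarrow> 'a op \<Rightarrow> bool"
  where "infinite_projection M P \<longleftrightarrow> P \<in> projections M \<and> \<not> finite_projection M P"

definition infinite_algebra :: "'a::complex_hilbert op set \<Rightarrow> bool"
  where "infinite_algebra M \<longleftrightarrow> infinite_projection M id_blinfun"

definition sigma_finite_algebra :: "'a::complex_hilbert op set \<Rightarrow> bool"
  where "sigma_finite_algebra M \<longleftrightarrow>
    (\<forall>F. F \<subseteq> projections M - {0} \<longrightarrow> pairwise (\<lambda>P Q. P o\<^sub>L Q = 0) F \<longrightarrow> countable F)"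

definition semifinite_algebra :: "'a::complex_hilbert op set \<Rightarrow> bool"
  where "semifinite_algebra M \<longleftrightarrow>
    (\<forall>Z\<in>projections (M \<inter> commutant M). Z \<noteq> 0 \<longrightarrow>
      (\<exists>P. finite_projection M P \<and> P \<noteq> 0 \<and> subprojection P Z))"

section \<open>Spectrum, the ideal of finite projections, and the essential spectrum\<close>

definition spectrum :: "'a::complex_hilbert op set \<Rightarrow> 'a op \<Rightarrow> complex set"
  where "spectrum M A = {l. \<not> (\<exists>T\<in>M.
    T o\<^sub>L (A - scalar_op l) = id_blinfun \<and> (A - scalar_op l) o\<^sub>L T = id_blinfun)}"

text \<open>Closure under scalar multiplication is contained in closure under multiplication by \<open>M\<close>.\<close>

definition closed_ideal :: "'a::complex_hilbert op set \<Rightarrow> 'a op set \<Rightarrow> bool"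
  where "closed_ideal M I \<longleftrightarrow> I \<subseteq> M \<and> closed I \<and> 0 \<in> I \<and>
    (\<forall>S\<in>I. \<forall>T\<in>I. S + T \<in> I) \<and> (\<forall>A\<in>M. \<forall>T\<in>I. A o\<^sub>L T \<in> I \<and> T o\<^sub>L A \<in> I)"

definition finite_ideal :: "'a::complex_hilbert op set \<Rightarrow> 'a op set"
  where "finite_ideal M = closed_ideal M hull {P. finite_projection M P}"

text \<open>The quotient map onto \<open>M / finite_ideal M\<close>, whose elements are cosets.\<close>

definition quotient_map :: "'a::complex_hilbert op set \<Rightarrow> 'a op \<Rightarrow> 'a op set"
  where "quotient_map M A = (\<lambda>K. A + K) ` finite_ideal M"

definition essential_norm :: "'a::complex_hilbert op set \<Rightarrow> 'a op \<Rightarrow> real"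
  where "essential_norm M A = Inf (norm ` quotient_map M A)"

text \<open>The spectrum of \<open>quotient_map M A\<close> in the quotient algebra; every element of the quotient is
  \<open>quotient_map M T\<close> for some \<open>T\<close> in \<open>M\<close>, and products are computed on representatives.\<close>

definition essential_spectrum :: "'a::complex_hilbert op set \<Rightarrow> 'a op \<Rightarrow> complex set"
  where "essential_spectrum M A = {l. \<not> (\<exists>T\<in>M.
    quotient_map M (T o\<^sub>L (A - scalar_op l)) = quotient_map M id_blinfun \<and>
    quotient_map M ((A - scalar_op l) o\<^sub>L T) = quotient_map M id_blinfun)}"

definition exactly_one :: "bool list \<Rightarrow> bool"
  where "exactly_one ps \<longleftrightarrow> (\<exists>!i. i < length ps \<and> ps ! i)"

end

theory Submission
  imports Defs
begin

text \<open>
  Since \<open>0 \<le> C\<^sub>j \<le> A\<close>, a vector on which some \<open>C\<^sub>j\<close> attains \<open>\<parallel>A\<parallel>\<close> is an eigenvector of \<open>A\<close>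
  annihilated by all other summands.  If \<open>\<parallel>A\<parallel> = \<parallel>B\<parallel>\<close>, the top eigenspaces of the summands are
  therefore infinitely many orthogonal equivalent projections below the top eigenspace of \<open>A\<close>, and
  the latter is infinite.  In the unitary case the top eigenspace of \<open>C\<^sub>0\<close> lies in the null
  space of \<open>C\<^sub>1\<close>, and the null space of \<open>A\<close> lies in that of every \<open>C\<^sub>j\<close>.

  The claims on the essential norm and the essential spectrum rest on one fact: if \<open>P\<close> is a finite
  projection bounded below on the ranges of projections \<open>F\<^sub>j\<close>, all of size at least \<open>E \<noteq> 0\<close>, then
  the sum of the \<open>F\<^sub>j\<close> cannot converge.  With a trace this would be immediate.  Instead of a trace
  we use the subadditive function \<open>e \<mapsto> sup {k / n. k \<cdot> P \<preceq> n \<cdot> e}\<close>.  By exhaustion, it is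
  dominated on a nonzero part of \<open>P\<close> by a multiple of \<open>e \<mapsto> \<langle>e y, y\<rangle>\<close> for a single vector \<open>y\<close>,
  and finitely many copies of that part cover \<open>P\<close>.

  All of this only uses the real part of the inner product, with a von Neumann algebra written as
  the set of real-linear operators commuting with a family that contains the multiplication by
  \<open>\<i>\<close>.  The spectral measure of \<open>B\<close> is built from the spectral projections of \<open>B - t\<close> for
  \<open>(-\<infinity>, 0]\<close>.\<close>

section \<open>Real Hilbert spaces\<close>

text \<open>The dimension-like function enters through two estimates: it is superadditive on
  orthogonal sums, which drives the exhaustion, and \<open>dim e \<le> d * dim f\<close> if
  \<open>e\<close> embeds into \<open>d\<close> copies of \<open>f\<close>. Forming multiples of
  projections needs room; two isometries in \<open>M\<close> with orthogonal ranges, available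
  because \<open>M\<close> is infinite, provide direct sums inside \<open>M\<close>. The domination
  by a vector holds only below a small part of \<open>P\<close>, while the \<open>F j\<close> vary
  with \<open>j\<close> and need not lie below \<open>P\<close> at all. Hence \<open>P\<close> is
  covered by finitely many pieces that embed into that part, the vector is carried to each piece,
  and each \<open>F j\<close> is compressed to the pieces; cutting the compressions at a fixed
  spectral level leaves parts into whose sum \<open>F j\<close> still embeds, so one of them has
  size at least \<open>dim E / d\<close>. For the essential spectrum, the range projections of the
  summands may overlap too little with a given finite projection; enlarging it to
  \<open>P \<oplus> e\<close>, where \<open>P\<close> bounds their complements, forces an overlap of
  at least a copy of \<open>e\<close>.\<close>

class real_hilbert = real_inner + complete_space

instance real_hilbert \<subseteq> banach ..

instance complex_hilbert \<subseteq> real_hilbert ..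

instance prod :: (real_hilbert, real_hilbert) real_hilbert ..

section \<open>Orthogonal projection onto a closed subspace\<close>

lemma inner_zero_if_norm_minimal:
  fixes u z :: "'a::real_inner"
  assumes "\<And>t. (norm u)\<^sup>2 \<le> (norm (u - t *\<^sub>R z))\<^sup>2"
  shows "inner u z = 0"
proof (cases "z = 0")
  case False
  \<comment> \<open>This value minimizes the quadratic polynomial in \<open>t\<close>; the minimum
    undercuts the value at 0 unless \<open>inner u z\<close> vanishes.\<close>
  define t where "t = inner u z / (norm z)\<^sup>2"
  have nz: "(norm z)\<^sup>2 > 0" using False by simp
  have "(norm (u - t *\<^sub>R z))\<^sup>2 = (norm u)\<^sup>2 - 2 * t * inner u z + t\<^sup>2 * (norm z)\<^sup>2"
    unfolding power2_norm_eq_inner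
    by (simp add: inner_simps inner_commute power2_eq_square algebra_simps)
  moreover have "t\<^sup>2 * (norm z)\<^sup>2 = t * inner u z"
    using nz by (simp add: t_def power2_eq_square)
  ultimately have "t * inner u z \<le> 0"
    using assms[of t] by simp
  then have "(inner u z)\<^sup>2 / (norm z)\<^sup>2 \<le> 0"
    by (simp add: t_def power2_eq_square)
  then have "(inner u z)\<^sup>2 \<le> 0"
    using nz by (simp add: divide_le_0_iff)
  then show ?thesis by simp
qed simp

text \<open>The parallelogram identity makes a minimizing sequence Cauchy, since midpoints stay in
  \<open>S\<close> and cannot beat the infimum; its limit is a nearest point, hence the foot of the
  perpendicular.\<close>

lemma exists_orthogonal_projection:
  fixes S :: "'a::real_hilbert set"
  assumes "closed S" "subspace S"
  shows "\<exists>y\<in>S. \<forall>z\<in>S. inner (x - y) z = 0"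
proof -
  define D where "D = (\<lambda>y. (norm (x - y))\<^sup>2) ` S"
  define d where "d = Inf D"
  have S0: "0 \<in> S" using assms(2) by (rule subspace_0)
  have ne: "D \<noteq> {}" using S0 by (auto simp: D_def)
  have bdd: "bdd_below D" by (rule bdd_belowI[of _ 0]) (auto simp: D_def)
  have low: "d \<le> (norm (x - y))\<^sup>2" if "y \<in> S" for y
    unfolding d_def using bdd that by (intro cInf_lower) (auto simp: D_def)
  have "\<exists>y\<in>S. (norm (x - y))\<^sup>2 < d + 1 / real (Suc n)" for n
  proof -
    have "Inf D < d + 1 / real (Suc n)" by (simp add: d_def)
    then show ?thesis
      using cInf_lessD[OF ne] by (fastforce simp: D_def)
  qed
  then obtain y where yS: "\<And>n. y n \<in> S"
    and y: "\<And>n. (norm (x - y n))\<^sup>2 < d + 1 / real (Suc n)" by metis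
  have par: "(norm (y m - y n))\<^sup>2 \<le> 2 / real (Suc m) + 2 / real (Suc n)" for m n
  proof -
    have eq: "(norm (y m - y n))\<^sup>2 = 2 * (norm (x - y m))\<^sup>2 + 2 * (norm (x - y n))\<^sup>2
        - 4 * (norm (x - (1/2) *\<^sub>R (y m + y n)))\<^sup>2"
      unfolding power2_norm_eq_inner
      by (simp add: inner_simps inner_commute algebra_simps)
    have "(1/2) *\<^sub>R (y m + y n) \<in> S"
      using yS assms(2) by (intro subspace_scale subspace_add) auto
    from low[OF this] eq y[of m] y[of n] show ?thesis by (simp add: algebra_simps)
  qed
  have "Cauchy y"
  proof (rule metric_CauchyI)
    fix e :: real assume "0 < e"
    then obtain N where N: "4 / e\<^sup>2 < real N" using reals_Archimedean2 by blast
    have "norm (y m - y n) < e" if "m \<ge> N" "n \<ge> N" for m n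
    proof -
      have pos: "0 < real N" using N \<open>0 < e\<close> by (smt (verit) divide_pos_pos zero_less_power)
      have a: "2 / real (Suc k) < 2 / real N" if "k \<ge> N" for k
        using that pos by (intro divide_strict_left_mono) auto
      have "(norm (y m - y n))\<^sup>2 < 4 / real N"
        using par[of m n] a[OF that(1)] a[OF that(2)] by simp
      also have "4 / real N < e\<^sup>2"
        using N \<open>0 < e\<close> pos by (simp add: field_simps)
      finally show ?thesis
        using \<open>0 < e\<close> by (simp add: power_less_imp_less_base)
    qed
    then show "\<exists>M. \<forall>m\<ge>M. \<forall>n\<ge>M. dist (y m) (y n) < e"
      by (auto simp: dist_norm)
  qed
  then obtain l where l: "y \<longlonglongrightarrow> l" using Cauchy_convergent convergent_def by blast
  have lS: "l \<in> S" using closed_sequentially[OF assms(1) _ l] yS by blast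
  have "(norm (x - l))\<^sup>2 \<le> d"
  proof (rule LIMSEQ_le)
    show "(\<lambda>n. (norm (x - y n))\<^sup>2) \<longlonglongrightarrow> (norm (x - l))\<^sup>2" by (intro tendsto_intros l)
    show "(\<lambda>n. d + 1 / real (Suc n)) \<longlonglongrightarrow> d"
      using tendsto_add[OF tendsto_const LIMSEQ_inverse_real_of_nat, of d]
      by (simp add: inverse_eq_divide)
    show "\<exists>N. \<forall>n\<ge>N. (norm (x - y n))\<^sup>2 \<le> d + 1 / real (Suc n)" using y less_imp_le by blast
  qed
  then have "inner (x - l) z = 0" if "z \<in> S" for z
  proof (intro inner_zero_if_norm_minimal)
    fix t
    have "l + t *\<^sub>R z \<in> S" using lS that assms(2) by (intro subspace_add subspace_scale)
    from low[OF this] \<open>(norm (x - l))\<^sup>2 \<le> d\<close>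
    show "(norm (x - l))\<^sup>2 \<le> (norm (x - l - t *\<^sub>R z))\<^sup>2"
      by (metis diff_diff_eq order_trans)
  qed
  then show ?thesis using lS by blast
qed

text \<open>The point is chosen separately for each \<open>x\<close>; linearity and boundedness of
  the choice, which \<open>Blinfun\<close> requires, follow from uniqueness when \<open>S\<close> is
  a closed subspace.\<close>

definition orth_proj :: "'a::real_hilbert set \<Rightarrow> 'a op"
  where "orth_proj S = Blinfun (\<lambda>x. SOME y. y \<in> S \<and> (\<forall>z\<in>S. inner (x - y) z = 0))"

lemma orthogonal_component_unique:
  fixes S :: "'a::real_inner set"
  assumes "subspace S" "y \<in> S" "y' \<in> S"
    "\<And>z. z \<in> S \<Longrightarrow> inner (x - y) z = 0" "\<And>z. z \<in> S \<Longrightarrow> inner (x - y') z = 0"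
  shows "y = y'"
proof -
  have "y - y' \<in> S" using assms(1-3) by (rule subspace_diff)
  then have "inner (x - y) (y - y') = 0" "inner (x - y') (y - y') = 0" using assms by blast+
  then have "inner (y - y') (y - y') = 0" by (simp add: inner_diff_left)
  then show ?thesis by simp
qed

context
  fixes S :: "'a::real_hilbert set"
  assumes S: "closed S" "subspace S"
begin

lemma orth_proj_aux:
  "orth_proj S x \<in> S \<and> (\<forall>z\<in>S. inner (x - orth_proj S x) z = 0)"
proof -
  define f where "f x = (SOME y. y \<in> S \<and> (\<forall>z\<in>S. inner (x - y) z = 0))" for x
  have f: "f x \<in> S" "\<And>z. z \<in> S \<Longrightarrow> inner (x - f x) z = 0" for x
    using someI_ex[of "\<lambda>y. y \<in> S \<and> (\<forall>z\<in>S. inner (x - y) z = 0)"]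
      exists_orthogonal_projection[OF S, of x] unfolding f_def by blast+
  have uniq: "f x = y" if "y \<in> S" "\<And>z. z \<in> S \<Longrightarrow> inner (x - y) z = 0" for x y
    using orthogonal_component_unique[OF S(2) f(1) that(1) f(2) that(2)] by blast
  have "bounded_linear f"
  proof (rule bounded_linear_intro[where K = 1])
    fix x y :: 'a and r :: real
    show "f (x + y) = f x + f y"
    proof (rule uniq)
      show "f x + f y \<in> S" using f S(2) by (intro subspace_add) auto
      show "inner (x + y - (f x + f y)) z = 0" if "z \<in> S" for z
        using f(2)[OF that, of x] f(2)[OF that, of y] by (simp add: inner_simps)
    qed
    show "f (r *\<^sub>R x) = r *\<^sub>R f x"
    proof (rule uniq)
      show "r *\<^sub>R f x \<in> S" using f S(2) by (intro subspace_scale) auto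
      show "inner (r *\<^sub>R x - r *\<^sub>R f x) z = 0" if "z \<in> S" for z
        using f(2)[OF that, of x] by (simp add: inner_simps)
    qed
    have "(norm (f x))\<^sup>2 = inner x (f x)"
      using f(2)[OF f(1), of x x] by (simp add: power2_norm_eq_inner inner_simps)
    also have "\<dots> \<le> norm x * norm (f x)" by (rule norm_cauchy_schwarz)
    finally show "norm (f x) \<le> norm x * 1"
      by (cases "f x = 0") (simp_all add: power2_eq_square)
  qed
  then have "blinfun_apply (orth_proj S) = f"
    by (simp add: orth_proj_def f_def[abs_def] bounded_linear_Blinfun_apply)
  then show ?thesis using f by simp
qed

lemma orth_proj_in [simp]: "orth_proj S x \<in> S"
  using orth_proj_aux by blast

lemma orth_proj_orthogonal: "z \<in> S \<Longrightarrow> inner (x - orth_proj S x) z = 0"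
  using orth_proj_aux by blast

lemma orth_proj_unique:
  "y \<in> S \<Longrightarrow> (\<And>z. z \<in> S \<Longrightarrow> inner (x - y) z = 0) \<Longrightarrow> orth_proj S x = y"
  using orthogonal_component_unique[OF S(2) orth_proj_in _ orth_proj_orthogonal] by blast

lemma orth_proj_eq_iff: "orth_proj S x = x \<longleftrightarrow> x \<in> S"
  using orth_proj_in[of x] orth_proj_unique[of x x] by (metis diff_self inner_zero_left)

lemma orth_proj_eq_0_iff: "orth_proj S x = 0 \<longleftrightarrow> (\<forall>z\<in>S. inner x z = 0)"
  using orth_proj_orthogonal[of _ x] orth_proj_unique[of 0 x] subspace_0[OF S(2)] by force

lemma range_orth_proj: "range (blinfun_apply (orth_proj S)) = S"
  using orth_proj_eq_iff by (metis orth_proj_in rangeI image_subset_iff subsetI subset_antisym)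

lemma orth_proj_inner: "inner (orth_proj S x) y = inner x (orth_proj S y)"
  using orth_proj_orthogonal[of "orth_proj S y" x] orth_proj_orthogonal[of "orth_proj S x" y]
  by (simp add: inner_diff_left inner_diff_right inner_commute)

end

text \<open>If \<open>f\<close> is not zero, the component \<open>z\<close> of \<open>x0\<close>
  orthogonal to the kernel of \<open>f\<close> spans the complement of the kernel: every
  \<open>x\<close> differs from a multiple of \<open>z\<close> by a kernel vector.\<close>

lemma riesz_representation:
  fixes f :: "'a::real_hilbert \<Rightarrow> real"
  assumes "bounded_linear f"
  shows "\<exists>y. \<forall>x. f x = inner x y"
proof (cases "\<forall>x. f x = 0")
  case True
  then show ?thesis by (intro exI[of _ 0]) simp
next
  case False
  then obtain x0 where x0: "f x0 \<noteq> 0" by blast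
  interpret bounded_linear f by fact
  define S where "S = {x. f x = 0}"
  have S: "closed S" "subspace S"
    unfolding S_def by (auto intro!: closed_Collect_eq continuous_intros continuous_on
        simp: subspace_def add scaleR zero)
  define z where "z = x0 - orth_proj S x0"
  have "f (orth_proj S x0) = 0" using orth_proj_in[OF S, of x0] by (simp add: S_def)
  then have fz: "f z \<noteq> 0" using x0 by (simp add: z_def diff)
  then have z0: "(norm z)\<^sup>2 > 0" using zero by auto
  have "f x = inner x ((f z / (norm z)\<^sup>2) *\<^sub>R z)" for x
  proof -
    have "f (x - (f x / f z) *\<^sub>R z) = 0" using fz by (simp add: diff scaleR)
    then have "inner z (x - (f x / f z) *\<^sub>R z) = 0"
      using orth_proj_orthogonal[OF S] by (simp add: z_def S_def)
    then have "inner x z = f x / f z * (norm z)\<^sup>2"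
      by (simp add: inner_simps inner_commute power2_norm_eq_inner)
    then show ?thesis using fz z0 by simp
  qed
  then show ?thesis by blast
qed

subsection \<open>Adjoints\<close>

text \<open>The adjoint for the real inner product. It exists for every bounded real-linear operator
  and coincides with the complex adjoint on complex-linear ones.\<close>

definition hadj :: "'a::real_hilbert op \<Rightarrow> 'a op" (\<open>_\<^sup>\<star>\<close> [1000] 1000)
  where "T\<^sup>\<star> = Blinfun (\<lambda>y. SOME z. \<forall>x. inner (T x) y = inner x z)"

lemma hadj_inner:
  fixes T :: "'a::real_hilbert op"
  shows "inner (T x) y = inner x (T\<^sup>\<star> y)"
proof -
  define g where "g y = (SOME z. \<forall>x. inner (T x) y = inner x z)" for y
  have g: "inner (T x) y = inner x (g y)" for x y
  proof -
    have "bounded_linear (\<lambda>x. inner (T x) y)"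
      by (rule bounded_linear_compose[OF bounded_linear_inner_left blinfun.bounded_linear_right])
    from riesz_representation[OF this] have "\<exists>z. \<forall>x. inner (T x) y = inner x z" .
    from someI_ex[OF this] show ?thesis unfolding g_def by blast
  qed
  have "bounded_linear g"
  proof (rule bounded_linear_intro[where K = "norm T"])
    fix x y :: 'a and r :: real
    have "\<forall>u. inner u (g (x + y)) = inner u (g x + g y)"
      by (simp only: inner_add_right g[symmetric]) simp
    then show "g (x + y) = g x + g y" by (simp only: vector_eq_ldot)
    have "\<forall>u. inner u (g (r *\<^sub>R x)) = inner u (r *\<^sub>R g x)"
      by (simp only: inner_scaleR_right g[symmetric]) simp
    then show "g (r *\<^sub>R x) = r *\<^sub>R g x" by (simp only: vector_eq_ldot)
    have "(norm (g x))\<^sup>2 = inner (T (g x)) x" by (simp only: power2_norm_eq_inner g)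
    also have "\<dots> \<le> norm (T (g x)) * norm x" by (rule norm_cauchy_schwarz)
    also have "\<dots> \<le> (norm T * norm (g x)) * norm x"
      by (intro mult_right_mono norm_blinfun) auto
    finally show "norm (g x) \<le> norm x * norm T"
      by (cases "g x = 0") (simp_all add: power2_eq_square mult.commute)
  qed
  then have "blinfun_apply (T\<^sup>\<star>) = g"
    by (simp add: hadj_def g_def[abs_def] bounded_linear_Blinfun_apply)
  then show ?thesis using g by simp
qed

lemma hadj_inner':
  fixes T :: "'a::real_hilbert op"
  shows "inner (T\<^sup>\<star> x) y = inner x (T y)"
  using hadj_inner[of T y x] by (simp add: inner_commute)

lemma hadjI:
  fixes S T :: "'a::real_hilbert op"
  assumes "\<And>x y. inner (T x) y = inner x (S y)"
  shows "T\<^sup>\<star> = S"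
proof (rule blinfun_eqI)
  fix y
  have "\<forall>x. inner x (T\<^sup>\<star> y) = inner x (S y)" using assms hadj_inner[of T] by metis
  then show "T\<^sup>\<star> y = S y" by (simp only: vector_eq_ldot)
qed

lemma op_eq_iff_inner:
  fixes S T :: "'a::real_hilbert op"
  shows "T = S \<longleftrightarrow> (\<forall>x y. inner (T x) y = inner (S x) y)"
proof
  assume R: "\<forall>x y. inner (T x) y = inner (S x) y"
  show "T = S"
  proof (rule blinfun_eqI)
    fix x
    have "\<forall>y. inner (T x) y = inner (S x) y" using R by blast
    then show "T x = S x" by (simp only: vector_eq_rdot)
  qed
qed simp

lemma hadj_hadj [simp]: "T\<^sup>\<star>\<^sup>\<star> = T"
  by (rule hadjI) (simp add: hadj_inner')

lemma hadj_compose [simp]: "(S o\<^sub>L T)\<^sup>\<star> = T\<^sup>\<star> o\<^sub>L S\<^sup>\<star>"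
  by (rule hadjI) (simp add: hadj_inner)

lemma hadj_add: "(S + T)\<^sup>\<star> = S\<^sup>\<star> + T\<^sup>\<star>"
  by (rule hadjI) (simp add: hadj_inner blinfun.bilinear_simps inner_simps)

lemma hadj_diff: "(S - T)\<^sup>\<star> = S\<^sup>\<star> - T\<^sup>\<star>"
  by (rule hadjI) (simp add: hadj_inner blinfun.bilinear_simps inner_simps)

lemma hadj_scaleR: "(r *\<^sub>R T)\<^sup>\<star> = r *\<^sub>R T\<^sup>\<star>"
  by (rule hadjI) (simp add: hadj_inner blinfun.bilinear_simps inner_simps)

lemma hadj_id [simp]: "(id_blinfun :: 'a::real_hilbert op)\<^sup>\<star> = id_blinfun"
  by (rule hadjI) simp

lemma hadj_0 [simp]: "(0 :: 'a::real_hilbert op)\<^sup>\<star> = 0"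
  by (rule hadjI) simp

lemma norm_hadj: "norm (T\<^sup>\<star>) = norm T"
proof -
  have le: "norm (T\<^sup>\<star>) \<le> norm T" for T :: "'a op"
  proof (rule norm_blinfun_bound)
    fix x
    have "(norm (T\<^sup>\<star> x))\<^sup>2 = inner (T (T\<^sup>\<star> x)) x" by (simp add: power2_norm_eq_inner hadj_inner)
    also have "\<dots> \<le> norm (T (T\<^sup>\<star> x)) * norm x" by (rule norm_cauchy_schwarz)
    also have "\<dots> \<le> (norm T * norm (T\<^sup>\<star> x)) * norm x"
      by (intro mult_right_mono norm_blinfun) auto
    finally show "norm (T\<^sup>\<star> x) \<le> norm T * norm x"
      by (cases "T\<^sup>\<star> x = 0") (simp_all add: power2_eq_square)
  qed simp
  show ?thesis using le[of T] le[of "T\<^sup>\<star>"] by simp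
qed

text \<open>The C-star identity; the lower bound on the composition is Cauchy-Schwarz for
  \<open>inner x ((T\<^sup>\<star> o\<^sub>L T) x)\<close>.\<close>

lemma hadj_compose_self_norm: "norm (T\<^sup>\<star> o\<^sub>L T) = (norm T)\<^sup>2"
proof (rule antisym)
  show "norm (T\<^sup>\<star> o\<^sub>L T) \<le> (norm T)\<^sup>2"
    using norm_blinfun_compose[of "T\<^sup>\<star>" T] by (simp add: norm_hadj power2_eq_square)
  have "norm T \<le> sqrt (norm (T\<^sup>\<star> o\<^sub>L T))"
  proof (rule norm_blinfun_bound)
    fix x
    have "(norm (T x))\<^sup>2 = inner x ((T\<^sup>\<star> o\<^sub>L T) x)" by (simp add: power2_norm_eq_inner hadj_inner)
    also have "\<dots> \<le> norm x * norm ((T\<^sup>\<star> o\<^sub>L T) x)" by (rule norm_cauchy_schwarz)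
    also have "\<dots> \<le> norm x * (norm (T\<^sup>\<star> o\<^sub>L T) * norm x)"
      by (intro mult_left_mono norm_blinfun) auto
    finally have "(norm (T x))\<^sup>2 \<le> (sqrt (norm (T\<^sup>\<star> o\<^sub>L T)) * norm x)\<^sup>2"
      by (simp add: power_mult_distrib power2_eq_square algebra_simps)
    then show "norm (T x) \<le> sqrt (norm (T\<^sup>\<star> o\<^sub>L T)) * norm x"
      by (rule power2_le_imp_le) simp
  qed simp
  then show "(norm T)\<^sup>2 \<le> norm (T\<^sup>\<star> o\<^sub>L T)"
    by (metis norm_ge_zero power_mono real_sqrt_pow2)
qed

subsection \<open>Positive operators\<close>

text \<open>Symmetry is demanded explicitly: over the reals, unlike in the complex case, a
  nonnegative quadratic form does not force it.\<close>

definition pos_op :: "'a::real_hilbert op \<Rightarrow> bool"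
  where "pos_op T \<longleftrightarrow> (\<forall>x y. inner (T x) y = inner x (T y)) \<and> (\<forall>x. inner x (T x) \<ge> 0)"

lemma pos_op_inner: "pos_op T \<Longrightarrow> inner (T x) y = inner x (T y)"
  by (simp add: pos_op_def)

lemma pos_op_nonneg: "pos_op T \<Longrightarrow> 0 \<le> inner (T x) x"
  by (simp add: pos_op_def inner_commute)

lemma pos_op_hadj_compose:
  fixes T :: "'a::real_hilbert op"
  shows "pos_op (T\<^sup>\<star> o\<^sub>L T)" "pos_op (T o\<^sub>L T\<^sup>\<star>)"
proof -
  have "pos_op (T\<^sup>\<star> o\<^sub>L T)" for T :: "'a op"
  proof -
    have "0 \<le> inner x (T\<^sup>\<star> (T x))" for x
      using hadj_inner[of T x "T x"] inner_ge_zero[of "T x"] by simp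
    then show ?thesis by (simp add: pos_op_def hadj_inner hadj_inner')
  qed
  from this[of T] this[of "T\<^sup>\<star>"] show "pos_op (T\<^sup>\<star> o\<^sub>L T)" "pos_op (T o\<^sub>L T\<^sup>\<star>)" by simp_all
qed

lemma pos_op_hadj: "pos_op T \<Longrightarrow> T\<^sup>\<star> = T"
  by (rule hadjI) (simp add: pos_op_inner)

lemma pos_op_cauchy_schwarz:
  assumes "pos_op T"
  shows "(inner (T x) y)\<^sup>2 \<le> inner (T x) x * inner (T y) y"
proof -
  define a b c where a_b_c_def: "a = inner (T x) x" "b = inner (T x) y" "c = inner (T y) y"
  have sym: "inner (T y) x = b" 
    using pos_op_inner[OF assms, of y x] by (simp add: a_b_c_def inner_commute)
  have q: "0 \<le> s\<^sup>2 * a + 2 * s * t * b + t\<^sup>2 * c" for s t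
  proof -
    have "0 \<le> inner (T (s *\<^sub>R x + t *\<^sub>R y)) (s *\<^sub>R x + t *\<^sub>R y)"
      using assms by (rule pos_op_nonneg)
    also have "\<dots> = s\<^sup>2 * a + 2 * s * t * b + t\<^sup>2 * c"
      using sym by (simp add: blinfun.bilinear_simps inner_simps power2_eq_square algebra_simps
          a_b_c_def)
    finally show ?thesis .
  qed
  have a: "a \<ge> 0" and c: "c \<ge> 0" using assms by (auto simp: a_b_c_def pos_op_nonneg)
  have "b\<^sup>2 \<le> a * c"
  proof (cases "c = 0")
    case True
    have "b = 0"
    proof (rule ccontr)
      assume "b \<noteq> 0"
      \<comment> \<open>With \<open>c = 0\<close> the form is affine in \<open>t\<close>; this
        \<open>t\<close> gives it the value -1.\<close>
      with q[of 1 "- (a + 1) / (2 * b)"] True show False by (simp add: field_simps)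
    qed
    then show ?thesis using True by simp
  next
    case False
    then have "c > 0" using c by simp
    \<comment> \<open>At \<open>(c, -b)\<close> the form equals
      \<open>c * (a * c - b\<^sup>2)\<close>.\<close>
    from q[of c "-b"] have "0 \<le> c * (a * c - b\<^sup>2)"
      by (simp add: power2_eq_square algebra_simps)
    with \<open>c > 0\<close> have "0 \<le> a * c - b\<^sup>2" by (simp add: zero_le_mult_iff)
    then show ?thesis by simp
  qed
  then show ?thesis by (simp add: a_b_c_def)
qed

text \<open>Cauchy-Schwarz for the form of \<open>T\<close> with \<open>y = T x\<close> bounds the
  fourth power of \<open>norm (T x)\<close>; one factor \<open>(norm (T x))\<^sup>2\<close>
  cancels.\<close>

lemma pos_op_norm_le:
  assumes "pos_op T"
  shows "(norm (T x))\<^sup>2 \<le> norm T * inner (T x) x"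
proof (cases "T x = 0")
  case False
  have "((norm (T x))\<^sup>2)\<^sup>2 = (inner (T x) (T x))\<^sup>2" by (simp add: power2_norm_eq_inner)
  also have "\<dots> \<le> inner (T x) x * inner (T (T x)) (T x)" by (rule pos_op_cauchy_schwarz[OF assms])
  also have "inner (T (T x)) (T x) \<le> norm T * (norm (T x))\<^sup>2"
    using norm_cauchy_schwarz[of "T (T x)" "T x"] norm_blinfun[of T "T x"]
    by (smt (verit, ccfv_threshold) mult.assoc mult_right_mono norm_ge_zero power2_eq_square)
  finally have "(norm (T x))\<^sup>2 * (norm (T x))\<^sup>2 \<le> (norm T * inner (T x) x) * (norm (T x))\<^sup>2"
    using mult_left_mono[OF _ pos_op_nonneg[OF assms, of x]]
    by (smt (verit, ccfv_threshold) power2_eq_square mult.assoc mult.commute)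
  then show ?thesis by (rule mult_right_le_imp_le) (use False in simp)
qed (simp add: pos_op_nonneg[OF assms])

lemma pos_op_zero_if_inner_zero:
  assumes "pos_op T" "inner (T x) x = 0"
  shows "T x = 0"
  using pos_op_norm_le[OF assms(1), of x] assms(2) by simp

text \<open>Inserting the hypothesis into
  \<open>(norm (T x))\<^sup>2 \<le> norm T * inner (T x) x\<close> gives
  \<open>(norm T)\<^sup>2 \<le> norm T * c\<close>.\<close>

lemma pos_op_norm_leI:
  assumes "pos_op T" "c \<ge> 0" "\<And>x. inner (T x) x \<le> c * (norm x)\<^sup>2"
  shows "norm T \<le> c"
proof -
  have "norm T \<le> sqrt (norm T * c)"
  proof (rule norm_blinfun_bound)
    fix x
    have "(norm (T x))\<^sup>2 \<le> norm T * (c * (norm x)\<^sup>2)"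
      using pos_op_norm_le[OF assms(1), of x] assms(3)[of x]
      by (meson mult_left_mono norm_ge_zero order_trans)
    then have "(norm (T x))\<^sup>2 \<le> (sqrt (norm T * c) * norm x)\<^sup>2"
      using assms(2) by (simp add: power_mult_distrib)
    then show "norm (T x) \<le> sqrt (norm T * c) * norm x"
      by (rule power2_le_imp_le) (simp add: assms(2))
  qed (simp add: assms(2))
  then have "(norm T)\<^sup>2 \<le> norm T * c"
    using assms(2) by (metis norm_ge_zero power_mono real_sqrt_pow2 mult_nonneg_nonneg)
  then show ?thesis using assms(2)
    by (cases "T = 0") (simp_all add: power2_eq_square)
qed

lemma inner_le_norm_op:
  fixes T :: "'a::real_hilbert op"
  shows "inner (T x) x \<le> norm T * (norm x)\<^sup>2"
proof -
  have "inner (T x) x \<le> norm (T x) * norm x" by (rule norm_cauchy_schwarz)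
  also have "\<dots> \<le> (norm T * norm x) * norm x" by (intro mult_right_mono norm_blinfun) auto
  finally show ?thesis by (simp add: power2_eq_square mult.assoc)
qed

lemma pos_op_norm_mono:
  fixes S T :: "'a::real_hilbert op"
  assumes "pos_op S" "\<And>x. inner (S x) x \<le> inner (T x) x"
  shows "norm S \<le> norm T"
  using assms(1)
  by (rule pos_op_norm_leI) (auto intro: order_trans[OF assms(2) inner_le_norm_op])

lemma pos_op_norm_minus:
  assumes "pos_op T"
  shows "pos_op (norm T *\<^sub>R id_blinfun - T)"
  using inner_le_norm_op[of T]
  by (simp add: pos_op_def blinfun.bilinear_simps inner_simps pos_op_inner[OF assms]
      power2_norm_eq_inner)

text \<open>The operator \<open>norm T *\<^sub>R id_blinfun - T\<close> is positive with vanishing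
  form at \<open>x\<close>, and a positive operator kills the zeros of its form.\<close>

lemma pos_op_top_eigenvector:
  assumes "pos_op T" "norm T * (norm x)\<^sup>2 \<le> inner (T x) x"
  shows "T x = norm T *\<^sub>R x"
proof -
  have "inner ((norm T *\<^sub>R id_blinfun - T) x) x = 0"
    using assms(2) inner_le_norm_op[of T x]
    by (simp add: blinfun.bilinear_simps inner_simps power2_norm_eq_inner)
  from pos_op_zero_if_inner_zero[OF pos_op_norm_minus[OF assms(1)] this] show ?thesis
    by (simp add: blinfun.bilinear_simps)
qed

lemma pos_op_add: "pos_op S \<Longrightarrow> pos_op T \<Longrightarrow> pos_op (S + T)"
  by (simp add: pos_op_def blinfun.bilinear_simps inner_simps)

lemma pos_op_scaleR: "0 \<le> r \<Longrightarrow> pos_op T \<Longrightarrow> pos_op (r *\<^sub>R T)"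
  by (simp add: pos_op_def blinfun.bilinear_simps inner_simps)

lemma pos_op_0: "pos_op 0" and pos_op_id: "pos_op id_blinfun"
  by (simp_all add: pos_op_def)

lemma selfadjoint_eqI:
  fixes S T :: "'a::real_hilbert op"
  assumes "S\<^sup>\<star> = S" "T\<^sup>\<star> = T" "\<And>x. inner (S x) x = inner (T x) x"
  shows "S = T"
proof -
  have "inner ((S - T) x) y = 0" for x y
  proof -
    have z: "inner ((S - T) w) w = 0" for w
      using assms(3)[of w] by (simp add: blinfun.bilinear_simps inner_simps)
    have "inner ((S - T) y) x = inner ((S - T) x) y"
      using hadj_inner[of "S - T" y x] assms(1,2) by (simp add: hadj_diff inner_commute)
    with z[of "x + y"] z[of x] z[of y] show ?thesis
      by (simp add: blinfun.bilinear_simps inner_simps)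
  qed
  then have "S - T = 0" unfolding op_eq_iff_inner by simp
  then show ?thesis by simp
qed

subsection \<open>Projections\<close>

definition is_proj :: "'a::real_hilbert op \<Rightarrow> bool"
  where "is_proj P \<longleftrightarrow> (\<forall>x. P (P x) = P x) \<and> (\<forall>x y. inner (P x) y = inner x (P y))"

lemma is_proj_idem: "is_proj P \<Longrightarrow> P (P x) = P x"
  and is_proj_inner: "is_proj P \<Longrightarrow> inner (P x) y = inner x (P y)"
  by (auto simp: is_proj_def)

lemma is_proj_iff: "is_proj P \<longleftrightarrow> P o\<^sub>L P = P \<and> P\<^sup>\<star> = P"
proof
  assume "is_proj P"
  then show "P o\<^sub>L P = P \<and> P\<^sup>\<star> = P"
    by (auto intro!: blinfun_eqI hadjI simp: is_proj_def)
next
  assume P: "P o\<^sub>L P = P \<and> P\<^sup>\<star> = P"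
  have "P (P x) = P x" for x
    using P by (metis blinfun_apply_blinfun_compose)
  moreover have "inner (P x) y = inner x (P y)" for x y
    using P hadj_inner[of P x y] by simp
  ultimately show "is_proj P" by (simp add: is_proj_def)
qed

lemma is_proj_hadj: "is_proj P \<Longrightarrow> P\<^sup>\<star> = P"
  by (simp add: is_proj_iff)

lemma is_proj_compose_self: "is_proj P \<Longrightarrow> P o\<^sub>L P = P"
  by (simp add: is_proj_iff)

lemma is_proj_0 [simp]: "is_proj 0" and is_proj_id [simp]: "is_proj id_blinfun"
  by (simp_all add: is_proj_def)

lemma is_proj_compl: "is_proj P \<Longrightarrow> is_proj (id_blinfun - P)"
  by (simp add: is_proj_def blinfun.bilinear_simps inner_simps)

lemma is_proj_orth_proj: "closed S \<Longrightarrow> subspace S \<Longrightarrow> is_proj (orth_proj S)"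
  by (simp add: is_proj_def orth_proj_inner orth_proj_eq_iff)

lemma is_proj_inner_self:
  assumes "is_proj P"
  shows "inner x (P x) = (norm (P x))\<^sup>2" "inner (P x) x = (norm (P x))\<^sup>2"
proof -
  show "inner x (P x) = (norm (P x))\<^sup>2"
    using is_proj_inner[OF assms, of x "P x"] is_proj_idem[OF assms, of x]
    by (simp add: power2_norm_eq_inner)
  then show "inner (P x) x = (norm (P x))\<^sup>2" by (simp add: inner_commute)
qed

lemma is_proj_pythagoras:
  assumes "is_proj P"
  shows "(norm x)\<^sup>2 = (norm (P x))\<^sup>2 + (norm (x - P x))\<^sup>2"
  using is_proj_inner_self[OF assms, of x]
  by (simp add: power2_norm_eq_inner inner_simps inner_commute)

lemma is_proj_norm_le:
  assumes "is_proj P"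
  shows "norm (P x) \<le> norm x"
proof (rule power2_le_imp_le)
  show "(norm (P x))\<^sup>2 \<le> (norm x)\<^sup>2"
    using is_proj_pythagoras[OF assms, of x] zero_le_power2[of "norm (x - P x)"] by linarith
qed simp

lemma is_proj_range:
  assumes "is_proj P"
  shows "range (blinfun_apply P) = {x. P x = x}"
proof (intro set_eqI iffI)
  fix x assume "x \<in> {x. P x = x}"
  then have "x = P x" by simp
  then show "x \<in> range (blinfun_apply P)" by (rule range_eqI)
qed (auto simp: is_proj_idem[OF assms])

lemma proj_le_sym:
  assumes "is_proj P" "is_proj Q"
  shows "Q o\<^sub>L P = P \<longleftrightarrow> P o\<^sub>L Q = P"
  using assms by (metis hadj_compose is_proj_hadj)

lemma proj_range_subset_iff:
  assumes "is_proj P" "is_proj Q"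
  shows "range (blinfun_apply P) \<subseteq> range (blinfun_apply Q) \<longleftrightarrow> Q o\<^sub>L P = P"
proof
  assume L: "range (blinfun_apply P) \<subseteq> range (blinfun_apply Q)"
  show "Q o\<^sub>L P = P"
    using L is_proj_range[OF assms(2)] by (intro blinfun_eqI) auto
next
  assume "Q o\<^sub>L P = P"
  then show "range (blinfun_apply P) \<subseteq> range (blinfun_apply Q)"
    by (metis blinfun_apply_blinfun_compose image_subsetI rangeI)
qed

lemma proj_orthogonal_sym:
  fixes P Q :: "'a::real_hilbert op"
  assumes "is_proj P" "is_proj Q" "P o\<^sub>L Q = 0"
  shows "Q o\<^sub>L P = 0"
  using assms by (metis hadj_compose is_proj_hadj hadj_0)

lemma is_proj_add:
  assumes "is_proj P" "is_proj Q" "P o\<^sub>L Q = 0"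
  shows "is_proj (P + Q)"
proof -
  have "P (Q x) = 0" "Q (P x) = 0" for x
    using assms(3) proj_orthogonal_sym[OF assms]
    by (metis blinfun_apply_blinfun_compose zero_blinfun.rep_eq)+
  then show ?thesis
    using assms(1,2) by (simp add: is_proj_def blinfun.bilinear_simps inner_simps)
qed

lemma is_proj_diff:
  assumes "is_proj P" "is_proj Q" "P o\<^sub>L Q = Q"
  shows "is_proj (P - Q)"
proof -
  have "P (Q x) = Q x" "Q (P x) = Q x" for x
    using assms(3) proj_le_sym[OF assms(2,1)] by (metis blinfun_apply_blinfun_compose)+
  then show ?thesis
    using assms(1,2) by (simp add: is_proj_def blinfun.bilinear_simps inner_simps)
qed

text \<open>Kernels determine projections, so the order can be tested on them; supports and
  orthogonal sums below are known through their kernels.\<close>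

lemma is_proj_le_iff_inner:
  assumes "is_proj P" "is_proj Q"
  shows "Q o\<^sub>L P = P \<longleftrightarrow> (\<forall>x. Q x = 0 \<longrightarrow> P x = 0)"
proof
  assume "Q o\<^sub>L P = P"
  then have "P o\<^sub>L Q = P" using proj_le_sym[OF assms] by simp
  then show "\<forall>x. Q x = 0 \<longrightarrow> P x = 0"
    by (metis blinfun_apply_blinfun_compose blinfun.zero_right)
next
  assume R: "\<forall>x. Q x = 0 \<longrightarrow> P x = 0"
  have "P (x - Q x) = 0" for x
    using R is_proj_idem[OF assms(2)] by (metis blinfun.diff_right cancel_comm_monoid_add_class.diff_cancel)
  then have "P o\<^sub>L Q = P"
    by (intro blinfun_eqI) (simp add: blinfun.diff_right)
  then show "Q o\<^sub>L P = P" using proj_le_sym[OF assms] by simp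
qed

lemma is_proj_eqI:
  assumes "is_proj P" "is_proj Q" "\<And>x. P x = 0 \<longleftrightarrow> Q x = 0"
  shows "P = Q"
  using is_proj_le_iff_inner[OF assms(1,2)] is_proj_le_iff_inner[OF assms(2,1)]
    proj_le_sym[OF assms(1,2)] assms(3) by simp

lemma is_proj_eq_rangeI:
  assumes "is_proj P" "is_proj Q" "range (blinfun_apply P) = range (blinfun_apply Q)"
  shows "P = Q"
  using proj_range_subset_iff[OF assms(1,2)] proj_range_subset_iff[OF assms(2,1)]
    proj_le_sym[OF assms(1,2)] assms(3) by simp

text \<open>Invariance under \<open>T\<close> and its adjoint makes \<open>K\<close> reducing: the
  orthogonal complement of \<open>K\<close> is then mapped into itself as well.\<close>

lemma orth_proj_commute:
  fixes T :: "'a::real_hilbert op"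
  assumes K: "closed K" "subspace K"
    and "\<And>x. x \<in> K \<Longrightarrow> T x \<in> K" "\<And>x. x \<in> K \<Longrightarrow> T\<^sup>\<star> x \<in> K"
  shows "T o\<^sub>L orth_proj K = orth_proj K o\<^sub>L T"
proof (rule blinfun_eqI)
  fix x
  have "orth_proj K (T x) = T (orth_proj K x)"
  proof (rule orth_proj_unique[OF K])
    show "T (orth_proj K x) \<in> K" using assms orth_proj_in[OF K] by blast
    show "inner (T x - T (orth_proj K x)) z = 0" if "z \<in> K" for z
      using orth_proj_orthogonal[OF K assms(4)[OF that], of x]
      by (simp add: hadj_inner flip: blinfun.diff_right)
  qed
  then show "(T o\<^sub>L orth_proj K) x = (orth_proj K o\<^sub>L T) x" by simp
qed

definition kernel :: "'a::real_hilbert op \<Rightarrow> 'a set" where "kernel T = {x. T x = 0}"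

lemma kernel_closed_subspace: "closed (kernel T)" "subspace (kernel T)"
  unfolding kernel_def
  by (auto intro!: closed_Collect_eq continuous_intros simp: subspace_def blinfun.bilinear_simps)

lemma is_proj_kernel: "is_proj (orth_proj (kernel T))"
  by (intro is_proj_orth_proj kernel_closed_subspace)

lemma orth_proj_kernel_eq_iff: "orth_proj (kernel T) x = x \<longleftrightarrow> T x = 0"
  using orth_proj_eq_iff[OF kernel_closed_subspace] by (simp add: kernel_def)

lemma orth_proj_kernel_commute:
  fixes S T :: "'a::real_hilbert op"
  assumes "S o\<^sub>L T = T o\<^sub>L S" "S\<^sup>\<star> o\<^sub>L T = T o\<^sub>L S\<^sup>\<star>"
  shows "S o\<^sub>L orth_proj (kernel T) = orth_proj (kernel T) o\<^sub>L S"
proof (rule orth_proj_commute[OF kernel_closed_subspace])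
  show "S x \<in> kernel T" if "x \<in> kernel T" for x
    using that assms(1) unfolding kernel_def
    by (metis (mono_tags, lifting) blinfun_apply_blinfun_compose blinfun.zero_right mem_Collect_eq)
  show "S\<^sup>\<star> x \<in> kernel T" if "x \<in> kernel T" for x
    using that assms(2) unfolding kernel_def
    by (metis (mono_tags, lifting) blinfun_apply_blinfun_compose blinfun.zero_right mem_Collect_eq)
qed

subsection \<open>Strong limits\<close>

definition strong_lim :: "(nat \<Rightarrow> 'a::real_hilbert op) \<Rightarrow> 'a op \<Rightarrow> bool"
  where "strong_lim S T \<longleftrightarrow> (\<forall>x. (\<lambda>n. S n x) \<longlonglongrightarrow> T x)"

lemma strong_lim_exists:
  fixes S :: "nat \<Rightarrow> 'a::real_hilbert op"
  assumes "\<And>x. convergent (\<lambda>n. S n x)" "\<And>n. norm (S n) \<le> K"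
  shows "\<exists>T. strong_lim S T"
proof -
  define f where "f x = lim (\<lambda>n. S n x)" for x
  have f: "(\<lambda>n. S n x) \<longlonglongrightarrow> f x" for x
    using assms(1) by (simp add: f_def convergent_LIMSEQ_iff)
  have "bounded_linear f"
  proof (rule bounded_linear_intro[where K = K])
    fix x y :: 'a and r :: real
    have "(\<lambda>n. S n (x + y)) \<longlonglongrightarrow> f x + f y"
      using tendsto_add[OF f f] by (simp add: blinfun.bilinear_simps)
    then show "f (x + y) = f x + f y" using f LIMSEQ_unique by blast
    have "(\<lambda>n. S n (r *\<^sub>R x)) \<longlonglongrightarrow> r *\<^sub>R f x"
      using tendsto_scaleR[OF tendsto_const f] by (simp add: blinfun.bilinear_simps)
    then show "f (r *\<^sub>R x) = r *\<^sub>R f x" using f LIMSEQ_unique by blast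
    have "norm (S n x) \<le> norm x * K" for n
      using norm_blinfun[of "S n" x] assms(2)[of n]
      by (metis mult.commute mult_left_mono norm_ge_zero order_trans)
    then show "norm (f x) \<le> norm x * K"
      by (intro Lim_bounded[OF tendsto_norm[OF f]]) auto
  qed
  then have "strong_lim S (Blinfun f)"
    using f by (simp add: strong_lim_def bounded_linear_Blinfun_apply)
  then show ?thesis by blast
qed

lemma strong_lim_commute:
  fixes S :: "nat \<Rightarrow> 'a::real_hilbert op"
  assumes "strong_lim S T" "\<And>n. U o\<^sub>L S n = S n o\<^sub>L U"
  shows "U o\<^sub>L T = T o\<^sub>L U"
proof (rule blinfun_eqI)
  fix x
  have c: "U (S n x) = S n (U x)" for n
    using assms(2) by (metis blinfun_apply_blinfun_compose)
  have "(\<lambda>n. U (S n x)) \<longlonglongrightarrow> U (T x)"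
    using assms(1) unfolding strong_lim_def
    by (intro bounded_linear.tendsto[OF blinfun.bounded_linear_right]) blast
  moreover have "(\<lambda>n. U (S n x)) \<longlonglongrightarrow> T (U x)"
    using assms(1) by (simp add: strong_lim_def c)
  ultimately show "(U o\<^sub>L T) x = (T o\<^sub>L U) x" using LIMSEQ_unique by auto
qed

lemma strong_lim_inner:
  fixes S :: "nat \<Rightarrow> 'a::real_hilbert op"
  shows "strong_lim S T \<Longrightarrow> (\<lambda>n. inner x (S n y)) \<longlonglongrightarrow> inner x (T y)"
  unfolding strong_lim_def by (intro tendsto_inner tendsto_const) blast

lemma strong_lim_sym:
  assumes "strong_lim S T" "\<And>n. (S n)\<^sup>\<star> = S n"
  shows "T\<^sup>\<star> = T"
proof (rule hadjI)
  fix x y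
  have "inner (S n y) x = inner y (S n x)" for n
    using hadj_inner[of "S n" y x] assms(2) by simp
  then have "(\<lambda>n. inner x (S n y)) = (\<lambda>n. inner y (S n x))" by (simp add: inner_commute)
  with strong_lim_inner[OF assms(1), of x y] strong_lim_inner[OF assms(1), of y x]
  show "inner (T x) y = inner x (T y)"
    using LIMSEQ_unique by (metis inner_commute)
qed

text \<open>For \<open>m \<le> n\<close> the positive difference satisfies
  \<open>(norm ((S n - S m) x))\<^sup>2 \<le> c * (a n - a m)\<close>, where the real sequence
  \<open>a n = inner x (S n x)\<close> is monotone and bounded, hence Cauchy.\<close>

lemma monotone_strong_lim:
  fixes S :: "nat \<Rightarrow> 'a::real_hilbert op"
  assumes sym: "\<And>n. (S n)\<^sup>\<star> = S n"
    and incr: "\<And>n x. inner x (S n x) \<le> inner x (S (Suc n) x)"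
    and bd: "\<And>n x. inner x (S n x) \<le> K * (norm x)\<^sup>2"
  shows "\<exists>T. strong_lim S T"
proof -
  \<comment> \<open>\<open>\<bar>K\<bar> + norm (S 0)\<close> bounds the form of every difference
    \<open>S n - S m\<close>, since \<open>S m\<close> dominates \<open>S 0\<close>; the 1 keeps
    \<open>c\<close> positive for the later division.\<close>
  define c where "c = \<bar>K\<bar> + norm (S 0) + 1"
  have mono: "inner x (S m x) \<le> inner x (S n x)" if "m \<le> n" for m n x
    using lift_Suc_mono_le[of "\<lambda>n. inner x (S n x)"] incr that by blast
  have lowb: "- norm (S 0) * (norm x)\<^sup>2 \<le> inner x (S 0 x)" for x
    using inner_le_norm_op[of "- S 0" x] by (simp add: blinfun.bilinear_simps inner_commute)
  have pos: "pos_op (S n - S m)" if "m \<le> n" for m n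
    using mono[OF that] hadj_inner[of "S n"] hadj_inner[of "S m"]
    by (simp add: pos_op_def blinfun.bilinear_simps inner_simps sym)
  have nrm: "norm (S n - S m) \<le> c" if "m \<le> n" for m n
  proof (rule pos_op_norm_leI[OF pos[OF that]])
    show "c \<ge> 0" by (simp add: c_def)
    fix x
    have "inner ((S n - S m) x) x = inner x (S n x) - inner x (S m x)"
      by (simp add: blinfun.bilinear_simps inner_simps inner_commute)
    also have "\<dots> \<le> K * (norm x)\<^sup>2 + norm (S 0) * (norm x)\<^sup>2"
      using bd[of x n] mono[of 0 m x] lowb[of x] by simp
    also have "\<dots> \<le> c * (norm x)\<^sup>2"
      by (simp add: c_def flip: distrib_right) (intro mult_right_mono, auto)
    finally show "inner ((S n - S m) x) x \<le> c * (norm x)\<^sup>2" .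
  qed
  have c0: "c > 0" by (simp add: c_def add_nonneg_pos)
  have conv: "convergent (\<lambda>n. S n x)" for x
  proof -
    define a where "a n = inner x (S n x)" for n
    have "convergent a"
    proof (rule Bseq_monoseq_convergent[OF BseqI'])
      show "norm (a n) \<le> \<bar>K * (norm x)\<^sup>2\<bar> + \<bar>a 0\<bar>" for n
        using bd[of x n] mono[of 0 n x] by (auto simp: a_def)
      show "monoseq a" using mono by (auto simp: monoseq_def a_def)
    qed
    then have Ca: "Cauchy a" by (rule convergent_Cauchy)
    have key: "(norm (S n x - S m x))\<^sup>2 \<le> c * (a n - a m)" if "m \<le> n" for m n
    proof -
      have "(norm ((S n - S m) x))\<^sup>2 \<le> norm (S n - S m) * inner ((S n - S m) x) x"
        by (rule pos_op_norm_le[OF pos[OF that]])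
      also have "\<dots> \<le> c * inner ((S n - S m) x) x"
        using pos_op_nonneg[OF pos[OF that]] nrm[OF that] by (intro mult_right_mono) auto
      also have "inner ((S n - S m) x) x = a n - a m"
        by (simp add: a_def blinfun.bilinear_simps inner_simps inner_commute)
      finally show ?thesis by (simp add: blinfun.bilinear_simps)
    qed
    have "Cauchy (\<lambda>n. S n x)"
    proof (rule metric_CauchyI)
      fix e :: real assume "0 < e"
      then have "0 < e\<^sup>2 / c" using c0 by simp
      then obtain N where N: "\<And>m n. m \<ge> N \<Longrightarrow> n \<ge> N \<Longrightarrow> \<bar>a m - a n\<bar> < e\<^sup>2 / c"
        using Ca by (metis metric_CauchyD dist_real_def)
      have le: "norm (S n x - S m x) < e" if "m \<ge> N" "m \<le> n" for m n
      proof -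
        have "a n - a m < e\<^sup>2 / c" using N[of n m] that by auto
        then have "c * (a n - a m) < e\<^sup>2" using c0 by (simp add: field_simps)
        then have "(norm (S n x - S m x))\<^sup>2 < e\<^sup>2" using key[OF that(2)] by simp
        then show ?thesis using \<open>0 < e\<close> by (simp add: power_less_imp_less_base)
      qed
      have "dist (S m x) (S n x) < e" if "m \<ge> N" "n \<ge> N" for m n
        using le[of m n] le[of n m] that by (cases "m \<le> n") (auto simp: dist_norm norm_minus_commute)
      then show "\<exists>M. \<forall>m\<ge>M. \<forall>n\<ge>M. dist (S m x) (S n x) < e" by blast
    qed
    then show ?thesis by (simp add: Cauchy_convergent_iff)
  qed
  have "norm (S n) \<le> c + norm (S 0)" for n
    using nrm[of 0 n] norm_triangle_ineq[of "S n - S 0" "S 0"] by simp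
  from strong_lim_exists[OF conv this] show ?thesis .
qed

subsection \<open>Square roots\<close>

text \<open>Polynomials in \<open>X\<close> with nonnegative coefficients, generated without naming
  the coefficients.\<close>

inductive_set pos_polys :: "'a::real_hilbert op \<Rightarrow> 'a op set" for X
  where zero: "0 \<in> pos_polys X"
  | one: "id_blinfun \<in> pos_polys X"
  | add: "S \<in> pos_polys X \<Longrightarrow> T \<in> pos_polys X \<Longrightarrow> S + T \<in> pos_polys X"
  | scale: "0 \<le> r \<Longrightarrow> S \<in> pos_polys X \<Longrightarrow> r *\<^sub>R S \<in> pos_polys X"
  | times: "S \<in> pos_polys X \<Longrightarrow> X o\<^sub>L S \<in> pos_polys X"

lemma blinfun_compose_assoc: "(A o\<^sub>L B) o\<^sub>L C = A o\<^sub>L (B o\<^sub>L C)"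
  by (rule blinfun_eqI) simp

lemmas blinfun_compose_simps =
  bounded_bilinear.add_left[OF bounded_bilinear_blinfun_compose]
  bounded_bilinear.add_right[OF bounded_bilinear_blinfun_compose]
  bounded_bilinear.diff_left[OF bounded_bilinear_blinfun_compose]
  bounded_bilinear.diff_right[OF bounded_bilinear_blinfun_compose]
  bounded_bilinear.scaleR_left[OF bounded_bilinear_blinfun_compose]
  bounded_bilinear.scaleR_right[OF bounded_bilinear_blinfun_compose]

lemma blinfun_compose_id [simp]: "A o\<^sub>L id_blinfun = A" "id_blinfun o\<^sub>L A = A"
  by (auto intro: blinfun_eqI)

lemma pos_polys_mult:
  assumes "S \<in> pos_polys X" "T \<in> pos_polys X"
  shows "S o\<^sub>L T \<in> pos_polys X"
  using assms
  by induction (auto simp: blinfun_compose_simps blinfun_compose_assoc intro: pos_polys.intros)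

lemma pos_polys_commute:
  assumes "S \<in> pos_polys X" "U o\<^sub>L X = X o\<^sub>L U"
  shows "U o\<^sub>L S = S o\<^sub>L U"
  using assms
proof induction
  case (times S)
  then show ?case by (metis blinfun_compose_assoc)
qed (auto simp: blinfun_compose_simps)

text \<open>The claim for \<open>X o\<^sub>L S\<close> is carried along in the induction because a
  product of commuting positive operators is not yet known to be positive; in the step,
  \<open>X o\<^sub>L (X o\<^sub>L S)\<close> equals \<open>X o\<^sub>L (S o\<^sub>L X)\<close>,
  whose form is that of \<open>S\<close> at \<open>X x\<close>.\<close>

lemma pos_polys_pos_op:
  assumes "S \<in> pos_polys X" "pos_op X"
  shows "pos_op S \<and> pos_op (X o\<^sub>L S)"
  using assms
proof induction
  case (times S)
  have "X o\<^sub>L (X o\<^sub>L S) = X o\<^sub>L (S o\<^sub>L X)"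
    using pos_polys_commute[OF times(1), of X] by simp
  moreover have "pos_op (X o\<^sub>L (S o\<^sub>L X))"
    using times by (simp add: pos_op_def) (metis pos_op_def)
  ultimately show ?case using times by simp
qed (auto simp: blinfun_compose_simps pos_op_0 pos_op_id intro: pos_op_add pos_op_scaleR)

text \<open>For numbers, iterating y to (x + y^2) / 2 from 0 leads to 1 - sqrt (1 - x); with
  \<open>X = id_blinfun - B\<close> the limit \<open>T\<close> yields the root
  \<open>id_blinfun - T\<close> of \<open>B\<close>. The increments are polynomials in
  \<open>X\<close> with nonnegative coefficients, so the iterates increase and converge
  strongly.\<close>

lemma pos_op_sqrt_contraction:
  fixes B :: "'a::real_hilbert op"
  assumes B: "pos_op B" and nB: "norm B \<le> 1"
  shows "\<exists>R. pos_op R \<and> R o\<^sub>L R = B \<and> (\<forall>U. U o\<^sub>L B = B o\<^sub>L U \<longrightarrow> U o\<^sub>L R = R o\<^sub>L U)"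
proof -
  define X where "X = id_blinfun - B"
  have Bx: "inner x (B x) \<le> (norm x)\<^sup>2" for x
    using inner_le_norm_op[of B x] nB mult_right_mono[OF nB, of "(norm x)\<^sup>2"]
    by (simp add: inner_commute)
  have X: "pos_op X"
    using Bx B by (simp add: X_def pos_op_def blinfun.bilinear_simps inner_simps power2_norm_eq_inner)
  have nX: "norm X \<le> 1"
  proof (rule pos_op_norm_leI[OF X])
    show "inner (X x) x \<le> 1 * (norm x)\<^sup>2" for x
      using pos_op_nonneg[OF B, of x]
      by (simp add: X_def blinfun.bilinear_simps inner_simps power2_norm_eq_inner)
  qed simp
  define Y where "Y = rec_nat 0 (\<lambda>_ y. (1/2) *\<^sub>R (X + (y o\<^sub>L y)))"
  have Y0: "Y 0 = 0" and YS: "Y (Suc n) = (1/2) *\<^sub>R (X + (Y n o\<^sub>L Y n))" for n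
    by (simp_all add: Y_def)
  have XC: "X \<in> pos_polys X" using pos_polys.times[OF pos_polys.one, of X] by simp
  have YC: "Y n \<in> pos_polys X" for n
    by (induction n) (auto simp: Y0 YS intro!: pos_polys.intros pos_polys_mult XC)
  have dC: "Y (Suc n) - Y n \<in> pos_polys X" for n
  proof (induction n)
    case 0
    show ?case using YC[of 1] by (simp add: Y0)
  next
    case (Suc n)
    \<comment> \<open>A difference of two squares, written without commuting the factors.\<close>
    have "Y (Suc (Suc n)) - Y (Suc n) = (1/2) *\<^sub>R
        (((Y (Suc n) - Y n) o\<^sub>L Y (Suc n)) + (Y n o\<^sub>L (Y (Suc n) - Y n)))"
      unfolding YS[of "Suc n"] by (subst (3) YS) (simp add: blinfun_compose_simps algebra_simps)
    then show ?case using Suc YC by (auto intro!: pos_polys.intros pos_polys_mult)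
  qed
  have Yn: "norm (Y n) \<le> 1" for n
  proof (induction n)
    case (Suc n)
    have "norm (Y n o\<^sub>L Y n) \<le> 1"
      using norm_blinfun_compose[of "Y n" "Y n"] Suc mult_le_one[of "norm (Y n)" "norm (Y n)"]
      by simp
    then have "norm (X + (Y n o\<^sub>L Y n)) \<le> 2"
      using nX norm_triangle_ineq[of X "Y n o\<^sub>L Y n"] by simp
    then show ?case by (simp add: YS)
  qed (simp add: Y0)
  have Ypos: "pos_op (Y n)" for n using pos_polys_pos_op[OF YC X] by simp
  have "\<exists>T. strong_lim Y T"
  proof (rule monotone_strong_lim)
    show "(Y n)\<^sup>\<star> = Y n" for n by (rule pos_op_hadj[OF Ypos])
    show "inner x (Y n x) \<le> inner x (Y (Suc n) x)" for n x
      using pos_op_nonneg[OF conjunct1[OF pos_polys_pos_op[OF dC X]], of n x]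
      by (simp add: blinfun.bilinear_simps inner_simps inner_commute)
    show "inner x (Y n x) \<le> 1 * (norm x)\<^sup>2" for n x
      using inner_le_norm_op[of "Y n" x] mult_right_mono[OF Yn[of n], of "(norm x)\<^sup>2"]
      by (simp add: inner_commute)
  qed
  then obtain T where T: "strong_lim Y T" by blast
  have TT: "T x = (1/2) *\<^sub>R (X x + T (T x))" for x
  proof -
    \<comment> \<open>Strong convergence passes to products here because the left factors are
      uniformly bounded.\<close>
    have "(\<lambda>n. Y n (Y n x)) \<longlonglongrightarrow> T (T x)"
    proof (rule Lim_transform2)
      show "(\<lambda>n. Y n (T x)) \<longlonglongrightarrow> T (T x)" using T by (simp add: strong_lim_def)
      have z: "(\<lambda>n. norm (T x - Y n x)) \<longlonglongrightarrow> 0"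
      proof -
        have "(\<lambda>n. norm (T x - Y n x)) \<longlonglongrightarrow> norm (T x - T x)"
          using T unfolding strong_lim_def by (intro tendsto_norm tendsto_diff tendsto_const) blast
        then show ?thesis by simp
      qed
      have "norm (Y n (T x) - Y n (Y n x)) \<le> norm (T x - Y n x)" for n
        using norm_blinfun[of "Y n" "T x - Y n x"] mult_right_mono[OF Yn[of n], of "norm (T x - Y n x)"]
        by (simp add: blinfun.bilinear_simps)
      then show "(\<lambda>n. Y n (T x) - Y n (Y n x)) \<longlonglongrightarrow> 0"
        by (intro Lim_null_comparison[OF _ z]) auto
    qed
    then have "(\<lambda>n. Y (Suc n) x) \<longlonglongrightarrow> (1/2) *\<^sub>R (X x + T (T x))"
      unfolding YS by (simp add: blinfun.add_left blinfun.scaleR_left)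
        (intro tendsto_scaleR tendsto_add tendsto_const)
    moreover have "(\<lambda>n. Y (Suc n) x) \<longlonglongrightarrow> T x"
      using T LIMSEQ_Suc[of "\<lambda>n. Y n x" "T x"] by (simp add: strong_lim_def)
    ultimately show ?thesis using LIMSEQ_unique by blast
  qed
  have Tsym: "T\<^sup>\<star> = T" using T by (rule strong_lim_sym) (rule pos_op_hadj[OF Ypos])
  have Tle: "inner x (T x) \<le> (norm x)\<^sup>2" for x
  proof (rule Lim_bounded[OF strong_lim_inner[OF T]])
    have "inner x (Y n x) \<le> (norm x)\<^sup>2" for n
      using inner_le_norm_op[of "Y n" x] mult_right_mono[OF Yn[of n], of "(norm x)\<^sup>2"]
      by (simp add: inner_commute)
    then show "\<forall>n\<ge>0. inner x (Y n x) \<le> (norm x)\<^sup>2" by blast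
  qed
  define R where "R = id_blinfun - T"
  have "pos_op R"
    using Tle hadj_inner[of T] Tsym
    by (simp add: R_def pos_op_def blinfun.bilinear_simps inner_simps power2_norm_eq_inner)
  moreover have "R o\<^sub>L R = B"
  proof (rule blinfun_eqI)
    fix x
    have "2 *\<^sub>R T x = X x + T (T x)" by (subst TT) simp
    then show "(R o\<^sub>L R) x = B x"
      by (simp add: R_def X_def blinfun.bilinear_simps algebra_simps scaleR_2)
  qed
  moreover have "U o\<^sub>L R = R o\<^sub>L U" if "U o\<^sub>L B = B o\<^sub>L U" for U
  proof -
    have "U o\<^sub>L X = X o\<^sub>L U" using that by (simp add: X_def blinfun_compose_simps)
    then have "U o\<^sub>L T = T o\<^sub>L U"
      by (intro strong_lim_commute[OF T] pos_polys_commute[OF YC])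
    then show ?thesis by (simp add: R_def blinfun_compose_simps)
  qed
  ultimately show ?thesis by blast
qed

lemma pos_op_sqrt:
  fixes B :: "'a::real_hilbert op"
  assumes B: "pos_op B"
  shows "\<exists>R. pos_op R \<and> R o\<^sub>L R = B \<and> (\<forall>U. U o\<^sub>L B = B o\<^sub>L U \<longrightarrow> U o\<^sub>L R = R o\<^sub>L U)"
proof (cases "B = 0")
  case True
  then show ?thesis by (intro exI[of _ 0]) (simp add: pos_op_0)
next
  case False
  define r where "r = norm B"
  have r: "r > 0" using False by (simp add: r_def)
  have "pos_op ((1 / r) *\<^sub>R B)" "norm ((1 / r) *\<^sub>R B) \<le> 1"
    using r by (simp_all add: pos_op_scaleR[OF _ B]) (simp add: r_def)
  from pos_op_sqrt_contraction[OF this] obtain R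
    where R: "pos_op R" "R o\<^sub>L R = (1 / r) *\<^sub>R B"
      and comm: "\<And>U. U o\<^sub>L ((1 / r) *\<^sub>R B) = ((1 / r) *\<^sub>R B) o\<^sub>L U \<Longrightarrow> U o\<^sub>L R = R o\<^sub>L U"
    by blast
  have "(sqrt r *\<^sub>R R) o\<^sub>L (sqrt r *\<^sub>R R) = B"
    using R(2) r by (simp add: blinfun_compose_simps)
  moreover have "U o\<^sub>L (sqrt r *\<^sub>R R) = (sqrt r *\<^sub>R R) o\<^sub>L U" if "U o\<^sub>L B = B o\<^sub>L U" for U
    using comm[of U] that by (simp add: blinfun_compose_simps)
  moreover have "pos_op (sqrt r *\<^sub>R R)" using pos_op_scaleR[OF _ R(1), of "sqrt r"] r by simp
  ultimately show ?thesis by blast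
qed

text \<open>\<open>P\<close> is the spectral projection of \<open>T\<close> for \<open>(-\<infinity>, 0]\<close>, obtained as the kernel of
  \<open>\<bar>T\<bar> + T\<close>.\<close>

lemma spectral_cut:
  fixes T :: "'a::real_hilbert op"
  assumes T: "T\<^sup>\<star> = T"
  shows "\<exists>P. is_proj P \<and> (\<forall>U. U o\<^sub>L T = T o\<^sub>L U \<longrightarrow> U o\<^sub>L P = P o\<^sub>L U) \<and>
    (\<forall>x. P x = x \<longrightarrow> inner x (T x) \<le> 0) \<and> (\<forall>x. P x = 0 \<longrightarrow> x \<noteq> 0 \<longrightarrow> 0 < inner x (T x))"
proof -
  obtain R where R: "pos_op R" "R o\<^sub>L R = T o\<^sub>L T"
    and comm: "\<And>U. U o\<^sub>L (T o\<^sub>L T) = (T o\<^sub>L T) o\<^sub>L U \<Longrightarrow> U o\<^sub>L R = R o\<^sub>L U"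
    using pos_op_sqrt[OF pos_op_hadj_compose(1)[of T]] unfolding T by blast
  have commR: "U o\<^sub>L R = R o\<^sub>L U" if "U o\<^sub>L T = T o\<^sub>L U" for U
    by (rule comm) (metis blinfun_compose_assoc that)
  define W where "W = R + T"
  have Wsym: "W\<^sup>\<star> = W" by (simp add: W_def hadj_add T pos_op_hadj[OF R(1)])
  define P where "P = orth_proj (kernel W)"
  have P: "is_proj P" unfolding P_def by (rule is_proj_kernel)
  have RT: "R (T x) = T (R x)" for x
    using commR[of T] by (metis blinfun_apply_blinfun_compose)
  have RR: "R (R x) = T (T x)" for x
    using R(2) by (metis blinfun_apply_blinfun_compose)
  have Pcomm: "U o\<^sub>L P = P o\<^sub>L U" if "U o\<^sub>L T = T o\<^sub>L U" for U
  proof -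
    have "U o\<^sub>L W = W o\<^sub>L U" using that commR[OF that] by (simp add: W_def blinfun_compose_simps)
    moreover from arg_cong[OF this, of hadj] have "U\<^sup>\<star> o\<^sub>L W = W o\<^sub>L U\<^sup>\<star>" by (simp add: Wsym)
    ultimately show ?thesis unfolding P_def by (rule orth_proj_kernel_commute)
  qed
  have le: "inner x (T x) \<le> 0" if "P x = x" for x
  proof -
    have "W x = 0" using that by (simp add: P_def orth_proj_kernel_eq_iff)
    then have "T x = - R x" by (simp add: W_def blinfun.bilinear_simps eq_neg_iff_add_eq_0 add.commute)
    then show ?thesis using pos_op_nonneg[OF R(1), of x] by (simp add: inner_commute)
  qed
  have gr: "0 < inner x (T x)" if "P x = 0" "x \<noteq> 0" for x
  proof -
    have orth: "inner x z = 0" if "W z = 0" for z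
      using \<open>P x = 0\<close> that orth_proj_eq_0_iff[OF kernel_closed_subspace, of W x]
      by (simp add: P_def kernel_def)
    have "inner ((R - T) x) y = 0" for y
    proof -
      \<comment> \<open>\<open>R\<close> and \<open>T\<close> commute and have the same square, so
        \<open>R + T\<close> kills the range of \<open>R - T\<close>; \<open>x\<close> is orthogonal
        to that kernel.\<close>
      have "W ((R - T) y) = 0"
        by (simp add: W_def blinfun.bilinear_simps RT RR)
      from orth[OF this] show ?thesis
        using hadj_inner[of "R - T" x y] by (simp add: hadj_diff T pos_op_hadj[OF R(1)])
    qed
    then have "(R - T) x = 0" using inner_eq_zero_iff by blast
    then have RTx: "R x = T x" by (simp add: blinfun.bilinear_simps)
    \<comment> \<open>On the complement of the kernel of \<open>W\<close>, \<open>T\<close> agrees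
      with \<open>R\<close>, so a vanishing form would put \<open>x\<close> into that
      kernel.\<close>
    have "inner x (T x) \<noteq> 0"
    proof
      assume "inner x (T x) = 0"
      then have "R x = 0" using RTx by (intro pos_op_zero_if_inner_zero[OF R(1)]) (simp add: inner_commute)
      then have "W x = 0" using RTx by (simp add: W_def blinfun.bilinear_simps)
      then have "inner x x = 0" by (rule orth)
      then show False using that by simp
    qed
    moreover have "0 \<le> inner x (T x)" using pos_op_nonneg[OF R(1), of x] RTx by (simp add: inner_commute)
    ultimately show ?thesis by simp
  qed
  from P Pcomm le gr show ?thesis by blast
qed

subsection \<open>Polar decomposition\<close>

text \<open>For symmetric \<open>R\<close> the range and the kernel together are total. The
  difference \<open>D\<close> vanishes on both: its adjoint maps into the kernel of
  \<open>R\<close>, so \<open>D\<close> after its adjoint is 0.\<close>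

lemma op_eq_range_kernel:
  fixes R S T :: "'a::real_hilbert op"
  assumes "R\<^sup>\<star> = R" "S o\<^sub>L R = T o\<^sub>L R" "\<And>z. R z = 0 \<Longrightarrow> S z = T z"
  shows "S = T"
proof -
  define D where "D = S - T"
  have "D o\<^sub>L R = 0" using assms(2) by (simp add: D_def blinfun_compose_simps)
  from arg_cong[OF this, of hadj] have RD: "R o\<^sub>L D\<^sup>\<star> = 0" using assms(1) by simp
  have "D\<^sup>\<star> y = 0" for y
  proof -
    have "R (D\<^sup>\<star> y) = 0" using RD by (metis blinfun_apply_blinfun_compose zero_blinfun.rep_eq)
    then have "D (D\<^sup>\<star> y) = 0" using assms(3) by (simp add: D_def blinfun.bilinear_simps)
    then have "inner (D\<^sup>\<star> y) (D\<^sup>\<star> y) = 0" by (simp add: hadj_inner')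
    then show ?thesis by simp
  qed
  then have "D\<^sup>\<star> = 0" by (intro blinfun_eqI) simp
  then have "D = 0" by (metis hadj_hadj hadj_0)
  then show ?thesis by (simp add: D_def)
qed

text \<open>If \<open>v\<^sup>\<star> o\<^sub>L v\<close> kills \<open>w\<close>, then so does
  \<open>v\<close>, because the form of this operator at \<open>w\<close> is
  \<open>(norm (v w))\<^sup>2\<close>.\<close>

lemma partial_isometry:
  fixes v :: "'a::real_hilbert op"
  assumes "is_proj (v\<^sup>\<star> o\<^sub>L v)"
  shows "v o\<^sub>L (v\<^sup>\<star> o\<^sub>L v) = v" "is_proj (v o\<^sub>L v\<^sup>\<star>)" "(v o\<^sub>L v\<^sup>\<star>) o\<^sub>L v = v"
proof -
  have "v (v\<^sup>\<star> (v x)) = v x" for x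
  proof -
    define w where "w = x - v\<^sup>\<star> (v x)"
    have "v\<^sup>\<star> (v w) = 0"
      using is_proj_idem[OF assms, of x] by (simp add: w_def blinfun.bilinear_simps)
    then have "inner (v w) (v w) = 0" by (simp add: hadj_inner)
    then show ?thesis by (simp add: w_def blinfun.bilinear_simps)
  qed
  then show 1: "v o\<^sub>L (v\<^sup>\<star> o\<^sub>L v) = v" by (intro blinfun_eqI) simp
  then show "(v o\<^sub>L v\<^sup>\<star>) o\<^sub>L v = v" by (simp add: blinfun_compose_assoc)
  then show "is_proj (v o\<^sub>L v\<^sup>\<star>)"
    unfolding is_proj_iff by (metis blinfun_compose_assoc hadj_compose hadj_hadj)
qed

lemma subspace_closure:
  fixes S :: "'a::real_normed_vector set"
  assumes "subspace S"
  shows "subspace (closure S)"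
proof (rule subspaceI)
  show "0 \<in> closure S" using subspace_0[OF assms] closure_subset by blast
next
  fix x y assume "x \<in> closure S" "y \<in> closure S"
  then obtain f g where "\<And>n. f n \<in> S" "f \<longlonglongrightarrow> x" "\<And>n. g n \<in> S" "g \<longlonglongrightarrow> y"
    unfolding closure_sequential by blast
  then show "x + y \<in> closure S"
    unfolding closure_sequential
    by (intro exI[of _ "\<lambda>n. f n + g n"]) (auto intro: tendsto_add subspace_add[OF assms])
next
  fix c x assume "x \<in> closure S"
  then obtain f where "\<And>n. f n \<in> S" "f \<longlonglongrightarrow> x"
    unfolding closure_sequential by blast
  then show "c *\<^sub>R x \<in> closure S"
    unfolding closure_sequential
    by (intro exI[of _ "\<lambda>n. c *\<^sub>R f n"])
      (auto intro: tendsto_scaleR tendsto_const subspace_scale[OF assms])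
qed

text \<open>Let \<open>G\<close> be the closure of the pairs \<open>(R x, X x)\<close>, where \<open>R = \<bar>X\<bar>\<close>.  It is the graph of a
  partial isometry \<open>v\<close>, and the projection onto \<open>G\<close> maps \<open>(z, 0)\<close> to \<open>(K z / 2, v z / 2)\<close>,
  where \<open>K\<close> is the support of \<open>R\<close>; hence \<open>v\<close> can be read off this projection.\<close>

lemma polar_decomposition:
  fixes X :: "'a::real_hilbert op"
  shows "\<exists>v R. is_proj (v\<^sup>\<star> o\<^sub>L v) \<and> pos_op R \<and> R o\<^sub>L R = X\<^sup>\<star> o\<^sub>L X \<and> v o\<^sub>L R = X \<and>
    (\<forall>x. v x = 0 \<longleftrightarrow> X x = 0) \<and> (\<forall>y. v\<^sup>\<star> y = 0 \<longleftrightarrow> X\<^sup>\<star> y = 0) \<and>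
    (\<forall>S. S o\<^sub>L X = X o\<^sub>L S \<longrightarrow> S\<^sup>\<star> o\<^sub>L X = X o\<^sub>L S\<^sup>\<star> \<longrightarrow> S o\<^sub>L v = v o\<^sub>L S)"
proof -
  obtain R where R: "pos_op R" "R o\<^sub>L R = X\<^sup>\<star> o\<^sub>L X"
    and comm: "\<And>U. U o\<^sub>L (X\<^sup>\<star> o\<^sub>L X) = (X\<^sup>\<star> o\<^sub>L X) o\<^sub>L U \<Longrightarrow> U o\<^sub>L R = R o\<^sub>L U"
    using pos_op_sqrt[OF pos_op_hadj_compose(1)] by blast
  have Rsym: "R\<^sup>\<star> = R" by (rule pos_op_hadj[OF R(1)])
  have RR: "R (R x) = X\<^sup>\<star> (X x)" for x using R(2) by (metis blinfun_apply_blinfun_compose)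
  have iso: "inner (R y) (R x) = inner (X y) (X x)" for x y
    by (simp add: hadj_inner RR Rsym)
  have kerR: "R x = 0 \<longleftrightarrow> X x = 0" for x
    using iso[of x x] by (metis inner_eq_zero_iff)
  define G where "G = closure (range (\<lambda>x. (R x, X x)))"
  have inG: "(R x, X x) \<in> G" for x
    unfolding G_def by (rule subsetD[OF closure_subset]) (rule rangeI)
  have Rlin: "linear (\<lambda>x. (R x, X x))" by (rule linearI) (simp_all add: blinfun.bilinear_simps)
  have G: "closed G" "subspace G"
    unfolding G_def
    by (auto intro!: subspace_closure linear_subspace_image[OF Rlin])
  have G1: "inner (fst p) (R x) = inner (snd p) (X x)" if "p \<in> G" for p x
  proof -
    have "G \<subseteq> {p. inner (fst p) (R x) = inner (snd p) (X x)}"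
      unfolding G_def
      by (rule closure_minimal) (auto simp: iso intro!: closed_Collect_eq continuous_intros)
    then show ?thesis using that by blast
  qed
  have G2: "norm (fst p) = norm (snd p)" if "p \<in> G" for p
  proof -
    have "G \<subseteq> {p. norm (fst p) = norm (snd p)}"
      unfolding G_def
      by (rule closure_minimal)
        (auto simp: iso norm_eq_sqrt_inner intro!: closed_Collect_eq continuous_intros)
    then show ?thesis using that by blast
  qed
  \<comment> \<open>The first component of a pair in \<open>G\<close> lies in the closed range of
    \<open>R\<close> and has the norm of the second, so orthogonality to that range kills the whole
    pair.\<close>
  have G3: "p = 0" if "p \<in> G" "\<And>x. inner (fst p) (R x) = 0" for p
  proof -
    have "G \<subseteq> {q. inner (fst p) (fst q) = 0}"
      unfolding G_def
      by (rule closure_minimal) (auto simp: that(2) intro!: closed_Collect_eq continuous_intros)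
    then have "inner (fst p) (fst p) = 0" using that(1) by blast
    then show ?thesis using G2[OF that(1)] by (simp add: prod_eq_iff)
  qed
  define v where "v = Blinfun (\<lambda>z. 2 *\<^sub>R snd (orth_proj G (z, 0)))"
  have v: "v z = 2 *\<^sub>R snd (orth_proj G (z, 0))" for z
    unfolding v_def
    by (subst bounded_linear_Blinfun_apply)
      (auto intro!: bounded_linear_intros bounded_linear_compose[OF bounded_linear_scaleR_right]
        bounded_linear_compose[OF bounded_linear_snd]
        bounded_linear_compose[OF blinfun.bounded_linear_right]
        bounded_linear_Pair bounded_linear_ident bounded_linear_zero)
  \<comment> \<open>Orthogonality of the residual of \<open>(z, 0)\<close> to
    \<open>(R x, X x)\<close> involves both components, which contribute equally on
    \<open>G\<close>; this is the source of the factor 2.\<close>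
  have key: "inner (z - 2 *\<^sub>R fst (orth_proj G (z, 0))) (R x) = 0" for z x
  proof -
    define p where "p = orth_proj G (z, 0)"
    have pG: "p \<in> G" unfolding p_def by (rule orth_proj_in[OF G])
    from orth_proj_orthogonal[OF G inG[of x], of "(z, 0)"]
    have "inner (z - fst p) (R x) - inner (snd p) (X x) = 0"
      by (simp add: p_def inner_prod_def inner_simps)
    then show ?thesis using G1[OF pG, of x] by (simp add: p_def[symmetric] inner_simps)
  qed
  have vR: "v (R y) = X y" for y
  proof -
    define p where "p = orth_proj G (R y, 0)"
    have pG: "p \<in> G" unfolding p_def by (rule orth_proj_in[OF G])
    have "2 *\<^sub>R p - (R y, X y) \<in> G"
      using G(2) pG inG[of y] by (intro subspace_diff subspace_scale)
    then have "2 *\<^sub>R p - (R y, X y) = 0"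
      using key[of "R y"] by (intro G3) (auto simp: p_def inner_simps)
    then have "2 *\<^sub>R snd p = X y" by (auto simp: prod_eq_iff)
    then show ?thesis by (simp add: v p_def)
  qed
  have vker: "v z = 0" if "R z = 0" for z
  proof -
    have "inner z (R x) = 0" for x
      using that hadj_inner'[of R z x] by (simp add: Rsym)
    then have "orth_proj G (z, 0) = 0"
      using key[of z] by (intro G3 orth_proj_in[OF G]) (simp add: inner_simps)
    then show ?thesis by (simp add: v)
  qed
  have vRX: "v o\<^sub>L R = X" by (rule blinfun_eqI) (simp add: vR)
  have "X\<^sup>\<star> o\<^sub>L v = R"
    by (rule op_eq_range_kernel[OF Rsym]) (simp_all add: blinfun_compose_assoc vRX R(2) vker)
  from arg_cong[OF this, of hadj] have vX: "v\<^sup>\<star> o\<^sub>L X = R" by (simp add: Rsym)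
  define e where "e = id_blinfun - orth_proj (kernel R)"
  have e: "is_proj e" unfolding e_def by (intro is_proj_compl is_proj_kernel)
  have ek: "e z = 0 \<longleftrightarrow> R z = 0" for z
    using orth_proj_kernel_eq_iff[of R z] by (auto simp: e_def blinfun.bilinear_simps)
  have eR: "e (R x) = R x" for x
  proof -
    have "orth_proj (kernel R) (R x) = 0"
      using orth_proj_eq_0_iff[OF kernel_closed_subspace, of R "R x"]
      by (auto simp: kernel_def hadj_inner Rsym)
    then show ?thesis by (simp add: e_def blinfun.bilinear_simps)
  qed
  have vve: "v\<^sup>\<star> o\<^sub>L v = e"
  proof (rule op_eq_range_kernel[OF Rsym])
    show "(v\<^sup>\<star> o\<^sub>L v) o\<^sub>L R = e o\<^sub>L R"
      using vRX vX eR by (intro blinfun_eqI) (auto simp: blinfun_compose_assoc)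
    show "(v\<^sup>\<star> o\<^sub>L v) z = e z" if "R z = 0" for z
      using that vker ek by simp
  qed
  have pv: "is_proj (v\<^sup>\<star> o\<^sub>L v)" using e vve by simp
  have k1: "v x = 0 \<longleftrightarrow> X x = 0" for x
  proof -
    have "v x = 0 \<longleftrightarrow> v\<^sup>\<star> (v x) = 0"
      using hadj_inner[of v x "v x"] by auto
    also have "\<dots> \<longleftrightarrow> e x = 0" using vve by (metis blinfun_apply_blinfun_compose)
    finally show ?thesis using ek kerR by simp
  qed
  have k2: "v\<^sup>\<star> y = 0 \<longleftrightarrow> X\<^sup>\<star> y = 0" for y
  proof -
    have "X\<^sup>\<star> = R o\<^sub>L v\<^sup>\<star>" using arg_cong[OF vRX, of hadj] by (simp add: Rsym)
    then have 1: "X\<^sup>\<star> y = 0 \<longleftrightarrow> R (v\<^sup>\<star> y) = 0" by simp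
    have "e o\<^sub>L v\<^sup>\<star> = v\<^sup>\<star>"
      using arg_cong[OF partial_isometry(1)[OF pv], of hadj] vve is_proj_hadj[OF e]
      by (simp add: blinfun_compose_assoc)
    then have "e (v\<^sup>\<star> y) = v\<^sup>\<star> y" by (metis blinfun_apply_blinfun_compose)
    then show ?thesis using 1 ek[of "v\<^sup>\<star> y"] by metis
  qed
  have k3: "S o\<^sub>L v = v o\<^sub>L S" if "S o\<^sub>L X = X o\<^sub>L S" "S\<^sup>\<star> o\<^sub>L X = X o\<^sub>L S\<^sup>\<star>" for S
  proof -
    from arg_cong[OF that(2), of hadj] have "S o\<^sub>L X\<^sup>\<star> = X\<^sup>\<star> o\<^sub>L S" by simp
    with that(1) have SR: "S o\<^sub>L R = R o\<^sub>L S" by (intro comm) (metis blinfun_compose_assoc)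
    show ?thesis
    proof (rule op_eq_range_kernel[OF Rsym])
      show "(S o\<^sub>L v) o\<^sub>L R = (v o\<^sub>L S) o\<^sub>L R"
        using that(1) SR vRX by (metis blinfun_compose_assoc)
      fix z assume z: "R z = 0"
      have "R (S z) = 0" using SR z by (metis blinfun_apply_blinfun_compose blinfun.zero_right)
      then show "(S o\<^sub>L v) z = (v o\<^sub>L S) z" using z vker by simp
    qed
  qed
  from pv R vRX k1 k2 k3 show ?thesis by blast
qed

section \<open>Projections in a von Neumann algebra\<close>

text \<open>\<open>N\<close> is a parameter because the locale is used twice: for the factor, and
  for the bicommutant of a single positive operator when its spectral measure is built.\<close>

locale vn_algebra =
  fixes N M :: "'a::real_hilbert op set"
  assumes N_adj: "S \<in> N \<Longrightarrow> S\<^sup>\<star> \<in> N"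
    and M_eq: "M = {T. \<forall>S\<in>N. S o\<^sub>L T = T o\<^sub>L S}"
begin

lemma in_MI: "(\<And>S. S \<in> N \<Longrightarrow> S o\<^sub>L T = T o\<^sub>L S) \<Longrightarrow> T \<in> M"
  and in_MD: "T \<in> M \<Longrightarrow> S \<in> N \<Longrightarrow> S o\<^sub>L T = T o\<^sub>L S"
  by (auto simp: M_eq)

lemma in_MD_apply: "T \<in> M \<Longrightarrow> S \<in> N \<Longrightarrow> S (T x) = T (S x)"
  using in_MD by (metis blinfun_apply_blinfun_compose)

lemma M_id [simp]: "id_blinfun \<in> M" and M_0 [simp]: "0 \<in> M"
  by (auto intro!: in_MI blinfun_eqI)

lemma M_add: "S \<in> M \<Longrightarrow> T \<in> M \<Longrightarrow> S + T \<in> M"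
  and M_diff: "S \<in> M \<Longrightarrow> T \<in> M \<Longrightarrow> S - T \<in> M"
  and M_scaleR: "T \<in> M \<Longrightarrow> r *\<^sub>R T \<in> M"
  by (auto simp: M_eq blinfun_compose_simps)

lemma M_compose: "S \<in> M \<Longrightarrow> T \<in> M \<Longrightarrow> S o\<^sub>L T \<in> M"
  unfolding M_eq by (simp add: blinfun_compose_assoc[symmetric]) (simp add: blinfun_compose_assoc)

lemma M_sum: "(\<And>i. i \<in> I \<Longrightarrow> T i \<in> M) \<Longrightarrow> sum T I \<in> M"
  by (induction I rule: infinite_finite_induct) (auto intro: M_add)

lemma M_hadj:
  assumes "T \<in> M"
  shows "T\<^sup>\<star> \<in> M"
proof (rule in_MI)
  fix S assume "S \<in> N"
  then have "S\<^sup>\<star> o\<^sub>L T = T o\<^sub>L S\<^sup>\<star>" using assms N_adj in_MD by blast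
  from arg_cong[OF this, of hadj] show "S o\<^sub>L T\<^sup>\<star> = T\<^sup>\<star> o\<^sub>L S" by simp
qed

lemma M_strong_lim:
  assumes "strong_lim S T" "\<And>n. S n \<in> M"
  shows "T \<in> M"
  using in_MD[OF assms(2)] by (intro in_MI strong_lim_commute[OF assms(1)]) blast

text \<open>What commutes with everything commuting with \<open>T\<close> is in the bicommutant of
  \<open>T\<close>; this places square roots and spectral projections in \<open>M\<close>.\<close>

lemma M_commutes: "T \<in> M \<Longrightarrow> (\<And>U. U o\<^sub>L T = T o\<^sub>L U \<Longrightarrow> U o\<^sub>L P = P o\<^sub>L U) \<Longrightarrow> P \<in> M"
  using in_MD in_MI by blast

lemma M_orth_proj_kernel: "T \<in> M \<Longrightarrow> orth_proj (kernel T) \<in> M"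
  using in_MD N_adj by (intro in_MI orth_proj_kernel_commute) blast+

lemma M_closed: "closed M"
proof -
  have "M = (\<Inter>S\<in>N. {T. S o\<^sub>L T = T o\<^sub>L S})" by (auto simp: M_eq)
  moreover have "closed {T. S o\<^sub>L T = T o\<^sub>L S}" for S :: "'a op"
    by (intro closed_Collect_eq continuous_intros
        bounded_linear.continuous_on[OF bounded_bilinear.bounded_linear_right[OF bounded_bilinear_blinfun_compose]]
        bounded_linear.continuous_on[OF bounded_bilinear.bounded_linear_left[OF bounded_bilinear_blinfun_compose]])
  ultimately show ?thesis by auto
qed

lemma M_polar_decomposition:
  assumes "X \<in> M"
  obtains v R where "v \<in> M" "is_proj (v\<^sup>\<star> o\<^sub>L v)" "pos_op R" "R o\<^sub>L R = X\<^sup>\<star> o\<^sub>L X" "v o\<^sub>L R = X"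
    "\<And>x. v x = 0 \<longleftrightarrow> X x = 0" "\<And>y. v\<^sup>\<star> y = 0 \<longleftrightarrow> X\<^sup>\<star> y = 0"
proof -
  obtain v R where *: "is_proj (v\<^sup>\<star> o\<^sub>L v)" "pos_op R" "R o\<^sub>L R = X\<^sup>\<star> o\<^sub>L X" "v o\<^sub>L R = X"
    "\<And>x. v x = 0 \<longleftrightarrow> X x = 0" "\<And>y. v\<^sup>\<star> y = 0 \<longleftrightarrow> X\<^sup>\<star> y = 0"
    and comm: "\<And>S. S o\<^sub>L X = X o\<^sub>L S \<Longrightarrow> S\<^sup>\<star> o\<^sub>L X = X o\<^sub>L S\<^sup>\<star> \<Longrightarrow> S o\<^sub>L v = v o\<^sub>L S"
    using polar_decomposition[of X] by blast
  have "v \<in> M"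
  proof (rule in_MI)
    fix S assume "S \<in> N"
    then show "S o\<^sub>L v = v o\<^sub>L S" using in_MD[OF assms] N_adj by (intro comm) blast+
  qed
  from that[OF this *] show thesis .
qed

definition projs :: "'a op set" where "projs = {P \<in> M. is_proj P}"

lemma projsD: "P \<in> projs \<Longrightarrow> P \<in> M" "P \<in> projs \<Longrightarrow> is_proj P"
  by (auto simp: projs_def)

lemma projs_0 [simp]: "0 \<in> projs" and projs_id [simp]: "id_blinfun \<in> projs"
  by (auto simp: projs_def)

lemma projs_idem: "P \<in> projs \<Longrightarrow> P (P x) = P x"
  using is_proj_idem projsD by blast

lemma projs_compose_self: "P \<in> projs \<Longrightarrow> P o\<^sub>L P = P"
  using is_proj_compose_self projsD by blast

lemma projs_compl: "P \<in> projs \<Longrightarrow> id_blinfun - P \<in> projs"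
  by (simp add: projs_def is_proj_compl M_diff)

lemma projs_hadj: "P \<in> projs \<Longrightarrow> P\<^sup>\<star> = P"
  by (simp add: projs_def is_proj_hadj)

lemma projs_add: "P \<in> projs \<Longrightarrow> Q \<in> projs \<Longrightarrow> P o\<^sub>L Q = 0 \<Longrightarrow> P + Q \<in> projs"
  by (simp add: projs_def is_proj_add M_add)

lemma projs_diff: "P \<in> projs \<Longrightarrow> Q \<in> projs \<Longrightarrow> P o\<^sub>L Q = Q \<Longrightarrow> P - Q \<in> projs"
  by (simp add: projs_def is_proj_diff M_diff)

lemma projs_orthogonal_sym: "P \<in> projs \<Longrightarrow> Q \<in> projs \<Longrightarrow> P o\<^sub>L Q = 0 \<Longrightarrow> Q o\<^sub>L P = 0"
  using proj_orthogonal_sym projsD by blast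

lemma projs_le_sym: "P \<in> projs \<Longrightarrow> Q \<in> projs \<Longrightarrow> Q o\<^sub>L P = P \<longleftrightarrow> P o\<^sub>L Q = P"
  using proj_le_sym projsD by blast

lemma projs_le_trans: "Q o\<^sub>L P = P \<Longrightarrow> R o\<^sub>L Q = Q \<Longrightarrow> R o\<^sub>L P = P"
  by (metis blinfun_compose_assoc)

lemma projs_orthogonal_mono:
  assumes "P \<in> projs" "P' \<in> projs" "Q \<in> projs" "Q' \<in> projs"
    and "P o\<^sub>L P' = P'" "Q o\<^sub>L Q' = Q'" "P o\<^sub>L Q = 0"
  shows "P' o\<^sub>L Q' = 0"
proof -
  have "P' o\<^sub>L Q' = (P' o\<^sub>L P) o\<^sub>L (Q o\<^sub>L Q')"
    using assms projs_le_sym[OF assms(2,1)] by simp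
  also have "\<dots> = P' o\<^sub>L ((P o\<^sub>L Q) o\<^sub>L Q')" by (simp add: blinfun_compose_assoc)
  finally show ?thesis using assms(7) by simp
qed

text \<open>The kernel of a sum of two positive operators is the intersection of their kernels, so
  this is the projection onto the intersection of the ranges.\<close>

definition meet :: "'a op \<Rightarrow> 'a op \<Rightarrow> 'a op"
  where "meet P Q = orth_proj (kernel ((id_blinfun - P) + (id_blinfun - Q)))"

lemma meet_projs: "P \<in> projs \<Longrightarrow> Q \<in> projs \<Longrightarrow> meet P Q \<in> projs"
  unfolding projs_def meet_def
  by (auto intro!: M_orth_proj_kernel is_proj_kernel M_add M_diff)

lemma meet_eq_iff:
  assumes "P \<in> projs" "Q \<in> projs"
  shows "meet P Q x = x \<longleftrightarrow> P x = x \<and> Q x = x"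
proof -
  have *: "is_proj (id_blinfun - P)" "is_proj (id_blinfun - Q)"
    using assms is_proj_compl projsD by blast+
  have "P x = x \<and> Q x = x" if "((id_blinfun - P) + (id_blinfun - Q)) x = 0"
  proof -
    have "inner x (((id_blinfun - P) + (id_blinfun - Q)) x) = 0" using that by simp
    then have "(norm ((id_blinfun - P) x))\<^sup>2 + (norm ((id_blinfun - Q) x))\<^sup>2 = 0"
      by (simp only: blinfun.add_left inner_add_right is_proj_inner_self[OF *(1)] is_proj_inner_self[OF *(2)])
    then show ?thesis by (simp add: sum_power2_eq_zero_iff blinfun.bilinear_simps)
  qed
  then show ?thesis
    unfolding meet_def orth_proj_kernel_eq_iff by (auto simp: blinfun.bilinear_simps)
qed

lemma meet_le:
  assumes "P \<in> projs" "Q \<in> projs"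
  shows "P o\<^sub>L meet P Q = meet P Q" "Q o\<^sub>L meet P Q = meet P Q"
  using meet_eq_iff[OF assms] projs_idem[OF meet_projs[OF assms]] by (auto intro!: blinfun_eqI)

definition join :: "'a op \<Rightarrow> 'a op \<Rightarrow> 'a op"
  where "join P Q = id_blinfun - meet (id_blinfun - P) (id_blinfun - Q)"

lemma join_projs: "P \<in> projs \<Longrightarrow> Q \<in> projs \<Longrightarrow> join P Q \<in> projs"
  by (simp add: join_def projs_compl meet_projs)

lemma join_eq_0_iff:
  assumes "P \<in> projs" "Q \<in> projs"
  shows "join P Q x = 0 \<longleftrightarrow> P x = 0 \<and> Q x = 0"
  using meet_eq_iff[OF projs_compl projs_compl, OF assms, of x]
  by (auto simp: join_def blinfun.bilinear_simps)

lemma projs_leI: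
  assumes "P \<in> projs" "Q \<in> projs" "\<And>x. Q x = 0 \<Longrightarrow> P x = 0"
  shows "Q o\<^sub>L P = P"
  using is_proj_le_iff_inner assms projsD by blast

lemma join_ge:
  assumes "P \<in> projs" "Q \<in> projs"
  shows "join P Q o\<^sub>L P = P" "join P Q o\<^sub>L Q = Q"
  using join_eq_0_iff[OF assms] join_projs[OF assms] assms by (auto intro!: projs_leI)

subsection \<open>Orthogonal sums\<close>

definition orth_family :: "(nat \<Rightarrow> 'a op) \<Rightarrow> bool"
  where "orth_family e \<longleftrightarrow> (\<forall>i. e i \<in> projs) \<and> (\<forall>i j. i \<noteq> j \<longrightarrow> e i o\<^sub>L e j = 0)"

text \<open>For orthogonal families the strong limit of the partial sums exists by monotonicity and
  is unique.\<close>

definition osum :: "(nat \<Rightarrow> 'a op) \<Rightarrow> 'a op"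
  where "osum e = (SOME E. strong_lim (\<lambda>n. \<Sum>i<n. e i) E)"

lemma orth_familyD:
  assumes "orth_family e"
  shows "e i \<in> projs" "e i \<in> M" "is_proj (e i)" "i \<noteq> j \<Longrightarrow> e i (e j x) = 0"
proof -
  show "e i (e j x) = 0" if "i \<noteq> j"
    using assms that unfolding orth_family_def
    by (metis blinfun_apply_blinfun_compose zero_blinfun.rep_eq)
qed (use assms projsD in \<open>auto simp: orth_family_def\<close>)

lemma orth_family_sum_apply:
  assumes "orth_family e" "finite I"
  shows "sum e I (e j x) = (if j \<in> I then e j x else 0)"
proof -
  have "sum e I (e j x) = (\<Sum>i\<in>I. if i = j then e j x else 0)"
    unfolding blinfun.sum_left
    using orth_familyD(4)[OF assms(1)] is_proj_idem[OF orth_familyD(3)[OF assms(1)]]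
    by (intro sum.cong) auto
  then show ?thesis using assms(2) by simp
qed

lemma orth_family_sum_projs:
  assumes "orth_family e" "finite I"
  shows "sum e I \<in> projs"
proof -
  have "sum e I (sum e I x) = sum e I x" for x
    unfolding blinfun.sum_left[of e I x] blinfun.sum_right
    by (intro sum.cong) (auto simp: orth_family_sum_apply[OF assms])
  moreover have "inner (sum e I x) y = inner x (sum e I y)" for x y
    by (simp add: blinfun.sum_left inner_sum_left inner_sum_right is_proj_inner[OF orth_familyD(3)[OF assms(1)]])
  ultimately show ?thesis
    using orth_familyD[OF assms(1)] by (auto simp: projs_def is_proj_def intro: M_sum)
qed

context
  fixes e :: "nat \<Rightarrow> 'a op"
  assumes e: "orth_family e"
begin

lemma osum_strong_lim: "strong_lim (\<lambda>n. \<Sum>i<n. e i) (osum e)"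
proof -
  have "\<exists>E. strong_lim (\<lambda>n. \<Sum>i<n. e i) E"
  proof (rule monotone_strong_lim)
    fix n x
    have p: "is_proj (\<Sum>i<n. e i)" using orth_family_sum_projs[OF e] projsD by auto
    show "(\<Sum>i<n. e i)\<^sup>\<star> = (\<Sum>i<n. e i)" using p by (rule is_proj_hadj)
    show "inner x ((\<Sum>i<n. e i) x) \<le> inner x ((\<Sum>i<Suc n. e i) x)"
      by (simp add: blinfun.add_left inner_add_right is_proj_inner_self[OF orth_familyD(3)[OF e]])
    show "inner x ((\<Sum>i<n. e i) x) \<le> 1 * (norm x)\<^sup>2"
      using is_proj_norm_le[OF p, of x] by (simp add: is_proj_inner_self[OF p])
  qed
  then show ?thesis unfolding osum_def by (rule someI_ex)
qed

lemma osum_limit: "(\<lambda>n. \<Sum>i<n. e i x) \<longlonglongrightarrow> osum e x"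
  using osum_strong_lim by (simp add: strong_lim_def blinfun.sum_left)

lemma osum_apply: "osum e (e i x) = e i x"
proof -
  have "(\<lambda>n. (\<Sum>j<n. e j) (e i x)) \<longlonglongrightarrow> e i x"
    by (rule tendsto_eventually)
      (auto simp: orth_family_sum_apply[OF e] eventually_at_top_linorder intro!: exI[of _ "Suc i"])
  then show ?thesis using osum_strong_lim LIMSEQ_unique unfolding strong_lim_def by blast
qed

lemma osum_projs: "osum e \<in> projs"
proof -
  have "osum e (osum e x) = osum e x" for x
  proof -
    have "(\<lambda>n. osum e (\<Sum>i<n. e i x)) \<longlonglongrightarrow> osum e (osum e x)"
      by (intro bounded_linear.tendsto[OF blinfun.bounded_linear_right] osum_limit)
    then have "(\<lambda>n. \<Sum>i<n. e i x) \<longlonglongrightarrow> osum e (osum e x)"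
      by (simp add: blinfun.sum_right osum_apply)
    then show ?thesis using osum_limit LIMSEQ_unique by blast
  qed
  moreover have "(osum e)\<^sup>\<star> = osum e"
    using orth_family_sum_projs[OF e] projs_hadj
    by (intro strong_lim_sym[OF osum_strong_lim]) auto
  ultimately have "is_proj (osum e)"
    unfolding is_proj_iff by (auto intro!: blinfun_eqI)
  moreover have "osum e \<in> M"
    using orth_family_sum_projs[OF e] projsD by (intro M_strong_lim[OF osum_strong_lim]) auto
  ultimately show ?thesis by (simp add: projs_def)
qed

lemma osum_eq_0_iff: "osum e x = 0 \<longleftrightarrow> (\<forall>i. e i x = 0)"
proof
  assume "osum e x = 0"
  moreover have "osum e o\<^sub>L e i = e i" for i by (rule blinfun_eqI) (simp add: osum_apply)
  then have "e i o\<^sub>L osum e = e i" for i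
    using projs_le_sym[OF orth_familyD(1)[OF e] osum_projs] by blast
  ultimately show "\<forall>i. e i x = 0"
    by (metis blinfun_apply_blinfun_compose blinfun.zero_right)
next
  assume "\<forall>i. e i x = 0"
  then show "osum e x = 0" using osum_limit[of x] by (simp add: LIMSEQ_const_iff)
qed

lemma osum_ge: "osum e o\<^sub>L e i = e i"
  by (rule blinfun_eqI) (simp add: osum_apply)

lemma osum_le:
  assumes "f \<in> projs" "\<And>i. f o\<^sub>L e i = e i"
  shows "f o\<^sub>L osum e = osum e"
proof (rule projs_leI[OF osum_projs assms(1)])
  fix x assume "f x = 0"
  have "e i x = 0" for i
    using assms(2)[of i] \<open>f x = 0\<close> projs_le_sym[OF orth_familyD(1)[OF e] assms(1)]
    by (metis blinfun_apply_blinfun_compose blinfun.zero_right)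
  then show "osum e x = 0" by (simp add: osum_eq_0_iff)
qed

lemma osum_inner_sums: "(\<lambda>i. inner x (e i x)) sums inner x (osum e x)"
  using tendsto_inner[OF tendsto_const osum_limit, of x x]
  by (simp add: sums_def inner_sum_right)

end

subsection \<open>Comparison of projections\<close>

text \<open>Murray-von Neumann subequivalence. The initial projection is prescribed exactly, while
  \<open>f o\<^sub>L v = v\<close> only places the final space below \<open>f\<close>.\<close>

definition msub :: "'a op \<Rightarrow> 'a op \<Rightarrow> bool" (infix \<open>\<preceq>\<close> 50)
  where "e \<preceq> f \<longleftrightarrow> (\<exists>v\<in>M. v\<^sup>\<star> o\<^sub>L v = e \<and> f o\<^sub>L v = v)"

lemma msub_le: "e \<in> projs \<Longrightarrow> f o\<^sub>L e = e \<Longrightarrow> e \<preceq> f"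
  unfolding msub_def by (intro bexI[of _ e]) (auto simp: projs_hadj projs_compose_self projsD)

lemma msub_refl: "e \<in> projs \<Longrightarrow> e \<preceq> e"
  by (rule msub_le) (auto simp: projs_compose_self)

lemma msub_zero: "0 \<preceq> f"
  unfolding msub_def by (intro bexI[of _ 0]) auto

lemma msub_trans:
  assumes "e \<preceq> f" "f \<preceq> g"
  shows "e \<preceq> g"
proof -
  obtain v w where v: "v \<in> M" "v\<^sup>\<star> o\<^sub>L v = e" "f o\<^sub>L v = v"
    and w: "w \<in> M" "w\<^sup>\<star> o\<^sub>L w = f" "g o\<^sub>L w = w"
    using assms by (auto simp: msub_def)
  have "(w o\<^sub>L v)\<^sup>\<star> o\<^sub>L (w o\<^sub>L v) = v\<^sup>\<star> o\<^sub>L ((w\<^sup>\<star> o\<^sub>L w) o\<^sub>L v)"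
    by (simp add: blinfun_compose_assoc)
  also have "\<dots> = e" using v w by simp
  finally have 1: "(w o\<^sub>L v)\<^sup>\<star> o\<^sub>L (w o\<^sub>L v) = e" .
  have 2: "g o\<^sub>L (w o\<^sub>L v) = w o\<^sub>L v" using w by (simp add: blinfun_compose_assoc[symmetric])
  from 1 2 v w show ?thesis unfolding msub_def by (intro bexI[of _ "w o\<^sub>L v"]) (auto intro: M_compose)
qed

lemma msub_mono: "e \<preceq> f \<Longrightarrow> g o\<^sub>L f = f \<Longrightarrow> e \<preceq> g"
  unfolding msub_def by (metis blinfun_compose_assoc)

text \<open>Orthogonality of the targets makes the cross terms of
  \<open>(v + w)\<^sup>\<star> o\<^sub>L (v + w)\<close> vanish, so the witnesses simply
  add.\<close>

lemma msub_add:
  assumes "e1 \<preceq> f1" "e2 \<preceq> f2" "f1 \<in> projs" "f2 \<in> projs" "f1 o\<^sub>L f2 = 0"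
  shows "e1 + e2 \<preceq> f1 + f2"
proof -
  obtain v w where v: "v \<in> M" "v\<^sup>\<star> o\<^sub>L v = e1" "f1 o\<^sub>L v = v"
    and w: "w \<in> M" "w\<^sup>\<star> o\<^sub>L w = e2" "f2 o\<^sub>L w = w"
    using assms by (auto simp: msub_def)
  have f21: "f2 o\<^sub>L f1 = 0" using assms projs_orthogonal_sym by blast
  have fw: "f1 o\<^sub>L w = 0" "f2 o\<^sub>L v = 0"
    using assms(5) f21 v w by (metis blinfun_compose_assoc blinfun_compose_zero(1))+
  have "v\<^sup>\<star> o\<^sub>L w = (f1 o\<^sub>L v)\<^sup>\<star> o\<^sub>L w" using v by simp
  also have "\<dots> = v\<^sup>\<star> o\<^sub>L (f1 o\<^sub>L w)" using projs_hadj[OF assms(3)] by (simp add: blinfun_compose_assoc)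
  finally have vw: "v\<^sup>\<star> o\<^sub>L w = 0" using fw by simp
  from arg_cong[OF this, of hadj] have wv: "w\<^sup>\<star> o\<^sub>L v = 0" by simp
  show ?thesis
    unfolding msub_def
  proof (intro bexI conjI)
    show "(v + w)\<^sup>\<star> o\<^sub>L (v + w) = e1 + e2"
      using v w vw wv by (simp add: hadj_add blinfun_compose_simps)
    show "(f1 + f2) o\<^sub>L (v + w) = v + w" using v w fw by (simp add: blinfun_compose_simps)
    show "v + w \<in> M" using v w by (intro M_add)
  qed
qed

text \<open>The partial isometry in the polar decomposition of \<open>X\<close> has the kernel of
  \<open>X\<close>, which is that of \<open>e\<close>, and its final space is the closed range of
  \<open>X\<close>, below \<open>f\<close>.\<close>

lemma msub_of_operator:
  assumes "X \<in> M" "e \<in> projs" "f \<in> projs" "\<And>x. X x = 0 \<Longrightarrow> e x = 0" "X o\<^sub>L e = X" "f o\<^sub>L X = X"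
  shows "e \<preceq> f"
proof -
  obtain v R where v: "v \<in> M" "is_proj (v\<^sup>\<star> o\<^sub>L v)"
    and k1: "\<And>x. v x = 0 \<longleftrightarrow> X x = 0" and k2: "\<And>y. v\<^sup>\<star> y = 0 \<longleftrightarrow> X\<^sup>\<star> y = 0"
    using M_polar_decomposition[OF assms(1)] by metis
  have "v\<^sup>\<star> o\<^sub>L v = e"
  proof (rule is_proj_eqI[OF v(2)])
    show "is_proj e" using assms projsD by blast
    have "X x = 0 \<longleftrightarrow> e x = 0" for x
      using assms(4,5) by (metis blinfun_apply_blinfun_compose blinfun.zero_right)
    moreover have "(v\<^sup>\<star> o\<^sub>L v) x = 0 \<longleftrightarrow> v x = 0" for x
      using hadj_inner[of v x "v x"] by auto
    ultimately show "(v\<^sup>\<star> o\<^sub>L v) x = 0 \<longleftrightarrow> e x = 0" for x using k1 by simp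
  qed
  moreover have "f o\<^sub>L v = v"
  proof -
    have "X\<^sup>\<star> (y - f y) = 0" for y
    proof -
      have "X\<^sup>\<star> o\<^sub>L f = X\<^sup>\<star>" using arg_cong[OF assms(6), of hadj] projs_hadj[OF assms(3)] by simp
      then have "X\<^sup>\<star> (f y) = X\<^sup>\<star> y" by (metis blinfun_apply_blinfun_compose)
      then show ?thesis by (simp add: blinfun.diff_right)
    qed
    then have "v\<^sup>\<star> (y - f y) = 0" for y using k2 by simp
    then have "v\<^sup>\<star> o\<^sub>L f = v\<^sup>\<star>" by (intro blinfun_eqI) (simp add: blinfun.diff_right)
    from arg_cong[OF this, of hadj] show ?thesis using projs_hadj[OF assms(3)] by simp
  qed
  ultimately show ?thesis using v(1) by (auto simp: msub_def)
qed

text \<open>The hypothesis says that \<open>f o\<^sub>L e\<close> is injective on the range of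
  \<open>e\<close>, so its polar part is the required embedding.\<close>

lemma msub_if_meet_zero:
  assumes "e \<in> projs" "f \<in> projs" "\<And>x. e x = x \<Longrightarrow> f x = 0 \<Longrightarrow> x = 0"
  shows "e \<preceq> f"
proof (rule msub_of_operator[where X = "f o\<^sub>L e"])
  show "f o\<^sub>L e \<in> M" using assms projsD by (intro M_compose) auto
  show "e x = 0" if "(f o\<^sub>L e) x = 0" for x
    using that assms(3)[of "e x"] projs_idem[OF assms(1)] by simp
qed (use assms in \<open>auto simp: blinfun_compose_assoc projs_compose_self,
      simp add: blinfun_compose_assoc[symmetric] projs_compose_self\<close>)

lemma msub_range:
  assumes "v \<in> M" "v\<^sup>\<star> o\<^sub>L v = e" "e \<in> projs"
  shows "v o\<^sub>L v\<^sup>\<star> \<in> projs" "v o\<^sub>L v\<^sup>\<star> \<preceq> e" "e \<preceq> v o\<^sub>L v\<^sup>\<star>" "v o\<^sub>L e = v"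
proof -
  have p: "is_proj (v\<^sup>\<star> o\<^sub>L v)" using assms projsD by simp
  note pi = partial_isometry[OF p]
  show "v o\<^sub>L v\<^sup>\<star> \<in> projs" using pi assms by (auto simp: projs_def intro: M_compose M_hadj)
  show ve: "v o\<^sub>L e = v" using pi assms by simp
  from arg_cong[OF this, of hadj] have "e o\<^sub>L v\<^sup>\<star> = v\<^sup>\<star>" using projs_hadj[OF assms(3)] by simp
  then show "v o\<^sub>L v\<^sup>\<star> \<preceq> e"
    unfolding msub_def using assms by (intro bexI[of _ "v\<^sup>\<star>"]) (auto intro: M_hadj)
  show "e \<preceq> v o\<^sub>L v\<^sup>\<star>"
    unfolding msub_def using assms pi by (intro bexI[of _ v]) auto
qed

lemma msubE:
  assumes "e \<preceq> f" "e \<in> projs"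
  obtains r where "r \<in> projs" "f o\<^sub>L r = r" "e \<preceq> r" "r \<preceq> e"
proof -
  obtain v where v: "v \<in> M" "v\<^sup>\<star> o\<^sub>L v = e" "f o\<^sub>L v = v"
    using assms(1) by (auto simp: msub_def)
  from msub_range[OF v(1,2) assms(2)] v(3) show thesis
    by (intro that[of "v o\<^sub>L v\<^sup>\<star>"]) (auto simp: blinfun_compose_assoc[symmetric])
qed

lemma orth_family_isometries_sum:
  assumes e: "orth_family e" and f: "orth_family f" and "finite I"
    and v: "\<And>i. v i \<in> M" "\<And>i. (v i)\<^sup>\<star> o\<^sub>L v i = e i" "\<And>i. f i o\<^sub>L v i = v i"
  shows "(sum v I)\<^sup>\<star> o\<^sub>L sum v I = sum e I"
  using \<open>finite I\<close>
proof induction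
  case (insert i I)
  have orth: "(v i)\<^sup>\<star> o\<^sub>L v j = 0" if "i \<noteq> j" for i j
  proof -
    have "(v i)\<^sup>\<star> o\<^sub>L v j = (f i o\<^sub>L v i)\<^sup>\<star> o\<^sub>L (f j o\<^sub>L v j)" by (simp add: v)
    also have "\<dots> = (v i)\<^sup>\<star> o\<^sub>L ((f i o\<^sub>L f j) o\<^sub>L v j)"
      using projs_hadj[OF orth_familyD(1)[OF f]] by (simp add: blinfun_compose_assoc)
    also have "f i o\<^sub>L f j = 0" using f that by (auto simp: orth_family_def)
    finally show ?thesis by simp
  qed
  have 1: "(v i)\<^sup>\<star> o\<^sub>L sum v I = 0"
  proof -
    have "(v i)\<^sup>\<star> o\<^sub>L sum v I = (\<Sum>j\<in>I. (v i)\<^sup>\<star> o\<^sub>L v j)"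
      by (rule bounded_bilinear.sum_right[OF bounded_bilinear_blinfun_compose])
    also have "\<dots> = 0" using insert(2) by (intro sum.neutral) (auto intro: orth)
    finally show ?thesis .
  qed
  from arg_cong[OF this, of hadj] have 2: "(sum v I)\<^sup>\<star> o\<^sub>L v i = 0" by simp
  show ?case using insert 1 2 v by (simp add: hadj_add blinfun_compose_simps)
qed simp

text \<open>The partial sums of the witnesses have increments of the same norm as those of
  \<open>e\<close>, hence converge strongly; the isometry identities pass to the limit.\<close>

lemma msub_osum:
  assumes e: "orth_family e" and f: "orth_family f" and ef: "\<And>i. e i \<preceq> f i"
  shows "osum e \<preceq> osum f"
proof -
  obtain v where v: "\<And>i. v i \<in> M" "\<And>i. (v i)\<^sup>\<star> o\<^sub>L v i = e i" "\<And>i. f i o\<^sub>L v i = v i"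
    using ef unfolding msub_def by metis
  define V where "V n = (\<Sum>i<n. v i)" for n
  define S where "S n = (\<Sum>i<n. e i)" for n
  have nrm: "norm (sum v I x) = norm (sum e I x)" if "finite I" for I x
  proof -
    have "is_proj (sum e I)" using orth_family_sum_projs[OF e that] projsD by blast
    note pr = is_proj_inner_self[OF this]
    have "(norm (sum v I x))\<^sup>2 = inner x (((sum v I)\<^sup>\<star> o\<^sub>L sum v I) x)"
      by (simp add: power2_norm_eq_inner hadj_inner)
    also have "\<dots> = (norm (sum e I x))\<^sup>2"
      using orth_family_isometries_sum[OF e f that v] pr by simp
    finally show ?thesis by simp
  qed
  have split: "sum g {..<n} - sum g {..<m} = sum g {m..<n}" if "m \<le> n" for g :: "nat \<Rightarrow> 'a op" and m n
    using sum.atLeastLessThan_concat[of 0 m n g] that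
    by (simp add: lessThan_atLeast0 algebra_simps)
  have d: "dist (V m x) (V n x) = dist (S m x) (S n x)" for m n x
  proof -
    have *: "norm (V n x - V m x) = norm (S n x - S m x)" if "m \<le> n" for m n
    proof -
      have "V n x - V m x = sum v {m..<n} x" "S n x - S m x = sum e {m..<n} x"
        unfolding V_def S_def split[OF that, symmetric] by (simp_all add: blinfun.diff_left)
      then show ?thesis using nrm by simp
    qed
    show ?thesis
      using *[of m n] *[of n m] by (cases "m \<le> n") (auto simp: dist_norm norm_minus_commute)
  qed
  have "convergent (\<lambda>n. V n x)" for x
  proof -
    have "Cauchy (\<lambda>n. S n x)"
      using osum_strong_lim[OF e] unfolding strong_lim_def S_def[symmetric]
      by (meson LIMSEQ_imp_Cauchy)
    then show ?thesis by (simp add: Cauchy_def d flip: Cauchy_convergent_iff)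
  qed
  moreover have "norm (V n) \<le> 1" for n
  proof (rule norm_blinfun_bound)
    have "is_proj (S n)" unfolding S_def using orth_family_sum_projs[OF e] projsD by blast
    then show "norm (V n x) \<le> 1 * norm x" for x
      using nrm[of "{..<n}" x] is_proj_norm_le[of "S n" x] by (simp add: V_def S_def)
  qed simp
  ultimately obtain W where W: "strong_lim V W" using strong_lim_exists by blast
  have "W \<in> M" by (rule M_strong_lim[OF W]) (auto simp: V_def intro: M_sum v)
  moreover have "W\<^sup>\<star> o\<^sub>L W = osum e"
    unfolding op_eq_iff_inner
  proof (intro allI)
    fix x y
    have "inner (V n x) (V n y) = inner (S n x) y" for n
    proof -
      have "inner (V n x) (V n y) = inner x (((V n)\<^sup>\<star> o\<^sub>L V n) y)" by (simp add: hadj_inner)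
      also have "(V n)\<^sup>\<star> o\<^sub>L V n = S n"
        unfolding V_def S_def by (rule orth_family_isometries_sum[OF e f _ v]) simp
      also have "inner x (S n y) = inner (S n x) y"
        unfolding S_def
        by (rule is_proj_inner[OF projsD(2)[OF orth_family_sum_projs[OF e]], symmetric]) simp
      finally show ?thesis .
    qed
    moreover have "(\<lambda>n. inner (V n x) (V n y)) \<longlonglongrightarrow> inner (W x) (W y)"
      using W unfolding strong_lim_def by (intro tendsto_inner) auto
    moreover have "(\<lambda>n. inner (S n x) y) \<longlonglongrightarrow> inner (osum e x) y"
      using osum_strong_lim[OF e] unfolding strong_lim_def S_def by (intro tendsto_inner) auto
    ultimately have "inner (W x) (W y) = inner (osum e x) y" using LIMSEQ_unique by simp
    then show "inner ((W\<^sup>\<star> o\<^sub>L W) x) y = inner (osum e x) y" by (simp add: hadj_inner')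
  qed
  moreover have "osum f o\<^sub>L W = W"
  proof (rule blinfun_eqI)
    fix x
    have "osum f (v i y) = v i y" for i y
      using osum_apply[OF f] v(3) by (metis blinfun_apply_blinfun_compose)
    then have "osum f (V n x) = V n x" for n
      by (simp add: V_def blinfun.sum_left blinfun.sum_right)
    moreover have "(\<lambda>n. osum f (V n x)) \<longlonglongrightarrow> osum f (W x)"
      using W unfolding strong_lim_def
      by (intro bounded_linear.tendsto[OF blinfun.bounded_linear_right]) auto
    moreover have "(\<lambda>n. V n x) \<longlonglongrightarrow> W x" using W by (simp add: strong_lim_def)
    ultimately have "osum f (W x) = W x" using LIMSEQ_unique by simp
    then show "(osum f o\<^sub>L W) x = W x" by simp
  qed
  ultimately show ?thesis by (auto simp: msub_def)
qed

subsection \<open>Finite projections\<close>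

definition fin :: "'a op \<Rightarrow> bool"
  where "fin e \<longleftrightarrow> e \<in> projs \<and> (\<forall>g\<in>projs. e o\<^sub>L g = g \<longrightarrow> e \<preceq> g \<longrightarrow> g = e)"

lemma fin_projs: "fin e \<Longrightarrow> e \<in> projs"
  by (simp add: fin_def)

lemma finD: "fin e \<Longrightarrow> g \<in> projs \<Longrightarrow> e o\<^sub>L g = g \<Longrightarrow> e \<preceq> g \<Longrightarrow> g = e"
  by (simp add: fin_def)

lemma fin_0: "fin 0"
  by (auto simp: fin_def)

text \<open>If \<open>f\<close> embeds into a part \<open>g\<close> of itself, adding
  \<open>e - f\<close> on both sides embeds \<open>e\<close> into \<open>g + (e - f)\<close>, and
  finiteness of \<open>e\<close> forces \<open>g = f\<close>.\<close>

lemma fin_le: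
  assumes "fin e" "f \<in> projs" "e o\<^sub>L f = f"
  shows "fin f"
  unfolding fin_def
proof (intro conjI ballI impI)
  fix g assume g: "g \<in> projs" "f o\<^sub>L g = g" "f \<preceq> g"
  have e: "e \<in> projs" using assms fin_projs by blast
  have ef: "e - f \<in> projs" using projs_diff[OF e assms(2,3)] .
  have eg: "e o\<^sub>L g = g" using projs_le_trans g(2) assms(3) by blast
  have fe: "f o\<^sub>L e = f" and gf: "g o\<^sub>L f = g" and ge: "g o\<^sub>L e = g"
    using projs_le_sym assms g e eg by blast+
  have orth: "g o\<^sub>L (e - f) = 0" by (simp add: blinfun_compose_simps gf ge)
  have "f + (e - f) \<preceq> g + (e - f)"
    using g ef orth by (intro msub_add msub_refl) auto
  then have "e \<preceq> g + (e - f)" by simp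
  moreover have "g + (e - f) \<in> projs" using projs_add[OF g(1) ef orth] .
  moreover have "e o\<^sub>L (g + (e - f)) = g + (e - f)"
    using assms eg e by (simp add: blinfun_compose_simps projs_compose_self)
  ultimately have "g + (e - f) = e" using finD[OF assms(1)] by blast
  then show "g = f" by simp
qed (rule assms(2))

text \<open>A witness \<open>v\<close> carries \<open>f\<close> onto a projection \<open>r\<close>
  below \<open>e\<close>, hence finite, and turns an embedding of \<open>f\<close> into
  \<open>g\<close> into one of \<open>r\<close> into the image of \<open>g\<close>.\<close>

lemma fin_msub:
  assumes "f \<preceq> e" "f \<in> projs" "fin e"
  shows "fin f"
  unfolding fin_def
proof (intro conjI ballI impI)
  fix g assume g: "g \<in> projs" "f o\<^sub>L g = g" "f \<preceq> g"
  obtain v where v: "v \<in> M" "v\<^sup>\<star> o\<^sub>L v = f" "e o\<^sub>L v = v"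
    using assms(1) by (auto simp: msub_def)
  define r where "r = v o\<^sub>L v\<^sup>\<star>"
  note vr = msub_range[OF v(1,2) assms(2), folded r_def]
  have "e o\<^sub>L r = r" using v by (simp add: r_def blinfun_compose_assoc[symmetric])
  then have r: "fin r" using fin_le[OF assms(3) vr(1)] by blast
  define w where "w = v o\<^sub>L g"
  have gf: "g o\<^sub>L f = g" using projs_le_sym assms g by blast
  have gg: "g o\<^sub>L g = g" "g\<^sup>\<star> = g" using g projs_compose_self projs_hadj by auto
  have "w\<^sup>\<star> o\<^sub>L w = g o\<^sub>L ((v\<^sup>\<star> o\<^sub>L v) o\<^sub>L g)" by (simp add: w_def gg blinfun_compose_assoc)
  then have ww: "w\<^sup>\<star> o\<^sub>L w = g" using v g gg by simp
  have wM: "w \<in> M" using v g projsD by (auto simp: w_def intro: M_compose)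
  note wr = msub_range[OF wM ww g(1)]
  have "r \<preceq> w o\<^sub>L w\<^sup>\<star>" using vr(2) g(3) wr(3) msub_trans by blast
  moreover have "r o\<^sub>L (w o\<^sub>L w\<^sup>\<star>) = w o\<^sub>L w\<^sup>\<star>"
  proof -
    have "r o\<^sub>L v = v" using partial_isometry(3)[of v] v assms projsD by (simp add: r_def)
    then show ?thesis by (simp add: w_def blinfun_compose_assoc[symmetric])
  qed
  ultimately have wwr: "w o\<^sub>L w\<^sup>\<star> = r" using finD[OF r wr(1)] by blast
  have "f = v\<^sup>\<star> o\<^sub>L (r o\<^sub>L v)"
    using partial_isometry(3)[of v] v assms projsD by (simp add: r_def)
  also have "\<dots> = (v\<^sup>\<star> o\<^sub>L w) o\<^sub>L (w\<^sup>\<star> o\<^sub>L v)" by (simp add: blinfun_compose_assoc flip: wwr)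
  also have "v\<^sup>\<star> o\<^sub>L w = g" using v g by (simp add: w_def blinfun_compose_assoc[symmetric])
  also have "w\<^sup>\<star> o\<^sub>L v = g" using v gf gg by (simp add: w_def blinfun_compose_assoc)
  finally show "g = f" using gg by simp
qed (rule assms(2))

lemma msub_zero_right:
  assumes "e \<preceq> 0"
  shows "e = 0"
  using assms by (auto simp: msub_def)

text \<open>An embedding \<open>v\<close> of \<open>e\<close> into a proper part \<open>g\<close> is
  a non-surjective isometry of the range of \<open>e\<close>; the images of the defect
  \<open>e - g\<close> under its powers are pairwise orthogonal and equivalent.\<close>

lemma infinite_orthogonal_copies:
  assumes e: "e \<in> projs" and "\<not> fin e"
  obtains R where "\<And>i. R i \<in> projs" "\<And>i. e o\<^sub>L R i = R i" "\<And>i. R i \<noteq> 0"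
    "\<And>i. R i \<preceq> R (0::nat)" "\<And>i. R 0 \<preceq> R i" "\<And>i j. i \<noteq> j \<Longrightarrow> R i o\<^sub>L R j = 0"
proof -
  obtain g where g: "g \<in> projs" "e o\<^sub>L g = g" "e \<preceq> g" "g \<noteq> e"
    using assms by (auto simp: fin_def)
  obtain v where v: "v \<in> M" "v\<^sup>\<star> o\<^sub>L v = e" "g o\<^sub>L v = v"
    using g(3) by (auto simp: msub_def)
  have gg: "g o\<^sub>L g = g" using g(1) projs_compose_self by blast
  define R where "R = rec_nat (e - g) (\<lambda>_ r. v o\<^sub>L r o\<^sub>L v\<^sup>\<star>)"
  have R0: "R 0 = e - g" and RS: "R (Suc i) = v o\<^sub>L R i o\<^sub>L v\<^sup>\<star>" for i
    by (simp_all add: R_def)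
  have ev: "e o\<^sub>L v = v" using v(3) g(2) by (metis blinfun_compose_assoc)
  have *: "R i \<in> projs \<and> e o\<^sub>L R i = R i \<and> R i \<preceq> R 0 \<and> R 0 \<preceq> R i" for i
  proof (induction i)
    case 0
    have "R 0 \<in> projs" unfolding R0 by (rule projs_diff[OF e g(1,2)])
    moreover have "e o\<^sub>L R 0 = R 0"
      using g(2) e projs_compose_self by (simp add: R0 blinfun_compose_simps)
    ultimately show ?case using msub_refl by blast
  next
    case (Suc i)
    define w where "w = v o\<^sub>L R i"
    have sq: "R i o\<^sub>L R i = R i" "(R i)\<^sup>\<star> = R i"
      using Suc projs_compose_self projs_hadj by blast+
    have ww: "w o\<^sub>L w\<^sup>\<star> = R (Suc i)"
      by (simp add: w_def RS sq blinfun_compose_assoc) (simp add: sq blinfun_compose_assoc[symmetric])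
    have "w\<^sup>\<star> o\<^sub>L w = R i o\<^sub>L ((v\<^sup>\<star> o\<^sub>L v) o\<^sub>L R i)" by (simp add: w_def sq blinfun_compose_assoc)
    then have "w\<^sup>\<star> o\<^sub>L w = R i" using Suc v(2) sq by simp
    moreover have "w \<in> M" using v(1) Suc projsD by (auto simp: w_def intro: M_compose)
    ultimately have "R (Suc i) \<in> projs" "R (Suc i) \<preceq> R i" "R i \<preceq> R (Suc i)"
      using msub_range[of w "R i"] Suc ww by auto
    moreover have "e o\<^sub>L R (Suc i) = R (Suc i)" using ev by (simp add: RS blinfun_compose_assoc[symmetric])
    ultimately show ?case using Suc msub_trans by blast
  qed
  have nz: "R i \<noteq> 0" for i
    using *[of i] msub_zero_right[of "R 0"] g(4) R0 by auto
  have lt: "R i o\<^sub>L R j = 0" if "i < j" for i j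
    using that
  proof (induction i arbitrary: j)
    case 0
    then obtain k where j: "j = Suc k" using gr0_implies_Suc by blast
    have "g o\<^sub>L R j = R j" using v(3) by (simp add: j RS blinfun_compose_assoc[symmetric])
    moreover have "e o\<^sub>L R j = R j" using * by blast
    ultimately show ?case by (simp add: R0 blinfun_compose_simps)
  next
    case (Suc i)
    then obtain k where j: "j = Suc k" "i < k" by (metis Suc_lessE)
    have "R (Suc i) o\<^sub>L R j = v o\<^sub>L (R i o\<^sub>L (((v\<^sup>\<star> o\<^sub>L v) o\<^sub>L R k) o\<^sub>L v\<^sup>\<star>))"
      by (simp add: j RS blinfun_compose_assoc)
    also have "\<dots> = v o\<^sub>L ((R i o\<^sub>L R k) o\<^sub>L v\<^sup>\<star>)" using * v(2) by (simp add: blinfun_compose_assoc)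
    finally show ?case using Suc.IH[OF j(2)] by simp
  qed
  have "R i o\<^sub>L R j = 0" if "i \<noteq> j" for i j
    using lt[of i j] lt[of j i] that * projs_orthogonal_sym by (metis nat_neq_iff)
  with * nz show thesis by (intro that[of R]) blast+
qed

end

section \<open>Factors\<close>

text \<open>Zorn's lemma for exhaustion arguments. \<open>F0\<close> seeds the family, and
  maximality asks for both \<open>R v w\<close> and \<open>R w v\<close> because \<open>R\<close> is
  not assumed symmetric.\<close>

lemma maximal_pairwise:
  assumes "F0 \<subseteq> Collect P" "pairwise R F0"
  obtains F where "F0 \<subseteq> F" "F \<subseteq> Collect P" "pairwise R F"
    "\<And>w. P w \<Longrightarrow> (\<And>v. v \<in> F \<Longrightarrow> R v w \<and> R w v) \<Longrightarrow> w \<in> F"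
proof -
  define A where "A = {F. F0 \<subseteq> F \<and> F \<subseteq> Collect P \<and> pairwise R F}"
  have "\<exists>F\<in>A. \<forall>X\<in>A. F \<subseteq> X \<longrightarrow> X = F"
  proof (rule subset_Zorn_nonempty)
    show "A \<noteq> {}" using assms by (auto simp: A_def)
    fix C assume C: "C \<noteq> {}" "subset.chain A C"
    have CA: "C \<subseteq> A" using C(2) by (simp add: subset_chain_def)
    have "pairwise R (\<Union>C)"
    proof (rule pairwise_chain_Union)
      show "pairwise R S" if "S \<in> C" for S using that CA by (auto simp: A_def)
      show "chain\<^sub>\<subseteq> C" using C(2) by (auto simp: subset_chain_def chain_subset_def)
    qed
    then show "\<Union>C \<in> A" using C(1) CA by (auto simp: A_def)
  qed
  then obtain F where F: "F \<in> A" and max: "\<And>X. X \<in> A \<Longrightarrow> F \<subseteq> X \<Longrightarrow> X = F" by blast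
  show thesis
  proof (rule that)
    show "F0 \<subseteq> F" "F \<subseteq> Collect P" "pairwise R F" using F by (auto simp: A_def)
    fix w assume w: "P w" "\<And>v. v \<in> F \<Longrightarrow> R v w \<and> R w v"
    then have "insert w F \<in> A" using F by (auto simp: A_def pairwise_insert)
    then show "w \<in> F" using max by blast
  qed
qed

text \<open>Padding with 0 lets finite and infinite families be treated alike as sequences; repeated
  zeros are harmless in orthogonal sums.\<close>

lemma countable_enum_padded:
  fixes F :: "'b::zero set"
  assumes "countable F"
  obtains s :: "nat \<Rightarrow> 'b" where "\<And>n. s n \<in> insert 0 F" "F \<subseteq> range s"
    "\<And>i j. i \<noteq> j \<Longrightarrow> s i = 0 \<or> s j = 0 \<or> s i \<noteq> s j"
proof -
  obtain g :: "'b \<Rightarrow> nat" where g: "inj_on g F" using assms by (auto simp: countable_def)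
  define s where "s n = (if n \<in> g ` F then the_inv_into F g n else 0)" for n
  have sg: "s (g x) = x" if "x \<in> F" for x
    using that g by (simp add: s_def the_inv_into_f_f)
  show thesis
  proof (rule that)
    show "s n \<in> insert 0 F" for n
      using g by (auto simp: s_def the_inv_into_f_f)
    show "F \<subseteq> range s" using sg by (metis rangeI subsetI)
    show "s i = 0 \<or> s j = 0 \<or> s i \<noteq> s j" if "i \<noteq> j" for i j
      using that g by (auto simp: s_def the_inv_into_f_f)
  qed
qed

locale vn_factor = vn_algebra +
  assumes central_proj: "Z \<in> projs \<Longrightarrow> (\<And>T. T \<in> M \<Longrightarrow> T o\<^sub>L Z = Z o\<^sub>L T) \<Longrightarrow> Z = 0 \<or> Z = id_blinfun"
    and sigma_finite: "F \<subseteq> projs - {0} \<Longrightarrow> pairwise (\<lambda>P Q. P o\<^sub>L Q = 0) F \<Longrightarrow> countable F"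
begin

text \<open>The vectors \<open>x\<close> with \<open>e (T x) = 0\<close> for all \<open>T\<close> in
  \<open>M\<close> form a closed subspace invariant under \<open>N\<close> and under
  \<open>M\<close>, so its projection is central. If all corners vanished, it would contain the
  range of \<open>f\<close> without being everything.\<close>

lemma nonzero_corner:
  assumes "e \<in> projs" "f \<in> projs" "e \<noteq> 0" "f \<noteq> 0"
  obtains T where "T \<in> M" "e o\<^sub>L (T o\<^sub>L f) \<noteq> 0"
proof (rule ccontr)
  assume "\<not> thesis"
  then have z: "\<And>T. T \<in> M \<Longrightarrow> e o\<^sub>L (T o\<^sub>L f) = 0" using that by blast
  define K where "K = {x. \<forall>T\<in>M. e (T x) = 0}"
  have "K = (\<Inter>T\<in>M. kernel (e o\<^sub>L T))" by (auto simp: K_def kernel_def)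
  then have K: "closed K" "subspace K"
    using kernel_closed_subspace by (auto intro!: subspace_Inter)
  define Z where "Z = orth_proj K"
  have inv: "S x \<in> K" if S: "S \<in> N" and x: "x \<in> K" for S x
  proof -
    have "e (T (S x)) = S (e (T x))" if "T \<in> M" for T
      using in_MD_apply[OF that S] in_MD_apply[OF projsD(1)[OF assms(1)] S] by simp
    then show ?thesis using x by (simp add: K_def)
  qed
  have invM: "T x \<in> K" if T: "T \<in> M" and x: "x \<in> K" for T x
  proof -
    have "e (U (T x)) = 0" if "U \<in> M" for U
      using x M_compose[OF that T] unfolding K_def
      by (metis (mono_tags, lifting) blinfun_apply_blinfun_compose mem_Collect_eq)
    then show ?thesis by (simp add: K_def)
  qed
  have "Z \<in> M"
    unfolding Z_def using inv N_adj by (intro in_MI orth_proj_commute[OF K]) auto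
  then have "Z \<in> projs" by (simp add: projs_def Z_def is_proj_orth_proj[OF K])
  moreover have "T o\<^sub>L Z = Z o\<^sub>L T" if "T \<in> M" for T
    unfolding Z_def using invM that M_hadj by (intro orth_proj_commute[OF K]) auto
  ultimately have "Z = 0 \<or> Z = id_blinfun" by (rule central_proj)
  moreover have "Z \<noteq> 0"
  proof
    assume "Z = 0"
    obtain x where x: "f x \<noteq> 0" using assms(4) by (metis blinfun_eqI zero_blinfun.rep_eq)
    have "e (T (f x)) = 0" if "T \<in> M" for T
      using z[OF that] by (metis blinfun_apply_blinfun_compose zero_blinfun.rep_eq)
    then have "f x \<in> K" by (simp add: K_def)
    then have "Z (f x) = f x" unfolding Z_def by (simp add: orth_proj_eq_iff[OF K])
    then show False using x \<open>Z = 0\<close> by simp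
  qed
  moreover have "Z \<noteq> id_blinfun"
  proof
    assume "Z = id_blinfun"
    then have "x \<in> K" for x using orth_proj_eq_iff[OF K, of x] by (simp add: Z_def)
    then have "e x = 0" for x using M_id unfolding K_def by fastforce
    then show False using assms(3) by (metis blinfun_eqI zero_blinfun.rep_eq)
  qed
  ultimately show False by blast
qed

lemma nonzero_partial_isometry:
  assumes "e \<in> projs" "f \<in> projs" "e \<noteq> 0" "f \<noteq> 0"
  obtains v where "v \<in> M" "v \<noteq> 0" "is_proj (v\<^sup>\<star> o\<^sub>L v)" "v o\<^sub>L e = v" "f o\<^sub>L v = v"
proof -
  obtain T where T: "T \<in> M" "f o\<^sub>L (T o\<^sub>L e) \<noteq> 0"
    using nonzero_corner[OF assms(2,1,4,3)] by blast
  define X where "X = f o\<^sub>L (T o\<^sub>L e)"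
  have XM: "X \<in> M" using T assms projsD by (auto simp: X_def intro: M_compose)
  obtain v where v: "v \<in> M" "is_proj (v\<^sup>\<star> o\<^sub>L v)"
    and k1: "\<And>x. v x = 0 \<longleftrightarrow> X x = 0" and k2: "\<And>y. v\<^sup>\<star> y = 0 \<longleftrightarrow> X\<^sup>\<star> y = 0"
    using M_polar_decomposition[OF XM] by metis
  have "v \<noteq> 0"
    using k1 T(2) unfolding X_def by (metis blinfun_eqI zero_blinfun.rep_eq)
  moreover have "v (x - e x) = 0" for x
    by (simp add: k1) (simp add: X_def blinfun.diff_right projs_idem[OF assms(1)])
  then have "v o\<^sub>L e = v" by (intro blinfun_eqI) (simp add: blinfun.diff_right)
  moreover have "v\<^sup>\<star> (x - f x) = 0" for x
    by (simp add: k2) (simp add: X_def projs_hadj[OF assms(2)] blinfun.diff_right projs_idem[OF assms(2)])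
  then have "v\<^sup>\<star> o\<^sub>L f = v\<^sup>\<star>" by (intro blinfun_eqI) (simp add: blinfun.diff_right)
  from arg_cong[OF this, of hadj] have "f o\<^sub>L v = v" using projs_hadj[OF assms(2)] by simp
  ultimately show thesis using v by (intro that[of v]) auto
qed

text \<open>Take a maximal family of partial isometries from parts of \<open>e\<close> to parts of
  \<open>f\<close> with mutually orthogonal initial and final spaces. If something of both
  \<open>e\<close> and \<open>f\<close> were left over, a nonzero corner would supply one more; so
  one of the two is exhausted.\<close>

theorem comparison:
  assumes e: "e \<in> projs" and f: "f \<in> projs"
  shows "e \<preceq> f \<or> f \<preceq> e"
proof -
  define Q where "Q v \<longleftrightarrow> v \<in> M \<and> v \<noteq> 0 \<and> is_proj (v\<^sup>\<star> o\<^sub>L v) \<and> v o\<^sub>L e = v \<and> f o\<^sub>L v = v" for v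
  define R where "R v w \<longleftrightarrow> v\<^sup>\<star> o\<^sub>L w = 0 \<and> v o\<^sub>L w\<^sup>\<star> = 0" for v w :: "'a op"
  obtain F where F: "F \<subseteq> Collect Q" "pairwise R F"
    and max: "\<And>w. Q w \<Longrightarrow> (\<And>v. v \<in> F \<Longrightarrow> R v w \<and> R w v) \<Longrightarrow> w \<in> F"
    using maximal_pairwise[of "{}" Q R] by auto
  have z: "v = 0" if "v\<^sup>\<star> o\<^sub>L v = 0" for v :: "'a op"
    using hadj_compose_self_norm[of v] that by simp
  have orth: "(v\<^sup>\<star> o\<^sub>L v) o\<^sub>L (w\<^sup>\<star> o\<^sub>L w) = 0" if "v \<in> F" "w \<in> F" "v \<noteq> w" for v w
  proof -
    have "v o\<^sub>L w\<^sup>\<star> = 0" using F(2) that by (auto simp: pairwise_def R_def)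
    moreover have "(v\<^sup>\<star> o\<^sub>L v) o\<^sub>L (w\<^sup>\<star> o\<^sub>L w) = v\<^sup>\<star> o\<^sub>L ((v o\<^sub>L w\<^sup>\<star>) o\<^sub>L w)" by (simp add: blinfun_compose_assoc)
    ultimately show ?thesis by simp
  qed
  have FQ: "Q v" if "v \<in> F" for v using F(1) that by blast
  have nz: "v\<^sup>\<star> o\<^sub>L v \<noteq> 0" if "v \<in> F" for v
    using z[of v] FQ[OF that] unfolding Q_def by blast
  have sq: "(v\<^sup>\<star> o\<^sub>L v) o\<^sub>L (v\<^sup>\<star> o\<^sub>L v) = v\<^sup>\<star> o\<^sub>L v" if "v \<in> F" for v
    using FQ[OF that] is_proj_compose_self unfolding Q_def by blast
  \<comment> \<open>Sigma-finiteness bounds families of projections, so the family is counted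
    through its initial projections.\<close>
  have inj: "inj_on (\<lambda>v. v\<^sup>\<star> o\<^sub>L v) F"
  proof (rule inj_onI, rule ccontr)
    fix v w assume "v \<in> F" "w \<in> F" "v\<^sup>\<star> o\<^sub>L v = w\<^sup>\<star> o\<^sub>L w" "v \<noteq> w"
    then show False using orth[of v w] sq[of v] nz[of v] by simp
  qed
  have "countable ((\<lambda>v. v\<^sup>\<star> o\<^sub>L v) ` F)"
  proof (rule sigma_finite)
    show "(\<lambda>v. v\<^sup>\<star> o\<^sub>L v) ` F \<subseteq> projs - {0}"
      using FQ nz by (auto simp: Q_def projs_def intro!: M_compose M_hadj)
    show "pairwise (\<lambda>P Q. P o\<^sub>L Q = 0) ((\<lambda>v. v\<^sup>\<star> o\<^sub>L v) ` F)"
      using orth by (auto simp: pairwise_def)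
  qed
  then have cF: "countable F" using inj countable_image_inj_on by blast
  obtain v :: "nat \<Rightarrow> 'a op" where v: "\<And>n. v n \<in> insert 0 F" "F \<subseteq> range v"
    "\<And>i j. i \<noteq> j \<Longrightarrow> v i = 0 \<or> v j = 0 \<or> v i \<noteq> v j"
    by (rule countable_enum_padded[OF cF]) (rule that)
  have vM: "v n \<in> M" and vp: "is_proj ((v n)\<^sup>\<star> o\<^sub>L v n)" and ve: "v n o\<^sub>L e = v n" and vf: "f o\<^sub>L v n = v n" for n
    using v(1)[of n] FQ[of "v n"] unfolding Q_def by auto
  have vo: "(v i)\<^sup>\<star> o\<^sub>L v j = 0" "v i o\<^sub>L (v j)\<^sup>\<star> = 0" if "i \<noteq> j" for i j
    using v(1)[of i] v(1)[of j] v(3)[OF that] F(2) by (auto simp: pairwise_def R_def)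
  define en where "en n = (v n)\<^sup>\<star> o\<^sub>L v n" for n
  define fn where "fn n = v n o\<^sub>L (v n)\<^sup>\<star>" for n
  have enp: "en n \<in> projs" for n using vM vp by (auto simp: en_def projs_def intro: M_compose M_hadj)
  note vr = msub_range[OF vM en_def[symmetric] enp, folded fn_def]
  have fnv: "fn n o\<^sub>L v n = v n" for n using partial_isometry(3)[OF vp] by (simp add: fn_def)
  have eo: "orth_family en"
    unfolding orth_family_def
  proof (intro conjI allI impI)
    fix i j :: nat assume "i \<noteq> j"
    have "en i o\<^sub>L en j = (v i)\<^sup>\<star> o\<^sub>L ((v i o\<^sub>L (v j)\<^sup>\<star>) o\<^sub>L v j)" by (simp add: en_def blinfun_compose_assoc)
    then show "en i o\<^sub>L en j = 0" using vo[OF \<open>i \<noteq> j\<close>] by simp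
  qed (rule enp)
  have fo: "orth_family fn"
    unfolding orth_family_def
  proof (intro conjI allI impI)
    fix i j :: nat assume "i \<noteq> j"
    have "fn i o\<^sub>L fn j = v i o\<^sub>L (((v i)\<^sup>\<star> o\<^sub>L v j) o\<^sub>L (v j)\<^sup>\<star>)" by (simp add: fn_def blinfun_compose_assoc)
    then show "fn i o\<^sub>L fn j = 0" using vo[OF \<open>i \<noteq> j\<close>] by simp
  qed (rule vr)
  have EF: "osum en \<preceq> osum fn" "osum fn \<preceq> osum en"
    using vr by (auto intro!: msub_osum eo fo)
  have een: "e o\<^sub>L en n = en n" for n
  proof -
    have "e o\<^sub>L (v n)\<^sup>\<star> = (v n)\<^sup>\<star>" using arg_cong[OF ve, of hadj] projs_hadj[OF e] by simp
    then show ?thesis by (simp add: en_def blinfun_compose_assoc[symmetric])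
  qed
  have ffn: "f o\<^sub>L fn n = fn n" for n
    using vf by (simp add: fn_def blinfun_compose_assoc[symmetric])
  have eE: "e o\<^sub>L osum en = osum en" using een by (intro osum_le eo e)
  have fF: "f o\<^sub>L osum fn = osum fn" using ffn by (intro osum_le fo f)
  define e' where "e' = e - osum en"
  define f' where "f' = f - osum fn"
  have e': "e' \<in> projs" unfolding e'_def by (rule projs_diff[OF e osum_projs[OF eo] eE])
  have f': "f' \<in> projs" unfolding f'_def by (rule projs_diff[OF f osum_projs[OF fo] fF])
  have ene': "en n o\<^sub>L e' = 0" for n
    using projs_le_sym[OF enp osum_projs[OF eo]] projs_le_sym[OF enp e] osum_ge[OF eo] een
    by (simp add: e'_def blinfun_compose_simps)
  have fnf': "fn n o\<^sub>L f' = 0" for n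
    using projs_le_sym[OF vr(1) osum_projs[OF fo]] projs_le_sym[OF vr(1) f] osum_ge[OF fo] ffn
    by (simp add: f'_def blinfun_compose_simps)
  have "e' = 0 \<or> f' = 0"
  proof (rule ccontr)
    assume "\<not> (e' = 0 \<or> f' = 0)"
    then obtain w where w: "w \<in> M" "w \<noteq> 0" "is_proj (w\<^sup>\<star> o\<^sub>L w)" "w o\<^sub>L e' = w" "f' o\<^sub>L w = w"
      using nonzero_partial_isometry[OF e' f'] by blast
    have ee': "e' o\<^sub>L e = e'" and ff': "f o\<^sub>L f' = f'"
      using projs_le_sym[OF osum_projs[OF eo] e] eE fF projs_compose_self e f
      by (auto simp: e'_def f'_def blinfun_compose_simps)
    have "Q w"
      using w ee' ff' unfolding Q_def by (metis blinfun_compose_assoc)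
    moreover have Rw: "R x w \<and> R w x" if xF: "x \<in> F" for x
    proof -
      obtain n where n: "x = v n" using xF v(2) by blast
      have "(v n)\<^sup>\<star> o\<^sub>L w = (fn n o\<^sub>L v n)\<^sup>\<star> o\<^sub>L (f' o\<^sub>L w)" by (simp add: fnv w(5))
      also have "\<dots> = (v n)\<^sup>\<star> o\<^sub>L ((fn n o\<^sub>L f') o\<^sub>L w)"
        using projs_hadj[OF vr(1)] by (simp add: blinfun_compose_assoc)
      finally have 1: "(v n)\<^sup>\<star> o\<^sub>L w = 0" by (simp add: fnf')
      have "v n o\<^sub>L w\<^sup>\<star> = (v n o\<^sub>L en n) o\<^sub>L (w o\<^sub>L e')\<^sup>\<star>" by (simp add: vr(4) w(4))
      also have "\<dots> = v n o\<^sub>L ((en n o\<^sub>L e') o\<^sub>L w\<^sup>\<star>)"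
        using projs_hadj[OF e'] by (simp add: blinfun_compose_assoc)
      finally have 2: "v n o\<^sub>L w\<^sup>\<star> = 0" by (simp add: ene')
      from arg_cong[OF 1, of hadj] have 3: "w\<^sup>\<star> o\<^sub>L v n = 0" by simp
      from arg_cong[OF 2, of hadj] have 4: "w o\<^sub>L (v n)\<^sup>\<star> = 0" by simp
      from 1 2 3 4 show ?thesis by (simp add: R_def n)
    qed
    ultimately have "w \<in> F" by (rule max)
    then have "w\<^sup>\<star> o\<^sub>L w = 0" using Rw by (auto simp: R_def)
    then show False using z w(2) by blast
  qed
  then show ?thesis
  proof
    assume "e' = 0"
    then have "e \<preceq> osum fn" using EF by (simp add: e'_def)
    then show ?thesis using fF msub_mono by blast
  next
    assume "f' = 0"
    then have "f \<preceq> osum en" using EF by (simp add: f'_def)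
    then show ?thesis using eE msub_mono by blast
  qed
qed

text \<open>The copies \<open>R i\<close> are extended to a maximal orthogonal family
  \<open>s\<close> of copies of \<open>R 0\<close> below \<open>e\<close>. The remainder
  \<open>t\<close> embeds into \<open>R 0\<close>, so \<open>t\<close> followed by all
  \<open>s n\<close> embeds into any infinite subfamily of \<open>s\<close>, such as the even or the
  odd members.\<close>

lemma halving:
  assumes e: "e \<in> projs" and "\<not> fin e"
  obtains g h where "g \<in> projs" "h \<in> projs" "g o\<^sub>L h = 0" "g + h = e" "e \<preceq> g" "e \<preceq> h"
proof -
  obtain R where R: "\<And>i. R i \<in> projs" "\<And>i. e o\<^sub>L R i = R i" "\<And>i. R i \<noteq> 0"
    "\<And>i. R i \<preceq> R (0::nat)" "\<And>i. R 0 \<preceq> R i" "\<And>i j. i \<noteq> j \<Longrightarrow> R i o\<^sub>L R j = 0"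
    using infinite_orthogonal_copies[OF assms] by blast
  define P where "P r \<longleftrightarrow> r \<in> projs \<and> e o\<^sub>L r = r \<and> r \<preceq> R 0 \<and> R 0 \<preceq> r" for r
  have "range R \<subseteq> Collect P" using R by (auto simp: P_def)
  moreover have "pairwise (\<lambda>r s. r o\<^sub>L s = 0) (range R)"
    using R(6) by (auto simp: pairwise_def) metis
  ultimately obtain F where F: "range R \<subseteq> F" "F \<subseteq> Collect P" "pairwise (\<lambda>r s. r o\<^sub>L s = 0) F"
    and max: "\<And>w. P w \<Longrightarrow> (\<And>v. v \<in> F \<Longrightarrow> v o\<^sub>L w = 0 \<and> w o\<^sub>L v = 0) \<Longrightarrow> w \<in> F"
    using maximal_pairwise[of "range R" P "\<lambda>r s. r o\<^sub>L s = 0"] by metis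
  have nz: "r \<noteq> 0" if "r \<in> F" for r
    using that F(2) msub_zero_right[of "R 0"] R(3)[of 0] by (auto simp: P_def)
  have "F \<subseteq> projs - {0}" using F(2) nz by (auto simp: P_def)
  then have "countable F" using F(3) by (rule sigma_finite)
  moreover have "infinite F"
  proof -
    have "inj R"
    proof (rule injI)
      fix i j assume "R i = R j"
      then show "i = j" using R(1,3) R(6)[of i j] projs_compose_self by metis
    qed
    then show ?thesis using F(1) finite_subset range_inj_infinite by blast
  qed
  ultimately have bij: "bij_betw (from_nat_into F) UNIV F" by (rule bij_betw_from_nat_into)
  define s where "s = from_nat_into F"
  have sF: "s n \<in> F" for n using bij by (auto simp: s_def bij_betw_def)
  have sP: "s n \<in> projs" "e o\<^sub>L s n = s n" "s n \<preceq> R 0" "R 0 \<preceq> s n" for n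
    using sF[of n] F(2) by (auto simp: P_def)
  have so: "s i o\<^sub>L s j = 0" if "i \<noteq> j" for i j
  proof -
    have "s i \<noteq> s j" using bij that unfolding s_def bij_betw_def by (metis injD)
    then show ?thesis using F(3) sF by (auto simp: pairwise_def)
  qed
  have os: "orth_family s" using sP so by (simp add: orth_family_def)
  have es: "e o\<^sub>L osum s = osum s" using sP by (intro osum_le os e)
  define t where "t = e - osum s"
  have t: "t \<in> projs" unfolding t_def by (rule projs_diff[OF e osum_projs[OF os] es])
  have et: "e o\<^sub>L t = t"
    using es projs_compose_self e by (simp add: t_def blinfun_compose_simps)
  have st: "s n o\<^sub>L t = 0" for n
    using projs_le_sym[OF sP(1) osum_projs[OF os]] projs_le_sym[OF sP(1) e] osum_ge[OF os] sP(2)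
    by (simp add: t_def blinfun_compose_simps)
  have tR: "t \<preceq> R 0"
  proof (rule ccontr)
    assume "\<not> t \<preceq> R 0"
    then have "R 0 \<preceq> t" using comparison[OF t R(1)] by blast
    then obtain r where r: "r \<in> projs" "t o\<^sub>L r = r" "R 0 \<preceq> r" "r \<preceq> R 0"
      using msubE[OF _ R(1)] by blast
    have "P r" using r et projs_le_trans by (auto simp: P_def)
    moreover have orth: "v o\<^sub>L r = 0 \<and> r o\<^sub>L v = 0" if vF: "v \<in> F" for v
    proof -
      have "v \<in> range s" using bij vF by (simp add: s_def bij_betw_def)
      then obtain n where n: "v = s n" by blast
      have "v o\<^sub>L r = (s n o\<^sub>L t) o\<^sub>L r" using r(2) by (simp add: n blinfun_compose_assoc)
      then have "v o\<^sub>L r = 0" by (simp add: st)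
      then show ?thesis using projs_orthogonal_sym sP(1) r(1) n by blast
    qed
    ultimately have "r \<in> F" by (rule max)
    then have "r o\<^sub>L r = 0" using orth by blast
    then have "r = 0" using r(1) projs_compose_self by metis
    then show False using r(3) msub_zero_right R(3) by blast
  qed
  \<comment> \<open>With the remainder in front, \<open>u\<close> sums to all of \<open>e\<close>,
    while each \<open>u n\<close> still embeds into every member of \<open>s\<close>.\<close>
  define u where "u = case_nat t s"
  have ou: "orth_family u"
    unfolding orth_family_def u_def
    using t sP so st projs_orthogonal_sym[OF sP(1) t st] by (auto split: nat.split)
  have "osum u = e"
  proof (rule is_proj_eqI)
    show "is_proj (osum u)" "is_proj e" using osum_projs[OF ou] e projsD by auto
    fix x
    have "osum u x = 0 \<longleftrightarrow> u 0 x = 0 \<and> (\<forall>i. u (Suc i) x = 0)"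
      unfolding osum_eq_0_iff[OF ou] by (metis not0_implies_Suc)
    also have "\<dots> \<longleftrightarrow> t x = 0 \<and> osum s x = 0"
      unfolding osum_eq_0_iff[OF os] by (simp add: u_def)
    also have "\<dots> \<longleftrightarrow> e x = 0"
    proof -
      have "osum s (e x) = osum s x"
        using projs_le_sym[OF osum_projs[OF os] e] es by (metis blinfun_apply_blinfun_compose)
      then show ?thesis by (auto simp: t_def blinfun.diff_left)
    qed
    finally show "osum u x = 0 \<longleftrightarrow> e x = 0" .
  qed
  have sub: "e \<preceq> osum (\<lambda>n. s (k n))" "orth_family (\<lambda>n. s (k n))" if "inj k" for k :: "nat \<Rightarrow> nat"
  proof -
    show o: "orth_family (\<lambda>n. s (k n))"
      using sP(1) so injD[OF that] unfolding orth_family_def by metis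
    have "u n \<preceq> R 0" for n using tR sP(3) by (cases n) (auto simp: u_def)
    then have "u n \<preceq> s (k n)" for n using sP(4) msub_trans by blast
    from msub_osum[OF ou o this] show "e \<preceq> osum (\<lambda>n. s (k n))"
      by (simp add: \<open>osum u = e\<close>)
  qed
  define g where "g = osum (\<lambda>n. s (2 * n))"
  define k where "k = osum (\<lambda>n. s (2 * n + 1))"
  have o: "orth_family (\<lambda>n. s (2 * n))" "orth_family (\<lambda>n. s (2 * n + 1))"
    using sub(2)[of "\<lambda>n. 2 * n"] sub(2)[of "\<lambda>n. 2 * n + 1"] by (auto simp: inj_def)
  have eg: "e \<preceq> g" and ek: "e \<preceq> k"
    using sub(1)[of "\<lambda>n. 2 * n"] sub(1)[of "\<lambda>n. 2 * n + 1"] by (auto simp: inj_def g_def k_def)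
  have g: "g \<in> projs" unfolding g_def by (rule osum_projs[OF o(1)])
  have leg: "e o\<^sub>L g = g" unfolding g_def using sP by (intro osum_le o e)
  \<comment> \<open>\<open>h\<close> is the full complement of \<open>g\<close>, not just the sum
    \<open>k\<close> of the odd members: it also takes up \<open>t\<close>, which gives
    \<open>g + h = e\<close>.\<close>
  define h where "h = e - g"
  have h: "h \<in> projs" unfolding h_def by (rule projs_diff[OF e g leg])
  have "h o\<^sub>L s (2 * n + 1) = s (2 * n + 1)" for n
  proof -
    have "g (s (2 * n + 1) x) = 0" for x
      unfolding g_def osum_eq_0_iff[OF o(1)]
    proof
      fix i
      have "2 * i \<noteq> 2 * n + 1" by presburger
      then show "s (2 * i) (s (2 * n + 1) x) = 0" by (rule orth_familyD(4)[OF os])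
    qed
    then have "g o\<^sub>L s (2 * n + 1) = 0" by (intro blinfun_eqI) simp
    then show ?thesis using sP(2) by (simp add: h_def blinfun_compose_simps)
  qed
  then have "h o\<^sub>L k = k" unfolding k_def by (intro osum_le o h)
  then have eh: "e \<preceq> h" using ek msub_mono by blast
  have "g o\<^sub>L h = 0"
    using projs_le_sym[OF g e] leg g projs_compose_self by (simp add: h_def blinfun_compose_simps)
  then show thesis using g h eg eh by (intro that[of g h]) (auto simp: h_def)
qed

text \<open>On the range of \<open>g\<close>, the operator \<open>q o\<^sub>L g\<close> vanishes
  exactly on the meet with \<open>p\<close>, since there \<open>q x = 0\<close> means
  \<open>p x = x\<close>. Its range is orthogonal to the meet of \<open>h\<close> and
  \<open>q\<close>, because \<open>h\<close> is orthogonal to \<open>g\<close>.\<close>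

lemma meet_complement_msub:
  assumes "p \<in> projs" "q \<in> projs" "g \<in> projs" "h \<in> projs"
    and "p o\<^sub>L q = 0" "g o\<^sub>L h = 0" "p + q = g + h"
  shows "g - meet g p \<preceq> q - meet h q"
proof (rule msub_of_operator[where X = "q o\<^sub>L g"])
  have qp: "q o\<^sub>L p = 0" and hg: "h o\<^sub>L g = 0" using projs_orthogonal_sym assms by blast+
  note m1 = meet_le[OF assms(3,1)] and m2 = meet_le[OF assms(4,2)]
  have mp: "meet g p \<in> projs" "meet h q \<in> projs" using meet_projs assms by blast+
  show "q o\<^sub>L g \<in> M" using assms projsD by (intro M_compose) auto
  show "g - meet g p \<in> projs" "q - meet h q \<in> projs"
    using projs_diff m1 m2 mp assms by blast+
  show "(g - meet g p) x = 0" if "(q o\<^sub>L g) x = 0" for x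
  proof -
    have "(p + q) (g x) = (g + h) (g x)" using assms(7) by simp
    then have "p (g x) = g x"
      using that hg projs_idem[OF assms(3)]
      by (simp add: blinfun.add_left) (metis add.right_neutral blinfun_apply_blinfun_compose zero_blinfun.rep_eq)
    then have "meet g p (g x) = g x" using meet_eq_iff[OF assms(3,1)] projs_idem[OF assms(3)] by blast
    moreover have "meet g p (g x) = meet g p x"
      using projs_le_sym[OF mp(1) assms(3)] m1 by (metis blinfun_apply_blinfun_compose)
    ultimately show ?thesis by (simp add: blinfun.diff_left)
  qed
  have "q o\<^sub>L meet g p = 0"
    using m1(2) qp by (metis blinfun_compose_assoc blinfun_compose_zero(1))
  moreover have "g o\<^sub>L meet g p = meet g p" by (rule m1)
  ultimately show "(q o\<^sub>L g) o\<^sub>L (g - meet g p) = q o\<^sub>L g"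
    using projs_compose_self[OF assms(3)]
    by (simp add: blinfun_compose_simps blinfun_compose_assoc)
  have "meet h q o\<^sub>L (q o\<^sub>L g) = (meet h q o\<^sub>L h) o\<^sub>L g"
    using projs_le_sym[OF mp(2) assms(2)] projs_le_sym[OF mp(2) assms(4)] m2
    by (simp add: blinfun_compose_assoc[symmetric])
  also have "\<dots> = 0" using hg by (simp add: blinfun_compose_assoc)
  finally show "(q - meet h q) o\<^sub>L (q o\<^sub>L g) = q o\<^sub>L g"
    using projs_compose_self[OF assms(2)]
    by (simp add: blinfun_compose_simps blinfun_compose_assoc[symmetric])
qed

text \<open>If \<open>p + q = g + h\<close> with both \<open>g\<close> and \<open>h\<close> dominating \<open>p + q\<close>, then comparing \<open>g \<and> p\<close> with
  \<open>h \<and> q\<close> embeds \<open>g\<close> into \<open>q\<close> or \<open>h\<close> into \<open>p\<close>.\<close>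

theorem fin_add:
  assumes p: "fin p" and q: "fin q" and pq: "p o\<^sub>L q = 0"
  shows "fin (p + q)"
proof (rule ccontr)
  assume inf: "\<not> fin (p + q)"
  have pp: "p \<in> projs" "q \<in> projs" using p q fin_projs by blast+
  have e: "p + q \<in> projs" using projs_add pp pq by blast
  obtain g h where gh: "g \<in> projs" "h \<in> projs" "g o\<^sub>L h = 0" "g + h = p + q"
    "p + q \<preceq> g" "p + q \<preceq> h"
    using halving[OF e inf] by metis
  have qp: "q o\<^sub>L p = 0" and hg: "h o\<^sub>L g = 0" using projs_orthogonal_sym pp pq gh by blast+
  \<comment> \<open>Stated for arbitrary letters because it is applied twice, the second time with
    \<open>p\<close> and \<open>q\<close> as well as \<open>g\<close> and \<open>h\<close>
    exchanged.\<close>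
  have key: False
    if "p \<in> projs" "fin q" "g \<in> projs" "h \<in> projs" "p o\<^sub>L q = 0" "g o\<^sub>L h = 0" "p + q = g + h"
      "\<not> fin g" "meet g p \<preceq> meet h q" for p q g h
  proof -
    have q: "q \<in> projs" using that fin_projs by blast
    have m: "meet g p \<in> projs" "meet h q \<in> projs" using meet_projs that q by blast+
    have lq: "q o\<^sub>L meet h q = meet h q" by (rule meet_le[OF that(4) q])
    have "q - meet h q \<in> projs" by (rule projs_diff[OF q m(2) lq])
    moreover have "(q - meet h q) o\<^sub>L meet h q = 0"
      using lq m(2) projs_compose_self by (simp add: blinfun_compose_simps)
    ultimately have "(g - meet g p) + meet g p \<preceq> (q - meet h q) + meet h q"
      using meet_complement_msub[OF that(1) q that(3-7)] that(9) m by (intro msub_add) auto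
    then have "g \<preceq> q" by simp
    then show False using fin_msub that by blast
  qed
  have nf: "\<not> fin g" "\<not> fin h" using inf fin_msub gh e by blast+
  have "meet g p \<in> projs" "meet h q \<in> projs" using meet_projs gh pp by blast+
  from comparison[OF this] show False
  proof
    assume "meet g p \<preceq> meet h q"
    then show False using key[OF pp(1) q gh(1,2) pq gh(3) _ nf(1)] gh(4) by simp
  next
    assume "meet h q \<preceq> meet g p"
    then show False using key[OF pp(2) p gh(2,1) qp hg _ nf(2)] gh(4) by (simp add: add.commute)
  qed
qed

text \<open>The part of the join outside \<open>p\<close> embeds into \<open>q\<close>: a vector of
  it killed by \<open>q\<close> is killed by \<open>p\<close> too, hence by the join.\<close>

lemma fin_join:
  assumes p: "fin p" and q: "fin q"
  shows "fin (join p q)"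
proof -
  have pp: "p \<in> projs" "q \<in> projs" using p q fin_projs by blast+
  note j = join_projs[OF pp] and jg = join_ge[OF pp]
  define f where "f = join p q - p"
  have f: "f \<in> projs" unfolding f_def by (rule projs_diff[OF j pp(1) jg(1)])
  have pf: "p o\<^sub>L f = 0"
    using projs_le_sym[OF pp(1) j] jg(1) pp(1) projs_compose_self
    by (simp add: f_def blinfun_compose_simps)
  have "f \<preceq> q"
  proof (rule msub_if_meet_zero[OF f pp(2)])
    fix x assume x: "f x = x" "q x = 0"
    have "p x = 0" using x(1) pf by (metis blinfun_apply_blinfun_compose zero_blinfun.rep_eq)
    then have "join p q x = 0" using x(2) join_eq_0_iff[OF pp] by blast
    then show "x = 0" using x(1) \<open>p x = 0\<close> by (simp add: f_def blinfun.diff_left)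
  qed
  then have "fin f" using fin_msub f q by blast
  from fin_add[OF p this pf] show ?thesis by (simp add: f_def)
qed

end

section \<open>A dimension function\<close>

text \<open>Projections under direct sum satisfy the monoid laws only up to equivalence, so the laws
  are stated as inequalities and no quotient is formed.\<close>

locale preordered_monoid =
  fixes C :: "'b set" and le :: "'b \<Rightarrow> 'b \<Rightarrow> bool" (infix \<open>\<sqsubseteq>\<close> 50)
    and plus :: "'b \<Rightarrow> 'b \<Rightarrow> 'b" (infixl \<open>\<oplus>\<close> 65) and zero :: 'b (\<open>\<zero>\<close>)
  assumes zero_closed [simp]: "\<zero> \<in> C"
    and plus_closed [simp]: "x \<in> C \<Longrightarrow> y \<in> C \<Longrightarrow> x \<oplus> y \<in> C"
    and refl [simp]: "x \<in> C \<Longrightarrow> x \<sqsubseteq> x"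
    and trans [trans]: "x \<sqsubseteq> y \<Longrightarrow> y \<sqsubseteq> z \<Longrightarrow> x \<sqsubseteq> z"
    and zero_le: "x \<in> C \<Longrightarrow> \<zero> \<sqsubseteq> x"
    and plus_mono: "x \<in> C \<Longrightarrow> x' \<in> C \<Longrightarrow> y \<in> C \<Longrightarrow> y' \<in> C \<Longrightarrow> x \<sqsubseteq> x' \<Longrightarrow> y \<sqsubseteq> y' \<Longrightarrow> x \<oplus> y \<sqsubseteq> x' \<oplus> y'"
    and plus_commute: "x \<in> C \<Longrightarrow> y \<in> C \<Longrightarrow> x \<oplus> y \<sqsubseteq> y \<oplus> x"
    and plus_assoc: "x \<in> C \<Longrightarrow> y \<in> C \<Longrightarrow> z \<in> C \<Longrightarrow> (x \<oplus> y) \<oplus> z \<sqsubseteq> x \<oplus> (y \<oplus> z)"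
    and plus_zero: "x \<in> C \<Longrightarrow> x \<oplus> \<zero> \<sqsubseteq> x"
    and plus_zero': "x \<in> C \<Longrightarrow> x \<sqsubseteq> x \<oplus> \<zero>"
begin

lemma plus_assoc':
  assumes "x \<in> C" "y \<in> C" "z \<in> C"
  shows "x \<oplus> (y \<oplus> z) \<sqsubseteq> (x \<oplus> y) \<oplus> z"
proof -
  have "x \<oplus> (y \<oplus> z) \<sqsubseteq> (y \<oplus> z) \<oplus> x" using assms by (intro plus_commute) auto
  also have "\<dots> \<sqsubseteq> y \<oplus> (z \<oplus> x)" using assms by (intro plus_assoc)
  also have "\<dots> \<sqsubseteq> (z \<oplus> x) \<oplus> y" using assms by (intro plus_commute) auto
  also have "\<dots> \<sqsubseteq> z \<oplus> (x \<oplus> y)" using assms by (intro plus_assoc)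
  also have "\<dots> \<sqsubseteq> (x \<oplus> y) \<oplus> z" using assms by (intro plus_commute) auto
  finally show ?thesis .
qed

lemma le_plus:
  assumes "x \<in> C" "y \<in> C" "y \<oplus> x \<sqsubseteq> z"
  shows "x \<sqsubseteq> z"
proof -
  have "x \<sqsubseteq> x \<oplus> \<zero>" using assms by (intro plus_zero')
  also have "\<dots> \<sqsubseteq> x \<oplus> y" using assms by (intro plus_mono) (auto intro: zero_le)
  also have "\<dots> \<sqsubseteq> y \<oplus> x" using assms by (intro plus_commute)
  also have "\<dots> \<sqsubseteq> z" by fact
  finally show ?thesis .
qed

fun mul :: "nat \<Rightarrow> 'b \<Rightarrow> 'b" where
  "mul 0 x = \<zero>"
| "mul (Suc n) x = x \<oplus> mul n x"

lemma mul_closed [simp]: "x \<in> C \<Longrightarrow> mul n x \<in> C"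
  by (induction n) auto

lemma mul_mono: "x \<in> C \<Longrightarrow> y \<in> C \<Longrightarrow> x \<sqsubseteq> y \<Longrightarrow> mul n x \<sqsubseteq> mul n y"
  by (induction n) (auto intro: plus_mono)

lemma mul_add: "x \<in> C \<Longrightarrow> mul m x \<oplus> mul n x \<sqsubseteq> mul (m + n) x"
proof (induction m)
  case 0
  have "\<zero> \<oplus> mul n x \<sqsubseteq> mul n x \<oplus> \<zero>" using 0 by (intro plus_commute) auto
  also have "\<dots> \<sqsubseteq> mul n x" using 0 by (intro plus_zero) auto
  finally show ?case by simp
next
  case (Suc m)
  have "(x \<oplus> mul m x) \<oplus> mul n x \<sqsubseteq> x \<oplus> (mul m x \<oplus> mul n x)" using Suc by (intro plus_assoc) auto
  also have "\<dots> \<sqsubseteq> x \<oplus> mul (m + n) x" using Suc by (intro plus_mono) auto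
  finally show ?case by simp
qed

lemma mul_add': "x \<in> C \<Longrightarrow> mul (m + n) x \<sqsubseteq> mul m x \<oplus> mul n x"
proof (induction m)
  case 0
  have "mul n x \<sqsubseteq> mul n x \<oplus> \<zero>" using 0 by (intro plus_zero') auto
  also have "\<dots> \<sqsubseteq> \<zero> \<oplus> mul n x" using 0 by (intro plus_commute) auto
  finally show ?case by simp
next
  case (Suc m)
  have "x \<oplus> mul (m + n) x \<sqsubseteq> x \<oplus> (mul m x \<oplus> mul n x)" using Suc by (intro plus_mono) auto
  also have "\<dots> \<sqsubseteq> (x \<oplus> mul m x) \<oplus> mul n x" using Suc by (intro plus_assoc') auto
  finally show ?case by simp
qed

lemma mul_mul: "x \<in> C \<Longrightarrow> mul m (mul n x) \<sqsubseteq> mul (m * n) x"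
proof (induction m)
  case (Suc m)
  have "mul n x \<oplus> mul m (mul n x) \<sqsubseteq> mul n x \<oplus> mul (m * n) x" using Suc by (intro plus_mono) auto
  also have "\<dots> \<sqsubseteq> mul (n + m * n) x" using Suc by (intro mul_add) auto
  finally show ?case by simp
qed simp

lemma mul_mul': "x \<in> C \<Longrightarrow> mul (m * n) x \<sqsubseteq> mul m (mul n x)"
proof (induction m)
  case (Suc m)
  have "mul (n + m * n) x \<sqsubseteq> mul n x \<oplus> mul (m * n) x" using Suc by (intro mul_add') auto
  also have "\<dots> \<sqsubseteq> mul n x \<oplus> mul m (mul n x)" using Suc by (intro plus_mono) auto
  finally show ?case by simp
qed simp

lemma mul_plus: "x \<in> C \<Longrightarrow> y \<in> C \<Longrightarrow> mul n x \<oplus> mul n y \<sqsubseteq> mul n (x \<oplus> y)"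
proof (induction n)
  case 0
  then show ?case by (auto intro: plus_zero)
next
  case (Suc n)
  have "(x \<oplus> mul n x) \<oplus> (y \<oplus> mul n y) \<sqsubseteq> x \<oplus> (mul n x \<oplus> (y \<oplus> mul n y))"
    using Suc by (intro plus_assoc) auto
  also have "\<dots> \<sqsubseteq> x \<oplus> ((mul n x \<oplus> y) \<oplus> mul n y)" using Suc by (intro plus_mono plus_assoc') auto
  also have "\<dots> \<sqsubseteq> x \<oplus> ((y \<oplus> mul n x) \<oplus> mul n y)" using Suc by (intro plus_mono plus_commute) auto
  also have "\<dots> \<sqsubseteq> x \<oplus> (y \<oplus> (mul n x \<oplus> mul n y))" using Suc by (intro plus_mono plus_assoc) auto
  also have "\<dots> \<sqsubseteq> x \<oplus> (y \<oplus> mul n (x \<oplus> y))" using Suc by (intro plus_mono) auto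
  also have "\<dots> \<sqsubseteq> (x \<oplus> y) \<oplus> mul n (x \<oplus> y)" using Suc by (intro plus_assoc') auto
  finally show ?case by simp
qed

end

text \<open>The last assumption is the combinatorial content of finiteness of a nonzero projection:
  no multiple of \<open>p\<close> absorbs further copies of \<open>p\<close>.\<close>

locale dimension = preordered_monoid +
  fixes p :: 'a
  assumes p_closed [simp]: "p \<in> C"
    and p_finite: "mul k p \<sqsubseteq> mul n p \<Longrightarrow> k \<le> n"
begin

text \<open>Rational lower bounds for the dimension of \<open>f\<close> measured in units of
  \<open>p\<close>; taking multiples on both sides makes incommensurable sizes comparable.\<close>

definition ratios :: "'a \<Rightarrow> real set"
  where "ratios f = {real k / real n | k n. n > 0 \<and> mul k p \<sqsubseteq> mul n f}"

definition dim :: "'a \<Rightarrow> real" where "dim f = Sup (ratios f)"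

lemma ratios_ne: "f \<in> C \<Longrightarrow> 0 \<in> ratios f"
  unfolding ratios_def by (rule CollectI, rule exI[of _ 0], rule exI[of _ 1]) (simp add: zero_le)

lemma ratios_le_1:
  assumes "f \<in> C" "f \<sqsubseteq> p" "r \<in> ratios f"
  shows "r \<le> 1"
proof -
  obtain k n where r: "r = real k / real n" "n > 0" "mul k p \<sqsubseteq> mul n f"
    using assms by (auto simp: ratios_def)
  have "mul n f \<sqsubseteq> mul n p" using assms by (intro mul_mono) auto
  then have "k \<le> n" using r trans p_finite by blast
  then show ?thesis using r by simp
qed

lemma ratios_bdd: "f \<in> C \<Longrightarrow> f \<sqsubseteq> p \<Longrightarrow> bdd_above (ratios f)"
  using ratios_le_1 by (intro bdd_aboveI) blast

lemma dim_le_1: "f \<in> C \<Longrightarrow> f \<sqsubseteq> p \<Longrightarrow> dim f \<le> 1"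
  unfolding dim_def using ratios_ne ratios_le_1 by (intro cSup_least) blast+

lemma dim_nonneg: "f \<in> C \<Longrightarrow> f \<sqsubseteq> p \<Longrightarrow> 0 \<le> dim f"
  unfolding dim_def using ratios_ne ratios_bdd by (intro cSup_upper)

lemma dim_lower: "f \<in> C \<Longrightarrow> f \<sqsubseteq> p \<Longrightarrow> n > 0 \<Longrightarrow> mul k p \<sqsubseteq> mul n f \<Longrightarrow> real k / real n \<le> dim f"
  unfolding dim_def using ratios_bdd by (intro cSup_upper) (auto simp: ratios_def)

lemma dim_upper:
  assumes "f \<in> C" "\<And>k n. n > 0 \<Longrightarrow> mul k p \<sqsubseteq> mul n f \<Longrightarrow> real k / real n \<le> c"
  shows "dim f \<le> c"
  unfolding dim_def using ratios_ne[OF assms(1)] assms(2)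
  by (intro cSup_least) (auto simp: ratios_def)

lemma dim_mono:
  assumes "f \<in> C" "g \<in> C" "f \<sqsubseteq> g" "g \<sqsubseteq> p"
  shows "dim f \<le> dim g"
proof (rule dim_upper[OF assms(1)])
  fix k n :: nat assume "n > 0" "mul k p \<sqsubseteq> mul n f"
  then show "real k / real n \<le> dim g"
    using mul_mono[OF assms(1-3), of n] assms trans by (intro dim_lower) blast+
qed

text \<open>Fractions for \<open>f\<close> and \<open>g\<close> are put over the common denominator
  \<open>n' * n\<close> and added; taking the two suprema one after the other gives the
  claim.\<close>

lemma dim_superadditive:
  assumes f: "f \<in> C" and g: "g \<in> C" and h: "h \<in> C" and fgh: "f \<oplus> g \<sqsubseteq> h" and "h \<sqsubseteq> p"
  shows "dim f + dim g \<le> dim h"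
proof -
  have key: "real k / real n + real k' / real n' \<le> dim h"
    if "n > 0" "n' > 0" "mul k p \<sqsubseteq> mul n f" "mul k' p \<sqsubseteq> mul n' g" for k n k' n'
  proof -
    have "mul (n' * k + n * k') p \<sqsubseteq> mul (n' * k) p \<oplus> mul (n * k') p" by (rule mul_add') simp
    also have "\<dots> \<sqsubseteq> mul n' (mul k p) \<oplus> mul n (mul k' p)"
      by (intro plus_mono mul_mul') auto
    also have "\<dots> \<sqsubseteq> mul n' (mul n f) \<oplus> mul n (mul n' g)"
      using that f g by (intro plus_mono mul_mono) auto
    also have "\<dots> \<sqsubseteq> mul (n' * n) f \<oplus> mul (n * n') g"
      using f g by (intro plus_mono mul_mul) auto
    also have "\<dots> \<sqsubseteq> mul (n' * n) (f \<oplus> g)"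
      using mul_plus[OF f g, of "n' * n"] by (simp add: mult.commute)
    also have "\<dots> \<sqsubseteq> mul (n' * n) h"
      using assms by (intro mul_mono) auto
    finally have "real (n' * k + n * k') / real (n' * n) \<le> dim h"
      using that assms by (intro dim_lower) auto
    moreover have "real (n' * k + n * k') / real (n' * n) = real k / real n + real k' / real n'"
      using that by (simp add: field_simps)
    ultimately show ?thesis by simp
  qed
  have "dim f \<le> dim h - dim g"
  proof (rule dim_upper[OF f])
    fix k n :: nat assume kn: "n > 0" "mul k p \<sqsubseteq> mul n f"
    have "dim g \<le> dim h - real k / real n"
    proof (rule dim_upper[OF g])
      fix k' n' :: nat assume "n' > 0" "mul k' p \<sqsubseteq> mul n' g"
      from key[OF kn(1) this(1) kn(2) this(2)]
      show "real k' / real n' \<le> dim h - real k / real n" by simp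
    qed
    then show "real k / real n \<le> dim h - dim g" by simp
  qed
  then show ?thesis by simp
qed

text \<open>Replacing each copy of \<open>e\<close> by \<open>d\<close> copies of \<open>f\<close>
  turns a fraction \<open>k / n\<close> for \<open>e\<close> into \<open>k / (n * d)\<close> for
  \<open>f\<close>.\<close>

lemma dim_le_mul:
  assumes e: "e \<in> C" and f: "f \<in> C" and "f \<sqsubseteq> p" and ef: "e \<sqsubseteq> mul d f" and d: "d > 0"
  shows "dim e \<le> real d * dim f"
proof (rule dim_upper[OF e])
  fix k n :: nat assume kn: "n > 0" "mul k p \<sqsubseteq> mul n e"
  have "mul k p \<sqsubseteq> mul n e" by fact
  also have "\<dots> \<sqsubseteq> mul n (mul d f)" using e f ef by (intro mul_mono) auto
  also have "\<dots> \<sqsubseteq> mul (n * d) f" using f by (rule mul_mul)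
  finally have "real k / real (n * d) \<le> dim f" using kn d assms by (intro dim_lower) auto
  then show "real k / real n \<le> real d * dim f" using kn d by (simp add: field_simps)
qed

lemma dim_pos:
  assumes "f \<in> C" "f \<sqsubseteq> p" "p \<sqsubseteq> mul m f"
  shows "0 < dim f"
proof -
  have "mul 1 p \<sqsubseteq> p" using plus_zero[of p] by simp
  then have le: "mul 1 p \<sqsubseteq> mul m f" using assms(3) trans by blast
  have "m > 0"
  proof (rule ccontr)
    assume "\<not> m > 0"
    then have "mul 1 p \<sqsubseteq> mul 0 p" using le by simp
    then show False using p_finite[of 1 0] by simp
  qed
  then have "real 1 / real m \<le> dim f" using le assms by (intro dim_lower)
  moreover have "0 < real 1 / real m" using \<open>m > 0\<close> by simp
  ultimately show ?thesis by linarith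
qed

end

section \<open>Direct sums in an infinite factor\<close>

locale vn_infinite_factor = vn_factor +
  assumes infinite: "\<not> fin id_blinfun"
begin

lemma isometry_pair:
  obtains S T where "S \<in> M" "T \<in> M" "S\<^sup>\<star> o\<^sub>L S = id_blinfun" "T\<^sup>\<star> o\<^sub>L T = id_blinfun" "S\<^sup>\<star> o\<^sub>L T = 0"
proof -
  obtain g h where gh: "g \<in> projs" "h \<in> projs" "g o\<^sub>L h = 0" "id_blinfun \<preceq> g" "id_blinfun \<preceq> h"
    using halving[OF projs_id infinite] by metis
  then obtain S T where S: "S \<in> M" "S\<^sup>\<star> o\<^sub>L S = id_blinfun" "g o\<^sub>L S = S"
    and T: "T \<in> M" "T\<^sup>\<star> o\<^sub>L T = id_blinfun" "h o\<^sub>L T = T"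
    by (auto simp: msub_def)
  have "S\<^sup>\<star> o\<^sub>L T = (g o\<^sub>L S)\<^sup>\<star> o\<^sub>L (h o\<^sub>L T)" using S T by simp
  also have "\<dots> = S\<^sup>\<star> o\<^sub>L ((g o\<^sub>L h) o\<^sub>L T)" using projs_hadj[OF gh(1)] by (simp add: blinfun_compose_assoc)
  finally have "S\<^sup>\<star> o\<^sub>L T = 0" using gh by simp
  with S T show thesis by (intro that)
qed

text \<open>Two isometries in \<open>M\<close> with orthogonal ranges replace matrices over
  \<open>M\<close>: direct sums of arbitrary projections then exist inside \<open>M\<close>
  itself.\<close>

definition iso_pair :: "'a op \<times> 'a op"
  where "iso_pair = (SOME (S, T). S \<in> M \<and> T \<in> M \<and> S\<^sup>\<star> o\<^sub>L S = id_blinfun \<and>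
    T\<^sup>\<star> o\<^sub>L T = id_blinfun \<and> S\<^sup>\<star> o\<^sub>L T = 0)"

abbreviation "iso1 \<equiv> fst iso_pair"
abbreviation "iso2 \<equiv> snd iso_pair"

lemma iso_pair: "iso1 \<in> M" "iso2 \<in> M" "iso1\<^sup>\<star> o\<^sub>L iso1 = id_blinfun" "iso2\<^sup>\<star> o\<^sub>L iso2 = id_blinfun"
  "iso1\<^sup>\<star> o\<^sub>L iso2 = 0"
proof -
  have "\<exists>x. case x of (S, T) \<Rightarrow> S \<in> M \<and> T \<in> M \<and> S\<^sup>\<star> o\<^sub>L S = id_blinfun \<and>
      T\<^sup>\<star> o\<^sub>L T = id_blinfun \<and> S\<^sup>\<star> o\<^sub>L T = 0"
  proof -
    obtain S T where "S \<in> M" "T \<in> M" "S\<^sup>\<star> o\<^sub>L S = id_blinfun" "T\<^sup>\<star> o\<^sub>L T = id_blinfun"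
      "S\<^sup>\<star> o\<^sub>L T = 0"
      by (rule isometry_pair)
    then show ?thesis by (intro exI[of _ "(S, T)"]) simp
  qed
  from someI_ex[OF this, folded iso_pair_def]
  show "iso1 \<in> M" "iso2 \<in> M" "iso1\<^sup>\<star> o\<^sub>L iso1 = id_blinfun" "iso2\<^sup>\<star> o\<^sub>L iso2 = id_blinfun"
    "iso1\<^sup>\<star> o\<^sub>L iso2 = 0"
    unfolding case_prod_beta by blast+
qed

definition conj :: "'a op \<Rightarrow> 'a op \<Rightarrow> 'a op"
  where "conj v e = v o\<^sub>L e o\<^sub>L v\<^sup>\<star>"

lemma conj_isometry:
  assumes v: "v \<in> M" "v\<^sup>\<star> o\<^sub>L v = f" and e: "e \<in> projs" "f o\<^sub>L e = e"
  shows "conj v e \<in> projs" "conj v e \<preceq> e" "e \<preceq> conj v e"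
proof -
  define w where "w = v o\<^sub>L e"
  note ee = projs_compose_self[OF e(1)] projs_hadj[OF e(1)]
  have "w\<^sup>\<star> o\<^sub>L w = e o\<^sub>L ((v\<^sup>\<star> o\<^sub>L v) o\<^sub>L e)" by (simp add: w_def ee blinfun_compose_assoc)
  then have ww: "w\<^sup>\<star> o\<^sub>L w = e" using v e ee by simp
  have "w o\<^sub>L w\<^sup>\<star> = v o\<^sub>L (e o\<^sub>L e) o\<^sub>L v\<^sup>\<star>" by (simp add: w_def ee(2) blinfun_compose_assoc)
  then have "w o\<^sub>L w\<^sup>\<star> = conj v e" by (simp add: conj_def ee)
  moreover have "w \<in> M" using v e projsD by (auto simp: w_def intro: M_compose)
  ultimately show "conj v e \<in> projs" "conj v e \<preceq> e" "e \<preceq> conj v e"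
    using msub_range[OF _ ww e(1)] by auto
qed

lemma conj_iso:
  assumes "e \<in> projs"
  shows "conj iso1 e \<in> projs" "conj iso1 e \<preceq> e" "e \<preceq> conj iso1 e"
    "conj iso2 e \<in> projs" "conj iso2 e \<preceq> e" "e \<preceq> conj iso2 e"
  using conj_isometry[OF iso_pair(1,3) assms] conj_isometry[OF iso_pair(2,4) assms] by auto

lemma conj_iso_mono:
  assumes "e \<in> projs" "f \<in> projs" "e \<preceq> f"
  shows "conj iso1 e \<preceq> conj iso1 f" "conj iso1 e \<preceq> conj iso2 f"
    "conj iso2 e \<preceq> conj iso1 f" "conj iso2 e \<preceq> conj iso2 f"
proof -
  have "conj iso1 e \<preceq> f" "conj iso2 e \<preceq> f"
    using conj_iso(2,5)[OF assms(1)] assms(3) msub_trans by blast+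
  moreover have "f \<preceq> conj iso1 f" "f \<preceq> conj iso2 f" using conj_iso(3,6)[OF assms(2)] .
  ultimately show "conj iso1 e \<preceq> conj iso1 f" "conj iso1 e \<preceq> conj iso2 f"
    "conj iso2 e \<preceq> conj iso1 f" "conj iso2 e \<preceq> conj iso2 f"
    using msub_trans by blast+
qed

lemma conj_orthogonal: "conj iso1 e o\<^sub>L conj iso2 f = 0"
proof -
  have "conj iso1 e o\<^sub>L conj iso2 f = iso1 o\<^sub>L (e o\<^sub>L ((iso1\<^sup>\<star> o\<^sub>L iso2) o\<^sub>L (f o\<^sub>L iso2\<^sup>\<star>)))"
    by (simp add: conj_def blinfun_compose_assoc)
  then show ?thesis by (simp add: iso_pair)
qed

lemma conj_orthogonal': "conj iso2 e o\<^sub>L conj iso1 f = 0"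
proof -
  from arg_cong[OF iso_pair(5), of hadj] have *: "iso2\<^sup>\<star> o\<^sub>L iso1 = 0" by simp
  have "conj iso2 e o\<^sub>L conj iso1 f = iso2 o\<^sub>L (e o\<^sub>L ((iso2\<^sup>\<star> o\<^sub>L iso1) o\<^sub>L (f o\<^sub>L iso1\<^sup>\<star>)))"
    by (simp add: conj_def blinfun_compose_assoc)
  then show ?thesis by (simp add: *)
qed

lemma conj_iso2_orthogonal:
  assumes "e o\<^sub>L f = 0"
  shows "conj iso2 e o\<^sub>L conj iso2 f = 0"
proof -
  have "conj iso2 e o\<^sub>L conj iso2 f = iso2 o\<^sub>L (e o\<^sub>L ((iso2\<^sup>\<star> o\<^sub>L iso2) o\<^sub>L (f o\<^sub>L iso2\<^sup>\<star>)))"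
    by (simp add: conj_def blinfun_compose_assoc)
  also have "\<dots> = iso2 o\<^sub>L ((e o\<^sub>L f) o\<^sub>L iso2\<^sup>\<star>)" by (simp add: iso_pair blinfun_compose_assoc)
  finally show ?thesis by (simp add: assms)
qed

lemma conj_add: "conj v (e + f) = conj v e + conj v f"
  by (simp add: conj_def blinfun_compose_simps)

definition dsum :: "'a op \<Rightarrow> 'a op \<Rightarrow> 'a op" (infixl \<open>\<oplus>\<close> 65)
  where "e \<oplus> f = conj iso1 e + conj iso2 f"

lemma dsum_projs: "e \<in> projs \<Longrightarrow> f \<in> projs \<Longrightarrow> e \<oplus> f \<in> projs"
  unfolding dsum_def by (intro projs_add conj_iso conj_orthogonal)

lemma dsum_mono: "e \<in> projs \<Longrightarrow> e' \<in> projs \<Longrightarrow> f \<in> projs \<Longrightarrow> f' \<in> projs \<Longrightarrow>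
    e \<preceq> e' \<Longrightarrow> f \<preceq> f' \<Longrightarrow> e \<oplus> f \<preceq> e' \<oplus> f'"
  unfolding dsum_def by (rule msub_add) (simp_all add: conj_iso conj_iso_mono conj_orthogonal)

lemma dsum_commute: "e \<in> projs \<Longrightarrow> f \<in> projs \<Longrightarrow> e \<oplus> f \<preceq> f \<oplus> e"
  unfolding dsum_def
  by (subst (2) add.commute, rule msub_add)
    (simp_all add: conj_iso conj_iso_mono conj_orthogonal' msub_refl)

text \<open>Both sides consist of three orthogonal copies, of \<open>e\<close>, \<open>f\<close> and
  \<open>g\<close>, placed differently; they are matched summand by summand.\<close>

lemma dsum_assoc:
  assumes e: "e \<in> projs" and f: "f \<in> projs" and g: "g \<in> projs"
  shows "(e \<oplus> f) \<oplus> g \<preceq> e \<oplus> (f \<oplus> g)"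
proof -
  note c = conj_iso
  have "(e \<oplus> f) \<oplus> g = conj iso1 (conj iso1 e) + (conj iso1 (conj iso2 f) + conj iso2 g)"
    by (simp add: dsum_def conj_add add.assoc)
  also have "\<dots> \<preceq> conj iso1 e + (conj iso2 (conj iso1 f) + conj iso2 (conj iso2 g))"
  proof (intro msub_add)
    show "conj iso1 (conj iso1 e) \<preceq> conj iso1 e" by (rule c(2)[OF c(1)[OF e]])
    have "conj iso2 f \<preceq> conj iso1 f" by (rule conj_iso_mono(3)[OF f f msub_refl[OF f]])
    then show "conj iso1 (conj iso2 f) \<preceq> conj iso2 (conj iso1 f)"
      by (rule conj_iso_mono(2)[OF c(4)[OF f] c(1)[OF f]])
    show "conj iso2 g \<preceq> conj iso2 (conj iso2 g)" by (rule c(6)[OF c(4)[OF g]])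
    show "conj iso1 e \<in> projs" "conj iso2 (conj iso1 f) \<in> projs" "conj iso2 (conj iso2 g) \<in> projs"
      using c e f g by auto
    show o: "conj iso2 (conj iso1 f) o\<^sub>L conj iso2 (conj iso2 g) = 0"
      by (intro conj_iso2_orthogonal conj_orthogonal)
    show "conj iso1 e o\<^sub>L (conj iso2 (conj iso1 f) + conj iso2 (conj iso2 g)) = 0"
      by (simp add: blinfun_compose_simps conj_orthogonal)
    show "conj iso2 (conj iso1 f) + conj iso2 (conj iso2 g) \<in> projs"
      using c e f g o by (intro projs_add) auto
  qed
  also have "\<dots> = e \<oplus> (f \<oplus> g)" by (simp add: dsum_def conj_add)
  finally show ?thesis .
qed

lemma dsum_zero: "e \<oplus> 0 = conj iso1 e"
  by (simp add: dsum_def conj_def)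

sublocale pm: preordered_monoid projs msub dsum 0
proof
  show "x \<oplus> 0 \<preceq> x" "x \<preceq> x \<oplus> 0" if "x \<in> projs" for x
    using that conj_iso by (simp_all add: dsum_zero)
qed (auto intro: dsum_projs msub_refl msub_trans msub_zero dsum_mono dsum_commute dsum_assoc)

lemma add_msub_dsum:
  assumes "e \<in> projs" "f \<in> projs"
  shows "e + f \<preceq> e \<oplus> f"
  unfolding dsum_def using conj_iso[OF assms(1)] conj_iso[OF assms(2)]
  by (intro msub_add conj_orthogonal) auto

lemma dsum_msub_add:
  assumes "e \<in> projs" "f \<in> projs" "e o\<^sub>L f = 0"
  shows "e \<oplus> f \<preceq> e + f"
  unfolding dsum_def using conj_iso[OF assms(1)] conj_iso[OF assms(2)] assms
  by (intro msub_add) auto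

lemma fin_dsum:
  assumes "fin e" "fin f"
  shows "fin (e \<oplus> f)"
proof -
  have p: "e \<in> projs" "f \<in> projs" using assms fin_projs by auto
  show ?thesis
    unfolding dsum_def using conj_iso[OF p(1)] conj_iso[OF p(2)] assms
    by (intro fin_add conj_orthogonal) (auto intro: fin_msub)
qed

text \<open>With orthogonal copies \<open>a\<close> of \<open>x\<close> and \<open>b\<close> of
  \<open>y\<close>, the hypothesis embeds the finite projection \<open>a + b\<close> into its part
  \<open>a\<close>, which leaves no room for \<open>b\<close>.\<close>

lemma fin_absorb:
  assumes "fin x" "y \<in> projs" "x \<oplus> y \<preceq> x"
  shows "y = 0"
proof -
  have x: "x \<in> projs" using assms fin_projs by blast
  define a where "a = conj iso1 x"
  define b where "b = conj iso2 y"
  have ab: "a \<in> projs" "b \<in> projs" "x \<preceq> a" "y \<preceq> b" "a o\<^sub>L b = 0"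
    using conj_iso x assms(2) conj_orthogonal by (auto simp: a_def b_def)
  have s: "a + b \<in> projs" using projs_add ab by blast
  have ax: "a + b \<preceq> x" using assms(3) by (simp add: dsum_def a_def b_def)
  then have "fin (a + b)" using fin_msub s assms(1) by blast
  moreover have "(a + b) o\<^sub>L a = a"
    using projs_orthogonal_sym[OF ab(1,2,5)] projs_compose_self[OF ab(1)]
    by (simp add: blinfun_compose_simps)
  moreover have "a + b \<preceq> a" using ax ab(3) msub_trans by blast
  ultimately have "a = a + b" using finD ab(1) by blast
  then have "b = 0" by simp
  then show ?thesis using ab(4) msub_zero_right by blast
qed

lemma fin_mul: "fin e \<Longrightarrow> fin (pm.mul n e)"
  by (induction n) (auto intro: fin_dsum fin_0)

text \<open>If \<open>k > n\<close>, the \<open>n\<close>-fold multiple of \<open>p\<close> would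
  absorb \<open>k - n\<close> further copies, against \<open>fin_absorb\<close>.\<close>

lemma dimension_fin:
  assumes p: "fin p" "p \<noteq> 0"
  shows "dimension projs msub dsum 0 p"
proof unfold_locales
  have pp: "p \<in> projs" using p fin_projs by blast
  show "p \<in> projs" by fact
  fix k n assume kn: "pm.mul k p \<preceq> pm.mul n p"
  show "k \<le> n"
  proof (rule ccontr)
    assume "\<not> k \<le> n"
    then obtain m where m: "k = n + Suc m" by (metis less_imp_Suc_add not_le add_Suc_right)
    have "pm.mul (Suc m) p \<in> projs" "pm.mul n p \<in> projs" using pp pm.mul_closed by blast+
    have *: "pm.mul n p \<oplus> pm.mul (Suc m) p \<preceq> pm.mul n p" 
    proof -
      have "pm.mul n p \<oplus> pm.mul (Suc m) p \<preceq> pm.mul k p" unfolding m by (rule pm.mul_add[OF pp])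
      then show ?thesis using kn msub_trans by blast
    qed
    have "pm.mul (Suc m) p = 0"
      using fin_absorb[OF fin_mul[OF p(1)] _ *] pp pm.mul_closed by blast
    then have "pm.mul m p \<oplus> p \<preceq> 0"
      using pm.plus_commute[OF pm.mul_closed[OF pp] pp, of m] by simp
    from pm.le_plus[OF pp pm.mul_closed[OF pp] this] show False using msub_zero_right p(2) by blast
  qed
qed

subsection \<open>Covering a finite projection by small ones\<close>

text \<open>The shift from \<open>s i\<close> to \<open>s (Suc i)\<close> embeds the sum of all
  copies into the sum of all but the first, while the total sum is finite.\<close>

lemma no_infinite_copies:
  assumes q: "fin q" and s: "orth_family s" "\<And>i. q o\<^sub>L s i = s i" "\<And>i j. s i \<preceq> s j"
  shows "s 0 = 0"
proof -
  have qp: "q \<in> projs" using q fin_projs by blast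
  have o: "orth_family (\<lambda>i. s (Suc i))" using s(1) by (simp add: orth_family_def)
  have "q o\<^sub>L osum s = osum s" using s by (intro osum_le qp)
  then have f: "fin (osum s)" using fin_le[OF q osum_projs[OF s(1)]] by blast
  have "osum s o\<^sub>L osum (\<lambda>i. s (Suc i)) = osum (\<lambda>i. s (Suc i))"
    by (intro osum_le o osum_projs s(1) osum_ge)
  moreover have "osum s \<preceq> osum (\<lambda>i. s (Suc i))" using s(3) by (intro msub_osum s(1) o)
  ultimately have eq: "osum (\<lambda>i. s (Suc i)) = osum s" using finD[OF f osum_projs[OF o]] by blast
  have "s 0 x = 0" for x
  proof -
    have "osum (\<lambda>i. s (Suc i)) (s 0 x) = 0"
      unfolding osum_eq_0_iff[OF o] using orth_familyD(4)[OF s(1)] by simp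
    then show ?thesis unfolding eq by (simp add: osum_apply[OF s(1)])
  qed
  then show ?thesis by (intro blinfun_eqI) simp
qed

text \<open>A maximal orthogonal family of copies of \<open>p\<close> below \<open>q\<close> is
  finite because \<open>q\<close> is; by comparability what it leaves over embeds into
  \<open>p\<close> and becomes the last piece.\<close>

lemma finite_cover:
  assumes q: "fin q" and p: "p \<in> projs" "p \<noteq> 0"
  obtains d :: nat and r where "orth_family r" "\<And>i. q o\<^sub>L r i = r i" "\<And>i. r i \<preceq> p" "q = (\<Sum>i<d. r i)"
proof -
  have qp: "q \<in> projs" using q fin_projs by blast
  define P where "P r \<longleftrightarrow> r \<in> projs \<and> q o\<^sub>L r = r \<and> r \<preceq> p \<and> p \<preceq> r" for r
  obtain F where F: "F \<subseteq> Collect P" "pairwise (\<lambda>r s. r o\<^sub>L s = 0) F"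
    and max: "\<And>w. P w \<Longrightarrow> (\<And>v. v \<in> F \<Longrightarrow> v o\<^sub>L w = 0 \<and> w o\<^sub>L v = 0) \<Longrightarrow> w \<in> F"
    using maximal_pairwise[of "{}" P "\<lambda>r s. r o\<^sub>L s = 0"] by auto
  have FP: "P r" if "r \<in> F" for r using F(1) that by blast
  have nz: "r \<noteq> 0" if "P r" for r
    using that msub_zero_right[of p] p(2) unfolding P_def by blast
  have "finite F"
  proof (rule ccontr)
    assume "infinite F"
    then obtain s :: "nat \<Rightarrow> 'a op" where s: "inj s" "range s \<subseteq> F"
      using infinite_countable_subset by blast
    have sP: "P (s i)" for i using s(2) FP by blast
    have sF: "s i \<in> F" for i using s(2) by blast
    have "s i o\<^sub>L s j = 0" if "i \<noteq> j" for i j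
      using F(2) sF injD[OF s(1), of i j] that by (auto simp: pairwise_def)
    then have "orth_family s" using sP by (simp add: orth_family_def P_def)
    moreover have "q o\<^sub>L s i = s i" "s i \<preceq> s j" for i j
      using sP[of i] sP[of j] msub_trans unfolding P_def by blast+
    ultimately have "s 0 = 0" by (intro no_infinite_copies[OF q])
    then show False using nz sP by blast
  qed
  then obtain s n where n: "bij_betw s {..<n::nat} F"
    using ex_bij_betw_nat_finite[OF \<open>finite F\<close>] unfolding lessThan_atLeast0 by blast
  have sF: "s i \<in> F" if "i < n" for i using n that by (auto simp: bij_betw_def)
  define s' where "s' i = (if i < n then s i else 0)" for i
  have os: "orth_family s'"
    unfolding orth_family_def
  proof (intro conjI allI impI)
    show "s' i \<in> projs" for i using FP[OF sF, of i] by (auto simp: s'_def P_def)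
    fix i j :: nat assume "i \<noteq> j"
    then show "s' i o\<^sub>L s' j = 0"
      using F(2) sF[of i] sF[of j] n unfolding s'_def bij_betw_def
      by (auto simp: pairwise_def inj_on_def)
  qed
  have qs: "q o\<^sub>L s' i = s' i" for i using FP[OF sF, of i] by (auto simp: s'_def P_def)
  define S where "S = (\<Sum>i<n. s' i)"
  have S: "S \<in> projs" unfolding S_def by (rule orth_family_sum_projs[OF os]) simp
  have qS: "q o\<^sub>L S = S"
    unfolding S_def bounded_bilinear.sum_right[OF bounded_bilinear_blinfun_compose] using qs by simp
  have Ss: "S o\<^sub>L s' i = s' i" for i
    by (rule blinfun_eqI) (simp add: S_def orth_family_sum_apply[OF os], simp add: s'_def)
  define t where "t = q - S"
  have t: "t \<in> projs" unfolding t_def by (rule projs_diff[OF qp S qS])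
  have qt: "q o\<^sub>L t = t" using qS projs_compose_self[OF qp] by (simp add: t_def blinfun_compose_simps)
  have ts: "t o\<^sub>L s' i = 0" for i using qs Ss by (simp add: t_def blinfun_compose_simps)
  have tp: "t \<preceq> p"
  proof (rule ccontr)
    assume "\<not> t \<preceq> p"
    then have "p \<preceq> t" using comparison[OF t p(1)] by blast
    then obtain r where r: "r \<in> projs" "t o\<^sub>L r = r" "p \<preceq> r" "r \<preceq> p"
      using msubE[OF _ p(1)] by blast
    have Pr: "P r" using r qt projs_le_trans by (auto simp: P_def)
    moreover have orth: "v o\<^sub>L r = 0 \<and> r o\<^sub>L v = 0" if vF: "v \<in> F" for v
    proof -
      obtain i where i: "i < n" "v = s i" using vF n by (auto simp: bij_betw_def)
      then have v: "v = s' i" by (simp add: s'_def)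
      have "r o\<^sub>L v = (r o\<^sub>L t) o\<^sub>L v" using projs_le_sym[OF r(1) t] r(2) by simp
      then have "r o\<^sub>L v = 0" using ts by (simp add: v blinfun_compose_assoc)
      then show ?thesis using projs_orthogonal_sym[OF r(1)] FP[OF vF] by (simp add: P_def)
    qed
    ultimately have "r \<in> F" by (rule max)
    then have "r o\<^sub>L r = 0" using orth by blast
    then show False using nz[OF Pr] projs_compose_self[OF r(1)] by simp
  qed
  \<comment> \<open>\<open>s' n\<close> is 0, so the index \<open>n\<close> is free for the
    remainder and there are \<open>n + 1\<close> pieces.\<close>
  define r where "r i = (if i = n then t else s' i)" for i
  have "orth_family r"
    using os t ts projs_orthogonal_sym[OF t] by (auto simp: orth_family_def r_def)
  moreover have "q o\<^sub>L r i = r i" for i using qt qs by (simp add: r_def)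
  moreover have "r i \<preceq> p" for i
    using tp FP[OF sF, of i] msub_zero by (auto simp: r_def s'_def P_def)
  moreover have "q = (\<Sum>i<Suc n. r i)" by (simp add: r_def t_def S_def)
  ultimately show thesis by (rule that)
qed

lemma sum_msub_mul:
  assumes r: "orth_family r" and f: "f \<in> projs" and "\<And>i. i < d \<Longrightarrow> r i \<preceq> f"
  shows "(\<Sum>i<d. r i) \<preceq> pm.mul d f"
  using assms(3)
proof (induction d)
  case (Suc d)
  have p: "(\<Sum>i<d. r i) \<in> projs" by (rule orth_family_sum_projs[OF r]) simp
  have "(\<Sum>i<Suc d. r i) \<preceq> r d \<oplus> (\<Sum>i<d. r i)"
    using add_msub_dsum[OF orth_familyD(1)[OF r] p, of d] by (simp add: add.commute)
  moreover have "r d \<oplus> (\<Sum>i<d. r i) \<preceq> f \<oplus> pm.mul d f"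
    using Suc p f orth_familyD(1)[OF r] by (intro dsum_mono) auto
  ultimately show ?case using msub_trans by simp
qed (simp add: msub_zero)

lemma largest_of_finitely_many:
  assumes "\<And>i. i < d \<Longrightarrow> f i \<in> projs" "d > (0::nat)"
  obtains i where "i < d" "\<And>k. k < d \<Longrightarrow> f k \<preceq> f i"
proof -
  have "\<exists>i<d. \<forall>k<d. f k \<preceq> f i"
    using assms
  proof (induction d)
    case (Suc d)
    show ?case
    proof (cases "d = 0")
      case True
      then show ?thesis using Suc msub_refl by auto
    next
      case False
      then obtain i where i: "i < d" "\<And>k. k < d \<Longrightarrow> f k \<preceq> f i" using Suc by auto
      show ?thesis
      proof (cases "f d \<preceq> f i")
        case True
        then show ?thesis using i by (auto simp: less_Suc_eq)
      next
        case False
        then have "f i \<preceq> f d" using comparison[of "f d" "f i"] Suc(2) i(1) by auto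
        have "f k \<preceq> f d" if "k < Suc d" for k
        proof (cases "k = d")
          case True
          then show ?thesis using msub_refl[OF Suc(2)[of d]] by simp
        next
          case False
          then have "f k \<preceq> f i" using i(2) that by simp
          then show ?thesis using \<open>f i \<preceq> f d\<close> by (rule msub_trans)
        qed
        then show ?thesis by blast
      qed
    qed
  qed simp
  then show thesis using that by blast
qed

subsection \<open>Summable families of equivalent projections\<close>

text \<open>Call \<open>e\<close> bad if \<open>dim e\<close> is at least
  \<open>c * (norm (e y))\<^sup>2\<close>, and take a maximal orthogonal family of nonzero bad
  projections below \<open>P\<close>. It cannot sum to \<open>P\<close>, since superadditivity would
  give \<open>c * (norm y)\<^sup>2 \<le> 1\<close>. By maximality the complement contains no nonzero
  bad projection.\<close>

lemma dim_dominated_by_vector: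
  assumes P: "fin P" and y: "P y = y" "y \<noteq> 0"
    and dm: "dimension projs msub dsum 0 P"
  obtains p where "p \<in> projs" "p \<noteq> 0" "P o\<^sub>L p = p"
    "\<And>e. e \<in> projs \<Longrightarrow> e \<noteq> 0 \<Longrightarrow> p o\<^sub>L e = e \<Longrightarrow>
      dimension.dim msub dsum 0 P e \<le> 2 / (norm y)\<^sup>2 * (norm (e y))\<^sup>2"
proof -
  interpret dimension projs msub dsum 0 P by (rule dm)
  have Pp: "P \<in> projs" using P fin_projs by blast
  \<comment> \<open>Any numerator above 1 would serve, as \<open>dim\<close> is at most 1 below
    \<open>P\<close>.\<close>
  define c where "c = 2 / (norm y)\<^sup>2"
  define B where "B e \<longleftrightarrow> e \<in> projs \<and> e \<noteq> 0 \<and> P o\<^sub>L e = e \<and> c * (norm (e y))\<^sup>2 \<le> dim e" for e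
  obtain F where F: "F \<subseteq> Collect B" "pairwise (\<lambda>r s. r o\<^sub>L s = 0) F"
    and max: "\<And>w. B w \<Longrightarrow> (\<And>v. v \<in> F \<Longrightarrow> v o\<^sub>L w = 0 \<and> w o\<^sub>L v = 0) \<Longrightarrow> w \<in> F"
    using maximal_pairwise[of "{}" B "\<lambda>r s. r o\<^sub>L s = 0"] by auto
  have FB: "B r" if "r \<in> F" for r using F(1) that by blast
  have d0: "0 \<le> dim 0" by (rule dim_nonneg[OF projs_0 msub_zero])
  have "F \<subseteq> projs - {0}" using F(1) by (auto simp: B_def)
  then have cF: "countable F" using F(2) by (rule sigma_finite)
  obtain s :: "nat \<Rightarrow> 'a op" where s: "\<And>n. s n \<in> insert 0 F" "F \<subseteq> range s"
    "\<And>i j. i \<noteq> j \<Longrightarrow> s i = 0 \<or> s j = 0 \<or> s i \<noteq> s j"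
    by (rule countable_enum_padded[OF cF]) (rule that)
  have sp: "s n \<in> projs" "P o\<^sub>L s n = s n" "c * (norm (s n y))\<^sup>2 \<le> dim (s n)" for n
    using s(1)[of n] FB[of "s n"] d0 by (auto simp: B_def)
  have os: "orth_family s"
    unfolding orth_family_def
  proof (intro conjI allI impI sp)
    fix i j :: nat assume "i \<noteq> j"
    then show "s i o\<^sub>L s j = 0"
      using s(1)[of i] s(1)[of j] s(3)[of i j] F(2) by (auto simp: pairwise_def)
  qed
  define S where "S = osum s"
  have S: "S \<in> projs" unfolding S_def by (rule osum_projs[OF os])
  have PS: "P o\<^sub>L S = S" unfolding S_def using sp by (intro osum_le os Pp)
  have sums: "(\<Sum>i<n. dim (s i)) \<le> dim (\<Sum>i<n. s i)" for n
  proof (induction n)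
    case 0
    show ?case using d0 by simp
  next
    case (Suc n)
    have a: "(\<Sum>i<n. s i) \<in> projs" "(\<Sum>i<Suc n. s i) \<in> projs"
      by (rule orth_family_sum_projs[OF os], simp)+
    have "(\<Sum>i<n. s i) o\<^sub>L s n = 0"
      by (rule blinfun_eqI) (simp add: orth_family_sum_apply[OF os])
    then have "(\<Sum>i<n. s i) \<oplus> s n \<preceq> (\<Sum>i<n. s i) + s n" by (intro dsum_msub_add a sp)
    moreover have "P o\<^sub>L (\<Sum>i<Suc n. s i) = (\<Sum>i<Suc n. s i)"
      unfolding bounded_bilinear.sum_right[OF bounded_bilinear_blinfun_compose] using sp by simp
    then have "(\<Sum>i<Suc n. s i) \<preceq> P" using a by (intro msub_le)
    ultimately have "dim (\<Sum>i<n. s i) + dim (s n) \<le> dim (\<Sum>i<Suc n. s i)"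
      using a sp by (intro dim_superadditive) auto
    then show ?case using Suc by simp
  qed
  have "S \<noteq> P"
  proof
    assume "S = P"
    have "(\<Sum>i<n. c * inner y (s i y)) \<le> 1" for n
    proof -
      have a: "(\<Sum>i<n. s i) \<in> projs" by (rule orth_family_sum_projs[OF os]) simp
      have "P o\<^sub>L (\<Sum>i<n. s i) = (\<Sum>i<n. s i)"
        unfolding bounded_bilinear.sum_right[OF bounded_bilinear_blinfun_compose] using sp by simp
      then have "(\<Sum>i<n. s i) \<preceq> P" using a by (intro msub_le)
      have "(\<Sum>i<n. c * inner y (s i y)) = (\<Sum>i<n. c * (norm (s i y))\<^sup>2)"
        by (simp add: is_proj_inner_self[OF projsD(2)[OF sp(1)]])
      also have "\<dots> \<le> (\<Sum>i<n. dim (s i))" by (intro sum_mono sp)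
      also have "\<dots> \<le> dim (\<Sum>i<n. s i)" by (rule sums)
      also have "\<dots> \<le> 1" using a \<open>(\<Sum>i<n. s i) \<preceq> P\<close> by (rule dim_le_1)
      finally show ?thesis .
    qed
    moreover have "(\<lambda>i. c * inner y (s i y)) sums (c * inner y (S y))"
      unfolding S_def by (intro sums_mult osum_inner_sums os)
    ultimately have "c * inner y (S y) \<le> 1"
      unfolding sums_def by (intro Lim_bounded) auto
    then show False using y \<open>S = P\<close> by (simp add: c_def power2_norm_eq_inner)
  qed
  define p where "p = P - S"
  have p: "p \<in> projs" unfolding p_def by (rule projs_diff[OF Pp S PS])
  have Ppp: "P o\<^sub>L p = p" using PS projs_compose_self[OF Pp] by (simp add: p_def blinfun_compose_simps)
  have sn: "p o\<^sub>L s n = 0" for n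
    using sp osum_ge[OF os, folded S_def] by (simp add: p_def blinfun_compose_simps)
  show thesis
  proof (rule that[OF p _ Ppp])
    show "p \<noteq> 0" using \<open>S \<noteq> P\<close> by (simp add: p_def)
    fix e assume e: "e \<in> projs" "e \<noteq> 0" "p o\<^sub>L e = e"
    show "dim e \<le> 2 / (norm y)\<^sup>2 * (norm (e y))\<^sup>2"
    proof (rule ccontr)
      assume "\<not> ?thesis"
      then have "B e" using e Ppp projs_le_trans by (auto simp: B_def c_def)
      moreover have orth: "v o\<^sub>L e = 0 \<and> e o\<^sub>L v = 0" if vF: "v \<in> F" for v
      proof -
        obtain n where n: "v = s n" using vF s(2) by blast
        have "e o\<^sub>L s n = (e o\<^sub>L p) o\<^sub>L s n" using projs_le_sym[OF e(1) p] e(3) by simp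
        also have "\<dots> = 0" using sn by (simp add: blinfun_compose_assoc)
        finally show ?thesis using projs_orthogonal_sym[OF e(1) sp(1)] n by simp
      qed
      ultimately have "e \<in> F" by (rule max)
      then have "e o\<^sub>L e = 0" using orth by blast
      then show False using e projs_compose_self by simp
    qed
  qed
qed

text \<open>\<open>q\<close> is the spectral projection of \<open>A\<close> for values above
  \<open>t\<close>, the complement of the cut of \<open>A - t *\<^sub>R id_blinfun\<close> at
  0.\<close>

lemma M_spectral_cut:
  assumes "A \<in> M" "A\<^sup>\<star> = A"
  obtains q where "q \<in> projs" "A o\<^sub>L q = q o\<^sub>L A"
    "\<And>x. q x = 0 \<Longrightarrow> inner x (A x) \<le> t * (norm x)\<^sup>2"
    "\<And>x. q x = x \<Longrightarrow> t * (norm x)\<^sup>2 \<le> inner x (A x)"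
    "\<And>U. U o\<^sub>L A = A o\<^sub>L U \<Longrightarrow> U o\<^sub>L q = q o\<^sub>L U"
    "\<And>x. q x = x \<Longrightarrow> x \<noteq> 0 \<Longrightarrow> t * (norm x)\<^sup>2 < inner x (A x)"
proof -
  define T where "T = A - t *\<^sub>R id_blinfun"
  have "T\<^sup>\<star> = T" by (simp add: T_def hadj_diff hadj_scaleR assms)
  from spectral_cut[OF this] obtain P
    where P0: "is_proj P \<and> (\<forall>U. U o\<^sub>L T = T o\<^sub>L U \<longrightarrow> U o\<^sub>L P = P o\<^sub>L U) \<and>
      (\<forall>x. P x = x \<longrightarrow> inner x (T x) \<le> 0) \<and> (\<forall>x. P x = 0 \<longrightarrow> x \<noteq> 0 \<longrightarrow> 0 < inner x (T x))"
    by (rule exE)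
  have P: "is_proj P" "\<And>U. U o\<^sub>L T = T o\<^sub>L U \<Longrightarrow> U o\<^sub>L P = P o\<^sub>L U"
    "\<And>x. P x = x \<Longrightarrow> inner x (T x) \<le> 0" "\<And>x. P x = 0 \<Longrightarrow> x \<noteq> 0 \<Longrightarrow> 0 < inner x (T x)"
    using P0 by (fast, fast, fast, fast)
  have Tx: "inner x (T x) = inner x (A x) - t * (norm x)\<^sup>2" for x
    by (simp add: T_def blinfun.bilinear_simps inner_simps power2_norm_eq_inner)
  have comm: "U o\<^sub>L P = P o\<^sub>L U" if "U o\<^sub>L A = A o\<^sub>L U" for U
    by (rule P(2)) (simp add: T_def blinfun_compose_simps that)
  define q where "q = id_blinfun - P"
  have qx: "q x = x \<longleftrightarrow> P x = 0" "q x = 0 \<longleftrightarrow> P x = x" for x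
    by (auto simp: q_def blinfun.diff_left)
  show thesis
  proof (rule that[of q])
    have "P \<in> M" using M_commutes[OF assms(1)] comm by blast
    then show "q \<in> projs" using P(1) by (simp add: q_def projs_compl projs_def is_proj_compl M_diff)
    show "A o\<^sub>L q = q o\<^sub>L A" using comm[of A] by (simp add: q_def blinfun_compose_simps)
    show "U o\<^sub>L q = q o\<^sub>L U" if "U o\<^sub>L A = A o\<^sub>L U" for U
      using comm[OF that] by (simp add: q_def blinfun_compose_simps)
    show "inner x (A x) \<le> t * (norm x)\<^sup>2" if "q x = 0" for x
      using P(3)[of x] that by (simp add: qx Tx)
    show lt: "t * (norm x)\<^sup>2 < inner x (A x)" if "q x = x" "x \<noteq> 0" for x
      using P(4)[of x] that by (simp add: qx Tx)
    show "t * (norm x)\<^sup>2 \<le> inner x (A x)" if "q x = x" for x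
      using lt[OF that] by (cases "x = 0") auto
  qed
qed

text \<open>\<open>P\<close> is covered by \<open>d\<close> pieces \<open>r i\<close> that embed
  into the part \<open>p\<close> dominated by \<open>y\<close>, and \<open>F j\<close> embeds into
  the sum of suitable parts \<open>f i j\<close> of the pieces. The largest of these has dimension
  at least \<open>dim E / d\<close>, which the domination turns into a lower bound, independent of
  \<open>j\<close>, for the sum over \<open>i\<close> of \<open>(norm (F j (z i)))\<^sup>2\<close>.
  Summing over \<open>j\<close> contradicts \<open>bound\<close>.\<close>

theorem no_summable_copies:
  fixes F :: "nat \<Rightarrow> 'a op"
  assumes P: "fin P" and E: "E \<in> projs" "E \<noteq> 0" and F: "\<And>j. F j \<in> projs" "\<And>j. E \<preceq> F j"
    and delta: "0 < \<delta>" "\<And>j x. F j x = x \<Longrightarrow> \<delta> * norm x \<le> norm (P x)"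
    and bound: "\<And>n x. (\<Sum>j<n. (norm (F j x))\<^sup>2) \<le> c * (norm x)\<^sup>2"
  shows False
proof -
  have Pp: "P \<in> projs" using P fin_projs by blast
  have "F 0 \<noteq> 0" using F(2)[of 0] msub_zero_right E(2) by auto
  then obtain x0 where "F 0 x0 \<noteq> 0" by (metis blinfun_eqI zero_blinfun.rep_eq)
  then have "0 < \<delta> * norm (F 0 x0)" using delta(1) by simp
  also have "\<dots> \<le> norm (P (F 0 x0))" by (rule delta(2)[OF projs_idem[OF F(1)]])
  finally obtain y where y: "P y = y" "y \<noteq> 0"
    using projs_idem[OF Pp] by (metis norm_zero less_irrefl)
  then have P0: "P \<noteq> 0" by auto
  interpret dimension projs msub dsum 0 P by (rule dimension_fin[OF P P0])
  have FP: "F j \<preceq> P" for j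
  proof (rule msub_if_meet_zero[OF F(1) Pp])
    fix x assume "F j x = x" "P x = 0"
    then have "\<delta> * norm x \<le> 0" using delta(2) by fastforce
    then show "x = 0" using delta(1) by (simp add: mult_le_0_iff)
  qed
  have EP: "E \<preceq> P" using F(2)[of 0] FP[of 0] msub_trans by blast
  have dimE: "0 < dim E"
  proof -
    obtain m :: nat and r where r: "orth_family r" "\<And>i. r i \<preceq> E" "P = (\<Sum>i<m. r i)"
      using finite_cover[OF P E] by metis
    have "(\<Sum>i<m. r i) \<preceq> pm.mul m E" by (rule sum_msub_mul[OF r(1) E(1) r(2)])
    then have "P \<preceq> pm.mul m E" using r(3) by simp
    then show ?thesis using dim_pos[OF E(1) EP] by blast
  qed
  define c0 where "c0 = 2 / (norm y)\<^sup>2"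
  obtain p where p: "p \<in> projs" "p \<noteq> 0" "P o\<^sub>L p = p"
    and dom: "\<And>e. e \<in> projs \<Longrightarrow> e \<noteq> 0 \<Longrightarrow> p o\<^sub>L e = e \<Longrightarrow> dim e \<le> c0 * (norm (e y))\<^sup>2"
    using dim_dominated_by_vector[OF P y dimension_axioms] unfolding c0_def by metis
  obtain d :: nat and r where r: "orth_family r" "\<And>i. P o\<^sub>L r i = r i" "\<And>i. r i \<preceq> p"
    and Psum: "P = (\<Sum>i<d. r i)"
    using finite_cover[OF P p(1,2)] by metis
  have d: "d > 0" using P0 Psum by (cases d) auto
  note rp = orth_familyD(1)[OF r(1)]
  obtain v where v: "\<And>i. v i \<in> M" "\<And>i. (v i)\<^sup>\<star> o\<^sub>L v i = r i" "\<And>i. p o\<^sub>L v i = v i"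
    using r(3) unfolding msub_def by metis
  \<comment> \<open>Pulling \<open>y\<close> back along \<open>v i\<close> moves the domination from
    \<open>p\<close> to the piece \<open>r i\<close>.\<close>
  define z where "z i = (v i)\<^sup>\<star> y" for i
  have rz: "r i (z i) = z i" for i
  proof -
    from arg_cong[OF msub_range(4)[OF v(1,2) rp], of hadj i]
    have "r i o\<^sub>L (v i)\<^sup>\<star> = (v i)\<^sup>\<star>" using projs_hadj[OF rp] by simp
    then show ?thesis unfolding z_def by (metis blinfun_apply_blinfun_compose)
  qed
  have domr: "dim e \<le> c0 * (norm (e (z i)))\<^sup>2" if e: "e \<in> projs" "e \<noteq> 0" "r i o\<^sub>L e = e" for e i
  proof -
    note c = conj_isometry[OF v(1,2) e(1,3)]
    have pc: "p o\<^sub>L conj (v i) e = conj (v i) e"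
      using v(3)[of i] by (simp add: conj_def blinfun_compose_assoc[symmetric])
    have cP: "conj (v i) e \<preceq> P"
      using projs_le_trans[OF pc p(3)] by (intro msub_le c)
    have nz: "conj (v i) e \<noteq> 0" using c(3) msub_zero_right e(2) by auto
    have "dim e \<le> dim (conj (v i) e)" by (intro dim_mono e c cP)
    also have "\<dots> \<le> c0 * (norm (conj (v i) e y))\<^sup>2" by (rule dom[OF c(1) nz pc])
    also have "(norm (conj (v i) e y))\<^sup>2 = inner y (v i (e (z i)))"
      unfolding is_proj_inner_self(1)[OF projsD(2)[OF c(1)], symmetric] by (simp add: conj_def z_def)
    also have "\<dots> = inner (z i) (e (z i))" unfolding z_def by (rule hadj_inner'[symmetric])
    also have "\<dots> = (norm (e (z i)))\<^sup>2" by (rule is_proj_inner_self[OF projsD(2)[OF e(1)]])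
    finally show ?thesis .
  qed
  \<comment> \<open>Chosen so that \<open>d\<close> components of squared norm at most
    \<open>t * (norm x)\<^sup>2\<close> add up to at most half of
    \<open>\<delta>\<^sup>2 * (norm x)\<^sup>2\<close>, the lower bound for
    \<open>(norm (P x))\<^sup>2\<close>.\<close>
  define t where "t = \<delta>\<^sup>2 / (2 * real d)"
  have t: "t > 0" using delta(1) d by (simp add: t_def)
  define A where "A i j = r i o\<^sub>L F j o\<^sub>L r i" for i j
  have AM: "A i j \<in> M" for i j
    unfolding A_def using rp F projsD by (intro M_compose) auto
  have Asym: "(A i j)\<^sup>\<star> = A i j" for i j
    unfolding A_def using projs_hadj[OF rp] projs_hadj[OF F(1)] by (simp add: blinfun_compose_assoc)
  have Ain: "inner x (A i j x) = (norm (F j (r i x)))\<^sup>2" for i j x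
    using is_proj_inner[OF projsD(2)[OF rp], of i x "F j (r i x)"]
      is_proj_inner_self(1)[OF projsD(2)[OF F(1)], of "r i x" j]
    by (simp add: A_def)
  have "\<exists>q. q \<in> projs \<and> A i j o\<^sub>L q = q o\<^sub>L A i j \<and> r i o\<^sub>L q = q \<and>
      (\<forall>x. q x = 0 \<longrightarrow> inner x (A i j x) \<le> t * (norm x)\<^sup>2) \<and>
      (\<forall>x. q x = x \<longrightarrow> t * (norm x)\<^sup>2 \<le> inner x (A i j x))" for i j
  proof -
    obtain q where q: "q \<in> projs" "A i j o\<^sub>L q = q o\<^sub>L A i j"
      "\<And>x. q x = 0 \<Longrightarrow> inner x (A i j x) \<le> t * (norm x)\<^sup>2"
      "\<And>x. q x = x \<Longrightarrow> t * (norm x)\<^sup>2 \<le> inner x (A i j x)"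
      "\<And>U. U o\<^sub>L A i j = A i j o\<^sub>L U \<Longrightarrow> U o\<^sub>L q = q o\<^sub>L U"
      by (rule M_spectral_cut[OF AM[of i j] Asym[of i j], of t]) (rule that)
    have "r i o\<^sub>L A i j = A i j o\<^sub>L r i"
      using projs_compose_self[OF rp] by (simp add: A_def blinfun_compose_assoc) (simp add: blinfun_compose_assoc[symmetric])
    then have rq: "r i o\<^sub>L q = q o\<^sub>L r i" by (rule q(5))
    \<comment> \<open>\<open>A i j\<close> vanishes off \<open>r i\<close>, so its part above the
      positive level \<open>t\<close> lies below \<open>r i\<close>.\<close>
    have "q x = 0" if "r i x = 0" for x
    proof -
      have "r i (q x) = 0" using rq that by (metis blinfun_apply_blinfun_compose blinfun.zero_right)
      then have "t * (norm (q x))\<^sup>2 \<le> 0" using q(4)[OF projs_idem[OF q(1)], of x] by (simp add: Ain)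
      then show ?thesis using t by (simp add: mult_le_0_iff)
    qed
    then have "r i o\<^sub>L q = q" by (intro projs_leI q rp)
    then show ?thesis using q by blast
  qed
  then obtain f where f: "\<And>i j. f i j \<in> projs" "\<And>i j. A i j o\<^sub>L f i j = f i j o\<^sub>L A i j"
      "\<And>i j. r i o\<^sub>L f i j = f i j"
      "\<And>i j x. f i j x = 0 \<Longrightarrow> inner x (A i j x) \<le> t * (norm x)\<^sup>2"
      "\<And>i j x. f i j x = x \<Longrightarrow> t * (norm x)\<^sup>2 \<le> inner x (A i j x)"
    by metis
  \<comment> \<open>\<open>f i j\<close> commutes with \<open>A i j\<close>, so the form of
    \<open>A i j\<close> at \<open>z i\<close> is the sum of its nonnegative values on the two
    components.\<close>
  have fz: "t * (norm (f i j (z i)))\<^sup>2 \<le> (norm (F j (z i)))\<^sup>2" for i j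
  proof -
    define w where "w = f i j (z i)"
    define u where "u = z i - w"
    have Af: "A i j (f i j x) = f i j (A i j x)" for x
      using f(2)[of i j] by (metis blinfun_apply_blinfun_compose)
    have fw: "f i j w = w" unfolding w_def by (rule projs_idem[OF f(1)])
    have fu: "f i j u = 0" by (simp add: u_def blinfun.diff_right fw) (simp add: w_def)
    have "inner u (A i j w) = 0"
      using Af[of w] fw fu is_proj_inner[OF projsD(2)[OF f(1)], of i j u "A i j w"] by simp
    moreover have "inner w (A i j u) = 0"
      using Af[of u] fw fu is_proj_inner[OF projsD(2)[OF f(1)], of i j w "A i j u"] by simp
    ultimately have "inner (z i) (A i j (z i)) = inner w (A i j w) + inner u (A i j u)"
      by (simp add: u_def blinfun.diff_right inner_diff_left inner_diff_right)
    then have "inner w (A i j w) \<le> (norm (F j (z i)))\<^sup>2" by (simp add: Ain rz)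
    then show ?thesis using f(5)[OF fw] by (simp add: w_def)
  qed
  \<comment> \<open>A vector \<open>x\<close> of \<open>F j\<close> killed by every
    \<open>f i j\<close> has only small components:
    \<open>(norm (r i x))\<^sup>2 = inner x (F j (r i x))\<close> is at most
    \<open>norm x * norm (F j (r i x))\<close>.\<close>
  have meet0: "x = 0" if x: "F j x = x" "\<And>i. i < d \<Longrightarrow> f i j x = 0" for j x
  proof -
    have small: "(norm (r i x))\<^sup>2 \<le> t * (norm x)\<^sup>2" if "i < d" for i
    proof -
      define w where "w = r i x"
      have rw: "r i w = w" unfolding w_def by (rule projs_idem[OF rp])
      have "f i j o\<^sub>L r i = f i j" using projs_le_sym[OF f(1) rp] f(3) by blast
      then have "f i j w = 0" using x(2)[OF that] unfolding w_def by (metis blinfun_apply_blinfun_compose)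
      then have "(norm (F j w))\<^sup>2 \<le> t * (norm w)\<^sup>2" using f(4)[of i j w] by (simp add: Ain rw)
      have "(norm w)\<^sup>2 = inner x w"
        unfolding w_def by (rule is_proj_inner_self(1)[OF projsD(2)[OF rp], symmetric])
      also have "\<dots> = inner x (F j w)"
        using is_proj_inner[OF projsD(2)[OF F(1)], of j x w] x(1) by simp
      also have "\<dots> \<le> norm x * norm (F j w)" by (rule norm_cauchy_schwarz)
      finally have "((norm w)\<^sup>2)\<^sup>2 \<le> (norm x * norm (F j w))\<^sup>2" by (intro power_mono) auto
      also have "\<dots> \<le> (norm x)\<^sup>2 * (t * (norm w)\<^sup>2)"
        unfolding power_mult_distrib using \<open>(norm (F j w))\<^sup>2 \<le> t * (norm w)\<^sup>2\<close> by (intro mult_left_mono) auto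
      finally have le: "(norm w)\<^sup>2 * (norm w)\<^sup>2 \<le> (t * (norm x)\<^sup>2) * (norm w)\<^sup>2"
        by (simp add: power2_eq_square algebra_simps)
      have "(norm w)\<^sup>2 \<le> t * (norm x)\<^sup>2"
      proof (cases "w = 0")
        case False
        then have "0 < (norm w)\<^sup>2" by simp
        with le show ?thesis by (rule mult_right_le_imp_le)
      qed (use t in simp)
      then show ?thesis by (simp add: w_def)
    qed
    have "(norm (P x))\<^sup>2 = inner x (P x)" by (rule is_proj_inner_self(1)[OF projsD(2)[OF Pp], symmetric])
    also have "\<dots> = (\<Sum>i<d. (norm (r i x))\<^sup>2)"
      by (simp add: Psum blinfun.sum_left inner_sum_right is_proj_inner_self[OF projsD(2)[OF rp]])
    also have "\<dots> \<le> (\<Sum>i<d. t * (norm x)\<^sup>2)" using small by (intro sum_mono) auto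
    also have "\<dots> = \<delta>\<^sup>2 * (norm x)\<^sup>2 / 2" using d by (simp add: t_def)
    finally have "(norm (P x))\<^sup>2 \<le> \<delta>\<^sup>2 * (norm x)\<^sup>2 / 2" .
    moreover have "(\<delta> * norm x)\<^sup>2 \<le> (norm (P x))\<^sup>2"
      using delta x(1) by (intro power_mono) auto
    ultimately have "\<delta>\<^sup>2 * (norm x)\<^sup>2 \<le> 0" by (simp add: power_mult_distrib)
    then show "x = 0" using delta(1) by (simp add: mult_le_0_iff)
  qed
  define K where "K = c0 / t"
  have c0: "c0 > 0" using y by (simp add: c0_def)
  have main: "dim E / real d \<le> K * (\<Sum>i<d. (norm (F j (z i)))\<^sup>2)" for j
  proof -
    define g where "g i = (if i < d then f i j else 0)" for i
    have fr: "f i j o\<^sub>L f k j = 0" if "i \<noteq> k" for i k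
      using r(1) that by (intro projs_orthogonal_mono[OF rp f(1) rp f(1) f(3) f(3)]) (simp add: orth_family_def)
    have og: "orth_family g" using f(1) fr by (auto simp: orth_family_def g_def)
    define G where "G = (\<Sum>i<d. g i)"
    have G: "G \<in> projs" unfolding G_def by (rule orth_family_sum_projs[OF og]) simp
    have Gx: "f i j x = 0" if "G x = 0" "i < d" for i x
    proof -
      have "G o\<^sub>L g i = g i"
        unfolding G_def using that(2) by (intro blinfun_eqI) (simp add: orth_family_sum_apply[OF og])
      then have "g i o\<^sub>L G = g i" using projs_le_sym[OF orth_familyD(1)[OF og] G] by blast
      then have "g i x = 0" using that(1) by (metis blinfun_apply_blinfun_compose blinfun.zero_right)
      then show ?thesis using that(2) by (simp add: g_def)
    qed
    \<comment> \<open>By \<open>meet0\<close>, \<open>G\<close> kills no nonzero vector of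
      \<open>F j\<close>.\<close>
    have "F j \<preceq> G"
      using meet0 Gx by (intro msub_if_meet_zero F G) blast
    then have EG: "E \<preceq> G" using F(2) msub_trans by blast
    obtain i where i: "i < d" "\<And>k. k < d \<Longrightarrow> f k j \<preceq> f i j"
      using largest_of_finitely_many[of d "\<lambda>i. f i j"] f(1) d by blast
    have "G \<preceq> pm.mul d (f i j)"
      unfolding G_def by (rule sum_msub_mul[OF og f(1)]) (simp add: g_def i)
    then have Emul: "E \<preceq> pm.mul d (f i j)" using EG msub_trans by blast
    have "f i j \<noteq> 0"
    proof
      assume "f i j = 0"
      then have "g k = 0" for k using i(2)[of k] msub_zero_right by (auto simp: g_def)
      then have "G = 0" by (simp add: G_def)
      then show False using EG msub_zero_right E(2) by blast
    qed
    have fP: "f i j \<preceq> P"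
      using projs_le_trans[OF f(3) r(2)] by (intro msub_le f)
    have "dim E / real d \<le> dim (f i j)"
      using dim_le_mul[OF E(1) f(1) fP Emul d] d by (simp add: field_simps)
    also have "\<dots> \<le> c0 * (norm (f i j (z i)))\<^sup>2" by (rule domr[OF f(1) \<open>f i j \<noteq> 0\<close> f(3)])
    also have "\<dots> \<le> K * (norm (F j (z i)))\<^sup>2"
      using fz[of i j] c0 t by (simp add: K_def field_simps)
    also have "\<dots> \<le> K * (\<Sum>i<d. (norm (F j (z i)))\<^sup>2)"
      using i(1) c0 t by (intro mult_left_mono member_le_sum) (auto simp: K_def)
    finally show ?thesis .
  qed
  define L where "L = K * (\<Sum>i<d. c * (norm (z i))\<^sup>2)"
  have bd: "real n * (dim E / real d) \<le> L" for n
  proof -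
    have "real n * (dim E / real d) = (\<Sum>j<n. dim E / real d)" by simp
    also have "\<dots> \<le> (\<Sum>j<n. K * (\<Sum>i<d. (norm (F j (z i)))\<^sup>2))" by (intro sum_mono main)
    also have "\<dots> = K * (\<Sum>i<d. \<Sum>j<n. (norm (F j (z i)))\<^sup>2)"
      by (subst sum.swap) (simp add: sum_distrib_left)
    also have "\<dots> \<le> L"
      unfolding L_def using c0 t by (intro mult_left_mono sum_mono bound) (auto simp: K_def)
    finally show ?thesis .
  qed
  have "0 < dim E / real d" using dimE d by simp
  then obtain n where "L < real n * (dim E / real d)"
    using reals_Archimedean3 by blast
  then show False using bd[of n] by simp
qed

end

section \<open>The ideal generated by the finite projections\<close>

context vn_factor
begin

text \<open>A concrete closed ideal containing the finite projections, hence the ideal they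
  generate; its members are arbitrarily small off finite projections, which is the property the
  estimates use.\<close>

definition almost_fin :: "'a op set"
  where "almost_fin = {T \<in> M. \<forall>\<epsilon>>0. \<exists>P. fin P \<and> norm (T o\<^sub>L (id_blinfun - P)) \<le> \<epsilon>}"

lemma almost_finD:
  assumes "T \<in> almost_fin" "\<epsilon> > 0"
  obtains P where "fin P" "norm (T o\<^sub>L (id_blinfun - P)) \<le> \<epsilon>"
  using assms by (auto simp: almost_fin_def)

lemma almost_fin_estimate:
  assumes "norm (T o\<^sub>L (id_blinfun - P)) \<le> \<epsilon>" "P x = 0"
  shows "norm (T x) \<le> \<epsilon> * norm x"
proof -
  have "norm (T x) = norm ((T o\<^sub>L (id_blinfun - P)) x)" using assms(2) by (simp add: blinfun.diff_left)
  also have "\<dots> \<le> norm (T o\<^sub>L (id_blinfun - P)) * norm x" by (rule norm_blinfun)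
  also have "\<dots> \<le> \<epsilon> * norm x" using assms(1) by (intro mult_right_mono) auto
  finally show ?thesis .
qed

lemma almost_finI:
  assumes "T \<in> M" "\<And>\<epsilon>. \<epsilon> > 0 \<Longrightarrow> \<exists>P. fin P \<and> (\<forall>x. P x = 0 \<longrightarrow> norm (T x) \<le> \<epsilon> * norm x)"
  shows "T \<in> almost_fin"
  unfolding almost_fin_def
proof (intro CollectI conjI allI impI)
  fix \<epsilon> :: real assume "\<epsilon> > 0"
  then obtain P where P: "fin P" "\<And>x. P x = 0 \<Longrightarrow> norm (T x) \<le> \<epsilon> * norm x"
    using assms(2) by blast
  have Pp: "P \<in> projs" using P fin_projs by blast
  have "norm (T o\<^sub>L (id_blinfun - P)) \<le> \<epsilon>"
  proof (rule norm_blinfun_bound)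
    fix x
    have "P ((id_blinfun - P) x) = 0" by (simp add: blinfun.diff_left blinfun.diff_right projs_idem[OF Pp])
    then have "norm (T ((id_blinfun - P) x)) \<le> \<epsilon> * norm ((id_blinfun - P) x)" by (rule P)
    also have "\<dots> \<le> \<epsilon> * norm x"
      using is_proj_norm_le[OF projsD(2)[OF projs_compl[OF Pp]]] \<open>\<epsilon> > 0\<close> by (intro mult_left_mono) auto
    finally show "norm ((T o\<^sub>L (id_blinfun - P)) x) \<le> \<epsilon> * norm x" by simp
  qed (use \<open>\<epsilon> > 0\<close> in simp)
  then show "\<exists>P. fin P \<and> norm (T o\<^sub>L (id_blinfun - P)) \<le> \<epsilon>" using P by blast
qed (rule assms(1))

lemma almost_finE:
  assumes "T \<in> almost_fin" "\<epsilon> > 0"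
  obtains P where "fin P" "\<And>x. P x = 0 \<Longrightarrow> norm (T x) \<le> \<epsilon> * norm x"
proof -
  obtain P where P: "fin P" "norm (T o\<^sub>L (id_blinfun - P)) \<le> \<epsilon>" by (rule almost_finD[OF assms])
  from that[OF P(1) almost_fin_estimate[OF P(2)]] show thesis .
qed

lemma fin_almost_fin:
  assumes "fin P"
  shows "P \<in> almost_fin"
proof (rule almost_finI)
  show "P \<in> M" using assms fin_projs projsD by blast
  show "\<exists>Q. fin Q \<and> (\<forall>x. Q x = 0 \<longrightarrow> norm (P x) \<le> \<epsilon> * norm x)" if "\<epsilon> > 0" for \<epsilon>
    using that assms by (intro exI[of _ P]) auto
qed

lemma almost_fin_add:
  assumes "S \<in> almost_fin" "T \<in> almost_fin"
  shows "S + T \<in> almost_fin"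
proof (rule almost_finI)
  show "S + T \<in> M" using assms by (auto simp: almost_fin_def intro: M_add)
  fix \<epsilon> :: real assume "\<epsilon> > 0"
  then have e2: "\<epsilon> / 2 > 0" by simp
  obtain P where P: "fin P" "\<And>x. P x = 0 \<Longrightarrow> norm (S x) \<le> \<epsilon> / 2 * norm x"
    by (rule almost_finE[OF assms(1) e2]) (rule that)
  obtain Q where Q: "fin Q" "\<And>x. Q x = 0 \<Longrightarrow> norm (T x) \<le> \<epsilon> / 2 * norm x"
    by (rule almost_finE[OF assms(2) e2]) (rule that)
  have "norm ((S + T) x) \<le> \<epsilon> * norm x" if "join P Q x = 0" for x
  proof -
    have "P x = 0" "Q x = 0" using join_eq_0_iff[OF fin_projs fin_projs, OF P(1) Q(1), of x] that by auto
    then show ?thesis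
      using P(2)[of x] Q(2)[of x] norm_triangle_ineq[of "S x" "T x"] by (simp add: blinfun.add_left)
  qed
  then show "\<exists>P. fin P \<and> (\<forall>x. P x = 0 \<longrightarrow> norm ((S + T) x) \<le> \<epsilon> * norm x)"
    using fin_join[OF P(1) Q(1)] by blast
qed

lemma almost_fin_left:
  assumes "A \<in> M" "T \<in> almost_fin"
  shows "A o\<^sub>L T \<in> almost_fin"
proof (rule almost_finI)
  show "A o\<^sub>L T \<in> M" using assms by (auto simp: almost_fin_def intro: M_compose)
  fix \<epsilon> :: real assume "\<epsilon> > 0"
  define \<delta> where "\<delta> = \<epsilon> / (norm A + 1)"
  have n1: "norm A + 1 > 0" by (simp add: add_nonneg_pos)
  then have d: "\<delta> > 0" using \<open>\<epsilon> > 0\<close> by (simp add: \<delta>_def)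
  obtain P where P: "fin P" "\<And>x. P x = 0 \<Longrightarrow> norm (T x) \<le> \<delta> * norm x"
    by (rule almost_finE[OF assms(2) d]) (rule that)
  have "norm ((A o\<^sub>L T) x) \<le> \<epsilon> * norm x" if "P x = 0" for x
  proof -
    have "norm (A (T x)) \<le> norm A * norm (T x)" by (rule norm_blinfun)
    also have "\<dots> \<le> (norm A + 1) * (\<delta> * norm x)"
      using P(2)[OF that] by (intro mult_mono) auto
    also have "\<dots> = \<epsilon> * norm x" using n1 by (simp add: \<delta>_def)
    finally show ?thesis by simp
  qed
  then show "\<exists>P. fin P \<and> (\<forall>x. P x = 0 \<longrightarrow> norm ((A o\<^sub>L T) x) \<le> \<epsilon> * norm x)" using P(1) by blast
qed

text \<open>\<open>A\<close> has to map the complement of the new projection into that of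
  \<open>P\<close>. The support \<open>Q\<close> of \<open>P o\<^sub>L A\<close> achieves this, and
  it embeds into \<open>P\<close>, so it is finite.\<close>

lemma almost_fin_right:
  assumes "A \<in> M" "T \<in> almost_fin"
  shows "T o\<^sub>L A \<in> almost_fin"
proof (rule almost_finI)
  show "T o\<^sub>L A \<in> M" using assms by (auto simp: almost_fin_def intro: M_compose)
  fix \<epsilon> :: real assume "\<epsilon> > 0"
  define \<delta> where "\<delta> = \<epsilon> / (norm A + 1)"
  have n1: "norm A + 1 > 0" by (simp add: add_nonneg_pos)
  then have d: "\<delta> > 0" using \<open>\<epsilon> > 0\<close> by (simp add: \<delta>_def)
  obtain P where P: "fin P" "\<And>x. P x = 0 \<Longrightarrow> norm (T x) \<le> \<delta> * norm x"
    by (rule almost_finE[OF assms(2) d]) (rule that)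
  have Pp: "P \<in> projs" using P fin_projs by blast
  have PA: "P o\<^sub>L A \<in> M" using Pp assms(1) projsD by (intro M_compose) auto
  define Q where "Q = id_blinfun - orth_proj (kernel (P o\<^sub>L A))"
  have Q: "Q \<in> projs"
    unfolding Q_def by (intro projs_compl) (simp add: projs_def is_proj_kernel M_orth_proj_kernel[OF PA])
  have Qk: "Q x = 0 \<longleftrightarrow> P (A x) = 0" for x
    using orth_proj_kernel_eq_iff[of "P o\<^sub>L A" x] by (auto simp: Q_def blinfun.diff_left)
  have "Q \<preceq> P"
  proof (rule msub_of_operator[OF PA Q Pp])
    show "Q x = 0" if "(P o\<^sub>L A) x = 0" for x using that Qk by simp
    have "P (A (x - Q x)) = 0" for x
    proof -
      have "Q (x - Q x) = 0" using projs_idem[OF Q] by (simp add: blinfun.diff_right)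
      then show ?thesis by (simp add: Qk)
    qed
    then show "(P o\<^sub>L A) o\<^sub>L Q = P o\<^sub>L A" by (intro blinfun_eqI) (simp add: blinfun.diff_right)
    show "P o\<^sub>L (P o\<^sub>L A) = P o\<^sub>L A"
      using projs_compose_self[OF Pp] by (simp add: blinfun_compose_assoc[symmetric])
  qed
  then have fQ: "fin Q" using fin_msub Q P(1) by blast
  have "norm ((T o\<^sub>L A) x) \<le> \<epsilon> * norm x" if "Q x = 0" for x
  proof -
    have "norm (T (A x)) \<le> \<delta> * norm (A x)" using that Qk P(2) by blast
    also have "\<dots> \<le> \<delta> * ((norm A + 1) * norm x)"
    proof (rule mult_left_mono)
      show "norm (A x) \<le> (norm A + 1) * norm x" using norm_blinfun[of A x] by (simp add: distrib_right add_increasing2)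
    qed (use d in simp)
    also have "\<dots> = \<epsilon> * norm x" using n1 by (simp add: \<delta>_def)
    finally show ?thesis by simp
  qed
  then show "\<exists>P. fin P \<and> (\<forall>x. P x = 0 \<longrightarrow> norm ((T o\<^sub>L A) x) \<le> \<epsilon> * norm x)" using fQ by blast
qed

lemma almost_fin_closed: "closed almost_fin"
  unfolding closed_sequential_limits
proof (intro allI impI, elim conjE)
  fix T :: "nat \<Rightarrow> 'a op" and S assume T0: "\<forall>n. T n \<in> almost_fin" and T1: "T \<longlonglongrightarrow> S"
  then have T: "\<And>n. T n \<in> almost_fin" "T \<longlonglongrightarrow> S" by auto
  show "S \<in> almost_fin"
  proof (rule almost_finI)
    have "T n \<in> M" for n using T(1)[of n] by (simp add: almost_fin_def)
    then show "S \<in> M" using T1 by (rule closed_sequentially[OF M_closed])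
    fix \<epsilon> :: real assume "\<epsilon> > 0"
    then have e2: "\<epsilon> / 2 > 0" by simp
    then obtain n where n: "norm (T n - S) < \<epsilon> / 2"
      using T(2) unfolding LIMSEQ_iff by blast
    obtain P where P: "fin P" "\<And>x. P x = 0 \<Longrightarrow> norm (T n x) \<le> \<epsilon> / 2 * norm x"
      by (rule almost_finE[OF T(1) e2]) (rule that)
    have "norm (S x) \<le> \<epsilon> * norm x" if "P x = 0" for x
    proof -
      have "norm ((T n - S) x) \<le> \<epsilon> / 2 * norm x"
        using norm_blinfun[of "T n - S" x] n by (smt (verit) mult_right_mono norm_ge_zero)
      moreover have "norm (S x) \<le> norm (T n x) + norm ((T n - S) x)"
        using norm_triangle_ineq4[of "T n x" "(T n - S) x"] by (simp add: blinfun.diff_left)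
      ultimately show ?thesis using P(2)[OF that] by simp
    qed
    then show "\<exists>P. fin P \<and> (\<forall>x. P x = 0 \<longrightarrow> norm (S x) \<le> \<epsilon> * norm x)" using P(1) by blast
  qed
qed

end

section \<open>Operators bounded below on a projection\<close>

context vn_algebra
begin

text \<open>\<open>E\<close> is the range projection of \<open>Y\<close>. With the polar
  decomposition \<open>Y = v o\<^sub>L R\<close>, the adjoint of \<open>Y\<close> at
  \<open>z\<close> is \<open>R (v\<^sup>\<star> z)\<close>, and on the range of \<open>q\<close>,
  where \<open>v\<^sup>\<star> z\<close> lies, \<open>R\<close> has the lower bound of
  \<open>Y\<close>.\<close>

lemma bounded_below_range:
  assumes "Y \<in> M" "q \<in> projs" "Y o\<^sub>L q = Y" "a > 0"
    and below: "\<And>x. q x = x \<Longrightarrow> a * (norm x)\<^sup>2 \<le> (norm (Y x))\<^sup>2"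
  obtains E where "E \<in> projs" "q \<preceq> E" "\<And>z. a * (norm (E z))\<^sup>2 \<le> (norm (Y\<^sup>\<star> z))\<^sup>2"
    "\<And>z. E z = 0 \<longleftrightarrow> Y\<^sup>\<star> z = 0"
proof -
  obtain v R where v: "v \<in> M" "is_proj (v\<^sup>\<star> o\<^sub>L v)" "pos_op R" "R o\<^sub>L R = Y\<^sup>\<star> o\<^sub>L Y" "v o\<^sub>L R = Y"
    and k1: "\<And>x. v x = 0 \<longleftrightarrow> Y x = 0" and k2: "\<And>y. v\<^sup>\<star> y = 0 \<longleftrightarrow> Y\<^sup>\<star> y = 0"
    by (rule M_polar_decomposition[OF assms(1)]) (rule that)
  have Yq: "Y (q x) = Y x" for x using assms(3) by (metis blinfun_apply_blinfun_compose)
  have Yk: "Y x = 0 \<longleftrightarrow> q x = 0" for x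
  proof
    assume "Y x = 0"
    then have "a * (norm (q x))\<^sup>2 \<le> 0" using below[OF projs_idem[OF assms(2)], of x] Yq[of x] by simp
    then show "q x = 0" using assms(4) by (simp add: mult_le_0_iff)
  next
    assume "q x = 0"
    then show "Y x = 0" using Yq[of x] by simp
  qed
  have vq: "v\<^sup>\<star> o\<^sub>L v = q"
  proof (rule is_proj_eqI[OF v(2) projsD(2)[OF assms(2)]])
    fix x
    have "(v\<^sup>\<star> o\<^sub>L v) x = 0 \<longleftrightarrow> v x = 0" using hadj_inner[of v x "v x"] by auto
    then show "(v\<^sup>\<star> o\<^sub>L v) x = 0 \<longleftrightarrow> q x = 0" using k1 Yk by simp
  qed
  define E where "E = v o\<^sub>L v\<^sup>\<star>"
  note vr = msub_range[OF v(1) vq assms(2), folded E_def]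
  have Ev: "(norm (E z))\<^sup>2 = (norm (v\<^sup>\<star> z))\<^sup>2" for z
    unfolding is_proj_inner_self(1)[OF projsD(2)[OF vr(1)], symmetric]
    by (simp add: E_def power2_norm_eq_inner hadj_inner')
  have YR: "norm (Y w) = norm (R w)" for w
  proof -
    have "(norm (Y w))\<^sup>2 = inner w ((Y\<^sup>\<star> o\<^sub>L Y) w)" by (simp add: power2_norm_eq_inner hadj_inner)
    also have "\<dots> = (norm (R w))\<^sup>2"
      unfolding v(4)[symmetric] using pos_op_inner[OF v(3), of w "R w"] by (simp add: power2_norm_eq_inner)
    finally show ?thesis by simp
  qed
  have Yadj: "Y\<^sup>\<star> z = R (v\<^sup>\<star> z)" for z
    using arg_cong[OF v(5), of hadj] pos_op_hadj[OF v(3)] by (metis blinfun_apply_blinfun_compose hadj_compose)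
  show thesis
  proof (rule that[of E])
    show "E \<in> projs" "q \<preceq> E" using vr by auto
    show "E z = 0 \<longleftrightarrow> Y\<^sup>\<star> z = 0" for z
    proof -
      have "norm (E z) = norm (v\<^sup>\<star> z)" using Ev[of z] by simp
      then show ?thesis using k2[of z] by (metis norm_eq_zero)
    qed
    fix z
    have "q o\<^sub>L v\<^sup>\<star> = v\<^sup>\<star>"
    proof -
      from arg_cong[OF vr(4), of hadj] show ?thesis using projs_hadj[OF assms(2)] by simp
    qed
    then have "q (v\<^sup>\<star> z) = v\<^sup>\<star> z" by (metis blinfun_apply_blinfun_compose)
    from below[OF this] show "a * (norm (E z))\<^sup>2 \<le> (norm (Y\<^sup>\<star> z))\<^sup>2"
      by (simp add: Ev Yadj YR)
  qed
qed

end

section \<open>Sums of equivalent positive operators\<close>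

text \<open>The eigenspace at the norm; for positive \<open>T\<close> it is identified below with
  the spectral projection of \<open>{norm T}\<close>, and for \<open>T = 0\<close> it is the
  identity.\<close>

definition top_eig :: "'a::real_hilbert op \<Rightarrow> 'a op"
  where "top_eig T = orth_proj (kernel (T - norm T *\<^sub>R id_blinfun))"

lemma is_proj_top_eig: "is_proj (top_eig T)"
  unfolding top_eig_def by (rule is_proj_kernel)

lemma top_eig_eq_iff: "top_eig T x = x \<longleftrightarrow> T x = norm T *\<^sub>R x"
  unfolding top_eig_def orth_proj_kernel_eq_iff by (simp add: blinfun.bilinear_simps)

lemma top_eig_apply: "T (top_eig T x) = norm T *\<^sub>R top_eig T x"
  using top_eig_eq_iff[of T "top_eig T x"] is_proj_idem[OF is_proj_top_eig] by blast

lemma top_eig_0: "top_eig 0 = id_blinfun"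
  by (rule blinfun_eqI) (simp add: top_eig_eq_iff)

text \<open>The summands are \<open>X j o\<^sub>L (X j)\<^sup>\<star>\<close>, each equivalent to
  \<open>B\<close>; the convergence of their sum is recorded through quadratic forms.\<close>

locale summable_copies = vn_infinite_factor +
  fixes A B :: "'a op" and X :: "nat \<Rightarrow> 'a op"
  assumes A: "A \<in> M" "pos_op A"
    and X: "X j \<in> M" "(X j)\<^sup>\<star> o\<^sub>L X j = B"
    and sums: "(\<lambda>j. (norm ((X j)\<^sup>\<star> x))\<^sup>2) sums inner x (A x)"
begin

lemma B: "B \<in> M" "pos_op B"
  using M_compose[OF M_hadj[OF X(1)[of 0]] X(1)[of 0]] pos_op_hadj_compose(1)[of "X 0"]
  by (simp_all only: X(2))

lemma B_apply: "(X j)\<^sup>\<star> (X j x) = B x"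
  using X(2)[of j] by (metis blinfun_apply_blinfun_compose)

lemma X_norm: "(norm (X j x))\<^sup>2 = inner x (B x)"
  by (simp add: power2_norm_eq_inner hadj_inner B_apply)

lemma sum_le: "(\<Sum>j<n. (norm ((X j)\<^sup>\<star> x))\<^sup>2) \<le> inner x (A x)"
  using sum_le_suminf[OF sums_summable[OF sums]] sums_unique[OF sums] by simp

lemma two_terms_le:
  assumes "j \<noteq> k"
  shows "(norm ((X j)\<^sup>\<star> x))\<^sup>2 + (norm ((X k)\<^sup>\<star> x))\<^sup>2 \<le> inner x (A x)"
proof -
  have "(norm ((X j)\<^sup>\<star> x))\<^sup>2 + (norm ((X k)\<^sup>\<star> x))\<^sup>2 = (\<Sum>i\<in>{j,k}. (norm ((X i)\<^sup>\<star> x))\<^sup>2)"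
    using assms by simp
  also have "\<dots> \<le> inner x (A x)"
    using sum_le_suminf[OF sums_summable[OF sums], of "{j,k}" x] sums_unique[OF sums] by simp
  finally show ?thesis .
qed

lemma term_le: "(norm ((X j)\<^sup>\<star> x))\<^sup>2 \<le> inner x (A x)"
  using two_terms_le[of j "Suc j" x] by (smt (verit) n_not_Suc_n zero_le_power2)

lemma X_hadj_zero: "A x = 0 \<Longrightarrow> (X j)\<^sup>\<star> x = 0"
  using term_le[of j x] by simp

lemma norm_B_le: "norm B \<le> norm A"
proof -
  have "norm (X 0 o\<^sub>L (X 0)\<^sup>\<star>) \<le> norm A"
  proof (rule pos_op_norm_mono)
    show "inner ((X 0 o\<^sub>L (X 0)\<^sup>\<star>) x) x \<le> inner (A x) x" for x
      using term_le[of 0 x] by (simp add: hadj_inner power2_norm_eq_inner inner_commute)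
  qed (rule pos_op_hadj_compose)
  moreover have "norm (X 0 o\<^sub>L (X 0)\<^sup>\<star>) = norm B"
    using hadj_compose_self_norm[of "X 0"] hadj_compose_self_norm[of "(X 0)\<^sup>\<star>"] X(2)[of 0]
    by (simp add: norm_hadj)
  ultimately show ?thesis by simp
qed

text \<open>\<open>X 0\<close> itself provides the embedding: its kernel is that of
  \<open>B\<close>, and its adjoint vanishes wherever \<open>A\<close> does.\<close>

lemma support_msub:
  assumes e: "e \<in> projs" "\<And>x. e x = 0 \<longleftrightarrow> B x = 0" and f: "f \<in> projs" "\<And>x. f x = 0 \<longleftrightarrow> A x = 0"
  shows "e \<preceq> f"
proof (rule msub_of_operator[OF X(1)[of 0] e(1) f(1)])
  have X0: "X 0 x = 0 \<longleftrightarrow> B x = 0" for x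
    using X_norm[of 0 x] B_apply[of 0 x] by auto
  show "e x = 0" if "X 0 x = 0" for x using that X0 e by blast
  have "e (x - e x) = 0" for x by (simp add: blinfun.diff_right projs_idem[OF e(1)])
  then have "X 0 (x - e x) = 0" for x using e(2) X0 by blast
  then show "X 0 o\<^sub>L e = X 0" by (intro blinfun_eqI) (simp add: blinfun.diff_right)
  have "f (x - f x) = 0" for x by (simp add: blinfun.diff_right projs_idem[OF f(1)])
  then have "(X 0)\<^sup>\<star> (x - f x) = 0" for x using f(2) X_hadj_zero by blast
  then have "(X 0)\<^sup>\<star> o\<^sub>L f = (X 0)\<^sup>\<star>" by (intro blinfun_eqI) (simp add: blinfun.diff_right)
  from arg_cong[OF this, of hadj] show "f o\<^sub>L X 0 = X 0" using projs_hadj[OF f(1)] by simp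
qed

text \<open>On the complement of a finite projection \<open>A\<close> cannot be smaller than \<open>norm B\<close>: otherwise the
  spectral parts of the summands above an intermediate value would be a summable sequence of
  equivalent projections that is bounded below on a finite corner.\<close>

theorem essential_lower_bound:
  assumes P: "fin P" and a: "a < norm B" and small: "\<And>x. P x = 0 \<Longrightarrow> norm (A x) \<le> a * norm x"
  shows False
proof -
  define a0 where "a0 = max a 0"
  \<comment> \<open>Were \<open>norm B\<close> zero, \<open>a\<close> would be negative and
    \<open>small\<close> would leave no nonzero vector off \<open>P\<close>; but \<open>P\<close> is
    finite and the identity is not.\<close>
  have B0: "norm B \<noteq> 0"
  proof
    assume "norm B = 0"
    then have "a < 0" using a by simp
    have "x = 0" if "P x = 0" for x
    proof -
      have "0 \<le> a * norm x" using small[OF that] norm_ge_zero[of "A x"] by linarith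
      then show ?thesis using \<open>a < 0\<close> by (simp add: zero_le_mult_iff)
    qed
    moreover have "P (x - P x) = 0" for x
      using projs_idem[OF fin_projs[OF P]] by (simp add: blinfun.diff_right)
    ultimately have "x - P x = 0" for x by blast
    then have "P = id_blinfun" by (intro blinfun_eqI) simp
    then show False using P infinite by simp
  qed
  have Pp: "P \<in> projs" using P fin_projs by blast
  have a0: "0 \<le> a0" "a0 < norm B" using a B0 by (auto simp: a0_def)
  \<comment> \<open>A level strictly between the size of \<open>A\<close> off \<open>P\<close> and
    the norm of \<open>B\<close>: \<open>B\<close> has a nonzero spectral projection
    \<open>q\<close> above it, and the gap \<open>b - a0\<close> keeps the copies of
    \<open>q\<close> away from the complement of \<open>P\<close>.\<close>
  define b where "b = (a0 + norm B) / 2"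
  have b: "a0 < b" "b < norm B" "0 < b" using a0 by (auto simp: b_def)
  obtain q where q: "q \<in> projs" "\<And>x. q x = 0 \<Longrightarrow> inner x (B x) \<le> b * (norm x)\<^sup>2"
    "\<And>x. q x = x \<Longrightarrow> b * (norm x)\<^sup>2 \<le> inner x (B x)"
    by (rule M_spectral_cut[OF B(1) pos_op_hadj[OF B(2)], of b]) (rule that)
  have "q \<noteq> 0"
  proof
    assume "q = 0"
    then have "norm B \<le> b"
      using b q(2) by (intro pos_op_norm_leI[OF B(2)]) (auto simp: inner_commute)
    then show False using b by simp
  qed
  \<comment> \<open>\<open>E j\<close> is the range projection of \<open>X j o\<^sub>L q\<close>;
    the \<open>j\<close>-th summand dominates \<open>b *\<^sub>R E j\<close>.\<close>
  have "\<exists>E. E \<in> projs \<and> q \<preceq> E \<and> (\<forall>z. b * (norm (E z))\<^sup>2 \<le> (norm ((X j)\<^sup>\<star> z))\<^sup>2)" for j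
  proof -
    have YM: "X j o\<^sub>L q \<in> M" using X(1) q(1) projsD by (intro M_compose) auto
    have Yq: "(X j o\<^sub>L q) o\<^sub>L q = X j o\<^sub>L q" using projs_compose_self[OF q(1)] by (simp add: blinfun_compose_assoc)
    have below: "b * (norm x)\<^sup>2 \<le> (norm ((X j o\<^sub>L q) x))\<^sup>2" if "q x = x" for x
      using q(3)[OF that] that by (simp add: X_norm)
    obtain E where E: "E \<in> projs" "q \<preceq> E" "\<And>z. b * (norm (E z))\<^sup>2 \<le> (norm ((X j o\<^sub>L q)\<^sup>\<star> z))\<^sup>2"
      by (rule bounded_below_range[OF YM q(1) Yq b(3)]) (erule below, rule that)
    have "(norm ((X j o\<^sub>L q)\<^sup>\<star> z))\<^sup>2 \<le> (norm ((X j)\<^sup>\<star> z))\<^sup>2" for z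
      using is_proj_norm_le[OF projsD(2)[OF q(1)]] projs_hadj[OF q(1)] by (simp add: power_mono)
    then show ?thesis using E order_trans by blast
  qed
  then obtain E where E: "\<And>j. E j \<in> projs" "\<And>j. q \<preceq> E j"
    "\<And>j z. b * (norm (E j z))\<^sup>2 \<le> (norm ((X j)\<^sup>\<star> z))\<^sup>2"
    by metis
  show False
  proof (rule no_summable_copies[OF P q(1) \<open>q \<noteq> 0\<close> E(1,2)])
    \<comment> \<open>On \<open>E j\<close>, \<open>A\<close> stretches by at least
      \<open>b\<close>, while the component off \<open>P\<close> accounts for at most
      \<open>a0\<close>; the difference must come from \<open>P x\<close>, and
      \<open>norm A + 1\<close> is a positive bound for \<open>A\<close> there.\<close>
    show "0 < (b - a0) / (norm A + 1)" using b by (simp add: add_nonneg_pos)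
    show "(b - a0) / (norm A + 1) * norm x \<le> norm (P x)" if "E j x = x" for j x
    proof -
      have "b * (norm x)\<^sup>2 \<le> inner x (A x)"
        using E(3)[of j x] that term_le[of j x] by simp
      also have "\<dots> \<le> norm x * norm (A x)" by (rule norm_cauchy_schwarz)
      finally have 1: "b * norm x \<le> norm (A x)"
        by (cases "x = 0") (auto simp: power2_eq_square)
      have "P (x - P x) = 0" using projs_idem[OF Pp] by (simp add: blinfun.diff_right)
      then have "norm (A (x - P x)) \<le> a * norm (x - P x)" by (rule small)
      also have "\<dots> \<le> a0 * norm x"
      proof -
        have "norm (x - P x) \<le> norm x"
          using is_proj_norm_le[OF is_proj_compl[OF projsD(2)[OF Pp]], of x] by (simp add: blinfun.diff_left)
        moreover have "a * norm (x - P x) \<le> a0 * norm (x - P x)" by (simp add: a0_def mult_right_mono)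
        ultimately show ?thesis using a0(1) by (meson mult_left_mono order_trans)
      qed
      finally have "norm (A (x - P x)) \<le> a0 * norm x" .
      moreover have "norm (A (P x)) \<le> (norm A + 1) * norm (P x)"
        using norm_blinfun[of A "P x"] by (simp add: distrib_right add_increasing2)
      moreover have "norm (A x) \<le> norm (A (x - P x)) + norm (A (P x))"
        using norm_triangle_ineq[of "A (x - P x)" "A (P x)"] by (simp add: blinfun.diff_right)
      ultimately have "(b - a0) * norm x \<le> (norm A + 1) * norm (P x)"
        using 1 by (simp add: left_diff_distrib)
      moreover have "0 < norm A + 1" by (simp add: add_nonneg_pos)
      ultimately show ?thesis by (simp add: field_simps)
    qed
    show "(\<Sum>j<n. (norm (E j x))\<^sup>2) \<le> norm A / b * (norm x)\<^sup>2" for n x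
    proof -
      have "b * (\<Sum>j<n. (norm (E j x))\<^sup>2) \<le> (\<Sum>j<n. (norm ((X j)\<^sup>\<star> x))\<^sup>2)"
        unfolding sum_distrib_left by (intro sum_mono E)
      also have "\<dots> \<le> inner x (A x)" by (rule sum_le)
      also have "\<dots> \<le> norm A * (norm x)\<^sup>2" using inner_le_norm_op[of A x] by (simp add: inner_commute)
      finally show ?thesis using b by (simp add: field_simps)
    qed
  qed
qed

section \<open>Eigenspaces at the norm\<close>

lemma top_eig_projs: "T \<in> M \<Longrightarrow> top_eig T \<in> projs"
  unfolding projs_def top_eig_def
  by (simp add: is_proj_kernel) (intro M_orth_proj_kernel M_diff M_scaleR M_id)

lemma eigenvector_of_summand:
  assumes eq: "norm A = norm B" and x: "norm B * (norm x)\<^sup>2 \<le> (norm ((X j)\<^sup>\<star> x))\<^sup>2"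
  shows "A x = norm A *\<^sub>R x" "k \<noteq> j \<Longrightarrow> (X k)\<^sup>\<star> x = 0"
proof -
  have "norm A * (norm x)\<^sup>2 \<le> inner (A x) x"
    using x term_le[of j x] eq by (simp add: inner_commute)
  then show *: "A x = norm A *\<^sub>R x" by (rule pos_op_top_eigenvector[OF A(2)])
  assume "k \<noteq> j"
  then have "(norm ((X k)\<^sup>\<star> x))\<^sup>2 + (norm ((X j)\<^sup>\<star> x))\<^sup>2 \<le> norm B * (norm x)\<^sup>2"
    using two_terms_le[of k j x] * eq by (simp add: power2_norm_eq_inner)
  then have "(norm ((X k)\<^sup>\<star> x))\<^sup>2 \<le> 0" using x by linarith
  then show "(X k)\<^sup>\<star> x = 0" by simp
qed

lemma eigenvector_image:
  assumes "B x = norm B *\<^sub>R x"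
  shows "norm B * (norm (X j x))\<^sup>2 \<le> (norm ((X j)\<^sup>\<star> (X j x)))\<^sup>2"
proof -
  have "(norm (X j x))\<^sup>2 = norm B * (norm x)\<^sup>2"
    unfolding X_norm assms by (simp add: power2_norm_eq_inner)
  then show ?thesis by (simp add: B_apply assms power_mult_distrib power2_eq_square)
qed

text \<open>On the top eigenspace of \<open>B\<close>, \<open>X j\<close> is
  \<open>sqrt (norm B)\<close> times an isometry, so dividing gives partial isometries from
  \<open>top_eig B\<close> onto the \<open>s j\<close>. By the last conclusion,
  \<open>norm B *\<^sub>R s j\<close> is the part of the \<open>j\<close>-th summand that comes from
  this eigenspace.\<close>

lemma eigenspace_copies:
  assumes eq: "norm A = norm B" and B0: "norm B \<noteq> 0"
  obtains s where "orth_family s" "\<And>j. top_eig A o\<^sub>L s j = s j" "\<And>i j. s i \<preceq> s j"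
    "top_eig B \<preceq> s 0" "\<And>j x. norm B *\<^sub>R s j x = X j (top_eig B ((X j)\<^sup>\<star> x))"
proof -
  define b where "b = norm B"
  have b: "b > 0" using B0 by (simp add: b_def)
  define e where "e = top_eig B"
  have e: "e \<in> projs" unfolding e_def by (rule top_eig_projs[OF B(1)])
  have Be: "B (e x) = b *\<^sub>R e x" for x unfolding e_def b_def by (rule top_eig_apply)
  define v where "v j = (1 / sqrt b) *\<^sub>R (X j o\<^sub>L e)" for j
  have vM: "v j \<in> M" for j unfolding v_def using X(1) e projsD by (intro M_scaleR M_compose) auto
  have vadj: "(v j)\<^sup>\<star> = (1 / sqrt b) *\<^sub>R (e o\<^sub>L (X j)\<^sup>\<star>)" for j
    by (simp add: v_def hadj_scaleR projs_hadj[OF e])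
  have vv: "(v j)\<^sup>\<star> o\<^sub>L v j = e" for j
  proof (rule blinfun_eqI)
    fix x
    have "((v j)\<^sup>\<star> o\<^sub>L v j) x = (1 / b) *\<^sub>R e (B (e x))"
      unfolding vadj using b by (simp add: v_def blinfun.bilinear_simps B_apply)
    then show "((v j)\<^sup>\<star> o\<^sub>L v j) x = e x"
      using b by (simp add: Be blinfun.bilinear_simps projs_idem[OF e])
  qed
  define s where "s j = v j o\<^sub>L (v j)\<^sup>\<star>" for j
  note vr = msub_range[OF vM vv e, folded s_def]
  have ev: "norm B * (norm (v j x))\<^sup>2 \<le> (norm ((X j)\<^sup>\<star> (v j x)))\<^sup>2" for j x
  proof -
    have "B ((1 / sqrt b) *\<^sub>R e x) = norm B *\<^sub>R ((1 / sqrt b) *\<^sub>R e x)"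
      by (simp add: blinfun.scaleR_right Be b_def)
    from eigenvector_image[OF this, of j] show ?thesis
      by (simp add: v_def blinfun.bilinear_simps)
  qed
  show thesis
  proof (rule that[of s])
    show "orth_family s"
      unfolding orth_family_def
    proof (intro conjI allI impI)
      fix i j :: nat assume "i \<noteq> j"
      have "(X i)\<^sup>\<star> (v j x) = 0" for x by (rule eigenvector_of_summand(2)[OF eq ev \<open>i \<noteq> j\<close>])
      then have "(v i)\<^sup>\<star> (v j x) = 0" for x by (simp add: vadj blinfun.bilinear_simps)
      then show "s i o\<^sub>L s j = 0" by (intro blinfun_eqI) (simp add: s_def)
    qed (rule vr)
    show "top_eig A o\<^sub>L s j = s j" for j
    proof (rule blinfun_eqI)
      fix x
      have "A (v j y) = norm A *\<^sub>R v j y" for y by (rule eigenvector_of_summand(1)[OF eq ev])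
      then show "(top_eig A o\<^sub>L s j) x = s j x" by (simp add: top_eig_eq_iff s_def)
    qed
    show "s i \<preceq> s j" for i j using vr(2)[of i] vr(3)[of j] msub_trans by blast
    show "top_eig B \<preceq> s 0" using vr(3) by (simp add: e_def)
    show "norm B *\<^sub>R s j x = X j (top_eig B ((X j)\<^sup>\<star> x))" for j x
    proof -
      have "s j x = (1 / b) *\<^sub>R X j (e (e ((X j)\<^sup>\<star> x)))"
        unfolding s_def vadj using b by (simp add: v_def blinfun.bilinear_simps)
      then show ?thesis using b by (simp add: projs_idem[OF e] b_def[symmetric] e_def[symmetric])
    qed
  qed
qed

lemma top_eig_infinite:
  assumes eq: "norm A = norm B" and "top_eig B \<noteq> 0"
  shows "\<not> fin (top_eig A)"
proof (cases "norm B = 0")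
  case True
  \<comment> \<open>Here \<open>A = 0\<close>, and its top eigenspace is the whole space.\<close>
  then show ?thesis using eq infinite by (simp add: top_eig_0)
next
  case False
  obtain s where s: "orth_family s" "\<And>j. top_eig A o\<^sub>L s j = s j" "\<And>i j. s i \<preceq> s j"
    "top_eig B \<preceq> s 0"
    by (rule eigenspace_copies[OF eq False]) (rule that)
  show ?thesis
  proof
    assume "fin (top_eig A)"
    from no_infinite_copies[OF this s(1-3)] s(4) have "top_eig B \<preceq> 0" by simp
    then show False using msub_zero_right assms(2) by blast
  qed
qed

text \<open>If \<open>B\<close> is a multiple of \<open>top_eig B\<close>, the \<open>j\<close>-th
  summand is the multiple \<open>norm B *\<^sub>R s j\<close> with \<open>s j\<close> below
  \<open>top_eig A\<close>; so \<open>A\<close> vanishes off \<open>top_eig A\<close>.\<close>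

lemma multiple_of_top_eig:
  assumes eq: "norm A = norm B" and Be: "B = norm B *\<^sub>R top_eig B"
  shows "A = norm A *\<^sub>R top_eig A"
proof (cases "norm B = 0")
  case True
  then show ?thesis using eq by simp
next
  case False
  obtain s where s: "orth_family s" "\<And>j. top_eig A o\<^sub>L s j = s j"
    "\<And>j x. norm B *\<^sub>R s j x = X j (top_eig B ((X j)\<^sup>\<star> x))"
    by (rule eigenspace_copies[OF eq False]) (rule that)
  define e where "e = top_eig B"
  define f where "f = top_eig A"
  have f: "f \<in> projs" unfolding f_def by (rule top_eig_projs[OF A(1)])
  have e: "e \<in> projs" unfolding e_def by (rule top_eig_projs[OF B(1)])
  have Xe: "X j (e x) = X j x" for j x
  proof -
    have "B (x - e x) = norm B *\<^sub>R e (x - e x)" by (subst Be) (simp add: blinfun.scaleR_left e_def)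
    then have "B (x - e x) = 0" by (simp add: blinfun.diff_right projs_idem[OF e])
    then have "X j (x - e x) = 0" using X_norm[of j "x - e x"] by simp
    then show ?thesis by (simp add: blinfun.diff_right)
  qed
  have Az: "A x = 0" if "f x = 0" for x
  proof -
    have "(X j)\<^sup>\<star> x = 0" for j
    proof -
      have "s j o\<^sub>L f = s j"
        using projs_le_sym[OF orth_familyD(1)[OF s(1)] f] s(2) by (simp add: f_def)
      then have "s j x = 0" using that by (metis blinfun_apply_blinfun_compose blinfun.zero_right)
      then have "X j ((X j)\<^sup>\<star> x) = 0" using s(3)[of j x] by (simp add: Xe flip: e_def)
      then have "inner ((X j)\<^sup>\<star> x) ((X j)\<^sup>\<star> x) = 0" by (simp add: hadj_inner')
      then show ?thesis by simp
    qed
    then have "(\<lambda>j. 0) sums inner x (A x)" using sums[of x] by simp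
    from sums_unique2[OF this sums_zero] have "inner (A x) x = 0" by (simp add: inner_commute)
    then show "A x = 0" by (rule pos_op_zero_if_inner_zero[OF A(2)])
  qed
  have "A x = norm A *\<^sub>R f x" for x
  proof -
    have "f (x - f x) = 0" by (simp add: blinfun.diff_right projs_idem[OF f])
    then have "A x = A (f x)" using Az[of "x - f x"] by (simp add: blinfun.diff_right)
    also have "\<dots> = norm A *\<^sub>R f x" unfolding f_def by (rule top_eig_apply)
    finally show ?thesis .
  qed
  then show ?thesis by (intro blinfun_eqI) (simp add: blinfun.scaleR_left f_def)
qed

end

locale summable_unitary_copies = vn_infinite_factor +
  fixes A B :: "'a op" and U :: "nat \<Rightarrow> 'a op"
  assumes A: "A \<in> M" "pos_op A" and B: "B \<in> M" "pos_op B"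
    and U: "U j \<in> M" "(U j)\<^sup>\<star> o\<^sub>L U j = id_blinfun" "U j o\<^sub>L (U j)\<^sup>\<star> = id_blinfun"
    and sums: "(\<lambda>j. U j (B ((U j)\<^sup>\<star> x))) sums A x"
begin

lemma U_apply: "(U j)\<^sup>\<star> (U j x) = x" "U j ((U j)\<^sup>\<star> x) = x"
  using U(2,3)[of j] by (metis blinfun_apply_blinfun_compose id_blinfun.rep_eq)+

lemma U_norm: "norm (U j x) = norm x" "norm ((U j)\<^sup>\<star> x) = norm x"
  by (simp_all add: norm_eq_sqrt_inner hadj_inner hadj_inner' U_apply)

lemma inner_sums: "(\<lambda>j. inner ((U j)\<^sup>\<star> x) (B ((U j)\<^sup>\<star> x))) sums inner x (A x)"
  using bounded_linear.sums[OF bounded_linear_inner_right sums, of x x] by (simp add: hadj_inner')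

lemma inner_sum_le: "(\<Sum>j<n. inner ((U j)\<^sup>\<star> x) (B ((U j)\<^sup>\<star> x))) \<le> inner x (A x)"
  using sum_le_suminf[OF sums_summable[OF inner_sums]] sums_unique[OF inner_sums]
    pos_op_nonneg[OF B(2)] by (simp add: inner_commute)

text \<open>With the square root \<open>R\<close> of \<open>B\<close>, the operators
  \<open>X j = U j o\<^sub>L R\<close> exhibit the unitary copies as equivalent copies, which
  transfers everything proved for the latter.\<close>

lemma summable_copies_sqrt:
  obtains X where "summable_copies N M A B X" "\<And>j x. (X j)\<^sup>\<star> x = 0 \<longleftrightarrow> B ((U j)\<^sup>\<star> x) = 0"
    "\<And>j. \<exists>R. pos_op R \<and> X j = U j o\<^sub>L R \<and> R o\<^sub>L R = B"
proof -
  from pos_op_sqrt[OF B(2)] obtain R where R: "pos_op R" "R o\<^sub>L R = B"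
    and comm: "\<And>T. T o\<^sub>L B = B o\<^sub>L T \<Longrightarrow> T o\<^sub>L R = R o\<^sub>L T" by blast
  have RM: "R \<in> M" by (rule M_commutes[OF B(1) comm])
  have RB: "R (R x) = B x" for x using R(2) by (metis blinfun_apply_blinfun_compose)
  define X where "X j = U j o\<^sub>L R" for j
  have Xadj: "(X j)\<^sup>\<star> x = R ((U j)\<^sup>\<star> x)" for j x by (simp add: X_def pos_op_hadj[OF R(1)])
  have RRi: "(norm (R x))\<^sup>2 = inner x (B x)" for x
    using pos_op_inner[OF R(1), of x "R x"] by (simp add: power2_norm_eq_inner RB)
  show thesis
  proof (rule that[of X])
    show "summable_copies N M A B X"
    proof unfold_locales
      show "X j \<in> M" for j unfolding X_def by (intro M_compose U RM)
      show "(X j)\<^sup>\<star> o\<^sub>L X j = B" for j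
        by (rule blinfun_eqI) (simp add: Xadj, simp add: X_def U_apply RB)
      show "(\<lambda>j. (norm ((X j)\<^sup>\<star> x))\<^sup>2) sums inner x (A x)" for x
        using inner_sums[of x] by (simp add: Xadj RRi)
    qed (rule A)+
    show "(X j)\<^sup>\<star> x = 0 \<longleftrightarrow> B ((U j)\<^sup>\<star> x) = 0" for j x
      using RRi[of "(U j)\<^sup>\<star> x"] RB[of "(U j)\<^sup>\<star> x"] by (auto simp: Xadj)
    show "\<exists>R. pos_op R \<and> X j = U j o\<^sub>L R \<and> R o\<^sub>L R = B" for j using R by (auto simp: X_def)
  qed
qed

lemma kernel_msub:
  assumes e: "e \<in> projs" and f: "f \<in> projs" "\<And>x. f x = x \<longleftrightarrow> B x = 0"
    and W: "W \<in> M" "\<And>x. W x = 0 \<Longrightarrow> x = 0" and ker: "\<And>x. e x = x \<Longrightarrow> B (W x) = 0"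
  shows "e \<preceq> f"
proof (rule msub_of_operator[where X = "W o\<^sub>L e"])
  show "W o\<^sub>L e \<in> M" using W e projsD by (intro M_compose) auto
  show "e x = 0" if "(W o\<^sub>L e) x = 0" for x using that W(2) by simp
  show "(W o\<^sub>L e) o\<^sub>L e = W o\<^sub>L e" using projs_compose_self[OF e] by (simp add: blinfun_compose_assoc)
  show "f o\<^sub>L (W o\<^sub>L e) = W o\<^sub>L e"
    using ker f(2) projs_idem[OF e] by (intro blinfun_eqI) simp
qed (rule e f)+

lemma null_msub:
  assumes "e \<in> projs" "\<And>x. e x = x \<longleftrightarrow> A x = 0" "f \<in> projs" "\<And>x. f x = x \<longleftrightarrow> B x = 0"
  shows "e \<preceq> f"
proof (rule kernel_msub[OF assms(1,3,4) M_hadj[OF U(1)[of 0]]])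
  show "x = 0" if "(U 0)\<^sup>\<star> x = 0" for x using that U_norm(2)[of 0 x] by simp
  obtain X where X: "summable_copies N M A B X" "\<And>j x. (X j)\<^sup>\<star> x = 0 \<longleftrightarrow> B ((U j)\<^sup>\<star> x) = 0"
    by (rule summable_copies_sqrt) (rule that)
  show "B ((U 0)\<^sup>\<star> x) = 0" if "e x = x" for x
    using summable_copies.X_hadj_zero[OF X(1), of x 0] that assms(2) X(2) by blast
qed

lemma top_eig_msub:
  assumes eq: "norm A = norm B" and f: "f \<in> projs" "\<And>x. f x = x \<longleftrightarrow> B x = 0"
  shows "top_eig B \<preceq> f"
proof -
  obtain X where X: "summable_copies N M A B X" "\<And>j x. (X j)\<^sup>\<star> x = 0 \<longleftrightarrow> B ((U j)\<^sup>\<star> x) = 0"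
    "\<And>j. \<exists>R. pos_op R \<and> X j = U j o\<^sub>L R \<and> R o\<^sub>L R = B"
    by (rule summable_copies_sqrt) (rule that)
  interpret X: summable_copies N M A B X by (rule X)
  show ?thesis
  proof (rule kernel_msub[OF X.top_eig_projs[OF B(1)] f])
    \<comment> \<open>\<open>U 0\<close> takes the top eigenspace of \<open>B\<close> to that of the
      summand with index 0, which the summand with index 1 annihilates; the adjoint of
      \<open>U 1\<close> brings it into the kernel of \<open>B\<close>.\<close>
    show "(U 1)\<^sup>\<star> o\<^sub>L U 0 \<in> M" by (intro M_compose M_hadj U)
    show "x = 0" if "((U 1)\<^sup>\<star> o\<^sub>L U 0) x = 0" for x
      using that U_norm(2)[of 1 "U 0 x"] U_norm(1)[of 0 x] by simp
    show "B (((U 1)\<^sup>\<star> o\<^sub>L U 0) x) = 0" if "top_eig B x = x" for x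
    proof (cases "norm B = 0")
      case True
      then show ?thesis by simp
    next
      case False
      have Bx: "B x = norm B *\<^sub>R x" using that by (simp add: top_eig_eq_iff)
      obtain R where R: "pos_op R" "X 0 = U 0 o\<^sub>L R" "R o\<^sub>L R = B" using X(3) by blast
      \<comment> \<open>\<open>U 0 x\<close> is exhibited, up to the factor \<open>norm B\<close>,
        as an image under \<open>X 0\<close>, the form in which the facts on equivalent copies
        apply.\<close>
      have UB: "X 0 (R x) = norm B *\<^sub>R U 0 x"
        using R(3) Bx by (simp add: R(2)) (metis blinfun_apply_blinfun_compose blinfun.scaleR_right)
      have "B (R x) = norm B *\<^sub>R R x"
        using R(3) Bx by (metis blinfun_apply_blinfun_compose blinfun.scaleR_right)
      from X.eigenvector_of_summand(2)[OF eq X.eigenvector_image[OF this, of 0], of 1]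
      have "(X 1)\<^sup>\<star> (norm B *\<^sub>R U 0 x) = 0" by (simp add: UB)
      then have "(X 1)\<^sup>\<star> (U 0 x) = 0" using False by (simp add: blinfun.scaleR_right)
      then show ?thesis by (simp add: X(2))
    qed
  qed
qed

text \<open>The terms of the convergent sum at \<open>x\<close> tend to 0, whereas a left inverse
  \<open>T\<close> of \<open>B\<close> would give each of them norm at least
  \<open>norm x / norm T\<close>.\<close>

lemma not_left_invertible: "T o\<^sub>L B \<noteq> id_blinfun"
proof
  assume TB: "T o\<^sub>L B = id_blinfun"
  have "x = 0" for x :: 'a
  proof -
    have "(\<lambda>j. U j (B ((U j)\<^sup>\<star> x))) \<longlonglongrightarrow> 0"
      using sums_summable[OF sums] by (rule summable_LIMSEQ_zero)
    then have "(\<lambda>j. norm (U j (B ((U j)\<^sup>\<star> x)))) \<longlonglongrightarrow> 0" by (rule tendsto_norm_zero)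
    then have lim: "(\<lambda>j. norm T * norm (U j (B ((U j)\<^sup>\<star> x)))) \<longlonglongrightarrow> norm T * 0"
      by (intro tendsto_mult tendsto_const)
    have "norm x \<le> norm T * norm (U j (B ((U j)\<^sup>\<star> x)))" for j
    proof -
      have "T (B ((U j)\<^sup>\<star> x)) = (U j)\<^sup>\<star> x"
        using TB by (metis blinfun_apply_blinfun_compose id_blinfun.rep_eq)
      then have "norm x = norm (T (B ((U j)\<^sup>\<star> x)))" by (simp add: U_norm)
      also have "\<dots> \<le> norm T * norm (B ((U j)\<^sup>\<star> x))" by (rule norm_blinfun)
      finally show ?thesis by (simp add: U_norm)
    qed
    then have "norm x \<le> norm T * 0" by (intro LIMSEQ_le_const[OF lim]) auto
    then show "x = 0" by simp
  qed
  then have "id_blinfun = (0 :: 'a op)" by (intro blinfun_eqI) metis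
  then show False using infinite fin_0 by simp
qed

text \<open>If \<open>B\<close> is bounded below off a finite projection, then the range projections \<open>D j\<close> of the
  summands have uniformly finite complements, so they all meet a large enough finite projection
  in a part of fixed size.\<close>

theorem not_bounded_below_off_fin:
  assumes P: "fin P" and c: "c > 0" and below: "\<And>x. P x = 0 \<Longrightarrow> c * norm x \<le> norm (B x)"
    and e: "fin e" "e \<noteq> 0"
  shows False
proof -
  have Pp: "P \<in> projs" and ep: "e \<in> projs" using P e fin_projs by blast+
  define q where "q = id_blinfun - P"
  have q: "q \<in> projs" unfolding q_def by (rule projs_compl[OF Pp])
  have qx: "q x = x \<longleftrightarrow> P x = 0" for x by (auto simp: q_def blinfun.diff_left)
  have YM: "B o\<^sub>L q \<in> M" using B q projsD by (intro M_compose) auto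
  have Yq: "(B o\<^sub>L q) o\<^sub>L q = B o\<^sub>L q" using projs_compose_self[OF q] by (simp add: blinfun_compose_assoc)
  have "c\<^sup>2 * (norm x)\<^sup>2 \<le> (norm ((B o\<^sub>L q) x))\<^sup>2" if "q x = x" for x
  proof -
    have "(c * norm x)\<^sup>2 \<le> (norm (B x))\<^sup>2" using below[of x] that qx c by (intro power_mono) auto
    then show ?thesis using that by (simp add: power_mult_distrib)
  qed
  then obtain E where E: "E \<in> projs" "\<And>z. c\<^sup>2 * (norm (E z))\<^sup>2 \<le> (norm ((B o\<^sub>L q)\<^sup>\<star> z))\<^sup>2"
    "\<And>z. E z = 0 \<longleftrightarrow> (B o\<^sub>L q)\<^sup>\<star> z = 0"
    using bounded_below_range[OF YM q Yq, of "c\<^sup>2"] c by (metis zero_less_power)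
  have Yadj: "(B o\<^sub>L q)\<^sup>\<star> z = q (B z)" for z
    by (simp add: projs_hadj[OF q] pos_op_hadj[OF B(2)])
  have E2: "c\<^sup>2 * (norm (E z))\<^sup>2 \<le> (norm (q (B z)))\<^sup>2" for z using E(2)[of z] unfolding Yadj .
  have E3: "E z = 0 \<longleftrightarrow> q (B z) = 0" for z using E(3)[of z] unfolding Yadj .
  have EB: "c\<^sup>2 * (norm (E z))\<^sup>2 \<le> norm B * inner z (B z)" for z
  proof -
    have "c\<^sup>2 * (norm (E z))\<^sup>2 \<le> (norm (q (B z)))\<^sup>2" by (rule E2)
    also have "\<dots> \<le> (norm (B z))\<^sup>2" using is_proj_norm_le[OF projsD(2)[OF q]] by (intro power_mono) auto
    also have "\<dots> \<le> norm B * inner z (B z)" using pos_op_norm_le[OF B(2), of z] by (simp add: inner_commute)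
    finally show ?thesis .
  qed
  \<comment> \<open>A vector off \<open>P\<close> and orthogonal to the range of
    \<open>B o\<^sub>L q\<close> has vanishing form for \<open>B\<close>, so \<open>B\<close> kills
    it, and the lower bound makes it 0.\<close>
  have EP: "id_blinfun - E \<preceq> P"
  proof (rule msub_if_meet_zero[OF projs_compl[OF E(1)] Pp])
    fix x assume x: "(id_blinfun - E) x = x" "P x = 0"
    then have "q (B x) = 0" using E3[of x] by (simp add: blinfun.diff_left)
    then have "inner (q x) (B x) = 0" using is_proj_inner[OF projsD(2)[OF q], of x "B x"] by simp
    moreover have "q x = x" using x(2) qx by blast
    ultimately have "B x = 0" using pos_op_zero_if_inner_zero[OF B(2)] by (simp add: inner_commute)
    then show "x = 0" using below[OF x(2)] c by (simp add: mult_le_0_iff)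
  qed
  define D where "D j = conj (U j) E" for j
  have Dp: "D j \<in> projs" for j
    unfolding D_def using conj_isometry(1)[OF U(1,2) E(1)] by simp
  have DP: "id_blinfun - D j \<preceq> P" for j
  proof -
    have "id_blinfun - D j = conj (U j) (id_blinfun - E)"
      by (simp add: D_def conj_def blinfun_compose_simps U(3))
    also have "\<dots> \<preceq> id_blinfun - E" using conj_isometry(2)[OF U(1,2) projs_compl[OF E(1)]] by simp
    finally show ?thesis using EP msub_trans by blast
  qed
  \<comment> \<open>The complement of each \<open>D j\<close> embeds into \<open>P\<close>, so the
    additional copy of \<open>e\<close> is what every meet \<open>F j\<close> must contain up to
    equivalence.\<close>
  define Q where "Q = P \<oplus> e"
  have fQ: "fin Q" unfolding Q_def by (rule fin_dsum[OF P e(1)])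
  have Qp: "Q \<in> projs" using fQ fin_projs by blast
  define F where "F j = meet Q (D j)" for j
  have Fp: "F j \<in> projs" for j unfolding F_def by (intro meet_projs Qp Dp)
  have eF: "e \<preceq> F j" for j
  proof (rule ccontr)
    assume ne: "\<not> e \<preceq> F j"
    then have "F j \<preceq> e" using comparison[OF ep Fp] by blast
    then obtain r where r: "r \<in> projs" "e o\<^sub>L r = r" "F j \<preceq> r" "r \<preceq> F j"
      using msubE[OF _ Fp] by blast
    \<comment> \<open>If \<open>F j\<close> were equivalent to a part \<open>r\<close> of
      \<open>e\<close>, then \<open>Q\<close>, the sum of \<open>F j\<close> and a projection
      \<open>g\<close> that embeds into \<open>P\<close>, would embed into
      \<open>P \<oplus> r\<close>; by finiteness nothing is left of \<open>e - r\<close>.\<close>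
    define g where "g = Q - F j"
    have QF: "Q o\<^sub>L F j = F j" unfolding F_def by (rule meet_le[OF Qp Dp])
    have g: "g \<in> projs" unfolding g_def by (rule projs_diff[OF Qp Fp QF])
    have "g \<preceq> id_blinfun - D j"
    proof (rule msub_if_meet_zero[OF g projs_compl[OF Dp]])
      fix x assume x: "g x = x" "(id_blinfun - D j) x = 0"
      have "Q o\<^sub>L g = g" using QF projs_compose_self[OF Qp] by (simp add: g_def blinfun_compose_simps)
      then have "Q x = x" using x(1) by (metis blinfun_apply_blinfun_compose)
      moreover have "D j x = x" using x(2) by (simp add: blinfun.diff_left)
      ultimately have "F j x = x" unfolding F_def using meet_eq_iff[OF Qp Dp] by blast
      then show "x = 0" using x(1) \<open>Q x = x\<close> by (simp add: g_def blinfun.diff_left)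
    qed
    then have gP: "g \<preceq> P" using DP msub_trans by blast
    define h where "h = e - r"
    have h: "h \<in> projs" unfolding h_def by (rule projs_diff[OF ep r(1,2)])
    have rh: "r o\<^sub>L h = 0"
      using projs_le_sym[OF r(1) ep] r(2) projs_compose_self[OF r(1)] by (simp add: h_def blinfun_compose_simps)
    note [trans] = msub_trans
    have "Q \<preceq> g \<oplus> F j" using add_msub_dsum[OF g Fp, of j] by (simp add: g_def)
    also have "\<dots> \<preceq> P \<oplus> r" using r gP by (intro dsum_mono g Fp Pp)
    finally have QPr: "Q \<preceq> P \<oplus> r" .
    have "(P \<oplus> r) \<oplus> h \<preceq> P \<oplus> (r \<oplus> h)" by (intro dsum_assoc Pp r h)
    also have "\<dots> \<preceq> P \<oplus> (r + h)"
      by (intro dsum_mono Pp dsum_projs r h projs_add rh msub_refl dsum_msub_add)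
    also have "P \<oplus> (r + h) = Q" by (simp add: h_def Q_def)
    finally have "(P \<oplus> r) \<oplus> h \<preceq> P \<oplus> r" using QPr msub_trans by blast
    moreover have "fin (P \<oplus> r)" by (rule fin_dsum[OF P fin_le[OF e(1) r(1,2)]])
    ultimately have "h = 0" using fin_absorb h by blast
    then show False using ne r(4) by (simp add: h_def)
  qed
  show False
  proof (rule no_summable_copies[OF fQ ep e(2) Fp eF])
    show "1 * norm x \<le> norm (Q x)" if "F j x = x" for j x
      using that meet_eq_iff[OF Qp Dp] by (simp add: F_def)
    show "(\<Sum>j<n. (norm (F j x))\<^sup>2) \<le> norm B * norm A / c\<^sup>2 * (norm x)\<^sup>2" for n x
    proof -
      have FD: "norm (F j x) \<le> norm (E ((U j)\<^sup>\<star> x))" for j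
      proof -
        have "D j o\<^sub>L F j = F j" unfolding F_def by (rule meet_le[OF Qp Dp])
        then have "F j (D j x) = F j x"
          using projs_le_sym[OF Fp Dp] by (metis blinfun_apply_blinfun_compose)
        then have "norm (F j x) \<le> norm (D j x)" using is_proj_norm_le[OF projsD(2)[OF Fp], of j "D j x"] by simp
        then show ?thesis by (simp add: D_def conj_def U_norm)
      qed
      have "c\<^sup>2 * (\<Sum>j<n. (norm (F j x))\<^sup>2) \<le> (\<Sum>j<n. norm B * inner ((U j)\<^sup>\<star> x) (B ((U j)\<^sup>\<star> x)))"
        unfolding sum_distrib_left
      proof (rule sum_mono)
        fix j
        have "c\<^sup>2 * (norm (F j x))\<^sup>2 \<le> c\<^sup>2 * (norm (E ((U j)\<^sup>\<star> x)))\<^sup>2"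
          using FD by (intro mult_left_mono power_mono) auto
        also have "\<dots> \<le> norm B * inner ((U j)\<^sup>\<star> x) (B ((U j)\<^sup>\<star> x))" by (rule EB)
        finally show "c\<^sup>2 * (norm (F j x))\<^sup>2 \<le> norm B * inner ((U j)\<^sup>\<star> x) (B ((U j)\<^sup>\<star> x))" .
      qed
      also have "\<dots> \<le> norm B * inner x (A x)"
        unfolding sum_distrib_left[symmetric] by (intro mult_left_mono inner_sum_le) auto
      also have "\<dots> \<le> norm B * (norm A * (norm x)\<^sup>2)"
        using inner_le_norm_op[of A x] by (intro mult_left_mono) (auto simp: inner_commute)
      finally show ?thesis using c by (simp add: field_simps)
    qed
  qed simp
qed

end

section \<open>Spectral measures\<close>

subsection \<open>Complex-linear operators\<close>

lemma scaleC_one: "1 *\<^sub>C x = (x :: 'a::complex_hilbert)"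
  using scaleC_of_real[of 1 x] by simp

lemma inner_scaleC: "inner (c *\<^sub>C x) y = inner x (cnj c *\<^sub>C (y :: 'a::complex_hilbert))"
proof -
  have "cinner x (cnj c *\<^sub>C y) = cnj (cnj c * cinner y x)"
    using cinner_commute[of x "cnj c *\<^sub>C y"] by (simp add: cinner_scaleC_left)
  also have "\<dots> = cinner (c *\<^sub>C x) y"
    using cinner_commute[of x y] by (simp add: cinner_scaleC_left)
  finally show ?thesis by (metis Re_cinner)
qed

text \<open>The real inner product determines the complex one: the scalars 1 and
  \<open>- \<i>\<close> extract the real and the imaginary part.\<close>

lemma cinner_eqI:
  fixes x y x' y' :: "'a::complex_hilbert"
  assumes "\<And>c. inner (c *\<^sub>C x) y = inner (c *\<^sub>C x') y'"
  shows "cinner x y = cinner x' y'"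
proof (rule complex_eqI)
  show "Re (cinner x y) = Re (cinner x' y')" using assms[of 1] by (simp add: scaleC_one Re_cinner)
  show "Im (cinner x y) = Im (cinner x' y')"
    using assms[of "- \<i>"] by (simp add: cinner_scaleC_left flip: Re_cinner)
qed

lemma bounded_opsD: "T \<in> bounded_ops \<Longrightarrow> T (c *\<^sub>C x) = c *\<^sub>C T x"
  by (simp add: bounded_ops_def)

lemma hadj_bounded_ops:
  fixes T :: "'a::complex_hilbert op"
  assumes "T \<in> bounded_ops"
  shows "T\<^sup>\<star> \<in> bounded_ops"
proof -
  have "T\<^sup>\<star> (c *\<^sub>C x) = c *\<^sub>C T\<^sup>\<star> x" for c x
  proof -
    have "inner u (T\<^sup>\<star> (c *\<^sub>C x)) = inner u (c *\<^sub>C T\<^sup>\<star> x)" for u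
    proof -
      have "inner u (T\<^sup>\<star> (c *\<^sub>C x)) = inner (T u) (c *\<^sub>C x)" by (simp only: hadj_inner)
      also have "\<dots> = inner (cnj c *\<^sub>C T u) x" using inner_scaleC[of "cnj c" "T u" x] by simp
      also have "\<dots> = inner (T (cnj c *\<^sub>C u)) x" by (simp only: bounded_opsD[OF assms])
      also have "\<dots> = inner (cnj c *\<^sub>C u) (T\<^sup>\<star> x)" by (rule hadj_inner)
      also have "\<dots> = inner u (c *\<^sub>C T\<^sup>\<star> x)" using inner_scaleC[of "cnj c"] by simp
      finally show ?thesis .
    qed
    then have "\<forall>u. inner u (T\<^sup>\<star> (c *\<^sub>C x)) = inner u (c *\<^sub>C T\<^sup>\<star> x)" by blast
    then show ?thesis by (simp only: vector_eq_ldot)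
  qed
  then show ?thesis by (simp add: bounded_ops_def)
qed

lemma cinner_hadj:
  fixes T :: "'a::complex_hilbert op"
  assumes "T \<in> bounded_ops"
  shows "cinner (T x) y = cinner x (T\<^sup>\<star> y)"
  by (rule cinner_eqI) (simp add: hadj_inner flip: bounded_opsD[OF assms])

text \<open>For complex-linear \<open>T\<close> the real adjoint satisfies the complex identity, and
  every solution of that identity solves its real part, which determines the adjoint.\<close>

lemma adj_eq_hadj:
  fixes T :: "'a::complex_hilbert op"
  assumes "T \<in> bounded_ops"
  shows "T\<^sup>\<dagger> = T\<^sup>\<star>"
  unfolding adj_def
proof (rule the_equality)
  show "\<forall>x y. cinner (T x) y = cinner x (T\<^sup>\<star> y)" using cinner_hadj[OF assms] by blast
  fix S :: "'a op" assume S: "\<forall>x y. cinner (T x) y = cinner x (S y)"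
  have "T\<^sup>\<star> = S"
  proof (rule hadjI)
    show "inner (T x) y = inner x (S y)" for x y using S Re_cinner by metis
  qed
  then show "S = T\<^sup>\<star>" by simp
qed

lemma is_projection_iff:
  fixes P :: "'a::complex_hilbert op"
  shows "is_projection P \<longleftrightarrow> P \<in> bounded_ops \<and> is_proj P"
  by (auto simp: is_projection_def is_proj_iff adj_eq_hadj)

lemma scalar_op_commute_iff:
  fixes T :: "'a::complex_hilbert op"
  shows "T \<in> bounded_ops \<longleftrightarrow> (\<forall>c. scalar_op c o\<^sub>L T = T o\<^sub>L scalar_op c)"
proof
  assume "T \<in> bounded_ops"
  then show "\<forall>c. scalar_op c o\<^sub>L T = T o\<^sub>L scalar_op c"
    by (intro allI blinfun_eqI) (simp add: bounded_opsD)
next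
  assume "\<forall>c. scalar_op c o\<^sub>L T = T o\<^sub>L scalar_op c"
  then have "T (c *\<^sub>C x) = c *\<^sub>C T x" for c x
    by (metis blinfun_apply_blinfun_compose scalar_op_apply)
  then show "T \<in> bounded_ops" by (simp add: bounded_ops_def)
qed

lemma scalar_op_hadj: "(scalar_op c :: 'a::complex_hilbert op)\<^sup>\<star> = scalar_op (cnj c)"
  by (rule hadjI) (simp add: inner_scaleC)

lemma projection_onto_eq:
  fixes P :: "'a::complex_hilbert op"
  assumes "P \<in> bounded_ops" "is_proj P" "range (blinfun_apply P) = S"
  shows "projection_onto S = P"
  unfolding projection_onto_def using assms
  by (intro the_equality) (auto simp: is_projection_iff intro: is_proj_eq_rangeI)

lemma cinner_pos_op:
  fixes B :: "'a::complex_hilbert op"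
  assumes "B \<in> bounded_ops" "pos_op B"
  shows "cinner (B x) x = complex_of_real (inner x (B x))"
proof (rule complex_eqI)
  have "cinner (B x) x = cnj (cinner (B x) x)"
    using cinner_hadj[OF assms(1), of x x] pos_op_hadj[OF assms(2)] cinner_commute[of x "B x"] by simp
  from arg_cong[OF this, of Im] show "Im (cinner (B x) x) = Im (complex_of_real (inner x (B x)))" by simp
  show "Re (cinner (B x) x) = Re (complex_of_real (inner x (B x)))"
    by (simp add: Re_cinner inner_commute)
qed

text \<open>A complex quadratic form with real values is symmetric by polarization; the real part of
  the symmetry comes from evaluating at \<open>x + \<i> *\<^sub>C y\<close>.\<close>

lemma pos_opI_complex:
  fixes A :: "'a::complex_hilbert op"
  assumes "A \<in> bounded_ops" "\<And>x. cinner (A x) x \<in> \<real>\<^sub>\<ge>\<^sub>0"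
  shows "pos_op A"
proof -
  have im: "Im (cinner (A x) x) = 0" and re: "0 \<le> inner (A x) x" for x
    using assms(2)[of x] by (auto simp: complex_nonneg_Reals_iff Re_cinner)
  have add: "cinner u (v + w) = cinner u v + cinner u w" for u v w :: 'a
    using cinner_commute[of u "v + w"] cinner_commute[of u v] cinner_commute[of u w]
    by (simp add: cinner_add_left)
  have scale: "cinner u (c *\<^sub>C v) = cnj c * cinner u v" for u v :: 'a and c
    using cinner_commute[of u "c *\<^sub>C v"] cinner_commute[of u v] by (simp add: cinner_scaleC_left)
  have "inner (A x) y = inner x (A y)" for x y
  proof -
    have "Im (cinner (A (x + \<i> *\<^sub>C y)) (x + \<i> *\<^sub>C y)) = 0" by (rule im)
    then have "Re (cinner (A x) y) = Re (cinner (A y) x)"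
      using im[of x] im[of y]
      by (simp add: blinfun.add_right bounded_opsD[OF assms(1)] add cinner_add_left scale cinner_scaleC_left)
    then show ?thesis by (simp add: Re_cinner inner_commute)
  qed
  then show ?thesis using re by (simp add: pos_op_def inner_commute)
qed

subsection \<open>Existence\<close>

text \<open>The increments of \<open>H\<close> are of second order: after cutting the interval into
  \<open>n + 1\<close> equal steps, the increments of \<open>g\<close> telescope and leave a total
  of at most \<open>(b - a) * (g b - g a) / real (Suc n)\<close>.\<close>

lemma telescoping_zero:
  fixes H g :: "real \<Rightarrow> real"
  assumes ab: "a \<le> b"
    and H: "\<And>s t. a \<le> s \<Longrightarrow> s \<le> t \<Longrightarrow> t \<le> b \<Longrightarrow> \<bar>H t - H s\<bar> \<le> (t - s) * (g t - g s)"
  shows "H b = H a"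
proof -
  have bound: "\<bar>H b - H a\<bar> \<le> (b - a) * (g b - g a) / real (Suc n)" for n
  proof -
    define h where "h = (b - a) / real (Suc n)"
    have h0: "h \<ge> 0" using ab by (simp add: h_def)
    have hn: "h * real (Suc n) = b - a" by (simp add: h_def)
    define p where "p i = a + real i * h" for i
    have pS: "p (Suc i) = p i + h" for i by (simp add: p_def algebra_simps)
    have pb: "p (Suc n) = b" using hn by (simp add: p_def mult.commute)
    have "\<bar>H (p i) - H a\<bar> \<le> h * (g (p i) - g a)" if "i \<le> Suc n" for i
      using that
    proof (induction i)
      case 0
      then show ?case by (simp add: p_def)
    next
      case (Suc i)
      have "real (Suc i) * h \<le> real (Suc n) * h" using Suc.prems h0 by (intro mult_right_mono) auto
      then have le: "p (Suc i) \<le> b" using pb by (simp add: p_def)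
      have "a \<le> p i" using h0 by (simp add: p_def)
      then have "\<bar>H (p (Suc i)) - H (p i)\<bar> \<le> h * (g (p (Suc i)) - g (p i))"
        using H[of "p i" "p (Suc i)"] h0 le by (simp add: pS)
      then show ?case using Suc by (simp add: algebra_simps)
    qed
    from this[of "Suc n"] show ?thesis by (simp add: pb h_def)
  qed
  have "\<bar>H b - H a\<bar> \<le> 0"
  proof (rule LIMSEQ_le_const)
    have "(\<lambda>n. (b - a) * (g b - g a) * inverse (real (Suc n))) \<longlonglongrightarrow> (b - a) * (g b - g a) * 0"
      by (intro tendsto_mult tendsto_const LIMSEQ_inverse_real_of_nat)
    then show "(\<lambda>n. (b - a) * (g b - g a) / real (Suc n)) \<longlonglongrightarrow> 0" by (simp add: divide_inverse)
    show "\<exists>N. \<forall>n\<ge>N. \<bar>H b - H a\<bar> \<le> (b - a) * (g b - g a) / real (Suc n)" using bound by blast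
  qed
  then show ?thesis by simp
qed

text \<open>\<open>F t\<close> plays the role of the spectral projection for \<open>{..t}\<close>;
  the strict inequality off \<open>F t\<close> puts eigenvectors at \<open>t\<close> into
  \<open>F t\<close> and makes the family right continuous.\<close>

locale spectral_family =
  fixes B :: "'a::real_hilbert op" and F :: "real \<Rightarrow> 'a op"
  assumes B: "pos_op B"
    and F_proj: "is_proj (F t)"
    and F_comm: "U o\<^sub>L B = B o\<^sub>L U \<Longrightarrow> U o\<^sub>L F t = F t o\<^sub>L U"
    and F_le: "F t x = x \<Longrightarrow> inner x (B x) \<le> t * (norm x)\<^sup>2"
    and F_gt: "F t x = 0 \<Longrightarrow> x \<noteq> 0 \<Longrightarrow> t * (norm x)\<^sup>2 < inner x (B x)"
begin

lemma FB: "F t o\<^sub>L B = B o\<^sub>L F t"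
  using F_comm[of B t] by simp

lemma FB_apply: "F t (B x) = B (F t x)"
  using FB by (metis blinfun_apply_blinfun_compose)

lemma FF_apply: "F s (F t x) = F t (F s x)"
  using F_comm[OF FB, of s t] by (metis blinfun_apply_blinfun_compose)

lemma F_mono:
  assumes "s \<le> t"
  shows "F t (F s x) = F s x"
proof -
  define y where "y = F s x - F t (F s x)"
  have 1: "F s y = y" by (simp add: y_def blinfun.diff_right is_proj_idem[OF F_proj] FF_apply[of s t])
  have 2: "F t y = 0" by (simp add: y_def blinfun.diff_right is_proj_idem[OF F_proj])
  have "y = 0"
  proof (rule ccontr)
    assume "y \<noteq> 0"
    then have "t * (norm y)\<^sup>2 < s * (norm y)\<^sup>2" using F_gt[OF 2] F_le[OF 1] by linarith
    moreover have "s * (norm y)\<^sup>2 \<le> t * (norm y)\<^sup>2" using assms by (intro mult_right_mono) auto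
    ultimately show False by simp
  qed
  then show ?thesis by (simp add: y_def)
qed

lemma F_neg: "t < 0 \<Longrightarrow> F t x = 0"
proof (rule ccontr)
  assume "t < 0" "F t x \<noteq> 0"
  then have "t * (norm (F t x))\<^sup>2 < 0" by (simp add: mult_less_0_iff)
  moreover have "inner (F t x) (B (F t x)) \<le> t * (norm (F t x))\<^sup>2"
    by (rule F_le) (rule is_proj_idem[OF F_proj])
  ultimately show False using pos_op_nonneg[OF B, of "F t x"] by (simp add: inner_commute)
qed

lemma F_top: "norm B \<le> t \<Longrightarrow> F t x = x"
proof (rule ccontr)
  assume t: "norm B \<le> t" "F t x \<noteq> x"
  define y where "y = x - F t x"
  have "F t y = 0" "y \<noteq> 0" using t by (simp_all add: y_def blinfun.diff_right is_proj_idem[OF F_proj])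
  then have "t * (norm y)\<^sup>2 < inner y (B y)" by (rule F_gt)
  also have "\<dots> \<le> norm B * (norm y)\<^sup>2" using inner_le_norm_op[of B y] by (simp add: inner_commute)
  also have "\<dots> \<le> t * (norm y)\<^sup>2" using t by (intro mult_right_mono) auto
  finally show False by simp
qed

definition dist_fun :: "'a \<Rightarrow> real \<Rightarrow> real" where "dist_fun x t = inner x (F t x)"

lemma dist_fun_norm: "dist_fun x t = (norm (F t x))\<^sup>2"
  by (simp add: dist_fun_def is_proj_inner_self[OF F_proj])

lemma F_diff_norm:
  assumes "s \<le> t"
  shows "(norm (F t x - F s x))\<^sup>2 = dist_fun x t - dist_fun x s"
proof -
  have "F s (F t x) = F s x" using F_mono[OF assms] FF_apply by metis
  then have "inner (F t x) (F s x) = inner x (F s x)" "inner (F s x) (F t x) = inner x (F s x)"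
    using is_proj_inner[OF F_proj, of t x "F s x"] F_mono[OF assms] by (simp_all add: inner_commute)
  then show ?thesis
    by (simp add: power2_norm_eq_inner inner_diff_left inner_diff_right)
      (simp add: dist_fun_def is_proj_inner_self[OF F_proj] flip: power2_norm_eq_inner)
qed

lemma dist_fun_mono: "s \<le> t \<Longrightarrow> dist_fun x s \<le> dist_fun x t"
  using F_diff_norm[of s t x] by (smt (verit) zero_le_power2)

text \<open>A nonzero vector in every \<open>F (t + 1 / real (Suc n))\<close> but off
  \<open>F t\<close> would have form both at most and strictly above \<open>t\<close> times its
  squared norm; so the limit of \<open>F (r n) x\<close> is \<open>F t x\<close>.\<close>

lemma dist_fun_right_limit: "(\<lambda>n. dist_fun x (t + 1 / real (Suc n))) \<longlonglongrightarrow> dist_fun x t"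
proof -
  define r where "r n = t + 1 / real (Suc n)" for n
  have rd: "r n \<le> r m" if "m \<le> n" for m n using that by (simp add: r_def frac_le)
  have rt: "t \<le> r n" for n by (simp add: r_def)
  \<comment> \<open>The projections decrease along \<open>r\<close>; the sign turns them into an
    increasing sequence.\<close>
  have "\<exists>T. strong_lim (\<lambda>n. - F (r n)) T"
  proof (rule monotone_strong_lim)
    show "(- F (r n))\<^sup>\<star> = - F (r n)" for n
      using is_proj_hadj[OF F_proj] hadj_diff[of 0 "F (r n)"] by simp
    show "inner x (blinfun_apply (- F (r n)) x) \<le> inner x (blinfun_apply (- F (r (Suc n))) x)" for n x
      using dist_fun_mono[OF rd[of n "Suc n"], of x] by (simp add: dist_fun_def blinfun.minus_left)
    show "inner x (blinfun_apply (- F (r n)) x) \<le> 0 * (norm x)\<^sup>2" for n x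
      by (simp add: blinfun.minus_left is_proj_inner_self[OF F_proj])
  qed
  then obtain T where T: "strong_lim (\<lambda>n. - F (r n)) T" by blast
  define z where "z = - T x"
  have z: "(\<lambda>n. F (r n) x) \<longlonglongrightarrow> z"
  proof -
    have "(\<lambda>n. - F (r n) x) \<longlonglongrightarrow> T x" using T by (simp add: strong_lim_def blinfun.minus_left)
    from tendsto_minus[OF this] show ?thesis by (simp add: z_def)
  qed
  have Fz: "F (r m) z = z" for m
  proof (rule LIMSEQ_unique)
    show "(\<lambda>n. F (r m) (F (r n) x)) \<longlonglongrightarrow> F (r m) z"
      by (intro bounded_linear.tendsto[OF blinfun.bounded_linear_right] z)
    show "(\<lambda>n. F (r m) (F (r n) x)) \<longlonglongrightarrow> z"
    proof (rule Lim_transform_eventually[OF z])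
      show "\<forall>\<^sub>F n in sequentially. F (r n) x = F (r m) (F (r n) x)"
        using F_mono[OF rd] by (auto simp: eventually_at_top_linorder intro!: exI[of _ m])
    qed
  qed
  define y where "y = z - F t z"
  have Fty: "F t y = 0" by (simp add: y_def blinfun.diff_right is_proj_idem[OF F_proj])
  have Fy: "F (r n) y = y" for n
    by (simp add: y_def blinfun.diff_right Fz FF_apply[of "r n" t])
  have "y = 0"
  proof (rule ccontr)
    assume "y \<noteq> 0"
    then have "t * (norm y)\<^sup>2 < inner y (B y)" by (rule F_gt[OF Fty])
    moreover have "inner y (B y) \<le> t * (norm y)\<^sup>2"
    proof (rule LIMSEQ_le_const)
      have "(\<lambda>n. (t + inverse (real (Suc n))) * (norm y)\<^sup>2) \<longlonglongrightarrow> (t + 0) * (norm y)\<^sup>2"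
        by (intro tendsto_intros LIMSEQ_inverse_real_of_nat)
      then show "(\<lambda>n. r n * (norm y)\<^sup>2) \<longlonglongrightarrow> t * (norm y)\<^sup>2" by (simp add: r_def inverse_eq_divide)
      show "\<exists>N. \<forall>n\<ge>N. inner y (B y) \<le> r n * (norm y)\<^sup>2" using F_le[OF Fy] by blast
    qed
    ultimately show False by simp
  qed
  then have "z = F t z" by (simp add: y_def)
  also have "F t z = F t x"
  proof (rule LIMSEQ_unique)
    show "(\<lambda>n. F t (F (r n) x)) \<longlonglongrightarrow> F t z"
      by (intro bounded_linear.tendsto[OF blinfun.bounded_linear_right] z)
    have "F t (F (r n) x) = F t x" for n using F_mono[OF rt, of n x] FF_apply by metis
    then show "(\<lambda>n. F t (F (r n) x)) \<longlonglongrightarrow> F t x" by simp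
  qed
  finally have "z = F t x" .
  then show ?thesis
    using tendsto_inner[OF tendsto_const z, of x] by (simp add: dist_fun_def r_def)
qed

lemma dist_fun_continuous: "continuous (at_right t) (dist_fun x)"
  unfolding continuous_within
proof (rule tendstoI)
  fix e :: real assume "e > 0"
  then obtain n where n: "dist (dist_fun x (t + 1 / real (Suc n))) (dist_fun x t) < e"
    using metric_LIMSEQ_D[OF dist_fun_right_limit] by blast
  have "dist (dist_fun x s) (dist_fun x t) < e" if "t < s" "s < t + 1 / real (Suc n)" for s
    using n dist_fun_mono[of t s x] dist_fun_mono[of s "t + 1 / real (Suc n)" x] that
    by (simp add: dist_real_def)
  then show "\<forall>\<^sub>F s in at_right t. dist (dist_fun x s) (dist_fun x t) < e"
    unfolding eventually_at_right_field by (intro exI[of _ "t + 1 / real (Suc n)"]) auto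
qed

abbreviation vmeas :: "'a \<Rightarrow> real measure" where "vmeas x \<equiv> interval_measure (dist_fun x)"

lemma emeasure_Ioc: "a \<le> b \<Longrightarrow> emeasure (vmeas x) {a<..b} = ennreal (dist_fun x b - dist_fun x a)"
  by (rule emeasure_interval_measure_Ioc) (auto simp: dist_fun_mono dist_fun_continuous)

lemma emeasure_atMost: "emeasure (vmeas x) {..t} = ennreal (inner x (F t x))"
proof -
  have "(\<lambda>n. emeasure (vmeas x) {- real (Suc n)<..t}) \<longlonglongrightarrow> emeasure (vmeas x) (\<Union>n. {- real (Suc n)<..t})"
    by (rule Lim_emeasure_incseq) (auto simp: incseq_def)
  moreover have "(\<Union>n. {- real (Suc n)<..t}) = {..t}"
  proof (intro equalityI subsetI)
    fix u assume "u \<in> {..t}"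
    obtain n where "- u < real n" using reals_Archimedean2 by blast
    then have "- real (Suc n) < u" by simp
    then show "u \<in> (\<Union>n. {- real (Suc n)<..t})" using \<open>u \<in> {..t}\<close> by auto
  qed auto
  moreover have "(\<lambda>n. emeasure (vmeas x) {- real (Suc n)<..t}) \<longlonglongrightarrow> ennreal (inner x (F t x))"
  proof (rule tendsto_eventually)
    obtain N where N: "- t < real N" using reals_Archimedean2 by blast
    have "emeasure (vmeas x) {- real (Suc n)<..t} = ennreal (inner x (F t x))" if "n \<ge> N" for n
    proof -
      have "- real (Suc n) \<le> t" using N that by simp
      then show ?thesis by (simp add: emeasure_Ioc) (simp add: dist_fun_def F_neg)
    qed
    then show "\<forall>\<^sub>F n in sequentially. emeasure (vmeas x) {- real (Suc n)<..t} = ennreal (inner x (F t x))"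
      by (auto simp: eventually_at_top_linorder)
  qed
  ultimately show ?thesis using LIMSEQ_unique by metis
qed

lemma emeasure_UNIV: "emeasure (vmeas x) UNIV = ennreal ((norm x)\<^sup>2)"
proof -
  have "(\<lambda>n. emeasure (vmeas x) {..real n}) \<longlonglongrightarrow> emeasure (vmeas x) (\<Union>n. {..real n})"
    by (rule Lim_emeasure_incseq) (auto simp: incseq_def)
  moreover have "(\<Union>n. {..real n}) = UNIV" using real_arch_simple by auto
  moreover have "(\<lambda>n. emeasure (vmeas x) {..real n}) \<longlonglongrightarrow> ennreal ((norm x)\<^sup>2)"
  proof (rule tendsto_eventually)
    obtain N where N: "norm B \<le> real N" using real_arch_simple by blast
    have "emeasure (vmeas x) {..real n} = ennreal ((norm x)\<^sup>2)" if "n \<ge> N" for n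
    proof -
      have "norm B \<le> real n" using N that by simp
      then show ?thesis by (simp add: emeasure_atMost F_top power2_norm_eq_inner)
    qed
    then show "\<forall>\<^sub>F n in sequentially. emeasure (vmeas x) {..real n} = ennreal ((norm x)\<^sup>2)"
      by (auto simp: eventually_at_top_linorder)
  qed
  ultimately show ?thesis using LIMSEQ_unique by metis
qed

section \<open>From Borel sets to projections\<close>

lemma finite_measure_vmeas: "finite_measure (vmeas x)"
  by (rule finite_measureI) (simp add: emeasure_UNIV)

text \<open>Working in the bicommutant of \<open>B\<close> makes every projection of the spectral
  measure commute with whatever commutes with \<open>B\<close>, in particular with the complex
  scalars when \<open>B\<close> is complex-linear.\<close>

definition commB :: "'a op set" where "commB = {U. U o\<^sub>L B = B o\<^sub>L U}"

definition bicommB :: "'a op set" where "bicommB = {T. \<forall>S\<in>commB. S o\<^sub>L T = T o\<^sub>L S}"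

sublocale bicommutant: vn_algebra commB bicommB
proof
  fix S assume "S \<in> commB"
  then have "S o\<^sub>L B = B o\<^sub>L S" by (simp add: commB_def)
  from arg_cong[OF this, of hadj] show "S\<^sup>\<star> \<in> commB" by (simp add: pos_op_hadj[OF B] commB_def)
qed (rule bicommB_def)

lemma projs_commute: "P \<in> bicommutant.projs \<Longrightarrow> U o\<^sub>L B = B o\<^sub>L U \<Longrightarrow> U o\<^sub>L P = P o\<^sub>L U"
  using bicommutant.in_MD[OF bicommutant.projsD(1), of P U] by (simp add: commB_def)

text \<open>\<open>P\<close> is the candidate for the spectral projection of \<open>S\<close>;
  through this relation the countable additivity of the scalar measures is transferred to
  projections.\<close>

definition represents :: "'a op \<Rightarrow> real set \<Rightarrow> bool"
  where "represents P S \<longleftrightarrow> P \<in> bicommutant.projs \<and> (\<forall>x. emeasure (vmeas x) S = ennreal (inner x (P x)))"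

text \<open>For \<open>x = Q y\<close> the set \<open>T\<close> already carries the full mass
  \<open>(norm x)\<^sup>2\<close>, so nothing is left for \<open>S\<close>.\<close>

lemma represents_orthogonal:
  assumes "represents P S" "represents Q T" "S \<in> sets borel" "T \<in> sets borel" "S \<inter> T = {}"
  shows "P o\<^sub>L Q = 0"
proof (rule blinfun_eqI)
  fix y
  have p: "is_proj P" "is_proj Q" using assms bicommutant.projsD by (auto simp: represents_def)
  define x where "x = Q y"
  have Qx: "Q x = x" unfolding x_def by (rule is_proj_idem[OF p(2)])
  have "emeasure (vmeas x) S + emeasure (vmeas x) T = emeasure (vmeas x) (S \<union> T)"
    using assms by (intro plus_emeasure) auto
  also have "\<dots> \<le> emeasure (vmeas x) UNIV" using assms by (intro emeasure_mono) auto
  finally have "ennreal (inner x (P x)) + ennreal (inner x (Q x)) \<le> ennreal ((norm x)\<^sup>2)"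
    using assms by (simp add: represents_def emeasure_UNIV)
  then have "ennreal ((norm (P x))\<^sup>2 + (norm x)\<^sup>2) \<le> ennreal ((norm x)\<^sup>2)"
    by (simp add: Qx is_proj_inner_self[OF p(1)] flip: power2_norm_eq_inner)
  then have "P x = 0" by (simp add: ennreal_le_iff)
  then show "(P o\<^sub>L Q) y = (0 :: 'a op) y" by (simp add: x_def)
qed

lemma represents_union:
  assumes S: "range S \<subseteq> sets borel" "disjoint_family S" and P: "\<And>n. represents (P n) (S n)"
  shows "bicommutant.orth_family P" "represents (bicommutant.osum P) (\<Union>n. S n)"
proof -
  have Pp: "P n \<in> bicommutant.projs" "emeasure (vmeas x) (S n) = ennreal (inner x (P n x))" for n x
    using P by (auto simp: represents_def)
  show o: "bicommutant.orth_family P"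
    unfolding bicommutant.orth_family_def
  proof (intro conjI allI impI Pp)
    fix i j :: nat assume "i \<noteq> j"
    then show "P i o\<^sub>L P j = 0"
      using S by (intro represents_orthogonal[OF P P]) (auto simp: disjoint_family_on_def)
  qed
  have "emeasure (vmeas x) (\<Union>n. S n) = ennreal (inner x (bicommutant.osum P x))" for x
  proof -
    have "emeasure (vmeas x) (\<Union>n. S n) = (\<Sum>n. emeasure (vmeas x) (S n))"
      using S by (intro suminf_emeasure[symmetric]) auto
    also have "\<dots> = (\<Sum>n. ennreal (inner x (P n x)))" by (simp add: Pp)
    also have "\<dots> = ennreal (\<Sum>n. inner x (P n x))"
      using bicommutant.osum_inner_sums[OF o, of x] Pp(1)
      by (intro suminf_ennreal2) (auto simp: sums_iff is_proj_inner_self[OF bicommutant.projsD(2)])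
    also have "(\<Sum>n. inner x (P n x)) = inner x (bicommutant.osum P x)"
      using bicommutant.osum_inner_sums[OF o, of x] by (simp add: sums_iff)
    finally show ?thesis .
  qed
  then show "represents (bicommutant.osum P) (\<Union>n. S n)"
    using bicommutant.osum_projs[OF o] by (simp add: represents_def)
qed

lemma represents_compl:
  assumes "represents P S" "S \<in> sets borel"
  shows "represents (id_blinfun - P) (UNIV - S)"
  unfolding represents_def
proof (intro conjI allI)
  have P: "P \<in> bicommutant.projs" using assms by (simp add: represents_def)
  then show "id_blinfun - P \<in> bicommutant.projs" by (rule bicommutant.projs_compl)
  fix x
  have "emeasure (vmeas x) (UNIV - S) = emeasure (vmeas x) UNIV - emeasure (vmeas x) S"
    using assms emeasure_Diff[of "vmeas x" S UNIV] finite_measure.emeasure_finite[OF finite_measure_vmeas] by auto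
  also have "\<dots> = ennreal ((norm x)\<^sup>2) - ennreal (inner x (P x))"
    using assms by (simp add: represents_def emeasure_UNIV)
  also have "\<dots> = ennreal ((norm x)\<^sup>2 - inner x (P x))"
    by (rule ennreal_minus) (simp add: is_proj_inner_self[OF bicommutant.projsD(2)[OF P]])
  finally show "emeasure (vmeas x) (UNIV - S) = ennreal (inner x ((id_blinfun - P) x))"
    by (simp add: blinfun.diff_left inner_diff_right power2_norm_eq_inner)
qed

text \<open>Half-lines are represented by \<open>F t\<close> and are stable under intersection, and
  representable sets are closed under complements and countable disjoint unions.\<close>

lemma represents_exists:
  assumes "S \<in> sets borel"
  shows "\<exists>P. represents P S"
proof -
  have "sets borel = sigma_sets UNIV (range (\<lambda>a::real. {..a}))"
    by (subst borel_eq_atMost) (rule sets_measure_of, simp)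
  then have S: "S \<in> sigma_sets UNIV (range (\<lambda>a::real. {..a}))" using assms by simp
  have borel: "T \<in> sets borel" if "T \<in> sigma_sets UNIV (range (\<lambda>a::real. {..a}))" for T :: "real set"
    using that \<open>sets borel = _\<close> by simp
  have "Int_stable (range (\<lambda>a::real. {..a}))"
    by (auto simp: Int_stable_def)
  moreover have "range (\<lambda>a::real. {..a}) \<subseteq> Pow UNIV" by simp
  ultimately show ?thesis using S
  proof (induction rule: sigma_sets_induct_disjoint)
    case (basic T)
    then obtain t where t: "T = {..t}" by blast
    have "F t \<in> bicommB" using F_comm by (simp add: bicommB_def commB_def)
    then have "F t \<in> bicommutant.projs" using F_proj by (simp add: bicommutant.projs_def)
    then show ?case using emeasure_atMost t by (auto simp: represents_def)
  next
    case empty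
    have "represents 0 {}" by (simp add: represents_def)
    then show ?case ..
  next
    case (compl T)
    then show ?case using represents_compl borel by blast
  next
    case (union T)
    then obtain P where "\<And>n. represents (P n) (T n)" by metis
    moreover have "range T \<subseteq> sets borel" using union(2) borel by blast
    ultimately show ?case using represents_union(2)[of T P] union(1) by blast
  qed
qed

lemma represents_unique:
  assumes "represents P S" "represents Q S"
  shows "P = Q"
proof (rule selfadjoint_eqI)
  have p: "is_proj P" "is_proj Q" using assms bicommutant.projsD by (auto simp: represents_def)
  show "P\<^sup>\<star> = P" "Q\<^sup>\<star> = Q" using is_proj_hadj p by auto
  fix x
  have "ennreal (inner x (P x)) = ennreal (inner x (Q x))" using assms by (metis represents_def)
  then show "inner (P x) x = inner (Q x) x"
    using is_proj_inner_self[OF p(1), of x] is_proj_inner_self[OF p(2), of x] by simp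
qed

definition spec :: "real set \<Rightarrow> 'a op" where "spec S = (SOME P. represents P S)"

lemma spec: "S \<in> sets borel \<Longrightarrow> represents (spec S) S"
  unfolding spec_def by (rule someI_ex) (rule represents_exists)

lemma spec_eqI: "S \<in> sets borel \<Longrightarrow> represents P S \<Longrightarrow> spec S = P"
  using spec represents_unique by blast

lemma spec_projs: "S \<in> sets borel \<Longrightarrow> spec S \<in> bicommutant.projs"
  using spec by (auto simp: represents_def)

lemma spec_empty: "spec {} = 0"
  by (rule spec_eqI) (auto simp: represents_def)

lemma spec_full:
  assumes "S \<in> sets borel" "\<And>x. emeasure (vmeas x) S = emeasure (vmeas x) UNIV"
  shows "spec S = id_blinfun"
  using assms by (intro spec_eqI) (auto simp: represents_def emeasure_UNIV power2_norm_eq_inner)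

lemma spec_sums:
  assumes S: "range S \<subseteq> sets borel" "disjoint_family S"
  shows "(\<lambda>n. spec (S n) x) sums spec (\<Union>n. S n) x"
proof -
  have r: "represents (spec (S n)) (S n)" for n using spec S by blast
  note u = represents_union[OF S r]
  have "(\<Union>n. S n) \<in> sets borel" using S by blast
  then have "spec (\<Union>n. S n) = bicommutant.osum (\<lambda>n. spec (S n))" using u(2) by (rule spec_eqI)
  then show ?thesis using bicommutant.osum_limit[OF u(1), of x] by (simp add: sums_def)
qed

lemma spec_union:
  assumes "S \<in> sets borel" "T \<in> sets borel" "S \<inter> T = {}"
  shows "spec (S \<union> T) = spec S + spec T"
proof (rule spec_eqI)
  have o: "spec S o\<^sub>L spec T = 0" using spec assms represents_orthogonal by blast
  have p: "is_proj (spec S)" "is_proj (spec T)" using spec_projs assms bicommutant.projsD by blast+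
  show "represents (spec S + spec T) (S \<union> T)"
    unfolding represents_def
  proof (intro conjI allI)
    show "spec S + spec T \<in> bicommutant.projs" using o spec_projs assms by (intro bicommutant.projs_add)
    fix x
    have "emeasure (vmeas x) (S \<union> T) = emeasure (vmeas x) S + emeasure (vmeas x) T"
      using assms by (intro plus_emeasure[symmetric]) auto
    also have "\<dots> = ennreal (inner x (spec S x)) + ennreal (inner x (spec T x))"
      using spec assms by (simp add: represents_def)
    also have "\<dots> = ennreal (inner x ((spec S + spec T) x))"
      by (simp add: blinfun.add_left inner_add_right is_proj_inner_self[OF p(1)] is_proj_inner_self[OF p(2)])
    finally show "emeasure (vmeas x) (S \<union> T) = ennreal (inner x ((spec S + spec T) x))" .
  qed
qed (use assms in auto)

text \<open>Both sets are split along \<open>S \<inter> T\<close>; all mixed products vanish because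
  disjoint sets have orthogonal projections.\<close>

lemma spec_inter:
  assumes "S \<in> sets borel" "T \<in> sets borel"
  shows "spec (S \<inter> T) = spec S o\<^sub>L spec T"
proof -
  have b: "S \<inter> T \<in> sets borel" "S - T \<in> sets borel" "T - S \<in> sets borel" using assms by auto
  have o: "spec U o\<^sub>L spec V = 0" if "U \<in> sets borel" "V \<in> sets borel" "U \<inter> V = {}" for U V
    using spec that represents_orthogonal by blast
  have "(S \<inter> T) \<union> (S - T) = S" "(S \<inter> T) \<union> (T - S) = T" by auto
  then have "spec S = spec (S \<inter> T) + spec (S - T)" "spec T = spec (S \<inter> T) + spec (T - S)"
    using spec_union[OF b(1,2)] spec_union[OF b(1,3)] by auto
  moreover have "spec (S \<inter> T) o\<^sub>L spec (T - S) = 0" "spec (S - T) o\<^sub>L spec (S \<inter> T) = 0"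
    "spec (S - T) o\<^sub>L spec (T - S) = 0"
    using b by (auto intro!: o)
  ultimately show ?thesis
    using bicommutant.projs_compose_self[OF spec_projs[OF b(1)]] by (simp add: blinfun_compose_simps)
qed

text \<open>The lower end -1 instead of 0 keeps a possible atom at 0 inside the half-open
  interval.\<close>

lemma vmeas_bounded: "AE t in vmeas x. t \<in> {-1<..norm B}"
proof (rule AE_I)
  show "{t \<in> space (vmeas x). t \<notin> {-1<..norm B}} \<subseteq> UNIV - {-1<..norm B}" by auto
  have "emeasure (vmeas x) (UNIV - {-1<..norm B}) =
      emeasure (vmeas x) UNIV - emeasure (vmeas x) {-1<..norm B}"
    using emeasure_Diff[of "vmeas x" "{-1<..norm B}" UNIV]
      finite_measure.emeasure_finite[OF finite_measure_vmeas] by auto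
  also have "emeasure (vmeas x) {-1<..norm B} = ennreal ((norm x)\<^sup>2)"
  proof -
    have "(-1 :: real) \<le> norm B" by (rule order_trans[OF _ norm_ge_zero]) simp
    then show ?thesis by (simp add: emeasure_Ioc) (simp add: dist_fun_norm F_neg F_top)
  qed
  finally show "emeasure (vmeas x) (UNIV - {-1<..norm B}) = 0" by (simp add: emeasure_UNIV)
qed simp

text \<open>\<open>H s\<close> compares the integral of \<open>t\<close> over
  \<open>{-1<..s}\<close> with the form of \<open>B\<close> at \<open>F s x\<close>. Over a step
  from \<open>s\<close> to \<open>u\<close> both grow by between \<open>s\<close> and
  \<open>u\<close> times the mass of the step, so their difference falls under
  \<open>telescoping_zero\<close>.\<close>

lemma integral_identity: "(\<integral>t. t \<partial>vmeas x) = inner x (B x)"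
proof -
  interpret finite_measure "vmeas x" by (rule finite_measure_vmeas)
  define b where "b = norm B"
  have b: "-1 \<le> b" unfolding b_def by (rule order_trans[OF _ norm_ge_zero]) simp
  define G where "G s = (\<integral>t. t * indicator {-1<..s} t \<partial>vmeas x)" for s
  define H where "H s = G s - inner (F s x) (B (F s x))" for s
  have int: "integrable (vmeas x) (\<lambda>t. t * indicator {s<..s'} t)" for s s' :: real
    by (rule integrable_const_bound[where B = "\<bar>s\<bar> + \<bar>s'\<bar>"]) (auto split: split_indicator)
  have "H b = H (-1)"
  proof (rule telescoping_zero[OF b])
    fix s u :: real assume su: "-1 \<le> s" "s \<le> u" "u \<le> b"
    define m where "m = dist_fun x u - dist_fun x s"
    have meas: "measure (vmeas x) {s<..u} = m"
      using emeasure_Ioc[OF su(2), of x] dist_fun_mono[OF su(2), of x] by (simp add: m_def measure_def)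
    have m: "(\<integral>t. c * indicator {s<..u} t \<partial>vmeas x) = c * m" for c :: real
      using meas by simp
    have ic: "integrable (vmeas x) (\<lambda>t. c * indicator {s<..u} t)" for c :: real
      by (rule integrable_const_bound[where B = "\<bar>c\<bar>"]) (auto split: split_indicator)
    have "G u - G s = (\<integral>t. t * indicator {-1<..u} t - t * indicator {-1<..s} t \<partial>vmeas x)"
      unfolding G_def by (rule Bochner_Integration.integral_diff[symmetric, OF int int])
    also have "\<dots> = (\<integral>t. t * indicator {s<..u} t \<partial>vmeas x)"
      using su by (intro Bochner_Integration.integral_cong) (auto split: split_indicator)
    finally have Gd: "G u - G s = (\<integral>t. t * indicator {s<..u} t \<partial>vmeas x)" .
    have G1: "s * m \<le> G u - G s"
      unfolding Gd m[symmetric] by (rule integral_mono[OF ic int]) (auto split: split_indicator)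
    have G2: "G u - G s \<le> u * m"
      unfolding Gd m[symmetric] by (rule integral_mono[OF int ic]) (auto split: split_indicator)
    define y where "y = F u x - F s x"
    have sF: "F s (F u x) = F s x" using F_mono[OF su(2)] FF_apply by metis
    have uy: "F u y = y" by (simp add: y_def blinfun.diff_right is_proj_idem[OF F_proj] F_mono[OF su(2)])
    have sy: "F s y = 0" by (simp add: y_def blinfun.diff_right is_proj_idem[OF F_proj] sF)
    have ny: "(norm y)\<^sup>2 = m" unfolding y_def m_def by (rule F_diff_norm[OF su(2)])
    have y1: "inner y (B y) \<le> u * m" using F_le[OF uy] ny by simp
    have y2: "s * m \<le> inner y (B y)" using F_gt[OF sy] ny by (cases "y = 0") auto
    \<comment> \<open>\<open>F s x\<close> and \<open>y\<close> lie in orthogonal subspaces reduced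
      by \<open>B\<close>, so the cross terms vanish.\<close>
    have c1: "inner (F s x) (B y) = 0"
      using is_proj_inner[OF F_proj, of s x "B y"] sy by (simp add: FB_apply)
    have c2: "inner y (B (F s x)) = 0" using c1 pos_op_inner[OF B, of y "F s x"] by (simp add: inner_commute)
    have "F u x = F s x + y" by (simp add: y_def)
    then have "inner (F u x) (B (F u x)) = inner (F s x) (B (F s x)) + inner y (B y)"
      using c1 c2 by (simp add: blinfun.add_right inner_add_left inner_add_right)
    then have "H u - H s = (G u - G s) - inner y (B y)" by (simp add: H_def)
    then have "\<bar>H u - H s\<bar> \<le> u * m - s * m" using G1 G2 y1 y2 by simp
    then show "\<bar>H u - H s\<bar> \<le> (u - s) * (dist_fun x u - dist_fun x s)"
      by (simp add: m_def left_diff_distrib)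
  qed
  moreover have "H (-1) = 0" by (simp add: H_def G_def F_neg)
  ultimately have "G b = inner x (B x)" by (simp add: H_def b_def F_top)
  moreover have "G b = (\<integral>t. t \<partial>vmeas x)"
    unfolding G_def b_def using vmeas_bounded[of x]
    by (intro integral_cong_AE) (auto split: split_indicator)
  ultimately show ?thesis by simp
qed

end

lemma spectral_family_exists:
  assumes B: "pos_op B"
  obtains F where "spectral_family B F"
proof -
  have "\<exists>P. is_proj P \<and> (\<forall>U. U o\<^sub>L B = B o\<^sub>L U \<longrightarrow> U o\<^sub>L P = P o\<^sub>L U) \<and>
      (\<forall>x. P x = x \<longrightarrow> inner x (B x) \<le> t * (norm x)\<^sup>2) \<and>
      (\<forall>x. P x = 0 \<longrightarrow> x \<noteq> 0 \<longrightarrow> t * (norm x)\<^sup>2 < inner x (B x))" for t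
  proof -
    define T where "T = B - t *\<^sub>R id_blinfun"
    have "T\<^sup>\<star> = T" by (simp add: T_def hadj_diff hadj_scaleR pos_op_hadj[OF B])
    from spectral_cut[OF this] obtain P
      where P0: "is_proj P \<and> (\<forall>U. U o\<^sub>L T = T o\<^sub>L U \<longrightarrow> U o\<^sub>L P = P o\<^sub>L U) \<and>
        (\<forall>x. P x = x \<longrightarrow> inner x (T x) \<le> 0) \<and> (\<forall>x. P x = 0 \<longrightarrow> x \<noteq> 0 \<longrightarrow> 0 < inner x (T x))"
      by (rule exE)
    have Tx: "inner x (T x) = inner x (B x) - t * (norm x)\<^sup>2" for x
      by (simp add: T_def blinfun.bilinear_simps inner_simps power2_norm_eq_inner)
    have "U o\<^sub>L T = T o\<^sub>L U" if "U o\<^sub>L B = B o\<^sub>L U" for U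
      by (simp add: T_def blinfun_compose_simps that)
    then show ?thesis using P0 unfolding Tx by (intro exI[of _ P]) simp
  qed
  then obtain F where "\<forall>t. is_proj (F t) \<and> (\<forall>U. U o\<^sub>L B = B o\<^sub>L U \<longrightarrow> U o\<^sub>L F t = F t o\<^sub>L U) \<and>
      (\<forall>x. F t x = x \<longrightarrow> inner x (B x) \<le> t * (norm x)\<^sup>2) \<and>
      (\<forall>x. F t x = 0 \<longrightarrow> x \<noteq> 0 \<longrightarrow> t * (norm x)\<^sup>2 < inner x (B x))"
    by metis
  then have "spectral_family B F" using B by unfold_locales blast+
  then show thesis by (rule that)
qed

lemma spectral_measure_exists:
  fixes B :: "'a::complex_hilbert op"
  assumes "B \<in> bounded_ops" "pos_op B"
  shows "\<exists>E. spectral_measure_of B E"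
proof -
  obtain F where "spectral_family B F" by (rule spectral_family_exists[OF assms(2)])
  then interpret spectral_family B F .
  have bnd: "P \<in> bounded_ops" if "P \<in> bicommutant.projs" for P
    unfolding scalar_op_commute_iff
    using projs_commute[OF that] assms(1)[unfolded scalar_op_commute_iff] by blast
  have proj: "is_projection (spec S)" if "S \<in> sets borel" for S
    using spec_projs[OF that] bnd bicommutant.projsD by (simp add: is_projection_iff)
  have diag: "diagonal_measure spec x = vmeas x" for x
  proof -
    have "diagonal_measure spec x = measure_of UNIV (sets borel) (emeasure (vmeas x))"
      unfolding diagonal_measure_def
    proof (rule measure_of_eq)
      fix S assume "S \<in> sigma_sets UNIV (sets (borel :: real measure))"
      then have "S \<in> sets borel" using sets.sigma_sets_eq[of "borel :: real measure"] by simp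
      then show "ennreal (Re (cinner (spec S x) x)) = emeasure (vmeas x) S"
        using spec by (simp add: represents_def Re_cinner inner_commute)
    qed simp
    then show ?thesis using measure_of_of_measure[of "vmeas x"] by simp
  qed
  have "spectral_measure_of B spec"
    unfolding spectral_measure_of_def projection_valued_measure_def
  proof (intro conjI ballI allI impI)
    show "spec UNIV = id_blinfun" by (rule spec_full) auto
    show "strong_sums (\<lambda>n. spec (S n)) (spec (\<Union>n. S n))"
      if "range S \<subseteq> sets borel" "disjoint_family S" for S
      using spec_sums[OF that] by (simp add: strong_sums_def)
    show "\<exists>K. compact K \<and> spec K = id_blinfun"
    proof (intro exI[of _ "{-1..norm B}"] conjI spec_full)
      show "emeasure (vmeas x) {-1..norm B} = emeasure (vmeas x) UNIV" for x
        using vmeas_bounded[of x] by (intro emeasure_eq_AE) auto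
    qed auto
    show "cinner (B x) x = complex_of_real (\<integral>t. t \<partial>diagonal_measure spec x)" for x
      by (simp add: diag integral_identity cinner_pos_op[OF assms])
  qed (auto simp: proj spec_empty spec_inter)
  then show ?thesis by (rule exI[of _ spec])
qed

subsection \<open>The spectral projection of the norm\<close>

text \<open>Independence of the choice of \<open>E\<close> is what makes the definite description in
  \<open>spectral_projection\<close> meaningful at \<open>{norm B}\<close>. No mass lies above the
  norm, so the form of \<open>B\<close> at \<open>x\<close> reaches
  \<open>norm B * (norm x)\<^sup>2\<close> exactly when all mass of \<open>x\<close> sits at that
  point.\<close>

lemma spectral_measure_top:
  fixes B :: "'a::complex_hilbert op"
  assumes B: "B \<in> bounded_ops" "pos_op B" and E: "spectral_measure_of B E"
  shows "E {norm B} = top_eig B"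
proof -
  define b where "b = norm B"
  have pvm: "projection_valued_measure E" using E by (simp add: spectral_measure_of_def)
  have proj: "is_proj (E S)" if "S \<in> sets borel" for S
    using pvm that by (simp add: projection_valued_measure_def is_projection_iff)
  have E0: "E {} = 0" and E1: "E UNIV = id_blinfun"
    using pvm by (simp_all add: projection_valued_measure_def)
  have inter: "E (S \<inter> T) = E S o\<^sub>L E T" if "S \<in> sets borel" "T \<in> sets borel" for S T
    using pvm that by (simp add: projection_valued_measure_def)
  have sums: "(\<lambda>n. E (S n) x) sums E (\<Union>n. S n) x" if "range S \<subseteq> sets borel" "disjoint_family S" for S x
    using pvm that by (simp add: projection_valued_measure_def strong_sums_def)
  obtain K where K: "compact K" "E K = id_blinfun" using E by (auto simp: spectral_measure_of_def)
  have Kb: "K \<in> sets borel" using K by (simp add: borel_compact)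
  define \<nu> where "\<nu> x = diagonal_measure E x" for x
  have f: "ennreal (Re (cinner (E S x) x)) = ennreal ((norm (E S x))\<^sup>2)" if "S \<in> sets borel" for S x
    using is_proj_inner_self[OF proj[OF that], of x] by (simp add: Re_cinner)
  have sets: "sets (\<nu> x) = sets borel" for x
    unfolding \<nu>_def diagonal_measure_def
    by (subst sets_measure_of) (auto simp: sets.sigma_sets_eq[of "borel :: real measure", simplified])
  have space: "space (\<nu> x) = UNIV" for x
    unfolding \<nu>_def diagonal_measure_def by (subst space_measure_of) auto
  \<comment> \<open>\<open>measure_of\<close> has the intended values only once countable additivity
    is verified.\<close>
  have em: "emeasure (\<nu> x) S = ennreal ((norm (E S x))\<^sup>2)" if S: "S \<in> sets borel" for S x
  proof -
    have "emeasure (\<nu> x) S = ennreal (Re (cinner (E S x) x))"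
      unfolding \<nu>_def diagonal_measure_def
    proof (rule emeasure_measure_of_sigma[OF _ _ _ S])
      show "sigma_algebra UNIV (sets (borel :: real measure))"
        using sets.sigma_algebra_axioms[of "borel :: real measure"] by simp
      show "positive (sets borel) (\<lambda>S. ennreal (Re (cinner (E S x) x)))"
        by (simp add: positive_def E0 Re_cinner)
      show "countably_additive (sets borel) (\<lambda>S. ennreal (Re (cinner (E S x) x)))"
      proof (rule countably_additiveI)
        fix A :: "nat \<Rightarrow> real set"
        assume A: "range A \<subseteq> sets borel" "disjoint_family A" "(\<Union>i. A i) \<in> sets borel"
        have Ai: "A i \<in> sets borel" for i using A(1) by blast
        have s: "(\<lambda>i. inner x (E (A i) x)) sums inner x (E (\<Union>i. A i) x)"
          by (rule bounded_linear.sums[OF bounded_linear_inner_right sums[OF A(1,2)]])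
        have "(\<Sum>i. ennreal (inner x (E (A i) x))) = ennreal (\<Sum>i. inner x (E (A i) x))"
          using s is_proj_inner_self(1)[OF proj[OF Ai]] by (intro suminf_ennreal2) (auto simp: sums_iff)
        then show "(\<Sum>i. ennreal (Re (cinner (E (A i) x) x))) = ennreal (Re (cinner (E (\<Union>i. A i) x) x))"
          using s by (simp add: Re_cinner inner_commute sums_iff)
      qed
    qed
    then show ?thesis using f[OF S] by simp
  qed
  have int: "(\<integral>t. t \<partial>\<nu> x) = inner x (B x)" for x
  proof -
    have "complex_of_real (\<integral>t. t \<partial>\<nu> x) = complex_of_real (inner x (B x))"
      using E cinner_pos_op[OF B, of x] by (simp add: spectral_measure_of_def \<nu>_def)
    then show ?thesis by (simp only: of_real_eq_iff)
  qed
  have fin: "finite_measure (\<nu> x)" for x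
    by (rule finite_measureI) (simp add: space em)
  have disj: "E S (E T x) = 0" if "S \<in> sets borel" "T \<in> sets borel" "S \<inter> T = {}" for S T x
    using inter[OF that(1,2)] that(3) E0 by (metis blinfun_apply_blinfun_compose zero_blinfun.rep_eq)
  have null: "AE t in \<nu> x. t \<in> S" if "S \<in> sets borel" "E (UNIV - S) x = 0" for S x
  proof (rule AE_I)
    show "{t \<in> space (\<nu> x). t \<notin> S} \<subseteq> UNIV - S" by auto
    show "emeasure (\<nu> x) (UNIV - S) = 0" using that by (subst em) auto
    show "UNIV - S \<in> sets (\<nu> x)" using that by (simp add: sets)
  qed
  have AEK: "AE t in \<nu> x. t \<in> K" for x
  proof (rule null[OF Kb])
    have "E K (E (UNIV - K) x) = 0" using Kb by (intro disj) auto
    then show "E (UNIV - K) x = 0" using K(2) by simp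
  qed
  obtain R where R: "\<And>t. t \<in> K \<Longrightarrow> norm t \<le> R"
    using compact_imp_bounded[OF K(1)] by (auto simp: bounded_iff)
  have meas_id: "(\<lambda>t. t) \<in> borel_measurable (\<nu> x)" for x
    using measurable_ident_sets[OF sets[of x]] by (simp add: id_def)
  have integrable: "integrable (\<nu> x) (\<lambda>t. t)" for x
    using AEK[of x] R by (intro finite_measure.integrable_const_bound[OF fin, where B = R] meas_id) auto
  have full: "measure (\<nu> x) UNIV = (norm x)\<^sup>2" for x
    by (simp add: measure_def em E1)
  have const: "(\<integral>t. c \<partial>\<nu> x) = c * (norm x)\<^sup>2" for c :: real and x
    using full[of x] by (simp add: space)
  have iconst: "integrable (\<nu> x) (\<lambda>t. c)" for c :: real and x
    by (rule finite_measure.integrable_const[OF fin])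
  have bset: "{b} \<in> sets borel" "UNIV - {b} \<in> sets borel" by auto
  have eig: "B x = b *\<^sub>R x" if "E {b} x = x" for x
  proof -
    have "E (UNIV - {b}) (E {b} x) = 0" using bset by (intro disj) auto
    then have "AE t in \<nu> x. t \<in> {b}" using that by (intro null bset) simp
    then have "(\<integral>t. t \<partial>\<nu> x) = (\<integral>t. b \<partial>\<nu> x)"
      by (intro integral_cong_AE meas_id borel_measurable_const) auto
    then have "norm B * (norm x)\<^sup>2 \<le> inner (B x) x"
      unfolding int const b_def by (simp add: inner_commute)
    then show ?thesis unfolding b_def by (rule pos_op_top_eigenvector[OF B(2)])
  qed
  \<comment> \<open>A vector in the range of \<open>E {c..}\<close> has form at least
    \<open>c\<close> times its squared norm, more than \<open>norm B\<close> allows unless it is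
    0.\<close>
  have above: "E {c..} x = 0" if "c > b" for c x
  proof -
    define y where "y = E {c..} x"
    have "E (UNIV - {c..}) y = 0" unfolding y_def by (rule disj) auto
    then have AE: "AE t in \<nu> y. t \<in> {c..}" by (intro null) auto
    have "(\<integral>t. c \<partial>\<nu> y) \<le> (\<integral>t. t \<partial>\<nu> y)"
      using AE by (intro integral_mono_AE iconst integrable) auto
    then have "c * (norm y)\<^sup>2 \<le> inner y (B y)" unfolding int const .
    also have "\<dots> \<le> b * (norm y)\<^sup>2" using inner_le_norm_op[of B y] by (simp add: b_def inner_commute)
    finally have "(c - b) * (norm y)\<^sup>2 \<le> 0" by (simp add: left_diff_distrib)
    then show ?thesis using that by (simp add: mult_le_0_iff y_def)
  qed
  have le_b: "AE t in \<nu> x. t \<le> b" for x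
  proof (rule AE_I)
    have eq: "{b<..} = (\<Union>n. {b + inverse (real (Suc n))..})"
    proof (intro equalityI subsetI)
      fix t assume "t \<in> {b<..}"
      then obtain n where "inverse (real (Suc n)) < t - b" using reals_Archimedean[of "t - b"] by auto
      then show "t \<in> (\<Union>n. {b + inverse (real (Suc n))..})" by (intro UN_I[of n]) auto
    next
      fix t assume "t \<in> (\<Union>n. {b + inverse (real (Suc n))..})"
      then obtain n where "b + inverse (real (Suc n)) \<le> t" by auto
      moreover have "0 < inverse (real (Suc n))" by simp
      ultimately have "b < t" by linarith
      then show "t \<in> {b<..}" by simp
    qed
    show "{t \<in> space (\<nu> x). \<not> t \<le> b} \<subseteq> {b<..}" by auto
    show "{b<..} \<in> sets (\<nu> x)" by (simp add: sets)
    have "emeasure (\<nu> x) {b + inverse (real (Suc n))..} = 0" for n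
    proof -
      have "b < b + inverse (real (Suc n))" by simp
      from above[OF this, of x] show ?thesis by (subst em) (auto simp del: of_nat_Suc)
    qed
    then show "emeasure (\<nu> x) {b<..} = 0"
      unfolding eq by (rule emeasure_UN_eq_0) (auto simp: sets)
  qed
  \<comment> \<open>\<open>b - t\<close> is nonnegative almost everywhere and has integral 0, so all
    mass of \<open>x\<close> sits at \<open>b\<close>.\<close>
  have conv: "E {b} x = x" if "B x = b *\<^sub>R x" for x
  proof -
    have "(\<integral>t. b - t \<partial>\<nu> x) = b * (norm x)\<^sup>2 - inner x (B x)"
      using Bochner_Integration.integral_diff[OF iconst integrable, of x b] unfolding int const .
    also have "\<dots> = 0" using that by (simp add: power2_norm_eq_inner)
    finally have "(\<integral>t. b - t \<partial>\<nu> x) = 0" .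
    moreover have "integrable (\<nu> x) (\<lambda>t. b - t)" by (rule Bochner_Integration.integrable_diff[OF iconst integrable])
    ultimately have "AE t in \<nu> x. b - t = 0"
      using le_b[of x] by (subst (asm) integral_nonneg_eq_0_iff_AE) auto
    then have "emeasure (\<nu> x) {b} = emeasure (\<nu> x) UNIV"
      by (intro emeasure_eq_AE) (auto simp: sets)
    then have "(norm (E {b} x))\<^sup>2 = (norm x)\<^sup>2" by (simp add: em E1)
    then show ?thesis using is_proj_pythagoras[OF proj[OF bset(1)], of x] by simp
  qed
  have "E {b} = top_eig B"
  proof (rule is_proj_eq_rangeI[OF proj[OF bset(1)] is_proj_top_eig])
    show "range (blinfun_apply (E {b})) = range (blinfun_apply (top_eig B))"
      unfolding is_proj_range[OF proj[OF bset(1)]] is_proj_range[OF is_proj_top_eig] top_eig_eq_iff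
      using eig conv by (auto simp: b_def)
  qed
  then show ?thesis by (simp add: b_def)
qed

lemma spectral_projection_norm:
  fixes B :: "'a::complex_hilbert op"
  assumes "B \<in> bounded_ops" "pos_op B"
  shows "spectral_projection {norm B} B = top_eig B"
  unfolding spectral_projection_def
proof (rule the_equality)
  show "\<exists>E. spectral_measure_of B E \<and> top_eig B = E {norm B}"
    using spectral_measure_exists[OF assms] spectral_measure_top[OF assms] by metis
  show "P = top_eig B" if "\<exists>E. spectral_measure_of B E \<and> P = E {norm B}" for P
    using that spectral_measure_top[OF assms] by blast
qed

section \<open>Infinite factors on complex Hilbert spaces\<close>

locale infinite_factor =
  fixes M :: "'a::complex_hilbert op set"
  assumes factor: "is_factor M" and inf: "infinite_algebra M" and sigma: "sigma_finite_algebra M"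
begin

lemma vna: "von_neumann_algebra M" and M_bounded: "M \<subseteq> bounded_ops"
  and M_bicommutant: "commutant (commutant M) = M"
  using factor by (auto simp: is_factor_def von_neumann_algebra_def)

lemma adj_M: "T \<in> M \<Longrightarrow> T\<^sup>\<dagger> = T\<^sup>\<star>"
  using M_bounded adj_eq_hadj by blast

lemma hadj_M: "T \<in> M \<Longrightarrow> T\<^sup>\<star> \<in> M"
  using vna adj_M unfolding von_neumann_algebra_def by metis

text \<open>Membership in \<open>M\<close> is commutation with the commutant; adding the scalars makes complex
  linearity one of the commutation conditions.\<close>

definition N :: "'a op set" where "N = commutant M \<union> range scalar_op"

sublocale vn: vn_algebra N M
proof
  fix S assume "S \<in> N"
  then consider "S \<in> commutant M" | c where "S = scalar_op c" by (auto simp: N_def)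
  then show "S\<^sup>\<star> \<in> N"
  proof cases
    case 1
    have "S\<^sup>\<star> o\<^sub>L T = T o\<^sub>L S\<^sup>\<star>" if "T \<in> M" for T
    proof -
      have "S o\<^sub>L T\<^sup>\<star> = T\<^sup>\<star> o\<^sub>L S" using 1 hadj_M[OF that] by (simp add: commutant_def)
      from arg_cong[OF this, of hadj] show ?thesis by simp
    qed
    then show ?thesis using 1 hadj_bounded_ops by (auto simp: N_def commutant_def)
  next
    case 2
    then show ?thesis by (simp add: N_def scalar_op_hadj)
  qed
next
  show "M = {T. \<forall>S\<in>N. S o\<^sub>L T = T o\<^sub>L S}"
  proof (intro equalityI subsetI)
    fix T assume T: "T \<in> M"
    then have "T \<in> bounded_ops" using M_bounded by blast
    then show "T \<in> {T. \<forall>S\<in>N. S o\<^sub>L T = T o\<^sub>L S}"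
      using T by (auto simp: N_def commutant_def scalar_op_commute_iff)
  next
    fix T assume "T \<in> {T. \<forall>S\<in>N. S o\<^sub>L T = T o\<^sub>L S}"
    then have c: "S o\<^sub>L T = T o\<^sub>L S" if "S \<in> N" for S using that by blast
    have "T \<in> bounded_ops" unfolding scalar_op_commute_iff using c by (simp add: N_def)
    then have "T \<in> commutant (commutant M)"
      unfolding commutant_def[of "commutant M"] using c by (simp add: N_def)
    then show "T \<in> M" by (simp add: M_bicommutant)
  qed
qed

section \<open>Translation of the notions of the theorem\<close>

lemma projections_eq: "projections M = vn.projs"
  using M_bounded by (auto simp: projections_def vn.projs_def is_projection_iff)

lemma op_equiv_iff: "op_equiv M P Q \<longleftrightarrow> (\<exists>X\<in>M. P = X o\<^sub>L X\<^sup>\<star> \<and> Q = X\<^sup>\<star> o\<^sub>L X)"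
  unfolding op_equiv_def using adj_M by (metis (no_types, lifting))

lemma subprojection_iff:
  "P \<in> vn.projs \<Longrightarrow> Q \<in> vn.projs \<Longrightarrow> subprojection P Q \<longleftrightarrow> Q o\<^sub>L P = P"
  unfolding subprojection_def by (intro proj_range_subset_iff vn.projsD)

text \<open>One definition speaks of subprojections equivalent to \<open>P\<close>, the other of
  subprojections \<open>g\<close> into which \<open>P\<close> embeds. The final projection
  \<open>r\<close> of such an embedding lies below \<open>g\<close>, so \<open>r = P\<close> forces
  \<open>g = P\<close>.\<close>

lemma finite_projection_iff: "finite_projection M P \<longleftrightarrow> vn.fin P"
proof
  assume fp: "finite_projection M P"
  then have P: "P \<in> vn.projs" by (simp add: finite_projection_def projections_eq)
  show "vn.fin P"
    unfolding vn.fin_def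
  proof (intro conjI P ballI impI)
    fix g assume g: "g \<in> vn.projs" "P o\<^sub>L g = g" "vn.msub P g"
    obtain v where v: "v \<in> M" "v\<^sup>\<star> o\<^sub>L v = P" "g o\<^sub>L v = v"
      using g(3) by (auto simp: vn.msub_def)
    define r where "r = v o\<^sub>L v\<^sup>\<star>"
    have r: "r \<in> vn.projs" unfolding r_def by (rule vn.msub_range[OF v(1,2) P])
    have gr: "g o\<^sub>L r = r" using v(3) by (simp add: r_def blinfun_compose_assoc[symmetric])
    have "op_equiv M P r"
      unfolding op_equiv_iff using v hadj_M by (intro bexI[of _ "v\<^sup>\<star>"]) (auto simp: r_def)
    moreover have "subprojection r P"
      using subprojection_iff[OF r P] vn.projs_le_trans[OF gr g(2)] by blast
    ultimately have "r = P" using fp r by (simp add: finite_projection_def projections_eq)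
    then show "g = P" using gr g vn.projs_le_sym[OF g(1) P] by simp
  qed
next
  assume f: "vn.fin P"
  then have P: "P \<in> vn.projs" by (rule vn.fin_projs)
  show "finite_projection M P"
    unfolding finite_projection_def projections_eq
  proof (intro conjI P ballI impI, elim conjE)
    fix Q assume Q: "Q \<in> vn.projs" "subprojection Q P" "op_equiv M P Q"
    obtain X where X: "X \<in> M" "P = X o\<^sub>L X\<^sup>\<star>" "Q = X\<^sup>\<star> o\<^sub>L X" using Q(3) op_equiv_iff by blast
    have "vn.msub P Q"
      using vn.msub_range(2)[OF X(1) X(3)[symmetric] Q(1)] X(2) by simp
    then show "Q = P" using vn.finD[OF f Q(1)] Q(2) subprojection_iff[OF Q(1) P] by blast
  qed
qed

lemma infinite_projection_iff: "infinite_projection M P \<longleftrightarrow> P \<in> vn.projs \<and> \<not> vn.fin P"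
  by (simp add: infinite_projection_def projections_eq finite_projection_iff)

sublocale vn: vn_infinite_factor N M
proof
  show "\<not> vn.fin id_blinfun" using inf by (simp add: infinite_algebra_def infinite_projection_iff)
  show "countable F" if "F \<subseteq> vn.projs - {0}" "pairwise (\<lambda>P Q. P o\<^sub>L Q = 0) F" for F
    using sigma that unfolding sigma_finite_algebra_def projections_eq by blast
  fix Z assume Z: "Z \<in> vn.projs" and comm: "\<And>T. T \<in> M \<Longrightarrow> T o\<^sub>L Z = Z o\<^sub>L T"
  have "Z \<in> M" using Z vn.projsD by blast
  moreover have "Z \<in> commutant M"
    using comm \<open>Z \<in> M\<close> M_bounded by (auto simp: commutant_def)
  ultimately have "Z \<in> range scalar_op" using factor by (auto simp: is_factor_def)
  then obtain c where c: "Z = scalar_op c" by blast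
  show "Z = 0 \<or> Z = id_blinfun"
  proof (cases "c = 0 \<or> c = 1")
    case True
    then show ?thesis
      using scaleC_of_real[of 0] by (auto simp: c scaleC_one intro!: blinfun_eqI)
  next
    \<comment> \<open>A scalar projection satisfies \<open>c * c = c\<close> on every nonzero
      vector, so for other \<open>c\<close> the space is trivial.\<close>
    case False
    have "x = 0" for x :: 'a
    proof -
      have "Z (Z x) = Z x" by (rule vn.projs_idem[OF Z])
      then have "(c * c) *\<^sub>C x + (- c) *\<^sub>C x = 0"
        by (simp add: c scaleC_scaleC) (metis add.right_inverse scaleC_add_left scaleC_of_real of_real_0 scaleR_zero_left)
      then have "norm ((c * c - c) *\<^sub>C x) = 0" by (simp flip: scaleC_add_left)
      then have "cmod (c * (c - 1)) * norm x = 0" by (simp add: norm_scaleC right_diff_distrib)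
      then show "x = 0" using False by (simp add: norm_mult)
    qed
    then have "Z = 0" by (intro blinfun_eqI) metis
    then show ?thesis ..
  qed
qed

lemma proj_subequivI:
  assumes "P \<in> vn.projs" "Q \<in> vn.projs" "vn.msub P Q"
  shows "proj_subequiv M P Q"
proof -
  obtain v where v: "v \<in> M" "v\<^sup>\<star> o\<^sub>L v = P" "Q o\<^sub>L v = v"
    using assms(3) by (auto simp: vn.msub_def)
  define r where "r = v o\<^sub>L v\<^sup>\<star>"
  have r: "r \<in> vn.projs" unfolding r_def by (rule vn.msub_range[OF v(1,2) assms(1)])
  have "Q o\<^sub>L r = r" using v(3) by (simp add: r_def blinfun_compose_assoc[symmetric])
  then have "subprojection r Q" using subprojection_iff[OF r assms(2)] by blast
  moreover have "op_equiv M P r"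
    unfolding op_equiv_iff using v hadj_M by (intro bexI[of _ "v\<^sup>\<star>"]) (auto simp: r_def)
  ultimately show ?thesis using r unfolding proj_subequiv_def projections_eq by blast
qed

lemma null_projection_eq:
  assumes "A \<in> M"
  shows "null_projection A \<in> vn.projs" "null_projection A x = x \<longleftrightarrow> A x = 0"
proof -
  define P where "P = orth_proj (kernel A)"
  have P: "P \<in> vn.projs"
    using assms by (simp add: P_def vn.projs_def is_proj_kernel vn.M_orth_proj_kernel)
  have "range (blinfun_apply P) = {x. A x = 0}"
    unfolding P_def by (simp add: is_proj_range[OF is_proj_kernel] orth_proj_kernel_eq_iff)
  then have "null_projection A = P"
    unfolding null_projection_def using P M_bounded vn.projsD by (intro projection_onto_eq) auto
  then show "null_projection A \<in> vn.projs" "null_projection A x = x \<longleftrightarrow> A x = 0"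
    using P by (simp_all add: P_def orth_proj_kernel_eq_iff)
qed

text \<open>For symmetric \<open>A\<close> the closed range is the orthogonal complement of the
  kernel, so the range projection is known through the kernel.\<close>

lemma range_projection_eq:
  assumes "A \<in> M" "pos_op A"
  shows "range_projection A \<in> vn.projs" "range_projection A x = 0 \<longleftrightarrow> A x = 0"
proof -
  define P where "P = id_blinfun - orth_proj (kernel A)"
  have P: "P \<in> vn.projs"
    unfolding P_def using assms(1)
    by (intro vn.projs_compl) (simp add: vn.projs_def is_proj_kernel vn.M_orth_proj_kernel)
  have Pk: "P x = 0 \<longleftrightarrow> A x = 0" for x
    using orth_proj_kernel_eq_iff[of A x] by (auto simp: P_def blinfun.diff_left)
  define K where "K = closure (range (blinfun_apply A))"
  have lin: "linear (blinfun_apply A)" by (rule linearI) (simp_all add: blinfun.bilinear_simps)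
  have K: "closed K" "subspace K"
    unfolding K_def by (auto intro!: subspace_closure linear_subspace_image[OF lin])
  have "P = orth_proj K"
  proof (rule is_proj_eqI[OF vn.projsD(2)[OF P] is_proj_orth_proj[OF K]])
    fix x
    have "orth_proj K x = 0 \<longleftrightarrow> (\<forall>z\<in>K. inner x z = 0)" by (rule orth_proj_eq_0_iff[OF K])
    also have "\<dots> \<longleftrightarrow> A x = 0"
    proof
      assume *: "\<forall>z\<in>K. inner x z = 0"
      have "A (A x) \<in> K" unfolding K_def by (rule subsetD[OF closure_subset]) simp
      then have "inner (A x) (A x) = 0" using * pos_op_inner[OF assms(2), of x "A x"] by simp
      then show "A x = 0" by simp
    next
      assume "A x = 0"
      then have "inner x (A y) = 0" for y using pos_op_inner[OF assms(2), of x y] by simp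
      then have "K \<subseteq> {z. inner x z = 0}"
        unfolding K_def by (intro closure_minimal) (auto intro!: closed_Collect_eq continuous_intros)
      then show "\<forall>z\<in>K. inner x z = 0" by blast
    qed
    finally show "P x = 0 \<longleftrightarrow> orth_proj K x = 0" using Pk by simp
  qed
  then have "range (blinfun_apply P) = closure (range (blinfun_apply A))"
    using range_orth_proj[OF K] by (simp add: K_def)
  then have "range_projection A = P"
    unfolding range_projection_def using P M_bounded vn.projsD by (intro projection_onto_eq) auto
  then show "range_projection A \<in> vn.projs" "range_projection A x = 0 \<longleftrightarrow> A x = 0"
    using P Pk by simp_all
qed

lemma positives_pos_op: "A \<in> positives M \<Longrightarrow> A \<in> M \<and> pos_op A"
  using M_bounded by (auto simp: positives_def intro: pos_opI_complex)

lemma spectral_projection_top: "A \<in> positives M \<Longrightarrow> spectral_projection {norm A} A = top_eig A"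
  using positives_pos_op M_bounded by (intro spectral_projection_norm) auto

lemma finite_ideal_almost_fin: "finite_ideal M \<subseteq> vn.almost_fin"
  unfolding finite_ideal_def
proof (rule hull_minimal)
  show "{P. finite_projection M P} \<subseteq> vn.almost_fin"
    using vn.fin_almost_fin by (auto simp: finite_projection_iff)
  show "closed_ideal M vn.almost_fin"
    unfolding closed_ideal_def
    using vn.almost_fin_closed vn.almost_fin_add vn.almost_fin_left vn.almost_fin_right
      vn.fin_almost_fin[OF vn.fin_0]
    by (auto simp: vn.almost_fin_def)
qed

lemma zero_in_finite_ideal: "0 \<in> finite_ideal M"
  unfolding finite_ideal_def hull_def closed_ideal_def by auto

lemma summable_copiesI:
  assumes A: "A \<in> positives M"
    and C: "(\<exists>C. (\<forall>j. C j \<in> positives M \<and> op_equiv M (C j) B) \<and> strong_sums C A)"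
  obtains X where "summable_copies N M A B X"
proof -
  obtain C where C: "\<And>j. op_equiv M (C j) B" "strong_sums C A" using C by blast
  then obtain X where X: "\<And>j. X j \<in> M" "\<And>j. C j = X j o\<^sub>L (X j)\<^sup>\<star>" "\<And>j. B = (X j)\<^sup>\<star> o\<^sub>L X j"
    unfolding op_equiv_iff by metis
  have "(\<lambda>j. (norm ((X j)\<^sup>\<star> x))\<^sup>2) sums inner x (A x)" for x
  proof -
    have "(\<lambda>j. inner x (C j x)) sums inner x (A x)"
      using C(2) by (intro bounded_linear.sums[OF bounded_linear_inner_right]) (simp add: strong_sums_def)
    moreover have "inner x (C j x) = (norm ((X j)\<^sup>\<star> x))\<^sup>2" for j
      by (simp add: X(2) power2_norm_eq_inner hadj_inner')
    ultimately show ?thesis by simp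
  qed
  then have "summable_copies N M A B X"
    using X positives_pos_op[OF A] by unfold_locales auto
  then show thesis by (rule that)
qed

lemma summable_unitary_copiesI:
  assumes A: "A \<in> positives M" and B: "B \<in> positives M"
    and C: "(\<exists>C. (\<forall>j. unitarily_equiv M (C j) B) \<and> strong_sums C A)"
  obtains U where "summable_unitary_copies N M A B U"
proof -
  obtain C where C: "\<And>j. unitarily_equiv M (C j) B" "strong_sums C A" using C by blast
  have "\<exists>U\<in>M. U o\<^sub>L U\<^sup>\<star> = id_blinfun \<and> U\<^sup>\<star> o\<^sub>L U = id_blinfun \<and> C j = U o\<^sub>L B o\<^sub>L U\<^sup>\<star>" for j
    using C(1)[of j] adj_M unfolding unitarily_equiv_def by (metis (no_types, lifting))
  then obtain U where U: "\<And>j. U j \<in> M" "\<And>j. U j o\<^sub>L (U j)\<^sup>\<star> = id_blinfun"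
    "\<And>j. (U j)\<^sup>\<star> o\<^sub>L U j = id_blinfun" "\<And>j. C j = U j o\<^sub>L B o\<^sub>L (U j)\<^sup>\<star>"
    by metis
  have "(\<lambda>j. U j (B ((U j)\<^sup>\<star> x))) sums A x" for x
    using C(2) by (simp add: strong_sums_def U(4))
  then have "summable_unitary_copies N M A B U"
    using U positives_pos_op[OF A] positives_pos_op[OF B] by unfold_locales auto
  then show thesis by (rule that)
qed

text \<open>Adding \<open>K\<close> from the ideal changes \<open>A\<close> by at most
  \<open>\<epsilon>\<close> off a finite projection, so a representative of norm below
  \<open>norm B\<close> would make \<open>A\<close> itself smaller than \<open>norm B\<close>
  there.\<close>

lemma essential_norm_ge:
  assumes "summable_copies N M A B X"
  shows "norm B \<le> essential_norm M A"
  unfolding essential_norm_def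
proof (rule cInf_greatest)
  interpret sc: summable_copies N M A B X by fact
  show "norm ` quotient_map M A \<noteq> {}" using zero_in_finite_ideal by (auto simp: quotient_map_def)
  fix r assume "r \<in> norm ` quotient_map M A"
  then obtain K where K: "K \<in> vn.almost_fin" "r = norm (A + K)"
    using finite_ideal_almost_fin by (auto simp: quotient_map_def)
  show "norm B \<le> r"
  proof (rule ccontr)
    assume "\<not> norm B \<le> r"
    define \<epsilon> where "\<epsilon> = (norm B - r) / 2"
    have e: "\<epsilon> > 0" "r + \<epsilon> < norm B" using \<open>\<not> norm B \<le> r\<close> by (auto simp: \<epsilon>_def field_simps)
    obtain P where P: "vn.fin P" "\<And>x. P x = 0 \<Longrightarrow> norm (K x) \<le> \<epsilon> * norm x"
      by (rule vn.almost_finE[OF K(1) e(1)]) (rule that)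
    show False
    proof (rule sc.essential_lower_bound[OF P(1) e(2)])
      fix x assume "P x = 0"
      have "norm (A x) \<le> norm ((A + K) x) + norm (K x)"
        using norm_triangle_ineq4[of "(A + K) x" "K x"] by (simp add: blinfun.add_left)
      also have "\<dots> \<le> r * norm x + \<epsilon> * norm x"
        using norm_blinfun[of "A + K" x] P(2)[OF \<open>P x = 0\<close>] K(2) by simp
      finally show "norm (A x) \<le> (r + \<epsilon>) * norm x" by (simp add: distrib_right)
    qed
  qed
qed

text \<open>An inverse \<open>T\<close> modulo the ideal gives
  \<open>T o\<^sub>L B = id_blinfun + K\<close>. Off a finite projection \<open>K\<close> is at most
  1/2, so \<open>B\<close> is bounded below there; semifiniteness supplies the nonzero finite
  projection for the contradiction.\<close>

lemma zero_in_essential_spectrum: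
  assumes "summable_unitary_copies N M A B U" and "semifinite_algebra M"
  shows "0 \<in> essential_spectrum M B"
proof (rule ccontr)
  interpret su: summable_unitary_copies N M A B U by fact
  have s0: "B - scalar_op 0 = B"
    using scaleC_of_real[of 0] by (intro blinfun_eqI) (simp add: blinfun.diff_left)
  assume "0 \<notin> essential_spectrum M B"
  then obtain T where T: "T \<in> M" "quotient_map M (T o\<^sub>L B) = quotient_map M id_blinfun"
    by (auto simp: essential_spectrum_def s0)
  have "(T o\<^sub>L B) + 0 \<in> quotient_map M (T o\<^sub>L B)"
    unfolding quotient_map_def using zero_in_finite_ideal by blast
  then obtain K where K: "K \<in> vn.almost_fin" "T o\<^sub>L B = id_blinfun + K"
    unfolding T(2) using finite_ideal_almost_fin by (auto simp: quotient_map_def)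
  obtain P where P: "vn.fin P" "\<And>x. P x = 0 \<Longrightarrow> norm (K x) \<le> 1/2 * norm x"
    by (rule vn.almost_finE[OF K(1), of "1/2"]) (simp, rule that)
  \<comment> \<open>The 2 comes from the 1/2 lost to \<open>K\<close>; adding 1 keeps the
    denominator positive.\<close>
  define c where "c = 1 / (2 * (norm T + 1))"
  have n1: "norm T + 1 > 0" by (simp add: add_nonneg_pos)
  then have c: "c > 0" by (simp add: c_def)
  have below: "c * norm x \<le> norm (B x)" if "P x = 0" for x
  proof -
    have "T (B x) = x + K x"
      using K(2) by (metis blinfun_apply_blinfun_compose blinfun.add_left id_blinfun.rep_eq)
    then have "norm x \<le> norm (T (B x)) + norm (K x)"
      using norm_triangle_ineq4[of "x + K x" "K x"] by simp
    moreover have "norm (T (B x)) \<le> (norm T + 1) * norm (B x)"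
      using norm_blinfun[of T "B x"] by (simp add: distrib_right add_increasing2)
    ultimately have "norm x \<le> norm (B x) * (2 * (norm T + 1))" using P(2)[OF that] by argo
    then show ?thesis using n1 by (simp add: c_def pos_divide_le_eq)
  qed
  have "id_blinfun \<in> projections (M \<inter> commutant M)" "id_blinfun \<noteq> (0 :: 'a op)"
    using vn.infinite vn.fin_0 by (auto simp: projections_def is_projection_iff commutant_def bounded_ops_def)
  then obtain e where "finite_projection M e" "e \<noteq> 0"
    using assms(2) unfolding semifinite_algebra_def by blast
  then show False
    using su.not_bounded_below_off_fin[OF P(1) c below] by (simp add: finite_projection_iff)
qed

end

lemma exactly_one_4:
  "exactly_one [a, b, c, d] \<longleftrightarrow>
    (a \<or> b \<or> c \<or> d) \<and> \<not> (a \<and> b) \<and> \<not> (a \<and> c) \<and> \<not> (a \<and> d) \<and> \<not> (b \<and> c) \<and> \<not> (b \<and> d) \<and> \<not> (c \<and> d)"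
proof -
  have P: "i < length [a, b, c, d] \<and> [a, b, c, d] ! i \<longleftrightarrow>
      (i = 0 \<and> a) \<or> (i = 1 \<and> b) \<or> (i = 2 \<and> c) \<or> (i = 3 \<and> d)" for i
    by (auto simp: less_Suc_eq numeral_eq_Suc)
  show ?thesis
    unfolding exactly_one_def P Ex1_def
    by (cases a; cases b; cases c; cases d; simp; presburger)
qed

theorem proposition5p1:
  fixes M :: "('a::complex_hilbert) op set" and A B :: "'a op"
  assumes "is_factor M" and "infinite_algebra M" and "sigma_finite_algebra M"
    and "A \<in> positives M" and "B \<in> positives M"
  shows
    "((\<exists>C. (\<forall>j. C j \<in> positives M \<and> op_equiv M (C j) B) \<and> strong_sums C A) \<or>
      (\<exists>C. (\<forall>j. unitarily_equiv M (C j) B) \<and> strong_sums C A) \<longrightarrow>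
        (norm A \<ge> norm B \<and>
         proj_subequiv M (range_projection B) (range_projection A) \<and>
         (semifinite_algebra M \<longrightarrow> essential_norm M A \<ge> norm B)) \<and>
        exactly_one
          [norm A > norm B,
           norm A = norm B \<and> spectral_projection {norm B} B = 0,
           norm A = norm B \<and> spectral_projection {norm B} B \<noteq> 0 \<and>
             B \<noteq> norm B *\<^sub>R spectral_projection {norm B} B \<and>
             infinite_projection M (spectral_projection {norm A} A),
           norm A = norm B \<and> B = norm B *\<^sub>R spectral_projection {norm B} B \<and>
             A = norm A *\<^sub>R spectral_projection {norm A} A \<and>
             infinite_projection M (spectral_projection {norm A} A)]) \<and>
     ((\<exists>C. (\<forall>j. unitarily_equiv M (C j) B) \<and> strong_sums C A) \<longrightarrow>
        proj_subequiv M (null_projection A) (null_projection B) \<and>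
        (0 \<in> spectrum M B \<and> (semifinite_algebra M \<longrightarrow> 0 \<in> essential_spectrum M B)) \<and>
        (norm A = norm B \<longrightarrow>
           proj_subequiv M (spectral_projection {norm B} B) (null_projection B)))"
proof -
  interpret infinite_factor M using assms(1-3) by unfold_locales
  have A: "A \<in> M" "pos_op A" and B: "B \<in> M" "pos_op B" using positives_pos_op assms by auto
  have top: "spectral_projection {norm A} A = top_eig A" "spectral_projection {norm B} B = top_eig B"
    using spectral_projection_top assms by auto
  show ?thesis
    unfolding top
  proof (intro conjI impI)
    assume "(\<exists>C. (\<forall>j. C j \<in> positives M \<and> op_equiv M (C j) B) \<and> strong_sums C A) \<or>
      (\<exists>C. (\<forall>j. unitarily_equiv M (C j) B) \<and> strong_sums C A)"
    then obtain X where "summable_copies N M A B X"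
    proof
      assume "\<exists>C. (\<forall>j. C j \<in> positives M \<and> op_equiv M (C j) B) \<and> strong_sums C A"
      then show thesis by (rule summable_copiesI[OF assms(4)]) (rule that)
    next
      assume C: "\<exists>C. (\<forall>j. unitarily_equiv M (C j) B) \<and> strong_sums C A"
      obtain U where "summable_unitary_copies N M A B U"
        by (rule summable_unitary_copiesI[OF assms(4,5) C])
      then show thesis by (rule summable_unitary_copies.summable_copies_sqrt) (rule that)
    qed
    then interpret sc: summable_copies N M A B X .
    show le: "norm B \<le> norm A" by (rule sc.norm_B_le)
    show "proj_subequiv M (range_projection B) (range_projection A)"
      by (intro proj_subequivI range_projection_eq sc.support_msub A B)
    show "norm B \<le> essential_norm M A" by (rule essential_norm_ge[OF sc.summable_copies_axioms])
    have inf: "infinite_projection M (top_eig A)" if "norm A = norm B" "top_eig B \<noteq> 0"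
      using sc.top_eig_infinite[OF that] sc.top_eig_projs[OF A(1)] by (simp add: infinite_projection_iff)
    \<comment> \<open>If \<open>top_eig B\<close> were 0, the equation would give
      \<open>B = 0\<close>, whose top eigenspace is everything. This separates the second condition
      from the fourth.\<close>
    have B0: "top_eig B \<noteq> 0" if "B = norm B *\<^sub>R top_eig B"
    proof
      assume z: "top_eig B = 0"
      with that have "B = 0" by simp
      with z have "id_blinfun = (0 :: 'a op)" by (simp add: top_eig_0)
      then show False using vn.infinite vn.fin_0 by simp
    qed
    show "exactly_one
          [norm A > norm B,
           norm A = norm B \<and> top_eig B = 0,
           norm A = norm B \<and> top_eig B \<noteq> 0 \<and> B \<noteq> norm B *\<^sub>R top_eig B \<and>
             infinite_projection M (top_eig A),
           norm A = norm B \<and> B = norm B *\<^sub>R top_eig B \<and> A = norm A *\<^sub>R top_eig A \<and>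
             infinite_projection M (top_eig A)]"
      unfolding exactly_one_4 using le inf B0 sc.multiple_of_top_eig by fastforce
  next
    assume C: "\<exists>C. (\<forall>j. unitarily_equiv M (C j) B) \<and> strong_sums C A"
    obtain U where U: "summable_unitary_copies N M A B U"
      by (rule summable_unitary_copiesI[OF assms(4,5) C])
    interpret su: summable_unitary_copies N M A B U by (rule U)
    show "proj_subequiv M (null_projection A) (null_projection B)"
      by (intro proj_subequivI null_projection_eq su.null_msub A B)
    have "B - scalar_op 0 = B"
      using scaleC_of_real[of 0] by (intro blinfun_eqI) (simp add: blinfun.diff_left)
    then show "0 \<in> spectrum M B" using su.not_left_invertible by (simp add: spectrum_def)
    show "0 \<in> essential_spectrum M B" if "semifinite_algebra M"
      by (rule zero_in_essential_spectrum[OF U that])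
    show "proj_subequiv M (top_eig B) (null_projection B)" if "norm A = norm B"
    proof (rule proj_subequivI)
      show "top_eig B \<in> vn.projs"
        unfolding vn.projs_def top_eig_def using B(1)
        by (simp add: is_proj_kernel) (intro vn.M_orth_proj_kernel vn.M_diff vn.M_scaleR vn.M_id)
    qed (intro null_projection_eq su.top_eig_msub that B)+
  qed
qed

end
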